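(* Let $N,p,q,\sigma$ be real numbers with $q>p-1>0$ and $N>p>-\sigma$. Consider the positive solutions of $$(\mathrm E_\varepsilon)\qquad -(|w'|^{p-2}w')'-\frac{N-1}{r}|w'|^{p-2}w'=\varepsilon r^{\sigma}w^{q},\qquad \varepsilon=\pm1 .$$ For $\varepsilon=\pm1$ and any $w_0>0$ there exists a unique local solution near $0$ such that $$\lim_{r\to0}w=w_0,\qquad \lim_{r\to0}r^{-\frac{\sigma+1}{p-1}}w'=-\varepsilon c(w_0),\quad c(w_0)>0.$$ (1) Let $p-1<q<q_c$. • For $\varepsilon=\pm1$ and any $k>0$ there exist infinitely many local solutions near $0$ such that $\lim_{r\to0}r^{\frac{N-p}{p-1}}w=k$ and $\lim_{r\to0}r^{\frac{N-1}{p-1}}w'=-c(k)<0$. • For $\varepsilon=1$ there is no positive solution in $(r_0,\infty)$, $r_0>0$. • For $\varepsilon=-1$ there exists the global particular solution $w^*=a^*r^{-\gamma}$. Moreover there exist (global) solutions such that $\lim_{r\to0}r^{\frac{N-p}{p-1}}w=k>0$ and $\lim_{r\to\infty}r^{\gamma}w=a^*$. (2) Let $q>q_c$. • For $\varepsilon=\pm1$ and $k>0$ there exists a local solution near $\infty$, unique up to a scaling, such that $\lim_{r\to\infty}r^{\frac{N-p}{p-1}}w=k>0$ and $\lim_{r\to\infty}r^{\frac{N-1}{p-1}}w'=-c(k)<0$. • For $\varepsilon=-1$ all the local solutions near $0$ are $C^0$-regular, and not global. • For $\varepsilon=1$ there is the particular solution $w^*=a^*r^{-\gamma}$. Moreover: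 (i) if $q<q_S$, there exists no $C^0$-ground state, and there exist solutions such that $\lim_{r\to0}r^\gamma w=a^*$ and $\lim_{r\to\infty}r^{\frac{N-p}{p-1}}w=k>0$; (ii) if $q>q_S$, there exist $C^0$-ground states such that $\lim_{r\to0}w=w_0>0$ and $\lim_{r\to\infty}r^\gamma w=a^*$; (iii) if $q=q_S$, there is a family of explicit $C^0$-ground states $$w=c\bigl(d+r^{\frac{p+\sigma}{p-1}}\bigr)^{-\frac{N-p}{p+\sigma}},\quad c>0,\qquad d=c^{\,q-p+1}(N+\sigma)^{-1}\Bigl(\frac{N-p}{p-1}\Bigr)^{1-p}.$$
   Context: $N$ is not necessarily an integer. $q_c=\frac{(N+\sigma)(p-1)}{N-p}$, $q_S=\frac{N(p-1)+p+p\sigma}{N-p}$, $\gamma=\frac{p+\sigma}{q+1-p}$, and $a^*>0$ is defined by $(a^* )^{q-p+1}=\varepsilon|\gamma|^{p-2}\gamma\,(N-p-(p-1)\gamma)$ (when the right side is positive). A local solution near $0$ (resp. near $\infty$) is a positive solution on $(0,r_0)$ (resp. $(r_0,\infty)$) for some $r_0>0$; a solution is global if it is a positive solution on $(0,\infty)$. A local solution $w$ near $0$ is $C^0$-regular if $\lim_{r\to0}w$ exists and is finite ($\geq 0$); a $C^0$-ground state is a $C^0$-regular global solution. $c(\cdot)$ denotes a positive constant depending on its argument (and on the parameters). Scaling means $w\mapsto\lambda^\gamma w(\lambda r)$, $\lambda>0$, which preserves the equation. *)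

theory Defs
  imports "HOL-Analysis.Analysis"
begin

definition p_flux :: "real \<Rightarrow> (real \<Rightarrow> real) \<Rightarrow> real \<Rightarrow> real" where
  "p_flux p w r = \<bar>deriv w r\<bar> powr (p - 2) * deriv w r"

(* Classical solutions on an open set I. It is enough to ask for differentiability: the flux,
   being differentiable, is continuous, hence so is w'; and the equation then makes the derivative
   of the flux continuous. At critical points of w the flux is 0 for every p > 1, as it should be,
   because of the factor deriv w r. *)
definition positive_solution_on ::
    "real \<Rightarrow> real \<Rightarrow> real \<Rightarrow> real \<Rightarrow> real \<Rightarrow> real set \<Rightarrow> (real \<Rightarrow> real) \<Rightarrow> bool" where
  "positive_solution_on N p q \<sigma> \<epsilon> I w \<longleftrightarrow>
     (\<forall>r\<in>I. w r > 0 \<and>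
        w differentiable (at r) \<and>
        p_flux p w differentiable (at r) \<and>
        - deriv (p_flux p w) r - (N - 1) / r * p_flux p w r = \<epsilon> * r powr \<sigma> * w r powr q)"

definition local_solution_0 ::
    "real \<Rightarrow> real \<Rightarrow> real \<Rightarrow> real \<Rightarrow> real \<Rightarrow> real \<Rightarrow> (real \<Rightarrow> real) \<Rightarrow> bool" where
  "local_solution_0 N p q \<sigma> \<epsilon> r0 w \<longleftrightarrow>
     r0 > 0 \<and> positive_solution_on N p q \<sigma> \<epsilon> {0<..<r0} w"

definition local_solution_infty ::
    "real \<Rightarrow> real \<Rightarrow> real \<Rightarrow> real \<Rightarrow> real \<Rightarrow> real \<Rightarrow> (real \<Rightarrow> real) \<Rightarrow> bool" where
  "local_solution_infty N p q \<sigma> \<epsilon> r0 w \<longleftrightarrow>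
     r0 > 0 \<and> positive_solution_on N p q \<sigma> \<epsilon> {r0<..} w"

definition global_solution ::
    "real \<Rightarrow> real \<Rightarrow> real \<Rightarrow> real \<Rightarrow> real \<Rightarrow> (real \<Rightarrow> real) \<Rightarrow> bool" where
  "global_solution N p q \<sigma> \<epsilon> w \<longleftrightarrow> positive_solution_on N p q \<sigma> \<epsilon> {0<..} w"

definition C0_regular :: "(real \<Rightarrow> real) \<Rightarrow> bool" where
  "C0_regular w \<longleftrightarrow> (\<exists>l\<ge>0. (w \<longlongrightarrow> l) (at_right 0))"

definition C0_ground_state ::
    "real \<Rightarrow> real \<Rightarrow> real \<Rightarrow> real \<Rightarrow> real \<Rightarrow> (real \<Rightarrow> real) \<Rightarrow> bool" where
  "C0_ground_state N p q \<sigma> \<epsilon> w \<longleftrightarrow> global_solution N p q \<sigma> \<epsilon> w \<and> C0_regular w"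

definition q_crit :: "real \<Rightarrow> real \<Rightarrow> real \<Rightarrow> real" where
  "q_crit N p \<sigma> = (N + \<sigma>) * (p - 1) / (N - p)"

definition q_Sobolev :: "real \<Rightarrow> real \<Rightarrow> real \<Rightarrow> real" where
  "q_Sobolev N p \<sigma> = (N * (p - 1) + p + p * \<sigma>) / (N - p)"

definition gamma_exp :: "real \<Rightarrow> real \<Rightarrow> real \<Rightarrow> real" where
  "gamma_exp p q \<sigma> = (p + \<sigma>) / (q + 1 - p)"

(* Meaningful only if the right-hand side is positive (and q - p + 1 is nonzero). *)
definition a_star :: "real \<Rightarrow> real \<Rightarrow> real \<Rightarrow> real \<Rightarrow> real \<Rightarrow> real" where
  "a_star N p q \<sigma> \<epsilon> =
     (let \<gamma> = gamma_exp p q \<sigma> in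
      THE a. a > 0 \<and>
        a powr (q - p + 1) = \<epsilon> * \<bar>\<gamma>\<bar> powr (p - 2) * \<gamma> * (N - p - (p - 1) * \<gamma>))"

definition w_star :: "real \<Rightarrow> real \<Rightarrow> real \<Rightarrow> real \<Rightarrow> real \<Rightarrow> real \<Rightarrow> real" where
  "w_star N p q \<sigma> \<epsilon> r = a_star N p q \<sigma> \<epsilon> * r powr (- gamma_exp p q \<sigma>)"

definition scaling :: "real \<Rightarrow> real \<Rightarrow> (real \<Rightarrow> real) \<Rightarrow> real \<Rightarrow> real" where
  "scaling \<gamma> t w r = t powr \<gamma> * w (t * r)"

definition regular_behaviour_0 ::
    "real \<Rightarrow> real \<Rightarrow> real \<Rightarrow> real \<Rightarrow> real \<Rightarrow> (real \<Rightarrow> real) \<Rightarrow> bool" where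
  "regular_behaviour_0 p \<sigma> \<epsilon> w0 c w \<longleftrightarrow>
     (w \<longlongrightarrow> w0) (at_right 0) \<and>
     ((\<lambda>r. r powr (- ((\<sigma> + 1) / (p - 1))) * deriv w r) \<longlongrightarrow> - \<epsilon> * c) (at_right 0)"

(* The behaviour of k times the p-harmonic function, along F = at_right 0 or F = at_top. *)
definition fundamental_behaviour ::
    "real \<Rightarrow> real \<Rightarrow> real filter \<Rightarrow> real \<Rightarrow> real \<Rightarrow> (real \<Rightarrow> real) \<Rightarrow> bool" where
  "fundamental_behaviour N p F k c w \<longleftrightarrow>
     ((\<lambda>r. r powr ((N - p) / (p - 1)) * w r) \<longlongrightarrow> k) F \<and>
     ((\<lambda>r. r powr ((N - 1) / (p - 1)) * deriv w r) \<longlongrightarrow> - c) F"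

end

theory Submission imports Defs begin

text \<open>Put P = p - 1, \<kappa> = (N - p)/(p - 1), M = N + \<sigma>, \<gamma> = (p + \<sigma>)/(q + 1 - p), and pass to the time
t = ln r. With W(t) = w(e^t) and the flux \<zeta>(t) = - r^(N-1) |w'|^(p-2) w' the equation becomes
W' = - e^(-\<kappa>t) \<psi>(\<zeta>), \<zeta>' = \<epsilon> e^(Mt) W^q, where \<psi> inverts x \<mapsto> |x|^(P-1) x
(log_at). The logarithmic derivatives x = - W'/W and z = \<zeta>'/\<zeta> satisfy the autonomous quadratic
system x' = x(x - \<kappa> + z/P), z' = z(M - qx - z) (lv_at), in which \<epsilon> only appears as the sign of xz.
Conversely (W, \<zeta>) is recovered from an orbit by explicit formulas (lv_imp_log), and scaling of w is
translation of t (log_scale). So solutions up to scaling are orbits in the plane, and each asymptotic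
behaviour in the theorem is convergence to one of three rest points: (0, M) for regular solutions, (\<kappa>, 0)
for the behaviour k r^(-\<kappa>), and (\<gamma>, P(\<kappa> - \<gamma>)) for a* r^(-\<gamma>).

The linearisation at (\<kappa>, 0) has eigenvalues \<kappa> and M - q\<kappa>. If q > q_c, that is q\<kappa> > M, this point is a
saddle, with one incoming orbit for each sign of z (fundamental_orbit); this is why the solution at infinity
exists and is unique up to scaling. If q < q_c, it repels all nearby orbits, whence infinitely many solutions near 0
(fundamental_orbit_family). Exchanging x and z, reversing time and replacing (P, q, \<kappa>, M) by
(1/q, 1/P, M, \<kappa>) maps the system to itself and swaps (\<kappa>, 0) with (0, M) (lv_dual); as \<kappa>P < M always holds, the
latter is always a saddle and its orbit yields the regular solutions.

The global solutions are connecting orbits. For \<epsilon> = 1 and q_c < q < q_S a Lyapunov function traps the orbit of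
the saddle (\<kappa>, 0), followed backwards, in a compact part of the quadrant, so that it comes from the interior rest point
(supercritical_connection); the ground states for q > q_S are the dual statement. For \<epsilon> = -1 and
q < q_c, shooting in a box produces an orbit from (\<kappa>, 0) to the interior rest point
(subcritical_connection). All orbits are found for fields clipped to a box, which are globally Lipschitz and
have a flow by Picard iteration in a weighted norm.

The nonexistence assertions rest on differential inequalities whose solutions blow up in finite time
(lv_blowup, source_no_solution_at_infinity) and, for ground states with q < q_S, on the Pohozaev function,
which increases from 0 and yet lies below a function that tends to 0 (source_no_ground_state). Uniqueness is proved
for (W, \<zeta>) rather than for orbits, because a solution may have a critical point, where the quotients degenerate and \<psi> need
not be Lipschitz: every bound on the difference of two solutions can be halved
(sol_unique_regular, sol_unique_fundamental, sol_unique_local).\<close>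

section \<open>Differential inequalities\<close>

text \<open>After the last time at which f is at least K, the mean value theorem would give f a negative slope
although f is below K there.\<close>

lemma stays_ge_barrier:
  fixes f f' :: "real \<Rightarrow> real"
  assumes der: "\<And>t. t \<ge> t1 \<Longrightarrow> t \<le> t2 \<Longrightarrow> (f has_real_derivative f' t) (at t)"
    and push: "\<And>t. t \<ge> t1 \<Longrightarrow> t \<le> t2 \<Longrightarrow> f t < K \<Longrightarrow> f' t \<ge> 0"
    and start: "f t1 \<ge> K" and t: "t1 \<le> t2"
  shows "f t2 \<ge> K"
proof (rule ccontr)
  assume neg: "\<not> f t2 \<ge> K"
  have cont: "continuous_on {t1..t2} f"
    using der by (intro DERIV_atLeastAtMost_imp_continuous_on) blast
  define A where "A = {t1..t2} \<inter> f -` {K..}"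
  have "closed A" unfolding A_def using continuous_closed_preimage[OF cont, of "{K..}"] by auto
  then have A: "compact A" "t1 \<in> A" using start t
    by (auto simp: A_def compact_eq_bounded_closed)
  then obtain s where s: "s \<in> A" "\<And>u. u \<in> A \<Longrightarrow> u \<le> s" using compact_attains_sup[of A] by auto
  have s2: "s < t2" "s \<ge> t1" "f s \<ge> K" using s neg by (auto simp: A_def order.order_iff_strict)
  obtain z where z: "z > s" "z < t2" "f t2 - f s = (t2 - s) * f' z"
    using MVT2[OF s2(1), of f f'] der s2 by auto
  have "f z < K" using s(2)[of z] z s2 by (force simp: A_def)
  then have "f' z \<ge> 0" using push[of z] z s2 by auto
  then have "(t2 - s) * f' z \<ge> 0" using s2 by simp
  then show False using z s2 neg by linarith
qed

lemma stays_gt_barrier: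
  fixes f f' :: "real \<Rightarrow> real"
  assumes der: "\<And>t. t \<ge> t1 \<Longrightarrow> t \<le> t2 \<Longrightarrow> (f has_real_derivative f' t) (at t)"
    and push: "\<And>t. t \<ge> t1 \<Longrightarrow> t \<le> t2 \<Longrightarrow> f t > K \<Longrightarrow> f' t \<ge> 0"
    and start: "f t1 > K" and t: "t1 \<le> t2"
  shows "f t2 > K"
proof (rule ccontr)
  assume neg: "\<not> f t2 > K"
  have "- f (- (- t1)) \<ge> - K"
  proof (rule stays_ge_barrier[where f = "\<lambda>u. - f (- u)" and f' = "\<lambda>u. f' (- u)" and ?t1.0 = "- t2"])
    fix u assume u: "- t2 \<le> u" "u \<le> - t1"
    have "((\<lambda>u. f (- u)) has_real_derivative f' (- u) * (- 1)) (at u)"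
      by (rule DERIV_chain2[where g = uminus]) (use u der in \<open>auto intro!: derivative_eq_intros\<close>)
    then show "((\<lambda>u. - f (- u)) has_real_derivative f' (- u)) (at u)"
      by (auto intro!: derivative_eq_intros)
    show "- f (- u) < - K \<Longrightarrow> 0 \<le> f' (- u)" using push[of "- u"] u by auto
  qed (use neg t in auto)
  then show False using start by simp
qed

text \<open>The bound on the slope says that y e^(ct) does not decrease while y is positive.\<close>

lemma stays_positive:
  fixes y y' :: "real \<Rightarrow> real"
  assumes der: "\<And>t. t \<ge> t1 \<Longrightarrow> t \<le> t2 \<Longrightarrow> (y has_real_derivative y' t) (at t)"
    and bd: "\<And>t. t \<ge> t1 \<Longrightarrow> t \<le> t2 \<Longrightarrow> y t > 0 \<Longrightarrow> y' t \<ge> - c * y t"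
    and start: "y t1 > 0" and t: "t1 \<le> t2"
  shows "y t2 > 0"
proof -
  have "y t2 * exp (c * t2) > 0"
  proof (rule stays_gt_barrier[where f = "\<lambda>t. y t * exp (c * t)" and f' = "\<lambda>t. (y' t + c * y t) * exp (c * t)", OF _ _ _ t])
    fix u assume u: "t1 \<le> u" "u \<le> t2"
    show "((\<lambda>t. y t * exp (c * t)) has_real_derivative (y' u + c * y u) * exp (c * u)) (at u)"
      by (auto intro!: derivative_eq_intros der u simp: algebra_simps)
    assume "0 < y u * exp (c * u)"
    then have "y u > 0" by (simp add: zero_less_mult_iff)
    then show "0 \<le> (y' u + c * y u) * exp (c * u)" using bd[OF u] by (intro mult_nonneg_nonneg) auto
  qed (use start in simp)
  then show ?thesis by (simp add: zero_less_mult_iff)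
qed

text \<open>An exit from Q would have a first time, because the complement of Q is closed; the hypothesis on initial intervals
excludes it.\<close>

lemma trapped_in_open:
  fixes X :: "real \<Rightarrow> 'a::topological_space"
  assumes cont: "continuous_on {0..} X" and O: "open Q" and start: "X 0 \<in> Q"
    and step: "\<And>T. T > 0 \<Longrightarrow> (\<And>s. 0 \<le> s \<Longrightarrow> s < T \<Longrightarrow> X s \<in> Q) \<Longrightarrow> X T \<in> Q"
    and t: "t \<ge> 0"
  shows "X t \<in> Q"
proof (rule ccontr)
  assume neg: "X t \<notin> Q"
  define A where "A = {0..t} \<inter> X -` (- Q)"
  have "continuous_on {0..t} X" by (rule continuous_on_subset[OF cont]) auto
  then have "closed A" unfolding A_def using continuous_closed_preimage[of "{0..t}" X "- Q"] O by auto
  then have A: "compact A" "t \<in> A" using neg t by (auto simp: A_def compact_eq_bounded_closed)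
  then obtain T where T: "T \<in> A" "\<And>u. u \<in> A \<Longrightarrow> T \<le> u" using compact_attains_inf[of A] by auto
  then have "T \<ge> 0" "T \<le> t" "X T \<notin> Q" by (auto simp: A_def)
  moreover have "T \<noteq> 0" using start calculation by auto
  moreover have "X s \<in> Q" if "0 \<le> s" "s < T" for s
    using T(2)[of s] that calculation by (force simp: A_def)
  ultimately show False using step[of T] by auto
qed

text \<open>Below the level K the slope is at least c, so that f reaches K after a time at most (K - f T)/c, and it
cannot fall back. Applied to the negative of a positive function with K = 0, this is the contradiction that ends
most of the nonexistence proofs below.\<close>

lemma eventually_above_barrier:
  fixes f f' :: "real \<Rightarrow> real"
  assumes der: "\<And>t. t \<ge> T \<Longrightarrow> (f has_real_derivative f' t) (at t)"
    and push: "\<And>t. t \<ge> T \<Longrightarrow> f t \<le> K \<Longrightarrow> f' t \<ge> c" and c: "c > 0"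
  shows "\<exists>T'\<ge>T. \<forall>t\<ge>T'. f t \<ge> K"
proof -
  have "\<exists>t1\<ge>T. f t1 \<ge> K"
  proof (rule ccontr)
    assume "\<not> ?thesis"
    then have lt: "f t < K" if "t \<ge> T" for t using that by (meson not_less)
    (* a time by which a function of slope at least c would have reached K *)
    define t where "t = T + (K - f T) / c"
    have t: "t > T" using lt[of T] c by (simp add: t_def)
    obtain z where z: "z > T" "z < t" "f t - f T = (t - T) * f' z"
      using MVT2[OF t, of f f'] der by auto
    have "f' z \<ge> c" using push[of z] lt[of z] z by auto
    then have "f t - f T \<ge> (t - T) * c" using z t by (simp add: mult_left_mono)
    also have "(t - T) * c = K - f T" using c by (simp add: t_def)
    finally show False using lt[of t] t by auto
  qed
  then obtain t1 where t1: "t1 \<ge> T" "f t1 \<ge> K" by blast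
  have "f t \<ge> K" if "t \<ge> t1" for t
  proof (rule stays_ge_barrier[where f = f and f' = f' and K = K, OF _ _ t1(2) that])
    fix u assume u: "t1 \<le> u"
    show "(f has_real_derivative f' u) (at u)" using der[of u] u t1 by simp
    show "0 \<le> f' u" if "f u < K" using push[of u] u t1 that c by simp
  qed
  then show ?thesis using t1 by auto
qed

lemma exp_decay_tendsto: "a > 0 \<Longrightarrow> ((\<lambda>u::real. exp (- a * u)) \<longlongrightarrow> 0) at_top"
proof -
  assume a: "a > 0"
  have "filterlim (\<lambda>u. a * u) at_top at_top"
    using filterlim_tendsto_pos_mult_at_top[OF tendsto_const a filterlim_ident] .
  then show ?thesis
    by (intro filterlim_compose[OF exp_at_bot]) (simp add: filterlim_uminus_at_bot)
qed

lemma exp_close_tendsto: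
  fixes x :: "real \<Rightarrow> real"
  assumes a: "a > 0" and x: "\<And>t. t \<ge> 0 \<Longrightarrow> \<bar>x t - l\<bar> \<le> C * exp (- a * t)"
  shows "(x \<longlongrightarrow> l) at_top"
proof -
  have "((\<lambda>t. x t - l) \<longlongrightarrow> 0) at_top"
  proof (rule Lim_null_comparison)
    show "\<forall>\<^sub>F t in at_top. norm (x t - l) \<le> C * exp (- a * t)"
      using eventually_ge_at_top[of "0::real"] by eventually_elim (use x in simp)
    show "((\<lambda>t. C * exp (- a * t)) \<longlongrightarrow> 0) at_top" by (rule tendsto_mult_right_zero[OF exp_decay_tendsto[OF a]])
  qed
  then show ?thesis by (simp add: LIM_zero_iff)
qed

text \<open>Integration of the bound for f' from t to infinity: the functions A e^(-at)/a -+ f decrease and tend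
to 0, hence are nonnegative.\<close>

lemma exp_tail_bound:
  fixes f f' :: "real \<Rightarrow> real"
  assumes der: "\<And>t. t > T \<Longrightarrow> (f has_real_derivative f' t) (at t)"
    and bd: "\<And>t. t > T \<Longrightarrow> \<bar>f' t\<bar> \<le> A * exp (- a * t)" and a: "a > 0"
    and lim: "(f \<longlongrightarrow> 0) at_top" and t: "t > T"
  shows "\<bar>f t\<bar> \<le> A * exp (- a * t) / a"
proof -
  have mono: "s * f t \<le> A * exp (- a * t) / a" if s: "s = 1 \<or> s = -1" for s
  proof -
    define g where "g u = A * exp (- a * u) / a - s * f u" for u
    have dg: "(g has_real_derivative (- A * exp (- a * u) - s * f' u)) (at u)" if "u > T" for u
      unfolding g_def using a by (auto intro!: derivative_eq_intros der that)
    have "g u \<le> g t" if "u \<ge> t" for u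
      using that
    proof (rule DERIV_nonpos_imp_nonincreasing)
      fix x assume "t \<le> x" "x \<le> u"
      then have x: "x > T" using t by auto
      have "- A * exp (- a * x) - s * f' x \<le> 0" using bd[OF x] s by auto
      then show "\<exists>y. DERIV g x :> y \<and> y \<le> 0" using dg[OF x] by blast
    qed
    then have ev: "\<forall>\<^sub>F u in at_top. g u \<le> g t" by (auto simp: eventually_at_top_linorder)
    note exp_decay_tendsto[OF a]
    then have "(g \<longlongrightarrow> A * 0 / a - s * 0) at_top" unfolding g_def using a by (intro tendsto_intros lim) auto
    then have "0 \<le> g t" using tendsto_le[OF _ tendsto_const _ ev] by fastforce
    then show ?thesis by (simp add: g_def)
  qed
  show ?thesis using mono[of 1] mono[of "-1"] by auto
qed

lemma monotone_bounded_at_top: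
  fixes f :: "real \<Rightarrow> real"
  assumes mono: "\<And>s t. T < s \<Longrightarrow> s \<le> t \<Longrightarrow> f s \<le> f t" and bd: "\<And>t. t > T \<Longrightarrow> f t \<le> B"
  shows "\<exists>l\<le>B. (f \<longlongrightarrow> l) at_top \<and> (\<forall>t>T. f t \<le> l)"
proof -
  define l where "l = Sup (f ` {T<..})"
  have bdd: "bdd_above (f ` {T<..})" using bd by (auto simp: bdd_above_def)
  have le: "f t \<le> l" if "t > T" for t unfolding l_def using that by (intro cSup_upper bdd) auto
  have "(f \<longlongrightarrow> l) at_top"
  proof (rule increasing_tendsto)
    show "\<forall>\<^sub>F n in at_top. f n \<le> l" using eventually_gt_at_top[of T] by eventually_elim (rule le)
    fix x assume "x < l"
    then obtain s where s: "s > T" "x < f s"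
      unfolding l_def using less_cSup_iff[OF _ bdd] by auto
    show "\<forall>\<^sub>F n in at_top. x < f n"
      using eventually_ge_at_top[of s] by eventually_elim (use mono s in fastforce)
  qed
  moreover have "l \<le> B" unfolding l_def by (rule cSup_least) (use bd gt_ex[of T] in auto)
  ultimately show ?thesis using le by blast
qed

text \<open>Subtracting and adding the tail A e^(-at)/a turns f into an increasing and a decreasing function, the
former below the latter.\<close>

lemma exp_tail_converges:
  fixes f f' :: "real \<Rightarrow> real"
  assumes der: "\<And>t. t > T \<Longrightarrow> (f has_real_derivative f' t) (at t)"
    and bd: "\<And>t. t > T \<Longrightarrow> \<bar>f' t\<bar> \<le> A * exp (- a * t)" and a: "a > 0"
  shows "\<exists>l. (f \<longlongrightarrow> l) at_top"
proof -
  define g where "g u = f u - A / a * exp (- a * u)" for u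
  have A: "A \<ge> 0" using bd[of "T+1"] by (smt (verit) exp_gt_zero zero_le_mult_iff less_add_one mult_neg_pos)
  have dg: "(g has_real_derivative (f' u + A * exp (- a * u))) (at u)" if "u > T" for u
    unfolding g_def using a by (auto intro!: derivative_eq_intros der that)
  have mono: "g s \<le> g t" if "T < s" "s \<le> t" for s t
    using that(2)
  proof (rule DERIV_nonneg_imp_nondecreasing)
    fix x assume "s \<le> x" "x \<le> t"
    then have x: "x > T" using that by auto
    have "f' x + A * exp (- a * x) \<ge> 0" using bd[OF x] by auto
    then show "\<exists>y. DERIV g x :> y \<and> y \<ge> 0" using dg[OF x] by blast
  qed
  define h where "h u = f u + A / a * exp (- a * u)" for u
  have dh: "(h has_real_derivative (f' u - A * exp (- a * u))) (at u)" if "u > T" for u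
    unfolding h_def using a by (auto intro!: derivative_eq_intros der that)
  have dec: "h t \<le> h s" if "T < s" "s \<le> t" for s t
    using that(2)
  proof (rule DERIV_nonpos_imp_nonincreasing)
    fix x assume "s \<le> x" "x \<le> t"
    then have x: "x > T" using that by auto
    have "f' x - A * exp (- a * x) \<le> 0" using bd[OF x] by auto
    then show "\<exists>y. DERIV h x :> y \<and> y \<le> 0" using dh[OF x] by blast
  qed
  have gh: "g u \<le> h u" for u using A a by (simp add: g_def h_def)
  have "g t \<le> h (T+1)" if "t > T" for t
  proof -
    have "g t \<le> g (max t (T+1))" using mono that by auto
    also have "\<dots> \<le> h (max t (T+1))" by (rule gh)
    also have "\<dots> \<le> h (T+1)" using dec by auto
    finally show ?thesis .
  qed
  then obtain l where l: "(g \<longlongrightarrow> l) at_top" using monotone_bounded_at_top[of T g] mono by blast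
  have "((\<lambda>u. g u + A / a * exp (- a * u)) \<longlongrightarrow> l + A / a * 0) at_top"
    by (intro tendsto_intros l exp_decay_tendsto a)
  then show ?thesis by (auto simp: g_def)
qed

lemma norm_increment_bound:
  fixes X :: "real \<Rightarrow> 'a::real_normed_vector"
  assumes "s \<le> t" and "\<And>x. s \<le> x \<Longrightarrow> x \<le> t \<Longrightarrow> (X has_vector_derivative X' x) (at x within {s..t})"
    and "\<And>x. s \<le> x \<Longrightarrow> x \<le> t \<Longrightarrow> norm (X' x) \<le> B"
  shows "norm (X t - X s) \<le> B * (t - s)"
proof -
  have "norm (X t - X s) \<le> B * norm (t - s)"
  proof (rule differentiable_bound[where f' = "\<lambda>x h. h *\<^sub>R X' x"])
    show "(X has_derivative (\<lambda>h. h *\<^sub>R X' x)) (at x within {s..t})" if "x \<in> {s..t}" for x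
      using assms(2)[of x] that by (auto simp: has_vector_derivative_def)
    show "onorm (\<lambda>h. h *\<^sub>R X' x) \<le> B" if "x \<in> {s..t}" for x
    proof (rule onorm_le)
      fix h :: real
      have "norm h * norm (X' x) \<le> norm h * B" using assms(3)[of x] that by (intro mult_left_mono) auto
      then show "norm (h *\<^sub>R X' x) \<le> B * norm h" by (simp add: mult.commute)
    qed
  qed (use assms in auto)
  then show ?thesis using assms by simp
qed

text \<open>Barbalat's lemma along the orbits of an autonomous field. An orbit in a compact set is Lipschitz in time,
so G is nearly constant along it on intervals of a fixed length h; if G (X t) were not small, the convergent
function f would change by a fixed amount on infinitely many of them.\<close>

lemma barbalat:
  fixes f :: "real \<Rightarrow> real" and X :: "real \<Rightarrow> 'a::euclidean_space"
  assumes der: "\<And>t. t \<ge> T \<Longrightarrow> (f has_real_derivative G (X t)) (at t)"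
    and lim: "(f \<longlongrightarrow> l) at_top"
    and dX: "\<And>t. t \<ge> T \<Longrightarrow> (X has_vector_derivative F (X t)) (at t)"
    and K: "compact K" "\<And>t. t \<ge> T \<Longrightarrow> X t \<in> K"
    and cG: "continuous_on K G" and cF: "continuous_on K F"
  shows "((\<lambda>t. G (X t)) \<longlongrightarrow> 0) at_top"
proof (rule tendstoI)
  fix e :: real assume e: "e > 0"
  have "compact (F ` K)" using K cF by (intro compact_continuous_image) auto
  then obtain B where B: "B > 0" "\<And>x. x \<in> K \<Longrightarrow> norm (F x) \<le> B"
    unfolding compact_eq_bounded_closed bounded_pos by auto
  have lip: "norm (X t - X s) \<le> B * (t - s)" if "T \<le> s" "s \<le> t" for s t
  proof -
    have "norm (X t - X s) \<le> B * (t - s)"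
      using that dX B K
      by (intro norm_increment_bound[where X' = "\<lambda>t. F (X t)"]) (auto intro: has_vector_derivative_at_within)
    then show ?thesis .
  qed
  have "uniformly_continuous_on K G" using K cG compact_uniformly_continuous by blast
  then obtain d where d: "d > 0" "\<And>x y. x \<in> K \<Longrightarrow> y \<in> K \<Longrightarrow> dist y x < d \<Longrightarrow> dist (G y) (G x) < e/2"
    unfolding uniformly_continuous_on_def using e by (metis half_gt_zero)
  define h where "h = d / (2*B)"
  have h: "h > 0" "B * h < d" using d B by (auto simp: h_def)
  have "\<forall>\<^sub>F t in at_top. dist (f t) l < e*h/4" using lim h e by (intro tendstoD) auto
  then obtain T1 where T1: "\<And>t. t \<ge> T1 \<Longrightarrow> dist (f t) l < e*h/4" by (auto simp: eventually_at_top_linorder)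
  have "dist (G (X t)) 0 < e" if t: "t \<ge> max T T1" for t
  proof -
    obtain z where z: "z > t" "z < t + h" "f (t+h) - f t = h * G (X z)"
      using MVT2[of t "t+h" f "\<lambda>t. G (X t)"] der t h by auto
    have "h * \<bar>G (X z)\<bar> = \<bar>f (t+h) - f t\<bar>" using z h by (simp add: abs_mult)
    also have "\<dots> \<le> \<bar>f (t+h) - l\<bar> + \<bar>f t - l\<bar>" by linarith
    also have "\<dots> < e*h/4 + e*h/4" using T1[of t] T1[of "t+h"] t h by (intro add_strict_mono) (auto simp: dist_real_def)
    finally have "\<bar>G (X z)\<bar> < e/2" using h by (simp add: mult.commute[of e h])
    moreover have "dist (X z) (X t) < d" using lip[of t z] z t h B(1)
      by (smt (verit) dist_norm max.bounded_iff mult_le_cancel_left_pos)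
    then have "dist (G (X z)) (G (X t)) < e/2" using d(2) K(2) t z by auto
    ultimately show ?thesis unfolding dist_real_def by linarith
  qed
  then show "\<forall>\<^sub>F t in at_top. dist (G (X t)) 0 < e" unfolding eventually_at_top_linorder by blast
qed

lemma DERIV_reflect:
  assumes "(f has_real_derivative d) (at (- t))"
  shows "((\<lambda>s. f (- s)) has_real_derivative - d) (at t)"
proof -
  have "((\<lambda>u. f (- u)) has_real_derivative d * (- 1)) (at t)"
    by (rule DERIV_chain2[where g = uminus]) (use assms in \<open>auto intro!: derivative_eq_intros\<close>)
  then show ?thesis by simp
qed

lemma DERIV_shift_arg:
  fixes f :: "real \<Rightarrow> real"
  assumes "(f has_real_derivative d) (at (t + h))"
  shows "((\<lambda>s. f (s + h)) has_real_derivative d) (at t)"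
  using assms by (simp add: DERIV_shift)

text \<open>Joins the forward and the backward half of an orbit at time 0.\<close>

lemma DERIV_glue:
  fixes f g :: "real \<Rightarrow> real"
  assumes f: "t \<ge> 0 \<Longrightarrow> (f has_real_derivative d) (at t)" and g: "t \<le> 0 \<Longrightarrow> (g has_real_derivative d) (at t)"
    and eq: "f 0 = g 0"
  shows "((\<lambda>t. if t \<ge> 0 then f t else g t) has_real_derivative d) (at t)"
proof -
  define h where "h t = (if t \<ge> 0 then f t else g t)" for t
  consider "t > 0" | "t < 0" | "t = 0" by linarith
  then have "(h has_real_derivative d) (at t)"
  proof cases
    case 1
    show ?thesis
      by (rule has_field_derivative_transform_within_open[of f _ _ "{0<..}"]) (use 1 f in \<open>auto simp: h_def\<close>)
  next
    case 2
    show ?thesis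
      by (rule has_field_derivative_transform_within_open[of g _ _ "{..<0}"]) (use 2 g in \<open>auto simp: h_def\<close>)
  next
    case 3
    have "((\<lambda>y. (f y - f 0) / (y - 0)) \<longlongrightarrow> d) (at 0)" "((\<lambda>y. (g y - g 0) / (y - 0)) \<longlongrightarrow> d) (at 0)"
      using f g 3 by (simp_all add: has_field_derivative_iff)
    then have "((\<lambda>y. (f y - f 0) / (y - 0)) \<longlongrightarrow> d) (at_right 0)" "((\<lambda>y. (g y - g 0) / (y - 0)) \<longlongrightarrow> d) (at_left 0)"
      by (auto intro: tendsto_within_subset)
    moreover have "\<forall>\<^sub>F y in at_right 0. (f y - f 0) / (y - 0) = (h y - h 0) / (y - 0)"
      "\<forall>\<^sub>F y in at_left 0. (g y - g 0) / (y - 0) = (h y - h 0) / (y - 0)"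
      using eq by (auto simp: h_def eventually_at_filter)
    ultimately have "((\<lambda>y. (h y - h 0) / (y - 0)) \<longlongrightarrow> d) (at_right 0)" "((\<lambda>y. (h y - h 0) / (y - 0)) \<longlongrightarrow> d) (at_left 0)"
      by (auto intro: Lim_transform_eventually)
    then have "((\<lambda>y. (h y - h 0) / (y - 0)) \<longlongrightarrow> d) (at 0)" using filterlim_split_at by blast
    then show ?thesis by (simp add: has_field_derivative_iff 3)
  qed
  then show ?thesis by (simp add: h_def[abs_def])
qed

section \<open>Flows of globally Lipschitz fields\<close>

text \<open>For the norm sup e^(-2Lt) |x(t) - x0| the Picard operator is a contraction with constant 1/2 on the whole
half-line, so no continuation of local solutions is needed. The fixed point theorem is applied to
the bounded continuous function g(t) = e^(-2Lt) (x(t) - x0), which is extended to t < 0 by the value at 0.\<close>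

lemma picard_bielecki:
  fixes F :: "'a::banach \<Rightarrow> 'a"
  assumes lip: "L-lipschitz_on UNIV F" and L: "L > 0"
  shows "\<exists>x. x 0 = x0 \<and> (\<forall>t\<ge>0. (x has_vector_derivative F (x t)) (at t within {0..}))"
proof -
  define pos where "pos t = max (0::real) t" for t
  define G where "G g s = F (x0 + exp (2*L * s) *\<^sub>R (apply_bcontfun g s))" for g :: "real \<Rightarrow>\<^sub>C 'a" and s :: real
  define J where "J g t = integral {0..t} (G g)" for g t
  (* the Picard operator in the weighted variable; J g is the integral of the field along x0 + e^(2Lt) g *)
  define T where "T g t = exp (- 2*L*pos t) *\<^sub>R J g (pos t)" for g t
  have cF: "continuous_on UNIV F" by (rule lipschitz_on_continuous_on[OF lip])
  have cG: "continuous_on A (G g)" for g A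
    unfolding G_def by (intro continuous_on_compose2[OF cF] continuous_intros) auto
  have intG: "(G g) integrable_on {a..b}" for g a b
    by (rule integrable_continuous_real[OF cG])
  have dJ: "(J g has_vector_derivative G g t) (at t within {0..b})" if "t \<in> {0..b}" for g t b
    unfolding J_def by (rule integral_has_vector_derivative[OF cG that])
  have ray: "at t within {0..t+1} = at t within {0..}" if "t \<ge> 0" for t :: real
    by (rule at_within_nhd[of t "{..<t+1}"]) (use that in auto)
  have bdexp: "((\<lambda>s. exp (2*L * s)) has_integral (exp (2*L * t) / (2*L) - 1 / (2*L))) {0..t}" if "t \<ge> 0" for t
  proof -
    have "((\<lambda>s. exp (2*L * s)) has_integral (exp (2*L * t) / (2*L) - exp (2*L*0) / (2*L))) {0..t}"
      using L that by (intro fundamental_theorem_of_calculus)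
        (auto intro!: derivative_eq_intros simp flip: has_real_derivative_iff_has_vector_derivative)
    then show ?thesis by simp
  qed
  have Gdiff: "norm (G g s - G h s) \<le> L * dist g h * exp (2*L * s)" for g h s
  proof -
    have "norm (G g s - G h s) \<le> L * norm (exp (2*L * s) *\<^sub>R (apply_bcontfun g s) - exp (2*L * s) *\<^sub>R (apply_bcontfun h s))"
      unfolding G_def using lipschitz_on_normD[OF lip, of "x0 + exp (2*L * s) *\<^sub>R (apply_bcontfun g s)" "x0 + exp (2*L * s) *\<^sub>R (apply_bcontfun h s)"]
      by simp
    also have "\<dots> = L * (exp (2*L * s) * dist (apply_bcontfun g s) (apply_bcontfun h s))"
      by (simp add: dist_norm flip: scaleR_diff_right)
    also have "\<dots> \<le> L * (exp (2*L * s) * dist g h)"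
      using L by (intro mult_left_mono dist_bounded) auto
    finally show ?thesis by (simp add: mult_ac)
  qed
  have Jdiff: "norm (J g t - J h t) \<le> dist g h * exp (2*L * t) / 2" if t: "t \<ge> 0" for g h t
  proof -
    have "J g t - J h t = integral {0..t} (\<lambda>s. G g s - G h s)"
      unfolding J_def by (simp add: integral_diff intG)
    also have "norm \<dots> \<le> integral {0..t} (\<lambda>s. L * dist g h * exp (2*L * s))"
      by (intro integral_norm_bound_integral integrable_diff intG Gdiff integrable_on_mult_right
          has_integral_integrable[OF bdexp[OF t]])
    also have "\<dots> = L * dist g h * (exp (2*L * t) / (2*L) - 1 / (2*L))"
      using integral_unique[OF bdexp[OF t]] by simp
    also have "\<dots> = dist g h * (exp (2*L * t) / 2 - 1 / 2)" using L by (simp add: field_simps)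
    also have "\<dots> \<le> dist g h * (exp (2*L * t) / 2)" by (intro mult_left_mono) auto
    finally show ?thesis by simp
  qed
  have J0: "norm (J 0 t) \<le> t * norm (F x0)" if "t \<ge> 0" for t
  proof -
    have "G 0 = (\<lambda>_. F x0)" by (auto simp: G_def)
    then have "J 0 t = t *\<^sub>R F x0" using that by (simp add: J_def)
    then show ?thesis using that by simp
  qed
  have texp: "exp (- 2*L * t) * t \<le> 1 / (2*L)" if "t \<ge> 0" for t
  proof -
    have "2*L * t \<le> exp (2*L * t)" using exp_ge_add_one_self[of "2*L * t"] by linarith
    then show ?thesis using L by (simp add: exp_minus field_simps)
  qed
  have Tb: "T g \<in> bcontfun" for g
  proof (rule bcontfun_normI)
    have "continuous_on {0..} (J g)"
    proof (rule continuous_on_vector_derivative)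
      fix t :: real assume "t \<in> {0..}"
      have "(J g has_vector_derivative G g t) (at t within {0..t+1})" using dJ \<open>t \<in> {0..}\<close> by auto
      then show "(J g has_vector_derivative G g t) (at t within {0..})"
        unfolding ray[OF \<open>t \<in> {0..}\<close>[simplified]] .
    qed
    then show "continuous_on UNIV (T g)"
      unfolding T_def pos_def
      by (intro continuous_on_scaleR continuous_on_compose2[of "{0..}" "J g" UNIV "max 0"]) (auto intro!: continuous_intros)
    fix t
    define s where "s = pos t"
    have s: "s \<ge> 0" by (simp add: s_def pos_def)
    have "norm (J g s) \<le> norm (J 0 s) + norm (J g s - J 0 s)" by (metis norm_triangle_sub)
    also have "\<dots> \<le> s * norm (F x0) + norm g * exp (2*L * s) / 2"
      using J0[OF s] Jdiff[OF s, of g 0] by (simp add: dist_norm)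
    finally have "exp (- 2*L * s) * norm (J g s) \<le> exp (- 2*L * s) * (s * norm (F x0) + norm g * exp (2*L * s) / 2)"
      by (intro mult_left_mono) auto
    also have "\<dots> = (exp (- 2*L * s) * s) * norm (F x0) + norm g / 2"
      by (simp add: algebra_simps exp_minus)
    also have "\<dots> \<le> 1 / (2*L) * norm (F x0) + norm g / 2"
      using texp[OF s] by (intro add_mono mult_right_mono) auto
    finally show "norm (T g t) \<le> 1 / (2*L) * norm (F x0) + norm g / 2"
      by (simp add: T_def s_def)
  qed
  define \<Phi> where "\<Phi> g = Bcontfun (T g)" for g
  have \<Phi>: "apply_bcontfun (\<Phi> g) = T g" for g
    unfolding \<Phi>_def by (rule Bcontfun_inverse[OF Tb])
  have "\<exists>!g. \<Phi> g = g"
  proof (rule banach_fix_type[where c = "1/2"])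
    show "\<forall>g h. dist (\<Phi> g) (\<Phi> h) \<le> 1/2 * dist g h"
    proof (intro allI dist_bound)
      fix g h t
      define s where "s = pos t"
      have s: "s \<ge> 0" by (simp add: s_def pos_def)
      have "dist (T g t) (T h t) = exp (- 2*L * s) * norm (J g s - J h s)"
        by (simp add: T_def s_def dist_norm flip: scaleR_diff_right)
      also have "\<dots> \<le> exp (- 2*L * s) * (dist g h * exp (2*L * s) / 2)"
        using Jdiff[OF s] by (intro mult_left_mono) auto
      also have "\<dots> = 1/2 * dist g h" by (simp add: exp_minus)
      finally show "dist (\<Phi> g t) (\<Phi> h t) \<le> 1/2 * dist g h" by (simp add: \<Phi>)
    qed
  qed auto
  then obtain g where "\<Phi> g = g" by blast
  then have g: "apply_bcontfun g t = T g t" for t using \<Phi>[of g] by simp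
  define x where "x t = x0 + J g t" for t
  have "(x has_vector_derivative F (x t)) (at t within {0..})" if t: "t \<ge> 0" for t
  proof -
    have "G g t = F (x t)" using t unfolding G_def g T_def x_def pos_def
      by (simp add: exp_minus)
    moreover have "(J g has_vector_derivative G g t) (at t within {0..t+1})" using dJ t by auto
    then have "(J g has_vector_derivative G g t) (at t within {0..})"
      unfolding ray[OF t] .
    ultimately show ?thesis unfolding x_def
      by (auto intro!: derivative_eq_intros)
  qed
  moreover have "x 0 = x0" by (simp add: x_def J_def)
  ultimately show ?thesis by blast
qed

text \<open>Negative times are the positive times of the field - F; the two halves have the same derivative at 0.\<close>

lemma lipschitz_ode_solution:
  fixes F :: "'a::banach \<Rightarrow> 'a"
  assumes lip: "L-lipschitz_on UNIV F"
  shows "\<exists>x. x 0 = x0 \<and> (\<forall>t. (x has_vector_derivative F (x t)) (at t))"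
proof -
  define L' where "L' = L + 1"
  have L': "L' > 0" "L'-lipschitz_on UNIV F"
    using lipschitz_on_nonneg[OF lip] lipschitz_on_mono[OF lip order_refl, of L'] by (auto simp: L'_def)
  have "L'-lipschitz_on UNIV (\<lambda>v. - F v)" using L' by simp
  then obtain y where y: "y 0 = x0" "\<And>t. t \<ge> 0 \<Longrightarrow> (y has_vector_derivative - F (y t)) (at t within {0..})"
    using picard_bielecki[OF _ L'(1), of "\<lambda>v. - F v" x0] by blast
  obtain x where x: "x 0 = x0" "\<And>t. t \<ge> 0 \<Longrightarrow> (x has_vector_derivative F (x t)) (at t within {0..})"
    using picard_bielecki[OF L'(2,1), of x0] by blast
  define u where "u t = (if t \<ge> 0 then x t else y (- t))" for t
  have ym: "((\<lambda>t. y (- t)) has_vector_derivative F (y (- t))) (at t within {..0})" if "t \<le> 0" for t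
  proof -
    have *: "uminus ` {..0::real} = {0..}" by (force simp: image_iff intro: bexI[of _ "- _"])
    have "(y \<circ> uminus has_vector_derivative (-1) *\<^sub>R (- F (y (- t)))) (at t within {..0})"
      by (intro vector_diff_chain_within)
        (use that y(2)[of "-t"] * in \<open>auto intro!: derivative_eq_intros\<close>)
    then show ?thesis by (simp add: o_def)
  qed
  have "(u has_vector_derivative F (u t)) (at t)" for t
  proof -
    have "((\<lambda>t. if t \<in> {0..} then x t else y (- t)) has_vector_derivative
        (if t \<in> {0..} then F (x t) else F (y (- t)))) (at t within UNIV)"
    proof (rule has_vector_derivative_If_within_closures[where T = "{..0}"])
      have c: "closure {0::real..} = {0..}" "closure {..0::real} = {..0}" by auto
      show "(x has_vector_derivative F (x t)) (at t within {0..} \<union> closure {0..} \<inter> closure {..0})"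
        if "t \<in> {0..} \<union> closure {0..} \<inter> closure {..0}"
      proof -
        have "{0..} \<union> closure {0..} \<inter> closure {..0} = {0::real..}" by auto
        then show ?thesis using that x(2)[of t] by auto
      qed
      show "((\<lambda>t. y (- t)) has_vector_derivative F (y (- t))) (at t within {..0} \<union> closure {0..} \<inter> closure {..0})"
        if "t \<in> {..0} \<union> closure {0..} \<inter> closure {..0}"
      proof -
        have "{..0} \<union> closure {0..} \<inter> closure {..0} = {..0::real}" by auto
        then show ?thesis using that ym[of t] by auto
      qed
    qed (use x y in auto)
    moreover have "u = (\<lambda>t. if t \<in> {0..} then x t else y (- t))" by (auto simp: u_def)
    ultimately show ?thesis by (simp add: u_def if_distrib[of F])
  qed
  moreover have "u 0 = x0" by (simp add: u_def x)
  ultimately show ?thesis by blast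
qed

text \<open>The function e^(-2Lt) |x - y|^2 does not increase.\<close>

lemma lipschitz_ode_gronwall:
  fixes F :: "'a::euclidean_space \<Rightarrow> 'a"
  assumes lip: "L-lipschitz_on S F" and ab: "a \<le> b"
    and x: "\<And>t. a \<le> t \<Longrightarrow> t \<le> b \<Longrightarrow> (x has_vector_derivative F (x t)) (at t) \<and> x t \<in> S"
    and y: "\<And>t. a \<le> t \<Longrightarrow> t \<le> b \<Longrightarrow> (y has_vector_derivative F (y t)) (at t) \<and> y t \<in> S"
  shows "norm (x b - y b) \<le> exp (L * (b - a)) * norm (x a - y a)"
proof -
  define n where "n t = exp (- 2 * L * (t - a)) * ((x t - y t) \<bullet> (x t - y t))" for t
  have "n b \<le> n a"
    using ab
  proof (rule DERIV_nonpos_imp_nonincreasing)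
    fix t assume t: "a \<le> t" "t \<le> b"
    note dx = conjunct1[OF x[OF t], unfolded has_vector_derivative_def]
      and dy = conjunct1[OF y[OF t], unfolded has_vector_derivative_def]
    have d: "(n has_real_derivative exp (- 2 * L * (t - a)) *
        (2 * ((x t - y t) \<bullet> (F (x t) - F (y t))) - 2 * L * ((x t - y t) \<bullet> (x t - y t)))) (at t)"
      unfolding n_def has_field_derivative_def
      by (rule derivative_eq_intros dx dy refl)+ (auto simp: fun_eq_iff algebra_simps inner_commute inner_diff_left inner_diff_right)
    have "(x t - y t) \<bullet> (F (x t) - F (y t)) \<le> norm (x t - y t) * norm (F (x t) - F (y t))"
      by (rule norm_cauchy_schwarz)
    also have "\<dots> \<le> norm (x t - y t) * (L * norm (x t - y t))"
      using lipschitz_on_normD[OF lip] x[OF t] y[OF t] by (intro mult_left_mono) auto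
    also have "\<dots> = L * ((x t - y t) \<bullet> (x t - y t))"
      by (simp add: dot_square_norm power2_eq_square)
    finally have "exp (- 2 * L * (t - a)) *
        (2 * ((x t - y t) \<bullet> (F (x t) - F (y t))) - 2 * L * ((x t - y t) \<bullet> (x t - y t))) \<le> 0"
      by (intro mult_nonneg_nonpos) auto
    then show "\<exists>z. (n has_real_derivative z) (at t) \<and> z \<le> 0" using d by blast
  qed
  then have "exp (- (2 * L * (b - a))) * (norm (x b - y b))\<^sup>2 \<le> (norm (x a - y a))\<^sup>2"
    by (simp add: n_def dot_square_norm)
  then have "(norm (x b - y b))\<^sup>2 \<le> exp (2 * L * (b - a)) * (norm (x a - y a))\<^sup>2"
    using mult_left_mono[of "exp (- (2 * L * (b - a))) * (norm (x b - y b))\<^sup>2" "(norm (x a - y a))\<^sup>2" "exp (2 * L * (b - a))"]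
    by (simp add: exp_minus_inverse del: minus_mult_minus flip: mult.assoc)
  also have "\<dots> = (exp (L * (b - a)) * norm (x a - y a))\<^sup>2"
    by (simp add: power_mult_distrib power2_eq_square mult_ac flip: exp_add)
  finally show ?thesis by (rule power2_le_imp_le) auto
qed

lemma lipschitz_flow:
  fixes F :: "'a::euclidean_space \<Rightarrow> 'a"
  assumes lip: "L-lipschitz_on UNIV F"
  shows "\<exists>\<phi>. (\<forall>v. \<phi> v 0 = v) \<and> (\<forall>v t. (\<phi> v has_vector_derivative F (\<phi> v t)) (at t))
      \<and> (\<forall>t\<ge>0. continuous_on UNIV (\<lambda>v. \<phi> v t))"
proof -
  obtain \<phi> where \<phi>: "\<And>v. \<phi> v 0 = v" "\<And>v t. (\<phi> v has_vector_derivative F (\<phi> v t)) (at t)"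
    using lipschitz_ode_solution[OF lip] by metis
  have "continuous_on UNIV (\<lambda>v. \<phi> v t)" if "t \<ge> 0" for t
  proof -
    have "(exp (L * t))-lipschitz_on UNIV (\<lambda>v. \<phi> v t)"
    proof (rule lipschitz_onI)
      fix v w show "dist (\<phi> v t) (\<phi> w t) \<le> exp (L * t) * dist v w"
        using lipschitz_ode_gronwall[OF lip that, of "\<phi> v" "\<phi> w"] \<phi> by (simp add: dist_norm)
    qed auto
    then show ?thesis by (rule lipschitz_on_continuous_on)
  qed
  then show ?thesis using \<phi> by blast
qed

text \<open>By continuity in the initial value, the starting points whose orbits enter U form an open set, and so
do those whose orbits enter D. A connected segment is not the union of two disjoint nonempty relatively open parts, so
some point of it belongs to neither.\<close>

lemma shooting:
  fixes \<phi> :: "'a::real_normed_vector \<Rightarrow> real \<Rightarrow> 'a"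
  assumes cont: "\<And>t. t \<ge> 0 \<Longrightarrow> continuous_on UNIV (\<lambda>v. \<phi> v t)"
    and U: "open U" and D: "open D"
    and excl: "\<And>v s t. v \<in> closed_segment p0 p1 \<Longrightarrow> s \<ge> 0 \<Longrightarrow> t \<ge> 0 \<Longrightarrow> \<phi> v s \<in> U \<Longrightarrow> \<phi> v t \<in> D \<Longrightarrow> False"
    and p0: "\<exists>t\<ge>0. \<phi> p0 t \<in> U" and p1: "\<exists>t\<ge>0. \<phi> p1 t \<in> D"
  shows "\<exists>v\<in>closed_segment p0 p1. \<forall>t\<ge>0. \<phi> v t \<notin> U \<and> \<phi> v t \<notin> D"
proof (rule ccontr)
  assume neg: "\<not> ?thesis"
  define A where "A Q = (\<Union>t\<in>{0..}. (\<lambda>v. \<phi> v t) -` Q)" for Q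
  have op: "open (A Q)" if "open Q" for Q
    unfolding A_def using that cont by (intro open_UN ballI open_vimage) auto
  have "connected (closed_segment p0 p1)" by simp
  moreover have "A U \<inter> A D \<inter> closed_segment p0 p1 = {}" using excl by (auto simp: A_def)
  moreover have "closed_segment p0 p1 \<subseteq> A U \<union> A D" using neg unfolding A_def by fastforce
  moreover have "A U \<inter> closed_segment p0 p1 \<noteq> {}" using p0 by (auto simp: A_def)
  moreover have "A D \<inter> closed_segment p0 p1 \<noteq> {}" using p1 by (auto simp: A_def)
  ultimately show False using connectedD[OF _ op[OF U] op[OF D]] by blast
qed

text \<open>A product of Lipschitz functions is Lipschitz when the factors are bounded. Quadratic fields fall into this class as soon as
their arguments are clipped to a box.\<close>

definition bounded_lipschitz :: "('a::metric_space \<Rightarrow> real) \<Rightarrow> bool" where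
  "bounded_lipschitz f \<longleftrightarrow> (\<exists>L B. L-lipschitz_on UNIV f \<and> (\<forall>x. \<bar>f x\<bar> \<le> B))"

lemma bounded_lipschitz_const [intro, simp]: "bounded_lipschitz (\<lambda>_. c)"
  unfolding bounded_lipschitz_def by (intro exI[of _ 0] exI[of _ "\<bar>c\<bar>"]) (auto intro: lipschitz_on_constant)

lemma bounded_lipschitz_add [intro]:
  assumes "bounded_lipschitz f" "bounded_lipschitz g" shows "bounded_lipschitz (\<lambda>x. f x + g x)"
proof -
  obtain L B M C where h: "L-lipschitz_on UNIV f" "M-lipschitz_on UNIV g" "\<And>x. \<bar>f x\<bar> \<le> B" "\<And>x. \<bar>g x\<bar> \<le> C"
    using assms unfolding bounded_lipschitz_def by blast
  have "\<bar>f x + g x\<bar> \<le> B + C" for x using h(3,4)[of x] by linarith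
  then show ?thesis using lipschitz_on_add[OF h(1,2)] unfolding bounded_lipschitz_def by metis
qed

lemma bounded_lipschitz_mult [intro]:
  assumes "bounded_lipschitz f" "bounded_lipschitz g" shows "bounded_lipschitz (\<lambda>x. f x * g x)"
proof -
  obtain L B M C where h: "L-lipschitz_on UNIV f" "M-lipschitz_on UNIV g" "\<And>x. \<bar>f x\<bar> \<le> B" "\<And>x. \<bar>g x\<bar> \<le> C"
    using assms unfolding bounded_lipschitz_def by blast
  have BC: "B \<ge> 0" "C \<ge> 0" using h(3,4) by (meson abs_ge_zero order_trans)+
  have "(L * C + B * M)-lipschitz_on UNIV (\<lambda>x. f x * g x)"
  proof (rule lipschitz_onI)
    fix x y
    have "f x * g x - f y * g y = (f x - f y) * g x + f y * (g x - g y)" by (simp add: algebra_simps)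
    then have "dist (f x * g x) (f y * g y) \<le> \<bar>f x - f y\<bar> * \<bar>g x\<bar> + \<bar>f y\<bar> * \<bar>g x - g y\<bar>"
      by (metis abs_mult abs_triangle_ineq dist_real_def)
    also have "\<dots> \<le> (L * dist x y) * C + B * (M * dist x y)"
      using h(3,4) lipschitz_onD[OF h(1), of x y] lipschitz_onD[OF h(2), of x y] BC lipschitz_on_nonneg[OF h(1)]
      by (intro add_mono mult_mono) (auto simp: dist_real_def)
    finally show "dist (f x * g x) (f y * g y) \<le> (L * C + B * M) * dist x y" by (simp add: algebra_simps)
  qed (use BC lipschitz_on_nonneg[OF h(1)] lipschitz_on_nonneg[OF h(2)] in auto)
  moreover have "\<And>x. \<bar>f x * g x\<bar> \<le> B * C" using h BC by (auto simp: abs_mult intro: mult_mono)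
  ultimately show ?thesis unfolding bounded_lipschitz_def by metis
qed

lemma bounded_lipschitz_diff [intro]:
  assumes "bounded_lipschitz f" "bounded_lipschitz g" shows "bounded_lipschitz (\<lambda>x. f x - g x)"
  using bounded_lipschitz_add[OF assms(1) bounded_lipschitz_mult[OF bounded_lipschitz_const[of "-1"] assms(2)]] by simp

definition clip :: "real \<Rightarrow> real \<Rightarrow> real \<Rightarrow> real" where
  "clip a b x = max a (min b x)"

lemma clip_id [simp]: "a \<le> x \<Longrightarrow> x \<le> b \<Longrightarrow> clip a b x = x"
  by (auto simp: clip_def)

lemma clip_bounds: "a \<le> b \<Longrightarrow> a \<le> clip a b x \<and> clip a b x \<le> b"
  by (auto simp: clip_def)

lemma clip_low [simp]: "a \<le> b \<Longrightarrow> x \<le> a \<Longrightarrow> clip a b x = a" and clip_high [simp]: "a \<le> b \<Longrightarrow> b \<le> x \<Longrightarrow> clip a b x = b"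
  by (auto simp: clip_def)

lemma bounded_lipschitz_clip [intro]:
  "bounded_lipschitz (\<lambda>v::real \<times> real. clip a b (fst v))" "bounded_lipschitz (\<lambda>v::real \<times> real. clip a b (snd v))"
proof -
  have b: "\<bar>clip a b x\<bar> \<le> \<bar>a\<bar> + \<bar>b\<bar>" for x by (auto simp: clip_def)
  have c: "dist (clip a b x) (clip a b y) \<le> dist x y" for x y by (auto simp: clip_def dist_real_def)
  have "1-lipschitz_on UNIV (\<lambda>v::real \<times> real. clip a b (fst v))" "1-lipschitz_on UNIV (\<lambda>v::real \<times> real. clip a b (snd v))"
    by (rule lipschitz_onI; simp only: mult_1; blast intro: order_trans[OF c] dist_fst_le dist_snd_le zero_le_one)+
  with b show "bounded_lipschitz (\<lambda>v::real \<times> real. clip a b (fst v))" "bounded_lipschitz (\<lambda>v::real \<times> real. clip a b (snd v))"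
    unfolding bounded_lipschitz_def by (intro exI[of _ 1] exI[of _ "\<bar>a\<bar> + \<bar>b\<bar>"] conjI allI; simp)+
qed

text \<open>This is the only source of orbits below: the field is clipped to a box, and an orbit that is shown never to leave
the box solves the original system.\<close>

lemma planar_flow:
  fixes f g :: "real \<times> real \<Rightarrow> real"
  assumes "bounded_lipschitz f" "bounded_lipschitz g"
  shows "\<exists>x y. (\<forall>v. x v 0 = fst v \<and> y v 0 = snd v)
      \<and> (\<forall>v t. (x v has_real_derivative f (x v t, y v t)) (at t) \<and> (y v has_real_derivative g (x v t, y v t)) (at t))
      \<and> (\<forall>t\<ge>0. continuous_on UNIV (\<lambda>v. (x v t, y v t)))"
proof -
  obtain L M where "L-lipschitz_on UNIV f" "M-lipschitz_on UNIV g"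
    using assms unfolding bounded_lipschitz_def by blast
  note lipschitz_flow[OF lipschitz_on_Pair[OF this]]
  then obtain \<phi> where "(\<forall>v. \<phi> v 0 = v)
      \<and> (\<forall>v t. (\<phi> v has_vector_derivative (f (\<phi> v t), g (\<phi> v t))) (at t))
      \<and> (\<forall>t\<ge>0. continuous_on UNIV (\<lambda>v. \<phi> v t))" by (rule exE)
  then have \<phi>: "\<And>v. \<phi> v 0 = v" "\<And>v t. (\<phi> v has_vector_derivative (f (\<phi> v t), g (\<phi> v t))) (at t)"
      "\<And>t. t \<ge> 0 \<Longrightarrow> continuous_on UNIV (\<lambda>v. \<phi> v t)" by (simp_all only: simp_thms)
  have "((\<lambda>t. fst (\<phi> v t)) has_vector_derivative fst (f (\<phi> v t), g (\<phi> v t))) (at t)"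
    "((\<lambda>t. snd (\<phi> v t)) has_vector_derivative snd (f (\<phi> v t), g (\<phi> v t))) (at t)" for v t
    by (intro bounded_linear.has_vector_derivative[OF bounded_linear_fst]
        bounded_linear.has_vector_derivative[OF bounded_linear_snd] \<phi>)+
  then show ?thesis
    using \<phi>(1,3)
    by (intro exI[of _ "\<lambda>v t. fst (\<phi> v t)"] exI[of _ "\<lambda>v t. snd (\<phi> v t)"])
      (simp add: has_real_derivative_iff_has_vector_derivative)
qed

section \<open>The Lotka-Volterra system near its rest point (\<kappa>, 0)\<close>

text \<open>The system satisfied by x = - W'/W and z = \<zeta>'/\<zeta> for a solution (W, \<zeta>) of the equation in the
time ln r. Its quadrants are invariant, and the sign of xz is that of \<epsilon>.\<close>

definition lv_at :: "real \<Rightarrow> real \<Rightarrow> real \<Rightarrow> real \<Rightarrow> (real \<Rightarrow> real) \<Rightarrow> (real \<Rightarrow> real) \<Rightarrow> real \<Rightarrow> bool" where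
  "lv_at P q \<kappa> M x z t \<longleftrightarrow>
     (x has_real_derivative x t * (x t - \<kappa> + z t / P)) (at t) \<and>
     (z has_real_derivative z t * (M - q * x t - z t)) (at t)"

text \<open>The stable manifold of the saddle (\<kappa>, 0), on the side z > 0 or z < 0 according to s. In the
coordinates y = sz and V = s(\<kappa> - x) it lies in a small box with corner at the origin: y decays exponentially there, while V
increases at the top V = w and decreases at the bottom, so that shooting from the side y = \<delta> gives an
orbit that never leaves. On this orbit V stays below the line V = y/P, since V - y/P would otherwise grow
exponentially; hence V decays like y.\<close>

lemma fundamental_orbit:
  fixes P q \<kappa> M s :: real
  assumes P: "P > 0" and q: "q > 0" and \<kappa>: "\<kappa> > 0" and M: "M < q * \<kappa>" and s: "s = 1 \<or> s = - 1"
  shows "\<exists>x z a C. a > 0 \<and> (\<forall>t\<ge>0. lv_at P q \<kappa> M x z t \<and> x t > 0 \<and> s * z t > 0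
            \<and> \<bar>x t - \<kappa>\<bar> \<le> C * exp (- a * t) \<and> \<bar>z t\<bar> \<le> C * exp (- a * t))"
proof -
  define \<nu> where "\<nu> = q * \<kappa> - M"
  (* with this \<delta> the rate - y'/y stays between \<nu>/2 and 3\<nu>/2 in the box *)
  define \<delta> where "\<delta> = min (P * \<kappa> / 4) (\<nu> / (2 * (2 * q / P + 1)))"
  have \<nu>: "\<nu> > 0" using M by (simp add: \<nu>_def)
  have \<delta>: "\<delta> > 0" using P q \<kappa> \<nu> by (auto simp: \<delta>_def intro!: divide_pos_pos add_pos_pos)
  (* twice the largest height y/P of the line on which V is stationary, so V increases at the top of the box *)
  define w where "w = 2 * \<delta> / P"
  have w: "w > 0" "w \<le> \<kappa> / 2" using \<delta> P \<kappa> by (auto simp: w_def \<delta>_def field_simps min_def)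
  have "\<delta> * (2 * (2 * q / P + 1)) \<le> \<nu>"
  proof -
    have "2 * (2 * q / P + 1) > 0" using P q by (auto intro!: add_pos_pos)
    moreover have "\<delta> \<le> \<nu> / (2 * (2 * q / P + 1))" by (simp add: \<delta>_def)
    ultimately show ?thesis by (simp add: pos_le_divide_eq)
  qed
  then have small: "q * w + \<delta> \<le> \<nu> / 2" by (simp add: w_def algebra_simps)
  define cy where "cy v = clip 0 \<delta> (fst v)" for v :: "real \<times> real"
  define cV where "cV v = clip 0 w (snd v)" for v :: "real \<times> real"
  define r where "r v = \<nu> - q * s * cV v + s * cy v" for v
  define f where "f v = (- 1) * (cy v * r v)" for v
  define g where "g v = (\<kappa> - s * cV v) * (cV v - 1 / P * cy v)" for v
  have bl: "bounded_lipschitz cy" "bounded_lipschitz cV" unfolding cy_def cV_def by auto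
  have "bounded_lipschitz f" "bounded_lipschitz g" unfolding f_def g_def r_def
    by (intro bounded_lipschitz_mult bounded_lipschitz_diff bounded_lipschitz_add bounded_lipschitz_const bl)+
  then obtain Y V where init: "\<And>v. Y v 0 = fst v" "\<And>v. V v 0 = snd v"
    and dY: "\<And>v t. (Y v has_real_derivative f (Y v t, V v t)) (at t)"
    and dV: "\<And>v t. (V v has_real_derivative g (Y v t, V v t)) (at t)"
    and cont: "\<And>t. t \<ge> 0 \<Longrightarrow> continuous_on UNIV (\<lambda>v. (Y v t, V v t))"
    using planar_flow[of f g] by blast
  have cyb: "0 \<le> cy v" "cy v \<le> \<delta>" for v using clip_bounds[of 0 \<delta>] \<delta> by (auto simp: cy_def)
  have cVb: "0 \<le> cV v" "cV v \<le> w" for v using clip_bounds[of 0 w] w by (auto simp: cV_def)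
  have kb: "\<kappa> - s * cV v \<ge> \<kappa> / 2" for v using s cVb[of v] w by auto
  have rb: "r v \<ge> \<nu> / 2" "r v \<le> 3 * \<nu> / 2" for v
  proof -
    have "q * cV v \<le> q * w" "q * cV v \<ge> 0" using cVb[of v] q by (auto simp: mult_left_mono)
    then show "r v \<ge> \<nu> / 2" "r v \<le> 3 * \<nu> / 2"
      unfolding r_def using s cyb[of v] small by auto
  qed
  have yw: "1 / P * cy v \<le> w / 2" for v using cyb[of v] P by (simp add: w_def divide_right_mono)
  have g_up: "g v > 0" if "snd v \<ge> w" for v
  proof -
    have "cV v = w" using that w by (simp add: cV_def)
    then have "cV v - 1 / P * cy v > 0" using yw[of v] w by linarith
    then show ?thesis unfolding g_def using kb[of v] \<kappa> by (intro mult_pos_pos) auto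
  qed
  have g_down: "g v \<le> 0" if "snd v \<le> 0" for v
  proof -
    have "cV v = 0" using that w by (simp add: cV_def)
    then show ?thesis unfolding g_def using cyb[of v] P \<kappa> by (auto intro!: mult_nonneg_nonpos)
  qed
  have "\<exists>v\<in>closed_segment (\<delta>, w) (\<delta>, 0).
      \<forall>t\<ge>0. (Y v t, V v t) \<notin> {v. snd v > w} \<and> (Y v t, V v t) \<notin> {v. snd v < 0}"
  proof (rule shooting[OF cont])
    show "open {v::real \<times> real. snd v > w}" "open {v::real \<times> real. snd v < 0}"
      by (auto intro!: open_Collect_less continuous_intros)
    fix v :: "real \<times> real" and a b :: real
    assume ab: "a \<ge> 0" "b \<ge> 0" "(Y v a, V v a) \<in> {v. snd v > w}" "(Y v b, V v b) \<in> {v. snd v < 0}"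
    show False
    proof (cases "a \<le> b")
      case True
      have "V v b > w"
        by (rule stays_gt_barrier[OF dV _ _ True]) (use ab g_up in \<open>auto intro: less_imp_le\<close>)
      then show ?thesis using ab w by auto
    next
      case False
      have "- V v a > 0"
        by (rule stays_gt_barrier[where f = "\<lambda>t. - V v t" and f' = "\<lambda>t. - g (Y v t, V v t)" and ?t1.0 = b])
          (use ab False g_down in \<open>auto intro!: derivative_eq_intros dV\<close>)
      then show ?thesis using ab w by auto
    qed
  next
    have "g (Y (\<delta>, w) 0, V (\<delta>, w) 0) > 0" using g_up by (simp add: init)
    then obtain h where "h > 0" "\<And>t. t > 0 \<Longrightarrow> t < h \<Longrightarrow> V (\<delta>, w) 0 < V (\<delta>, w) (0 + t)"
      using DERIV_pos_inc_right[OF dV] by blast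
    from this(1) this(2)[of "h/2"] show "\<exists>t\<ge>0. (Y (\<delta>, w) t, V (\<delta>, w) t) \<in> {v. snd v > w}"
      by (intro exI[of _ "h/2"]) (auto simp: init)
    have "g (Y (\<delta>, 0) 0, V (\<delta>, 0) 0) < 0"
      using \<delta> w P \<kappa> by (simp add: init g_def cV_def cy_def)
    then obtain h where "h > 0" "\<And>t. t > 0 \<Longrightarrow> t < h \<Longrightarrow> V (\<delta>, 0) 0 > V (\<delta>, 0) (0 + t)"
      using DERIV_neg_dec_right[OF dV] by blast
    from this(1) this(2)[of "h/2"] show "\<exists>t\<ge>0. (Y (\<delta>, 0) t, V (\<delta>, 0) t) \<in> {v. snd v < 0}"
      by (intro exI[of _ "h/2"]) (auto simp: init)
  qed
  then obtain v where v: "v \<in> closed_segment (\<delta>, w) (\<delta>, 0)" "\<And>t. t \<ge> 0 \<Longrightarrow> V v t \<le> w \<and> 0 \<le> V v t"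
    by force
  have fstv: "fst v = \<delta>" using v(1) by (auto simp: closed_segment_def algebra_simps)
  define y where "y = Y v"
  define W where "W = V v"
  have y0: "y 0 = \<delta>" by (simp add: y_def init fstv)
  have W: "0 \<le> W t" "W t \<le> w" if "t \<ge> 0" for t using v(2)[OF that] by (auto simp: W_def)
  have dy: "(y has_real_derivative f (y t, W t)) (at t)" and dW: "(W has_real_derivative g (y t, W t)) (at t)" for t
    using dY dV by (auto simp: y_def W_def)
  have f0: "f u \<le> 0" for u using rb[of u] cyb[of u] \<nu> by (auto simp: f_def intro!: mult_nonneg_nonneg)
  have y_le: "y t \<le> \<delta>" if "t \<ge> 0" for t
    using DERIV_nonpos_imp_nonincreasing[OF that, of y] dy f0 y0 by metis
  have y_pos: "y t > 0" if t: "t \<ge> 0" for t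
  proof (rule stays_positive[OF dy _ _ t, where c = "3 * \<nu> / 2"])
    fix u assume u: "0 \<le> u" and yu: "y u > 0"
    then have "cy (y u, W u) = y u" using y_le[OF u] by (simp add: cy_def)
    then have "f (y u, W u) = - (y u * r (y u, W u))" by (simp add: f_def)
    moreover have "y u * r (y u, W u) \<le> y u * (3 * \<nu> / 2)"
      using rb yu by (intro mult_left_mono) auto
    ultimately show "- (3 * \<nu> / 2) * y u \<le> f (y u, W u)" by (simp add: mult.commute)
  qed (use y0 \<delta> in auto)
  have feq: "f (y t, W t) = - y t * (\<nu> - q * s * W t + s * y t)"
    and geq: "g (y t, W t) = (\<kappa> - s * W t) * (W t - y t / P)" if "t \<ge> 0" for t
    using y_le[OF that] y_pos[OF that] W[OF that] by (auto simp: f_def g_def r_def cy_def cV_def)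
  have y_exp: "y t \<le> \<delta> * exp (- (\<nu> / 2) * t)" if t: "t \<ge> 0" for t
  proof -
    have "y t * exp (\<nu> / 2 * t) \<le> y 0 * exp (\<nu> / 2 * 0)"
      using t
    proof (rule DERIV_nonpos_imp_nonincreasing)
      fix u assume u: "0 \<le> u" "u \<le> t"
      have "cy (y u, W u) = y u" using y_le[OF u(1)] y_pos[OF u(1)] by (simp add: cy_def)
      then have "f (y u, W u) = - (y u * r (y u, W u))" by (simp add: f_def)
      moreover have "y u * r (y u, W u) \<ge> y u * (\<nu> / 2)"
        using rb y_pos[OF u(1)] by (intro mult_left_mono) auto
      ultimately have "(f (y u, W u) + \<nu> / 2 * y u) * exp (\<nu> / 2 * u) \<le> 0"
        by (intro mult_nonpos_nonneg) (auto simp: mult.commute)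
      moreover have "((\<lambda>t. y t * exp (\<nu> / 2 * t)) has_real_derivative
          (f (y u, W u) + \<nu> / 2 * y u) * exp (\<nu> / 2 * u)) (at u)"
        by (auto intro!: derivative_eq_intros dy simp: algebra_simps)
      ultimately show "\<exists>d. DERIV (\<lambda>t. y t * exp (\<nu> / 2 * t)) u :> d \<and> d \<le> 0" by blast
    qed
    then show ?thesis by (simp add: y0 exp_minus field_simps)
  qed
  (* D = W - y/P satisfies D' >= (\<kappa>/2) D where it is positive, which a bounded W excludes *)
  have W_le: "W t \<le> y t / P" if t: "t \<ge> 0" for t
  proof (rule ccontr)
    assume neg: "\<not> W t \<le> y t / P"
    define D where "D u = W u - y u / P" for u
    define D' where "D' u = g (y u, W u) - f (y u, W u) / P" for u
    have dD: "(D has_real_derivative D' u) (at u)" for u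
      unfolding D_def D'_def using P by (auto intro!: derivative_eq_intros dy dW)
    define d where "d = D t"
    have d: "d > 0" using neg by (simp add: d_def D_def)
    have D'ge: "D' u \<ge> \<kappa> / 2 * D u" if "u \<ge> 0" "D u \<ge> 0" for u
    proof -
      have "f (y u, W u) / P \<le> 0" using f0[of "(y u, W u)"] P by (simp add: divide_nonpos_pos)
      then have "D' u \<ge> (\<kappa> - s * W u) * D u" using geq[OF that(1)] by (simp add: D'_def D_def)
      moreover have "(\<kappa> - s * W u) * D u \<ge> \<kappa> / 2 * D u"
        using that(2) W[OF that(1)] w s by (intro mult_right_mono) auto
      ultimately show ?thesis by linarith
    qed
    have Dd: "D u > d / 2" if u: "u \<ge> t" for u
    proof (rule stays_gt_barrier[OF dD _ _ u])
      fix u assume "t \<le> u" "d / 2 < D u"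
      then show "D' u \<ge> 0" using D'ge[of u] d t \<kappa> by (smt (verit) divide_pos_pos mult_pos_pos)
    qed (use d in \<open>auto simp: d_def\<close>)
    have "\<exists>T'\<ge>t. \<forall>u\<ge>T'. D u \<ge> w + 1"
    proof (rule eventually_above_barrier[OF dD])
      fix u assume u: "t \<le> u"
      have "\<kappa> / 2 * D u \<ge> \<kappa> / 2 * (d / 2)" using Dd[OF u] \<kappa> by (intro mult_left_mono) auto
      then show "D' u \<ge> \<kappa> / 2 * (d / 2)" using D'ge[of u] Dd[OF u] d u t by auto
    qed (use \<kappa> d in auto)
    then obtain T where T: "T \<ge> t" "D T \<ge> w + 1" by blast
    moreover have "D T \<le> w" using W[of T] y_pos[of T] T t P unfolding D_def by (smt (verit) divide_pos_pos)
    ultimately show False by simp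
  qed
  define x where "x t = \<kappa> - s * W t" for t
  define z where "z t = s * y t" for t
  have ss: "s * s = 1" using s by auto
  have "lv_at P q \<kappa> M x z t \<and> x t > 0 \<and> s * z t > 0
      \<and> \<bar>x t - \<kappa>\<bar> \<le> (\<delta> + \<delta> / P) * exp (- (\<nu> / 2) * t) \<and> \<bar>z t\<bar> \<le> (\<delta> + \<delta> / P) * exp (- (\<nu> / 2) * t)" if t: "t \<ge> 0" for t
  proof (intro conjI)
    have "- s * g (y t, W t) = x t * (x t - \<kappa> + z t / P)"
      unfolding geq[OF t] x_def z_def by (simp add: algebra_simps diff_divide_distrib)
    moreover have "(x has_real_derivative - s * g (y t, W t)) (at t)"
      unfolding x_def by (auto intro!: derivative_eq_intros dW)
    moreover have "s * f (y t, W t) = z t * (M - q * x t - z t)"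
      unfolding feq[OF t] x_def z_def \<nu>_def by (simp add: algebra_simps)
    moreover have "(z has_real_derivative s * f (y t, W t)) (at t)"
      unfolding z_def by (auto intro!: derivative_eq_intros dy)
    ultimately show "lv_at P q \<kappa> M x z t" by (simp add: lv_at_def)
    show "x t > 0" using W[OF t] w \<kappa> s by (auto simp: x_def)
    show "s * z t > 0" using y_pos[OF t] ss by (simp add: z_def flip: mult.assoc)
    have E: "0 \<le> exp (- (\<nu> / 2) * t)" by simp
    have "\<bar>x t - \<kappa>\<bar> = W t" using s W[OF t] by (auto simp: x_def)
    also have "\<dots> \<le> \<delta> * exp (- (\<nu> / 2) * t) / P" using W_le[OF t] y_exp[OF t] P by (meson divide_right_mono less_imp_le order_trans)
    also have "\<dots> \<le> (\<delta> + \<delta> / P) * exp (- (\<nu> / 2) * t)" using \<delta> by (simp add: algebra_simps)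
    finally show "\<bar>x t - \<kappa>\<bar> \<le> (\<delta> + \<delta> / P) * exp (- (\<nu> / 2) * t)" .
    have "\<bar>z t\<bar> = y t" using s y_pos[OF t] by (auto simp: z_def)
    also have "\<dots> \<le> \<delta> * exp (- (\<nu> / 2) * t)" by (rule y_exp[OF t])
    also have "\<dots> \<le> (\<delta> + \<delta> / P) * exp (- (\<nu> / 2) * t)" using \<delta> P by (simp add: algebra_simps)
    finally show "\<bar>z t\<bar> \<le> (\<delta> + \<delta> / P) * exp (- (\<nu> / 2) * t)" .
  qed
  moreover have "\<nu> / 2 > 0" using \<nu> by simp
  ultimately show ?thesis by blast
qed

text \<open>Both orbits stay in the square of half-width R, where the field agrees with its clipped, globally
Lipschitz version.\<close>

lemma lv_unique:
  fixes P q \<kappa> M R a b :: real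
  assumes ab: "a \<le> b"
    and 1: "\<And>t. a \<le> t \<Longrightarrow> t \<le> b \<Longrightarrow> lv_at P q \<kappa> M x1 z1 t \<and> \<bar>x1 t\<bar> \<le> R \<and> \<bar>z1 t\<bar> \<le> R"
    and 2: "\<And>t. a \<le> t \<Longrightarrow> t \<le> b \<Longrightarrow> lv_at P q \<kappa> M x2 z2 t \<and> \<bar>x2 t\<bar> \<le> R \<and> \<bar>z2 t\<bar> \<le> R"
    and eq: "x1 a = x2 a" "z1 a = z2 a"
  shows "x1 b = x2 b \<and> z1 b = z2 b"
proof -
  define cx where "cx v = clip (- R) R (fst v)" for v :: "real \<times> real"
  define cz where "cz v = clip (- R) R (snd v)" for v :: "real \<times> real"
  define f where "f v = cx v * (cx v - \<kappa> + 1 / P * cz v)" for v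
  define g where "g v = cz v * (M - q * cx v - cz v)" for v
  have bl: "bounded_lipschitz cx" "bounded_lipschitz cz" unfolding cx_def cz_def by auto
  have "bounded_lipschitz f" "bounded_lipschitz g" unfolding f_def g_def
    by (intro bounded_lipschitz_mult bounded_lipschitz_diff bounded_lipschitz_add bounded_lipschitz_const bl)+
  then obtain L K where "L-lipschitz_on UNIV f" "K-lipschitz_on UNIV g"
    unfolding bounded_lipschitz_def by blast
  note lip = lipschitz_on_Pair[OF this]
  have der: "((\<lambda>t. (x t, z t)) has_vector_derivative (f (x t, z t), g (x t, z t))) (at t)"
    if "lv_at P q \<kappa> M x z t \<and> \<bar>x t\<bar> \<le> R \<and> \<bar>z t\<bar> \<le> R" for x z t
  proof -
    have "cx (x t, z t) = x t" "cz (x t, z t) = z t" using that by (auto simp: cx_def cz_def)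
    then show ?thesis using that
      by (intro has_vector_derivative_Pair)
        (auto simp: lv_at_def f_def g_def has_real_derivative_iff_has_vector_derivative)
  qed
  have "norm ((x1 b, z1 b) - (x2 b, z2 b)) \<le> exp (sqrt (L\<^sup>2 + K\<^sup>2) * (b - a)) * norm ((x1 a, z1 a) - (x2 a, z2 a))"
    by (rule lipschitz_ode_gronwall[OF lip ab, where x = "\<lambda>t. (x1 t, z1 t)" and y = "\<lambda>t. (x2 t, z2 t)"])
      (use der 1 2 in auto)
  then have "norm ((x1 b, z1 b) - (x2 b, z2 b)) \<le> 0" using eq by simp
  then show ?thesis by (simp add: zero_prod_def)
qed

text \<open>Backwards in time and with z negligible, x' = - x(x - \<kappa>), so (x - \<kappa>)^2 decreases until it is small. Then
z'/z is close to M - q\<kappa> > 0, which gives the exponential rate.\<close>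

lemma lv_backward_fundamental:
  fixes P q \<kappa> M R c0 :: real
  assumes P: "P > 0" and q: "q > 0" and \<kappa>: "\<kappa> > 0" and M: "q * \<kappa> < M" and c0: "c0 > 0"
    and orb: "\<And>t. t \<le> 0 \<Longrightarrow> lv_at P q \<kappa> M x z t \<and> c0 \<le> x t \<and> x t \<le> R"
    and z: "(z \<longlongrightarrow> 0) at_bot"
  shows "(x \<longlongrightarrow> \<kappa>) at_bot \<and> (\<exists>a C T. a > 0 \<and> (\<forall>t\<le>T. \<bar>z t\<bar> \<le> C * exp (a * t)))"
proof -
  define y where "y t = x (- t)" for t
  define v where "v t = z (- t)" for t
  have R: "R > 0" using orb[of 0] c0 by auto
  have yb: "c0 \<le> y t" "y t \<le> R" if "t \<ge> 0" for t using orb[of "- t"] that by (auto simp: y_def)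
  have dy: "(y has_real_derivative - (y t * (y t - \<kappa> + v t / P))) (at t)"
    and dv: "(v has_real_derivative - (v t * (M - q * y t - v t))) (at t)" if "t \<ge> 0" for t
    using orb[of "- t"] that unfolding y_def v_def lv_at_def by (auto intro: DERIV_reflect)
  have v0: "(v \<longlongrightarrow> 0) at_top" using z unfolding v_def by (simp add: filterlim_at_bot_mirror)
  have y\<kappa>: "(y \<longlongrightarrow> \<kappa>) at_top"
  proof (rule tendstoI)
    fix e :: real assume e: "e > 0"
    define m where "m = min 1 (c0 * (e/2)\<^sup>2 / (2 * R * (R + \<kappa>) / P))"
    have den: "2 * R * (R + \<kappa>) / P > 0" using R \<kappa> P by simp
    have "c0 * (e/2)\<^sup>2 / (2 * R * (R + \<kappa>) / P) > 0" using R P \<kappa> c0 e by (intro divide_pos_pos mult_pos_pos) auto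
    then have m: "m > 0" unfolding m_def by simp
    have "\<forall>\<^sub>F t in at_top. dist (v t) 0 < m" using v0 m by (rule tendstoD)
    then obtain T0 where "\<And>t. t \<ge> T0 \<Longrightarrow> \<bar>v t\<bar> < m" by (auto simp: eventually_at_top_linorder)
    then obtain T where T: "T \<ge> 0" "\<And>t. t \<ge> T \<Longrightarrow> \<bar>v t\<bar> < m" by (metis max.bounded_iff max.cobounded1)
    define h' where "h' t = 2 * (y t - \<kappa>) * (y t * (y t - \<kappa> + v t / P))" for t
    have "\<exists>T'\<ge>T. \<forall>t\<ge>T'. - (y t - \<kappa>)\<^sup>2 \<ge> - (e/2)\<^sup>2"
    proof (rule eventually_above_barrier[where f' = h'])
      fix t assume t: "T \<le> t"
      show "((\<lambda>t. - (y t - \<kappa>)\<^sup>2) has_real_derivative h' t) (at t)"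
        unfolding h'_def using T t by (auto intro!: derivative_eq_intros dy simp: algebra_simps diff_divide_distrib add_divide_distrib)
      assume "- (y t - \<kappa>)\<^sup>2 \<le> - (e/2)\<^sup>2"
      then have "(e/2)\<^sup>2 \<le> (y t - \<kappa>)\<^sup>2" by simp
      then have A: "2 * y t * (y t - \<kappa>)\<^sup>2 \<ge> 2 * c0 * (e/2)\<^sup>2"
        using yb[of t] T t c0 by (intro mult_mono) auto
      have "\<bar>2 * (y t - \<kappa>) * y t * v t / P\<bar> \<le> 2 * (R + \<kappa>) * R * m / P"
        unfolding abs_mult abs_divide using yb[of t] T(2)[of t] T(1) t c0 P \<kappa> R m
        by (intro divide_mono mult_mono) auto
      also have "\<dots> = m * (2 * R * (R + \<kappa>) / P)" by simp
      also have "\<dots> \<le> c0 * (e/2)\<^sup>2"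
        using den pos_le_divide_eq[OF den, of m "c0 * (e/2)\<^sup>2"] by (simp add: m_def)
      finally have B: "\<bar>2 * (y t - \<kappa>) * y t * v t / P\<bar> \<le> c0 * (e/2)\<^sup>2" .
      have "h' t = 2 * y t * (y t - \<kappa>)\<^sup>2 + 2 * (y t - \<kappa>) * y t * v t / P"
        by (simp add: h'_def power2_eq_square algebra_simps diff_divide_distrib add_divide_distrib)
      then show "h' t \<ge> c0 * (e/2)\<^sup>2" using A B by linarith
    qed (use c0 e in auto)
    then obtain T' where T': "\<And>t. t \<ge> T' \<Longrightarrow> (y t - \<kappa>)\<^sup>2 \<le> (e/2)\<^sup>2" by auto
    have "dist (y t) \<kappa> < e" if "t \<ge> T'" for t
      using abs_le_square_iff[of "y t - \<kappa>" "e/2"] T'[OF that] e by (simp add: dist_real_def)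
    then show "\<forall>\<^sub>F t in at_top. dist (y t) \<kappa> < e" by (auto simp: eventually_at_top_linorder)
  qed
  define a where "a = (M - q * \<kappa>) / 2"
  have a: "a > 0" using M by (simp add: a_def)
  have "((\<lambda>t. M - q * y t - v t) \<longlongrightarrow> M - q * \<kappa> - 0) at_top" by (intro tendsto_intros y\<kappa> v0)
  moreover have "a < M - q * \<kappa> - 0" using M by (simp add: a_def field_simps)
  ultimately have "\<forall>\<^sub>F t in at_top. a < M - q * y t - v t" by (rule order_tendstoD(1))
  then obtain T0 where "\<And>t. t \<ge> T0 \<Longrightarrow> a < M - q * y t - v t" by (auto simp: eventually_at_top_linorder)
  then obtain T where T: "T \<ge> 0" "\<And>t. t \<ge> T \<Longrightarrow> a < M - q * y t - v t" by (metis max.bounded_iff max.cobounded1)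
  have "\<bar>v t\<bar> \<le> \<bar>v T\<bar> * exp (a * T) * exp (- a * t)" if t: "t \<ge> T" for t
  proof -
    have "(v t * exp (a * t))\<^sup>2 \<le> (v T * exp (a * T))\<^sup>2"
      using t
    proof (rule DERIV_nonpos_imp_nonincreasing)
      fix u assume u: "T \<le> u" "u \<le> t"
      define d where "d = 2 * (v u * exp (a * u)) * ((a - (M - q * y u - v u)) * (v u * exp (a * u)))"
      have "((\<lambda>t. (v t * exp (a * t))\<^sup>2) has_real_derivative d) (at u)"
        unfolding d_def using u T by (auto intro!: derivative_eq_intros dv simp: algebra_simps power2_eq_square)
      moreover have "d = 2 * (a - (M - q * y u - v u)) * (v u * exp (a * u))\<^sup>2" by (simp add: d_def power2_eq_square)
      moreover have "2 * (a - (M - q * y u - v u)) * (v u * exp (a * u))\<^sup>2 \<le> 0"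
        by (rule mult_nonpos_nonneg) (use T(2)[OF u(1)] in simp_all)
      ultimately show "\<exists>d. DERIV (\<lambda>t. (v t * exp (a * t))\<^sup>2) u :> d \<and> d \<le> 0" by auto
    qed
    then have "\<bar>v t * exp (a * t)\<bar> \<le> \<bar>v T * exp (a * T)\<bar>" by (simp add: abs_le_square_iff)
    then show ?thesis by (simp add: abs_mult exp_minus field_simps)
  qed
  then have "\<forall>t\<le>- T. \<bar>z t\<bar> \<le> \<bar>v T\<bar> * exp (a * T) * exp (a * t)"
    by (metis (no_types, opaque_lifting) minus_le_iff minus_minus minus_mult_minus v_def)
  moreover have "(x \<longlongrightarrow> \<kappa>) at_bot" using y\<kappa> unfolding y_def by (simp add: filterlim_at_bot_mirror)
  ultimately show ?thesis using a by blast
qed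

text \<open>For M > q\<kappa> both eigenvalues at (\<kappa>, 0) are positive: in reversed time every orbit that starts in a small
box stays there and tends to the rest point. The starting points (u, s\<eta>) differ in x only; since |z| is strictly
increasing in t, an orbit meets the line |z| = \<eta> at time 0 only, and so different u belong to different orbits.\<close>

lemma fundamental_orbit_family:
  fixes P q \<kappa> M s :: real
  assumes P: "P > 0" and q: "q > 0" and \<kappa>: "\<kappa> > 0" and M: "q * \<kappa> < M" and s: "s = 1 \<or> s = - 1"
  shows "\<exists>X Z \<delta> \<eta>. 0 < \<delta> \<and> \<delta> < \<kappa> \<and> 0 < \<eta> \<and> (\<forall>u. \<kappa> - \<delta> \<le> u \<and> u \<le> \<kappa> + \<delta> \<longrightarrow> X u 0 = u \<and> s * Z u 0 = \<eta> \<and>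
     (\<forall>t\<le>0. lv_at P q \<kappa> M (X u) (Z u) t \<and> \<kappa> - \<delta> \<le> X u t \<and> X u t \<le> \<kappa> + \<delta> \<and> 0 < s * Z u t \<and> s * Z u t \<le> \<eta>)
     \<and> (\<forall>t<0. s * Z u t < \<eta>) \<and> (Z u \<longlongrightarrow> 0) at_bot)"
proof -
  define \<nu> where "\<nu> = M - q * \<kappa>"
  have \<nu>: "\<nu> > 0" using M by (simp add: \<nu>_def)
  (* with \<eta> = P \<delta> the term z/P cannot outweigh x - \<kappa> at the sides of the box; \<delta> also keeps the rate of z between \<nu>/2 and 3\<nu>/2 *)
  define \<delta> where "\<delta> = min (\<kappa> / 2) (\<nu> / (2 * (q + P)))"
  define \<eta> where "\<eta> = P * \<delta>"
  have \<delta>: "0 < \<delta>" using P q \<kappa> \<nu> by (auto simp: \<delta>_def)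
  have "\<delta> \<le> \<kappa> / 2" unfolding \<delta>_def by (rule min.cobounded1)
  with \<delta> P \<kappa> have \<delta>: "0 < \<delta>" "\<delta> < \<kappa>" and \<eta>: "\<eta> > 0" by (auto simp: \<eta>_def)
  have "\<delta> \<le> \<nu> / (2 * (q + P))" by (simp add: \<delta>_def)
  then have small: "q * \<delta> + \<eta> \<le> \<nu> / 2" using P q by (simp add: pos_le_divide_eq \<eta>_def algebra_simps)
  define cx where "cx v = clip (\<kappa> - \<delta>) (\<kappa> + \<delta>) (fst v)" for v :: "real \<times> real"
  define cy where "cy v = clip 0 \<eta> (snd v)" for v :: "real \<times> real"
  define r where "r v = M - q * cx v - s * cy v" for v
  define f where "f v = (- 1) * (cx v * (cx v - \<kappa> + s / P * cy v))" for v
  define g where "g v = (- 1) * (cy v * r v)" for v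
  have bl: "bounded_lipschitz cx" "bounded_lipschitz cy" unfolding cx_def cy_def by auto
  have "bounded_lipschitz f" "bounded_lipschitz g" unfolding f_def g_def r_def
    by (intro bounded_lipschitz_mult bounded_lipschitz_diff bounded_lipschitz_add bounded_lipschitz_const bl)+
  then obtain X Y where init: "\<And>v. X v 0 = fst v" "\<And>v. Y v 0 = snd v"
    and dX: "\<And>v t. (X v has_real_derivative f (X v t, Y v t)) (at t)"
    and dY: "\<And>v t. (Y v has_real_derivative g (X v t, Y v t)) (at t)"
    using planar_flow[of f g] by blast
  have cxb: "\<kappa> - \<delta> \<le> cx v" "cx v \<le> \<kappa> + \<delta>" for v using clip_bounds[of "\<kappa> - \<delta>" "\<kappa> + \<delta>"] \<delta> by (auto simp: cx_def)
  have cyb: "0 \<le> cy v" "cy v \<le> \<eta>" for v using clip_bounds[of 0 \<eta>] \<eta> by (auto simp: cy_def)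
  have sy: "- \<delta> \<le> s / P * cy v" "s / P * cy v \<le> \<delta>" for v
    using s cyb[of v] P \<delta> by (auto simp: \<eta>_def field_simps)
  have rb: "r v \<ge> \<nu> / 2" "r v \<le> 3 * \<nu> / 2" for v
  proof -
    have "q * cx v \<le> q * (\<kappa> + \<delta>)" "q * cx v \<ge> q * (\<kappa> - \<delta>)" using cxb[of v] q by (auto simp: mult_left_mono)
    then have "q * cx v \<le> q * \<kappa> + q * \<delta>" "q * cx v \<ge> q * \<kappa> - q * \<delta>" by (simp_all add: distrib_left right_diff_distrib)
    moreover have "\<bar>s * cy v\<bar> \<le> \<eta>" using s cyb[of v] by auto
    ultimately show "r v \<ge> \<nu> / 2" "r v \<le> 3 * \<nu> / 2"
      unfolding r_def using small \<nu>_def by linarith+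
  qed
  have main: "X (u, \<eta>) 0 = u \<and> Y (u, \<eta>) 0 = \<eta> \<and>
     (\<forall>t\<ge>0. \<kappa> - \<delta> \<le> X (u, \<eta>) t \<and> X (u, \<eta>) t \<le> \<kappa> + \<delta> \<and> 0 < Y (u, \<eta>) t \<and> Y (u, \<eta>) t \<le> \<eta> * exp (- (\<nu> / 2) * t))"
    if u: "\<kappa> - \<delta> \<le> u" "u \<le> \<kappa> + \<delta>" for u
  proof -
    define x where "x = X (u, \<eta>)"
    define y where "y = Y (u, \<eta>)"
    have x0: "x 0 = u" "y 0 = \<eta>" by (auto simp: x_def y_def init)
    have dx: "(x has_real_derivative f (x t, y t)) (at t)" and dy: "(y has_real_derivative g (x t, y t)) (at t)" for t
      using dX dY by (auto simp: x_def y_def)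
    have x_lo: "x t \<ge> \<kappa> - \<delta>" if t: "t \<ge> 0" for t
    proof (rule stays_ge_barrier[OF dx _ _ t])
      fix t assume "x t < \<kappa> - \<delta>"
      then have "cx (x t, y t) = \<kappa> - \<delta>" using \<delta> by (simp add: cx_def)
      then show "f (x t, y t) \<ge> 0" using sy[of "(x t, y t)"] \<delta>
        by (auto simp: f_def intro!: mult_nonneg_nonpos)
    qed (use x0 u in auto)
    have x_hi: "- x t \<ge> - (\<kappa> + \<delta>)" if t: "t \<ge> 0" for t
    proof (rule stays_ge_barrier[where f = "\<lambda>t. - x t" and f' = "\<lambda>t. - f (x t, y t)", OF _ _ _ t])
      fix t assume "- x t < - (\<kappa> + \<delta>)"
      then have "cx (x t, y t) = \<kappa> + \<delta>" using \<delta> by (simp add: cx_def)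
      then show "- f (x t, y t) \<ge> 0" using sy[of "(x t, y t)"] \<delta> \<kappa>
        by (auto simp: f_def intro!: mult_nonneg_nonneg)
    qed (use x0 u in \<open>auto intro!: derivative_eq_intros dx\<close>)
    have g0: "g w \<le> 0" for w using rb[of w] cyb[of w] \<nu> by (auto simp: g_def intro!: mult_nonneg_nonneg)
    have y_le: "y t \<le> \<eta>" if "t \<ge> 0" for t
      using DERIV_nonpos_imp_nonincreasing[OF that, of y] dy g0 x0 by metis
    have y_pos: "y t > 0" if t: "t \<ge> 0" for t
    proof (rule stays_positive[OF dy _ _ t, where c = "3 * \<nu> / 2"])
      fix u assume u: "0 \<le> u" and yu: "y u > 0"
      then have "cy (x u, y u) = y u" using y_le[OF u] by (simp add: cy_def)
      then have "g (x u, y u) = - (y u * r (x u, y u))" by (simp add: g_def)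
      moreover have "y u * r (x u, y u) \<le> y u * (3 * \<nu> / 2)"
        using rb yu by (intro mult_left_mono) auto
      ultimately show "- (3 * \<nu> / 2) * y u \<le> g (x u, y u)" by (simp add: mult.commute)
    qed (use x0 \<eta> in auto)
    have "y t \<le> \<eta> * exp (- (\<nu> / 2) * t)" if t: "t \<ge> 0" for t
    proof -
      have "y t * exp (\<nu> / 2 * t) \<le> y 0 * exp (\<nu> / 2 * 0)"
        using t
      proof (rule DERIV_nonpos_imp_nonincreasing)
        fix u assume u: "0 \<le> u" "u \<le> t"
        have "cy (x u, y u) = y u" using y_le[OF u(1)] y_pos[OF u(1)] by (simp add: cy_def)
        then have "g (x u, y u) = - (y u * r (x u, y u))" by (simp add: g_def)
        moreover have "y u * r (x u, y u) \<ge> y u * (\<nu> / 2)"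
          using rb y_pos[OF u(1)] by (intro mult_left_mono) auto
        ultimately have "(g (x u, y u) + \<nu> / 2 * y u) * exp (\<nu> / 2 * u) \<le> 0"
          by (intro mult_nonpos_nonneg) (auto simp: mult.commute)
        moreover have "((\<lambda>t. y t * exp (\<nu> / 2 * t)) has_real_derivative
            (g (x u, y u) + \<nu> / 2 * y u) * exp (\<nu> / 2 * u)) (at u)"
          by (auto intro!: derivative_eq_intros dy simp: algebra_simps)
        ultimately show "\<exists>d. DERIV (\<lambda>t. y t * exp (\<nu> / 2 * t)) u :> d \<and> d \<le> 0" by blast
      qed
      then show ?thesis by (simp add: x0 exp_minus field_simps)
    qed
    moreover have "x t \<le> \<kappa> + \<delta>" if "t \<ge> 0" for t using x_hi[OF that] by simp
    ultimately show ?thesis using x_lo y_pos x0 by (simp add: x_def y_def)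
  qed
  have ss: "s * s = 1" using s by auto
  have sst: "s * (s * a) = a" for a using ss by (simp flip: mult.assoc)
  define X' where "X' u t = X (u, \<eta>) (- t)" for u t
  define Z' where "Z' u t = s * Y (u, \<eta>) (- t)" for u t
  have "X' u 0 = u \<and> s * Z' u 0 = \<eta> \<and>
     (\<forall>t\<le>0. lv_at P q \<kappa> M (X' u) (Z' u) t \<and> \<kappa> - \<delta> \<le> X' u t \<and> X' u t \<le> \<kappa> + \<delta> \<and> 0 < s * Z' u t \<and> s * Z' u t \<le> \<eta>)
     \<and> (\<forall>t<0. s * Z' u t < \<eta>) \<and> (Z' u \<longlongrightarrow> 0) at_bot" if u: "\<kappa> - \<delta> \<le> u \<and> u \<le> \<kappa> + \<delta>" for u
  proof -
    note m = main[OF conjunct1[OF u] conjunct2[OF u]]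
    have lt: "Y (u, \<eta>) t < \<eta>" if "t > 0" for t
    proof -
      have "Y (u, \<eta>) t \<le> \<eta> * exp (- (\<nu> / 2) * t)"
        using conjunct2[OF conjunct2[OF m], rule_format, OF less_imp_le[OF that]] by (elim conjE)
      also have "\<dots> < \<eta> * 1" using \<eta> \<nu> that by (intro mult_strict_left_mono) auto
      finally show ?thesis by simp
    qed
    have dec: "Y (u, \<eta>) t \<le> \<eta> * exp (- (\<nu> / 2) * t)" if "t \<ge> 0" for t
      using conjunct2[OF conjunct2[OF m], rule_format, OF that] by (elim conjE)
    have bds: "\<kappa> - \<delta> \<le> X (u, \<eta>) t" "X (u, \<eta>) t \<le> \<kappa> + \<delta>" "0 < Y (u, \<eta>) t" "Y (u, \<eta>) t \<le> \<eta>" if "t \<ge> 0" for t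
      using conjunct2[OF conjunct2[OF m], rule_format, OF that] lt[of t] conjunct1[OF conjunct2[OF m]] that
      by (cases "t = 0"; simp)+
    have "lv_at P q \<kappa> M (X' u) (Z' u) t" if t: "t \<le> 0" for t
    proof -
      define v where "v = (X (u, \<eta>) (- t), Y (u, \<eta>) (- t))"
      have v: "cx v = X (u, \<eta>) (- t)" "cy v = Y (u, \<eta>) (- t)"
        using bds[of "- t"] t unfolding cx_def cy_def v_def by (auto intro!: clip_id)
      have "(X' u has_real_derivative - f v) (at t)" unfolding X'_def v_def by (rule DERIV_reflect[OF dX])
      moreover have "((\<lambda>t. Y (u, \<eta>) (- t)) has_real_derivative - g v) (at t)" unfolding v_def by (rule DERIV_reflect[OF dY])
      then have "(Z' u has_real_derivative s * - g v) (at t)" unfolding Z'_def by (rule DERIV_cmult)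
      moreover have "- f v = X' u t * (X' u t - \<kappa> + Z' u t / P)" by (simp add: f_def v X'_def Z'_def)
      moreover have "s * - g v = Z' u t * (M - q * X' u t - Z' u t)" by (simp add: g_def r_def v X'_def Z'_def)
      ultimately show ?thesis unfolding lv_at_def by simp
    qed
    moreover have "((\<lambda>t. Y (u, \<eta>) t) \<longlongrightarrow> 0) at_top"
    proof (rule tendsto_sandwich)
      show "\<forall>\<^sub>F t in at_top. 0 \<le> Y (u, \<eta>) t" "\<forall>\<^sub>F t in at_top. Y (u, \<eta>) t \<le> \<eta> * exp (- (\<nu> / 2) * t)"
        unfolding eventually_at_top_linorder using bds(3) dec by (meson less_imp_le)+
      show "((\<lambda>t. \<eta> * exp (- (\<nu> / 2) * t)) \<longlongrightarrow> 0) at_top"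
        using \<nu> by (intro tendsto_mult_right_zero exp_decay_tendsto) auto
    qed simp
    then have "(Z' u \<longlongrightarrow> 0) at_bot" unfolding Z'_def filterlim_at_bot_mirror
      by (simp add: tendsto_mult_right_zero)
    moreover have "0 < s * Z' u t" "s * Z' u t \<le> \<eta>" if "t \<le> 0" for t
      using bds[of "- t"] that unfolding Z'_def sst by simp_all
    moreover have "s * Z' u t < \<eta>" if "t < 0" for t using lt[of "- t"] that unfolding Z'_def sst by simp
    moreover have "\<kappa> - \<delta> \<le> X' u t" "X' u t \<le> \<kappa> + \<delta>" if "t \<le> 0" for t
      using bds[of "- t"] that unfolding X'_def by simp_all
    moreover have "X' u 0 = u" "s * Z' u 0 = \<eta>" using conjunct1[OF m] conjunct1[OF conjunct2[OF m]] unfolding X'_def Z'_def sst by simp_all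
    ultimately show ?thesis by blast
  qed
  then show ?thesis using \<delta> \<eta> by blast
qed

section \<open>A Lyapunov function and the interior rest point\<close>

text \<open>Let z > 0. In terms of y = r^\<gamma> w and t = ln r one has (z x^P)^((P+1)/(q-P)) = y^(P+1), y x = \<gamma>y - y' and
z x^P = y^(q-P). So this is the function
P/(P+1) (\<gamma>y - y')^(P+1) - \<gamma> y (\<gamma>y - y')^P + y^(q+1)/(q+1) + C y^(P+1) for the autonomous second order equation of y, with
the constant C for which its derivative has one sign.\<close>

definition lv_energy :: "real \<Rightarrow> real \<Rightarrow> real \<Rightarrow> real \<Rightarrow> real \<Rightarrow> real \<Rightarrow> real" where
  "lv_energy P q \<kappa> \<gamma> x z =
     (z * x powr P) powr ((P + 1) / (q - P)) *
     (x powr P * x * P / (P + 1) - \<gamma> * x powr P + z * x powr P / (q + 1)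
        + (\<gamma> - P * (\<kappa> - \<gamma>)) * \<gamma> powr P / (P + 1))"

definition lv_dissipation :: "real \<Rightarrow> real \<Rightarrow> real \<Rightarrow> real \<Rightarrow> real \<Rightarrow> real \<Rightarrow> real" where
  "lv_dissipation P q \<kappa> \<gamma> x z = (z * x powr P) powr ((P + 1) / (q - P)) *
     ((\<gamma> - P * (\<kappa> - \<gamma>)) * ((\<gamma> - x) * (\<gamma> powr P - x powr P)))"

lemma DERIV_powr_const:
  assumes "(f has_real_derivative d) (at t)" "f t > 0"
  shows "((\<lambda>t. f t powr a) has_real_derivative a * f t powr a * (d / f t)) (at t)"
proof -
  have "((\<lambda>t. f t powr a) has_real_derivative a * f t powr (a - 1) * d) (at t)"
    using assms by (auto intro!: derivative_eq_intros simp: powr_diff)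
  then show ?thesis using assms by (simp add: powr_diff)
qed

text \<open>Along an orbit that comes from a solution, |z| |x|^P = r^(p+\<sigma>) w^(q-P); its growth rate involves x only and
vanishes at x = \<gamma>.\<close>

lemma DERIV_lv_product:
  assumes P: "P > 0" and \<gamma>: "\<gamma> * (q - P) = M - \<kappa> * P"
    and lv: "lv_at P q \<kappa> M x z t" and pos: "x t > 0"
  shows "((\<lambda>t. x t powr P) has_real_derivative x t powr P * (P * (x t - \<kappa>) + z t)) (at t)"
    and "((\<lambda>t. z t * x t powr P) has_real_derivative z t * x t powr P * ((q - P) * (\<gamma> - x t))) (at t)"
proof -
  define dx where "dx = x t * (x t - \<kappa> + z t / P)"
  define dz where "dz = z t * (M - q * x t - z t)"
  define A where "A = x t powr P"
  have Dx: "(x has_real_derivative dx) (at t)" and Dz: "(z has_real_derivative dz) (at t)"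
    using lv by (auto simp: lv_at_def dx_def dz_def)
  have "P * A * (dx / x t) = A * (P * (x t - \<kappa>) + z t)" using pos P by (simp add: dx_def field_simps)
  then show DA: "((\<lambda>t. x t powr P) has_real_derivative x t powr P * (P * (x t - \<kappa>) + z t)) (at t)"
    using DERIV_powr_const[OF Dx pos(1), of P] by (simp add: A_def)
  have "dz * A + A * (P * (x t - \<kappa>) + z t) * z t = z t * A * ((q - P) * (\<gamma> - x t))"
    using \<gamma> unfolding dz_def by algebra
  then show "((\<lambda>t. z t * x t powr P) has_real_derivative z t * x t powr P * ((q - P) * (\<gamma> - x t))) (at t)"
    using DERIV_mult[OF Dz DA] by (simp add: A_def mult_ac)
qed

lemma DERIV_lv_energy:
  assumes P: "P > 0" and q: "q > P" and \<gamma>: "\<gamma> * (q - P) = M - \<kappa> * P"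
    and lv: "lv_at P q \<kappa> M x z t" and pos: "x t > 0" "z t > 0"
  shows "((\<lambda>t. lv_energy P q \<kappa> \<gamma> (x t) (z t)) has_real_derivative lv_dissipation P q \<kappa> \<gamma> (x t) (z t)) (at t)"
proof -
  define k where "k = (P + 1) / (q - P)"
  define c where "c = (\<gamma> - P * (\<kappa> - \<gamma>)) * \<gamma> powr P"
  define dx where "dx = x t * (x t - \<kappa> + z t / P)"
  define A where "A = x t powr P"
  define U where "U = (z t * A) powr k"
  have A: "A > 0" using pos by (simp add: A_def)
  have Dx: "(x has_real_derivative dx) (at t)" using lv by (auto simp: lv_at_def dx_def)
  note DA = DERIV_lv_product(1)[OF P \<gamma> lv pos(1), folded A_def]
    and DzA = DERIV_lv_product(2)[OF P \<gamma> lv pos(1), folded A_def]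
  have DU: "((\<lambda>t. (z t * x t powr P) powr k) has_real_derivative U * ((P + 1) * (\<gamma> - x t))) (at t)"
  proof -
    have "z t * x t powr P > 0" using pos by simp
    from DERIV_powr_const[OF DzA this, of k]
    show ?thesis using pos A q by (simp add: U_def A_def k_def mult_ac)
  qed
  have De: "((\<lambda>t. x t powr P * x t * P / (P + 1) - \<gamma> * x t powr P + z t * x t powr P / (q + 1) + c / (P + 1)) has_real_derivative
      (A * (P * (x t - \<kappa>) + z t) * x t + dx * A) * P / (P + 1) - \<gamma> * (A * (P * (x t - \<kappa>) + z t))
        + z t * A * ((q - P) * (\<gamma> - x t)) / (q + 1)) (at t)"
  proof -
    define pa where "pa t = x t powr P" for t
    define pb where "pb t = z t * x t powr P" for t
    have "(pa has_real_derivative A * (P * (x t - \<kappa>) + z t)) (at t)"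
      "(pb has_real_derivative z t * A * ((q - P) * (\<gamma> - x t))) (at t)"
      using DA DzA by (simp_all add: pa_def[abs_def] pb_def[abs_def])
    then have "((\<lambda>t. pa t * x t * P / (P + 1) - \<gamma> * pa t + pb t / (q + 1) + c / (P + 1)) has_real_derivative
      (A * (P * (x t - \<kappa>) + z t) * x t + dx * pa t) * P / (P + 1) - \<gamma> * (A * (P * (x t - \<kappa>) + z t))
        + z t * A * ((q - P) * (\<gamma> - x t)) / (q + 1)) (at t)"
      using P q Dx by (auto intro!: derivative_eq_intros)
    then show ?thesis by (simp add: pa_def pb_def A_def)
  qed
  have key: "U * ((P + 1) * (\<gamma> - x t)) * (A * x t * P / (P + 1) - \<gamma> * A + z t * A / (q + 1) + c / (P + 1))
      + ((A * (P * (x t - \<kappa>) + z t) * x t + dx * A) * P / (P + 1) - \<gamma> * (A * (P * (x t - \<kappa>) + z t))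
        + z t * A * ((q - P) * (\<gamma> - x t)) / (q + 1)) * U
      = U * ((\<gamma> - P * (\<kappa> - \<gamma>)) * ((\<gamma> - x t) * (\<gamma> powr P - A)))"
  proof -
    have dxP: "dx * A * P = A * x t * (P * (x t - \<kappa>) + z t)" using P by (simp add: dx_def field_simps)
    have e1: "(A * (P * (x t - \<kappa>) + z t) * x t + dx * A) * P / (P + 1) = A * x t * (P * (x t - \<kappa>) + z t)"
    proof -
      have "(A * (P * (x t - \<kappa>) + z t) * x t + dx * A) * P = A * x t * (P * (x t - \<kappa>) + z t) * (P + 1)"
        using dxP by algebra
      then show ?thesis using P by simp
    qed
    have e2: "(P + 1) * (A * x t * P / (P + 1) - \<gamma> * A + z t * A / (q + 1) + c / (P + 1))
        = A * x t * P - (P + 1) * \<gamma> * A + (P + 1) * (z t * A / (q + 1)) + c"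
    proof -
      have "(P + 1) * (r / (P + 1)) = r" for r using P by simp
      from this[of "A * x t * P"] this[of c] show ?thesis by algebra
    qed
    define w where "w = z t * A / (q + 1)"
    have w: "z t * A = w * (q + 1)" using q P by (simp add: w_def)
    have e3: "z t * A * ((q - P) * (\<gamma> - x t)) / (q + 1) = w * ((q - P) * (\<gamma> - x t))" by (simp add: w_def)
    have "(A * x t * P - (P + 1) * \<gamma> * A + (P + 1) * w + c) * (\<gamma> - x t) +
      (A * x t * (P * (x t - \<kappa>) + z t) - \<gamma> * (A * (P * (x t - \<kappa>) + z t)) + w * ((q - P) * (\<gamma> - x t)))
      = (\<gamma> - P * (\<kappa> - \<gamma>)) * ((\<gamma> - x t) * (\<gamma> powr P - A))"
      unfolding c_def using w by algebra
    then show ?thesis unfolding e1 e3 using e2 unfolding w_def[symmetric] by algebra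
  qed
  show ?thesis
    unfolding lv_energy_def lv_dissipation_def k_def[symmetric] c_def[symmetric]
    using DERIV_mult[OF DU De] key by (simp add: A_def U_def mult_ac)
qed

text \<open>LaSalle's principle for the interior rest point. Barbalat's lemma for the monotone quantity f gives
x \<longrightarrow> \<gamma>; Barbalat's lemma for x itself then gives x' \<longrightarrow> 0, and the first equation of the system determines the limit
of z. The factor s allows both directions of time.\<close>

lemma lv_equilibrium_limit:
  assumes P: "P > 0" and q: "q > P"
    and K: "compact K" and G: "continuous_on K G"
    and X: "\<And>t. t \<ge> 0 \<Longrightarrow> (x t, z t) \<in> K"
    and dx: "\<And>t. t \<ge> 0 \<Longrightarrow> (x has_real_derivative s * (x t * (x t - \<kappa> + z t / P))) (at t)"
    and dz: "\<And>t. t \<ge> 0 \<Longrightarrow> (z has_real_derivative s * (z t * (M - q * x t - z t))) (at t)"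
    and s: "s \<noteq> 0"
    and df: "\<And>t. t \<ge> 0 \<Longrightarrow> (f has_real_derivative G (x t, z t)) (at t)" and lim: "(f \<longlongrightarrow> l) at_top"
    and zero: "\<And>a b. (a, b) \<in> K \<Longrightarrow> G (a, b) = 0 \<Longrightarrow> a = \<gamma>" and \<gamma>: "\<gamma> > 0"
  shows "(x \<longlongrightarrow> \<gamma>) at_top \<and> (z \<longlongrightarrow> P * (\<kappa> - \<gamma>)) at_top"
proof -
  define F where "F v = (s * (fst v * (fst v - \<kappa> + snd v / P)), s * (snd v * (M - q * fst v - snd v)))" for v :: "real \<times> real"
  have dX: "((\<lambda>t. (x t, z t)) has_vector_derivative F (x t, z t)) (at t)" if "t \<ge> 0" for t
    unfolding F_def using dx[OF that] dz[OF that]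
    by (intro has_vector_derivative_Pair) (auto simp: has_real_derivative_iff_has_vector_derivative)
  have cF: "continuous_on A F" for A unfolding F_def using P by (intro continuous_intros) auto
  have G0: "((\<lambda>t. G (x t, z t)) \<longlongrightarrow> 0) at_top"
    by (rule barbalat[OF df lim dX K X G cF])
  have evK: "\<forall>\<^sub>F t in at_top. (x t, z t) \<in> K" using X by (auto simp: eventually_at_top_linorder)
  have x\<gamma>: "(x \<longlongrightarrow> \<gamma>) at_top"
    proof (rule tendstoI)
      fix e :: real assume e: "e > 0"
      define K' where "K' = K \<inter> {v. e \<le> \<bar>fst v - \<gamma>\<bar>}"
      have "closed {v :: real \<times> real. e \<le> \<bar>fst v - \<gamma>\<bar>}" by (intro closed_Collect_le continuous_intros)
      then have K': "compact K'" unfolding K'_def using K by blast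
      have "\<forall>\<^sub>F t in at_top. (x t, z t) \<notin> K'"
      proof (cases "K' = {}")
        case False
        have "continuous_on K' (\<lambda>v. \<bar>G v\<bar>)"
          by (intro continuous_intros continuous_on_subset[OF G]) (auto simp: K'_def)
        then obtain v where v: "v \<in> K'" "\<And>w. w \<in> K' \<Longrightarrow> \<bar>G v\<bar> \<le> \<bar>G w\<bar>"
          using continuous_attains_inf[OF K' False] by blast
        have "\<bar>G v\<bar> > 0" using zero[of "fst v" "snd v"] v(1) e by (auto simp: K'_def)
        then have "\<forall>\<^sub>F t in at_top. dist (G (x t, z t)) 0 < \<bar>G v\<bar>" using G0 by (intro tendstoD) auto
        then show ?thesis by eventually_elim (use v(2) in force)
      qed auto
      then show "\<forall>\<^sub>F t in at_top. dist (x t) \<gamma> < e"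
        using evK by eventually_elim (auto simp: K'_def dist_real_def)
    qed
  have "((\<lambda>t. fst (F (x t, z t))) \<longlongrightarrow> 0) at_top"
    by (rule barbalat[OF _ x\<gamma> dX K X _ cF, where G = "\<lambda>v. fst (F v)"])
      (use P in \<open>auto simp: F_def dx intro!: continuous_intros\<close>)
  then have "((\<lambda>t. P * (fst (F (x t, z t)) / (s * x t)) + P * (\<kappa> - x t)) \<longlongrightarrow> P * (0 / (s * \<gamma>)) + P * (\<kappa> - \<gamma>)) at_top"
    using s \<gamma> by (intro tendsto_intros x\<gamma>) auto
  moreover have "\<forall>\<^sub>F t in at_top. x t > 0" using order_tendstoD(1)[OF x\<gamma> \<gamma>] .
  then have "\<forall>\<^sub>F t in at_top. P * (fst (F (x t, z t)) / (s * x t)) + P * (\<kappa> - x t) = z t"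
    by eventually_elim (use P s in \<open>simp add: F_def field_simps\<close>)
  ultimately have "(z \<longlongrightarrow> P * (0 / (s * \<gamma>)) + P * (\<kappa> - \<gamma>)) at_top" by (rule Lim_transform_eventually)
  then show ?thesis using x\<gamma> by simp
qed

section \<open>Connecting orbits\<close>

text \<open>The part of the quadrant where the energy is at most e0 < 0 is relatively compact in the open quadrant. In the second factor of the energy
the only negative term is - \<gamma> x^P, so each of the others is smaller than \<gamma> x^P; this
bounds x and z from above and x from below. The first factor cannot be too small either, because the product is at
most e0; this bounds z from below.\<close>

lemma lv_energy_bounds:
  assumes P: "P > 0" and q: "q > P" and \<gamma>: "\<gamma> > 0" "\<gamma> > P * (\<kappa> - \<gamma>)" and pos: "a > 0" "b > 0"
    and E: "lv_energy P q \<kappa> \<gamma> a b \<le> e0" "e0 < 0"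
  shows "a < \<gamma> * (P + 1) / P" "b < \<gamma> * (q + 1)"
    "((\<gamma> - P * (\<kappa> - \<gamma>)) * \<gamma> powr P / (P + 1) / \<gamma>) powr (1 / P) < a"
    "(- e0 / (\<gamma> * (\<gamma> * (P + 1) / P) powr P)) powr ((q - P) / (P + 1)) / (\<gamma> * (P + 1) / P) powr P < b"
proof -
  define A where "A = a powr P"
  define c where "c = (\<gamma> - P * (\<kappa> - \<gamma>)) * \<gamma> powr P / (P + 1)"
  define k where "k = (P + 1) / (q - P)"
  define R where "R = \<gamma> * (P + 1) / P"
  define e where "e = A * a * P / (P + 1) - \<gamma> * A + b * A / (q + 1) + c"
  have A: "A > 0" using pos by (simp add: A_def)
  have c: "c > 0" using P \<gamma> by (simp add: c_def)
  have k: "k > 0" using P q by (simp add: k_def)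
  have U: "(b * A) powr k > 0" using A pos by simp
  have Ue: "(b * A) powr k * e \<le> e0" using E(1) by (simp add: lv_energy_def A_def e_def c_def k_def)
  then have "(b * A) powr k * e < 0" using E(2) by simp
  then have e: "e < 0" using U by (simp add: mult_less_0_iff)
  have t1: "A * a * P / (P + 1) > 0" and t2: "b * A / (q + 1) > 0" using A pos P q by simp_all
  have "A * (a * P / (P + 1) - \<gamma>) < 0" using e t2 c by (simp add: e_def algebra_simps)
  then have "a * P / (P + 1) < \<gamma>" using A by (simp add: mult_less_0_iff)
  then show aR: "a < \<gamma> * (P + 1) / P" using P by (simp add: field_simps)
  have "A * (b / (q + 1) - \<gamma>) < 0" using e t1 c by (simp add: e_def algebra_simps)
  then have "b / (q + 1) < \<gamma>" using A by (simp add: mult_less_0_iff)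
  then show "b < \<gamma> * (q + 1)" using P q by (simp add: field_simps)
  have "c < \<gamma> * A" using e t1 t2 by (simp add: e_def)
  then have "c / \<gamma> < A" using \<gamma> by (simp add: field_simps)
  then have "(c / \<gamma>) powr (1 / P) < A powr (1 / P)" using c \<gamma> P by (intro powr_less_mono2) auto
  then show "((\<gamma> - P * (\<kappa> - \<gamma>)) * \<gamma> powr P / (P + 1) / \<gamma>) powr (1 / P) < a"
    using P pos by (simp add: A_def powr_powr c_def)
  have R: "R > 0" using P \<gamma> by (simp add: R_def)
  have AR: "A < R powr P" unfolding A_def using aR pos P by (intro powr_less_mono2) (auto simp: R_def)
  have "- e < \<gamma> * A" using t1 t2 c by (simp add: e_def)
  also have "\<dots> < \<gamma> * R powr P" using AR \<gamma> by simp
  finally have "(b * A) powr k * (- e) < (b * A) powr k * (\<gamma> * R powr P)"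
    using U by (rule mult_strict_left_mono)
  with Ue have "- e0 < (b * A) powr k * (\<gamma> * R powr P)" by linarith
  moreover have "\<gamma> * R powr P > 0" using \<gamma> R by simp
  ultimately have "- e0 / (\<gamma> * R powr P) < (b * A) powr k" by (simp only: pos_divide_less_eq)
  then have "(- e0 / (\<gamma> * R powr P)) powr (1 / k) < ((b * A) powr k) powr (1 / k)"
    using E(2) \<gamma> R k by (intro powr_less_mono2) (auto intro!: divide_nonneg_pos divide_nonpos_pos mult_pos_pos)
  also have "\<dots> = b * A" using k A pos by (simp add: powr_powr)
  also have "\<dots> < b * R powr P" using AR pos by simp
  finally have "(- e0 / (\<gamma> * R powr P)) powr (1 / k) / R powr P < b" using R by (simp add: pos_divide_less_eq)
  then show "(- e0 / (\<gamma> * (\<gamma> * (P + 1) / P) powr P)) powr ((q - P) / (P + 1)) / (\<gamma> * (P + 1) / P) powr P < b"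
    by (simp add: k_def R_def)
qed

text \<open>Both factors of (\<gamma> - x)(\<gamma>^P - x^P) have the same sign, as u \<mapsto> u^P is increasing.\<close>

lemma lv_dissipation_sign:
  assumes P: "P > 0" and \<gamma>: "\<gamma> > 0" "\<gamma> > P * (\<kappa> - \<gamma>)" and pos: "a > 0" "b > 0"
  shows "lv_dissipation P q \<kappa> \<gamma> a b \<ge> 0" "lv_dissipation P q \<kappa> \<gamma> a b = 0 \<Longrightarrow> a = \<gamma>"
proof -
  have "(\<gamma> - a) * (\<gamma> powr P - a powr P) > 0" if "a \<noteq> \<gamma>"
  proof (cases "a < \<gamma>")
    case True
    then show ?thesis using P pos powr_less_mono2[of P a \<gamma>] by (intro mult_pos_pos) auto
  next
    case False
    then show ?thesis using that P \<gamma> powr_less_mono2[of P \<gamma> a] by (intro mult_neg_neg) auto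
  qed
  moreover have "(b * a powr P) powr ((P + 1) / (q - P)) > 0" using pos by simp
  ultimately have pos': "lv_dissipation P q \<kappa> \<gamma> a b > 0" if "a \<noteq> \<gamma>"
    using that \<gamma>(2) unfolding lv_dissipation_def by (metis mult_pos_pos diff_gt_0_iff_gt)
  show "lv_dissipation P q \<kappa> \<gamma> a b = 0 \<Longrightarrow> a = \<gamma>" using pos' by force
  show "lv_dissipation P q \<kappa> \<gamma> a b \<ge> 0"
    using pos' by (cases "a = \<gamma>") (auto simp: lv_dissipation_def less_imp_le)
qed

text \<open>For \<gamma> > P(\<kappa> - \<gamma>), which means q < q_S, the energy increases along orbits. It tends to 0 at (\<kappa>, 0), because of
its factor z^((P+1)/(q-P)), so it is negative on the incoming orbit of that saddle. Followed backwards, the orbit stays in the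
compact set of lv_energy_bounds, and LaSalle's principle sends it to the interior rest point.\<close>

lemma supercritical_connection:
  fixes P q \<kappa> M :: real
  assumes P: "P > 0" and q: "q > P" and \<kappa>: "\<kappa> > 0" and M: "M < q * \<kappa>" "\<kappa> * P < M"
    and sob: "\<kappa> * P * (q + 1) < M * (P + 1)" and \<gamma>_def: "\<gamma> = (M - \<kappa> * P) / (q - P)"
  shows "\<exists>x z a C. a > 0 \<and> (\<forall>t. lv_at P q \<kappa> M x z t \<and> x t > 0 \<and> z t > 0)
      \<and> (x \<longlongrightarrow> \<gamma>) at_bot \<and> (z \<longlongrightarrow> P * (\<kappa> - \<gamma>)) at_bot
      \<and> (x \<longlongrightarrow> \<kappa>) at_top \<and> (\<forall>t\<ge>0. \<bar>z t\<bar> \<le> C * exp (- a * t))"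
proof -
  have \<gamma>e: "\<gamma> * (q - P) = M - \<kappa> * P" using q by (simp add: \<gamma>_def)
  have \<gamma>: "\<gamma> > 0" using q M by (simp add: \<gamma>_def)
  have "(\<kappa> - \<gamma>) * (q - P) > 0" using \<gamma>e M by (simp add: algebra_simps)
  then have \<gamma>\<kappa>: "\<gamma> < \<kappa>" using q by (simp add: zero_less_mult_iff)
  have "(\<gamma> - P * (\<kappa> - \<gamma>)) * (q - P) = M * (P + 1) - \<kappa> * P * (q + 1)" using \<gamma>e by algebra
  then have "(\<gamma> - P * (\<kappa> - \<gamma>)) * (q - P) > 0" using sob by simp
  then have \<gamma>\<alpha>: "\<gamma> > P * (\<kappa> - \<gamma>)" using q by (simp add: zero_less_mult_iff)
  have \<alpha>: "P * (\<kappa> - \<gamma>) > 0" using P \<gamma>\<kappa> by simp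
  define E where "E = lv_energy P q \<kappa> \<gamma>"
  define D where "D = lv_dissipation P q \<kappa> \<gamma>"
  have q0: "q > 0" using q P by simp
  from fundamental_orbit[OF P q0 \<kappa> M(1) disjI1[OF refl], unfolded mult_1]
  obtain x z a C where a: "a > 0" and orb': "\<forall>t\<ge>0. lv_at P q \<kappa> M x z t \<and> x t > 0 \<and> z t > 0
            \<and> \<bar>x t - \<kappa>\<bar> \<le> C * exp (- a * t) \<and> \<bar>z t\<bar> \<le> C * exp (- a * t)"
    by (elim exE conjE)
  note orb = orb'[rule_format]
  have dE: "((\<lambda>t. E (x t) (z t)) has_real_derivative D (x t) (z t)) (at t)" if "t \<ge> 0" for t
    unfolding E_def D_def using orb[OF that] by (intro DERIV_lv_energy[OF P q \<gamma>e]) auto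
  have D0: "D u v \<ge> 0" if "u > 0" "v > 0" for u v
    unfolding D_def by (rule lv_dissipation_sign[OF P \<gamma> \<gamma>\<alpha> that])
  have Dz: "u = \<gamma>" if "u > 0" "v > 0" "D u v = 0" for u v
    using lv_dissipation_sign(2)[OF P \<gamma> \<gamma>\<alpha>, of u v q] that by (auto simp: D_def)
  have x\<kappa>: "(x \<longlongrightarrow> \<kappa>) at_top" by (rule exp_close_tendsto[OF a, of x \<kappa> C]) (use orb in simp)
  have z0: "(z \<longlongrightarrow> 0) at_top" by (rule exp_close_tendsto[OF a, of z 0 C]) (use orb in simp)
  have E0: "((\<lambda>t. E (x t) (z t)) \<longlongrightarrow> 0) at_top"
  proof -
    define k where "k = (P + 1) / (q - P)"
    have k: "k > 0" using P q by (simp add: k_def)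
    have "((\<lambda>t. z t * x t powr P) \<longlongrightarrow> 0 * \<kappa> powr P) at_top" using \<kappa> by (intro tendsto_intros z0 x\<kappa>) auto
    then have "((\<lambda>t. z t * x t powr P) \<longlongrightarrow> 0) at_top" by simp
    moreover have "\<forall>\<^sub>F t in at_top. 0 \<le> z t * x t powr P"
      using eventually_ge_at_top[of "0::real"] by eventually_elim (use orb in \<open>simp add: less_imp_le\<close>)
    ultimately have "((\<lambda>t. (z t * x t powr P) powr k) \<longlongrightarrow> 0 powr k) at_top"
      using k by (intro tendsto_powr') auto
    then have "((\<lambda>t. (z t * x t powr P) powr k) \<longlongrightarrow> 0) at_top" by simp
    moreover define e where "e t = x t powr P * x t * P / (P + 1) - \<gamma> * x t powr P + z t * x t powr P / (q + 1)
        + (\<gamma> - P * (\<kappa> - \<gamma>)) * \<gamma> powr P / (P + 1)" for t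
    have "(e \<longlongrightarrow> \<kappa> powr P * \<kappa> * P / (P + 1) - \<gamma> * \<kappa> powr P + 0 * \<kappa> powr P / (q + 1)
        + (\<gamma> - P * (\<kappa> - \<gamma>)) * \<gamma> powr P / (P + 1)) at_top"
      unfolding e_def by (intro tendsto_intros x\<kappa> z0) (use P q \<kappa> in auto)
    ultimately have "((\<lambda>t. (z t * x t powr P) powr k * e t) \<longlongrightarrow> 0 * (\<kappa> powr P * \<kappa> * P / (P + 1) - \<gamma> * \<kappa> powr P + 0 * \<kappa> powr P / (q + 1)
        + (\<gamma> - P * (\<kappa> - \<gamma>)) * \<gamma> powr P / (P + 1))) at_top"
      by (rule tendsto_mult)
    then show ?thesis unfolding E_def lv_energy_def k_def[symmetric] e_def mult_zero_left .
  qed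
  have mono: "E (x s) (z s) \<le> E (x t) (z t)" if "0 \<le> s" "s \<le> t" for s t
    using that(2)
  proof (rule DERIV_nonneg_imp_nondecreasing)
    fix u assume "s \<le> u" "u \<le> t"
    then have "u \<ge> 0" using that by auto
    then show "\<exists>d. ((\<lambda>t. E (x t) (z t)) has_real_derivative d) (at u) \<and> 0 \<le> d"
      using dE[of u] D0[of "x u" "z u"] orb[of u] by blast
  qed
  have Ele: "E (x t) (z t) \<le> 0" if "t \<ge> 0" for t
    by (rule tendsto_lowerbound[OF E0]) (use mono that in \<open>auto simp: eventually_at_top_linorder\<close>)
  define e0 where "e0 = E (x 0) (z 0)"
  (* otherwise the energy vanishes from time 0 on and x = \<gamma> there, against x tending to \<kappa> *)
  have e0: "e0 < 0"
  proof (rule ccontr)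
    assume "\<not> e0 < 0"
    then have const: "E (x t) (z t) = 0" if "t \<ge> 0" for t
      using mono[of 0 t] Ele[of t] Ele[of 0] that by (auto simp: e0_def)
    have "x t = \<gamma>" if t: "t > 0" for t
    proof -
      have "((\<lambda>t. 0) has_real_derivative D (x t) (z t)) (at t)"
        by (rule has_field_derivative_transform_within_open[OF dE, of _ "{0<..}"]) (use t const in auto)
      then have "D (x t) (z t) = 0" using DERIV_unique DERIV_const by blast
      then show ?thesis using Dz orb[of t] t by auto
    qed
    then have "\<forall>\<^sub>F t in at_top. \<gamma> = x t" by (auto simp: eventually_at_top_dense)
    then have "(x \<longlongrightarrow> \<gamma>) at_top" by (rule Lim_transform_eventually[OF tendsto_const])
    then have "\<gamma> = \<kappa>" using x\<kappa> tendsto_unique trivial_limit_at_top_linorder by blast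
    then show False using \<gamma>\<kappa> by simp
  qed
  define R where "R = \<gamma> * (P + 1) / P"
  define zm where "zm = \<gamma> * (q + 1)"
  define xl where "xl = ((\<gamma> - P * (\<kappa> - \<gamma>)) * \<gamma> powr P / (P + 1) / \<gamma>) powr (1 / P)"
  define zl where "zl = (- e0 / (\<gamma> * R powr P)) powr ((q - P) / (P + 1)) / R powr P"
  have bounds: "xl < u \<and> u < R \<and> zl < v \<and> v < zm" if "u > 0" "v > 0" "E u v \<le> e0" for u v
    using lv_energy_bounds[OF P q \<gamma> \<gamma>\<alpha> that(1,2) _ e0] that(3)
    unfolding E_def R_def zm_def xl_def zl_def by blast
  have R: "R > 0" using \<gamma> P by (simp add: R_def)
  have xl: "xl > 0" using P \<gamma> \<gamma>\<alpha> by (simp add: xl_def)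
  have zl: "zl > 0" using e0 \<gamma> R by (simp add: zl_def divide_less_0_iff)
  have b0: "xl < x 0 \<and> x 0 < R \<and> zl < z 0 \<and> z 0 < zm" using bounds[of "x 0" "z 0"] orb[of 0] by (auto simp: e0_def)
  (* the time-reversed field, clipped to the box that contains the sublevel set *)
  define cx where "cx v = clip xl R (fst v)" for v :: "real \<times> real"
  define cz where "cz v = clip zl zm (snd v)" for v :: "real \<times> real"
  define f where "f v = (- 1) * (cx v * (cx v - \<kappa> + 1 / P * cz v))" for v
  define g where "g v = (- 1) * (cz v * (M - q * cx v - cz v))" for v
  have bl: "bounded_lipschitz cx" "bounded_lipschitz cz" unfolding cx_def cz_def by auto
  have "bounded_lipschitz f" "bounded_lipschitz g" unfolding f_def g_def
    by (intro bounded_lipschitz_mult bounded_lipschitz_diff bounded_lipschitz_add bounded_lipschitz_const bl)+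
  then obtain X Z where init: "\<And>v. X v 0 = fst v" "\<And>v. Z v 0 = snd v"
    and dX: "\<And>v t. (X v has_real_derivative f (X v t, Z v t)) (at t)"
    and dZ: "\<And>v t. (Z v has_real_derivative g (X v t, Z v t)) (at t)"
    using planar_flow[of f g] by blast
  define y where "y = X (x 0, z 0)"
  define w where "w = Z (x 0, z 0)"
  have yw0: "y 0 = x 0" "w 0 = z 0" by (simp_all add: y_def w_def init)
  have dy: "(y has_real_derivative f (y t, w t)) (at t)" and dw: "(w has_real_derivative g (y t, w t)) (at t)" for t
    using dX dZ by (auto simp: y_def w_def)
  define box where "box = {xl..R} \<times> {zl..zm}"
  define Q where "Q = {xl<..<R} \<times> {zl<..<zm}"
  have true_field: "f (y t, w t) = - (y t * (y t - \<kappa> + w t / P))" "g (y t, w t) = - (w t * (M - q * y t - w t))"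
    if "(y t, w t) \<in> box" for t using that by (auto simp: f_def g_def cx_def cz_def box_def)
  have lvr: "lv_at P q \<kappa> M (\<lambda>s. y (- s)) (\<lambda>s. w (- s)) (- t)" if "(y t, w t) \<in> box" for t
    using DERIV_reflect[of y _ "- t"] DERIV_reflect[of w _ "- t"] dy[of t] dw[of t] true_field[OF that]
    unfolding lv_at_def by fastforce
  have dEr: "((\<lambda>t. E (y t) (w t)) has_real_derivative - D (y t) (w t)) (at t)" if "(y t, w t) \<in> box" for t
  proof -
    have "y t > 0" "w t > 0" using that xl zl by (auto simp: box_def)
    then have "((\<lambda>s. E (y (- s)) (w (- s))) has_real_derivative D (y t) (w t)) (at (- t))"
      unfolding E_def D_def using DERIV_lv_energy[OF P q \<gamma>e lvr[OF that]] by simp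
    from DERIV_reflect[OF this] show ?thesis by simp
  qed
  have cont: "continuous_on A y" "continuous_on A w" for A
    using dy dw by (auto intro!: DERIV_continuous_on intro: has_field_derivative_at_within)
  (* up to a first exit time the orbit is in the closed box, so its energy is at most e0, and this puts it into the open box *)
  have inQ: "(y t, w t) \<in> Q" if "t \<ge> 0" for t
  proof (rule trapped_in_open[OF _ _ _ _ that])
    show "continuous_on {0..} (\<lambda>t. (y t, w t))" by (intro continuous_intros cont)
    show "open Q" unfolding Q_def by (intro open_Times) auto
    show "(y 0, w 0) \<in> Q" using b0 by (simp add: Q_def yw0)
    fix T :: real assume T: "T > 0" and inside: "\<And>s. 0 \<le> s \<Longrightarrow> s < T \<Longrightarrow> (y s, w s) \<in> Q"
    have ev: "\<forall>\<^sub>F s in at_left T. (y s, w s) \<in> Q"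
      unfolding eventually_at_left_field using T inside by (auto intro!: exI[of _ 0])
    have ly: "(y \<longlongrightarrow> y T) (at_left T)" and lw: "(w \<longlongrightarrow> w T) (at_left T)"
      using DERIV_isCont[OF dy[of T]] DERIV_isCont[OF dw[of T]]
      by (auto simp: isCont_def intro: tendsto_within_subset)
    have e: "\<forall>\<^sub>F s in at_left T. xl \<le> y s" "\<forall>\<^sub>F s in at_left T. y s \<le> R"
      "\<forall>\<^sub>F s in at_left T. zl \<le> w s" "\<forall>\<^sub>F s in at_left T. w s \<le> zm"
      using ev by (auto elim!: eventually_mono simp: Q_def)
    have "xl \<le> y T" "y T \<le> R" "zl \<le> w T" "w T \<le> zm"
      using tendsto_lowerbound[OF ly e(1)] tendsto_upperbound[OF ly e(2)]
        tendsto_lowerbound[OF lw e(3)] tendsto_upperbound[OF lw e(4)] by simp_all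
    then have "(y T, w T) \<in> box" by (simp add: box_def)
    with inside have inb: "(y s, w s) \<in> box" if "0 \<le> s" "s \<le> T" for s
      using that by (cases "s = T") (force simp: Q_def box_def)+
    have "E (y T) (w T) \<le> E (y 0) (w 0)"
    proof (rule DERIV_nonpos_imp_nonincreasing[of 0 T])
      fix s assume "0 \<le> s" "s \<le> T"
      from inb[OF this] show "\<exists>d. ((\<lambda>t. E (y t) (w t)) has_real_derivative d) (at s) \<and> d \<le> 0"
        using dEr[of s] D0[of "y s" "w s"] xl zl by (force simp: box_def)
    qed (use T in simp)
    then show "(y T, w T) \<in> Q"
      using bounds[of "y T" "w T"] inb[of T] T xl zl by (auto simp: Q_def e0_def yw0 box_def)
  qed
  then have inbox: "(y t, w t) \<in> box" if "t \<ge> 0" for t using that by (force simp: Q_def box_def)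
  have cbox: "compact box" unfolding box_def by (intro compact_Times) auto
  have contE: "continuous_on box (\<lambda>v. E (fst v) (snd v))" and contD: "continuous_on box (\<lambda>v. - D (fst v) (snd v))"
    unfolding E_def D_def lv_energy_def lv_dissipation_def using xl zl P q
    by (auto intro!: continuous_intros simp: box_def)
  then obtain B where B: "\<And>v. v \<in> box \<Longrightarrow> \<bar>E (fst v) (snd v)\<bar> \<le> B"
    using compact_imp_bounded[OF compact_continuous_image[OF contE cbox]] by (auto simp: bounded_real)
  have Edec: "E (y t) (w t) \<le> E (y s) (w s)" if "0 \<le> s" "s \<le> t" for s t
  proof (rule DERIV_nonpos_imp_nonincreasing[OF that(2)])
    fix u assume "s \<le> u" "u \<le> t"
    with that have "u \<ge> 0" by simp
    from inbox[OF this] show "\<exists>d. ((\<lambda>t. E (y t) (w t)) has_real_derivative d) (at u) \<and> d \<le> 0"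
      using dEr[of u] D0[of "y u" "w u"] xl zl by (force simp: box_def)
  qed
  have "\<exists>l\<le>B. ((\<lambda>t. - E (y t) (w t)) \<longlongrightarrow> l) at_top \<and> (\<forall>t>0. - E (y t) (w t) \<le> l)"
    by (rule monotone_bounded_at_top) (use Edec B[OF inbox] in \<open>auto simp: abs_le_iff\<close>)
  then obtain l where l: "((\<lambda>t. - E (y t) (w t)) \<longlongrightarrow> l) at_top" by blast
  have lim: "((\<lambda>t. E (y t) (w t)) \<longlongrightarrow> - l) at_top" using tendsto_minus[OF l] by simp
  have conv: "(y \<longlongrightarrow> \<gamma>) at_top \<and> (w \<longlongrightarrow> P * (\<kappa> - \<gamma>)) at_top"
  proof (rule lv_equilibrium_limit[OF P q cbox contD inbox _ _ _ _ lim])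
    fix t :: real assume t: "0 \<le> t"
    show "(y has_real_derivative - 1 * (y t * (y t - \<kappa> + w t / P))) (at t)"
      using dy[of t] true_field(1)[OF inbox[OF t]] by simp
    show "(w has_real_derivative - 1 * (w t * (M - q * y t - w t))) (at t)"
      using dw[of t] true_field(2)[OF inbox[OF t]] by simp
    show "((\<lambda>t. E (y t) (w t)) has_real_derivative - D (fst (y t, w t)) (snd (y t, w t))) (at t)"
      using dEr[OF inbox[OF t]] by simp
  next
    fix a b assume "(a, b) \<in> box" "- D (fst (a, b)) (snd (a, b)) = 0"
    then show "a = \<gamma>" using Dz[of a b] xl zl by (simp add: box_def)
  qed (use \<gamma> in auto)
  define x' where "x' t = (if t \<ge> 0 then x t else y (- t))" for t
  define z' where "z' t = (if t \<ge> 0 then z t else w (- t))" for t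
  have "lv_at P q \<kappa> M x' z' t" for t
  proof -
    have 1: "lv_at P q \<kappa> M (\<lambda>s. y (- s)) (\<lambda>s. w (- s)) t" if "t \<le> 0" using lvr[OF inbox[of "- t"]] that by simp
    have 2: "lv_at P q \<kappa> M x z t" if "t \<ge> 0" using orb that by blast
    have v: "t \<ge> 0 \<Longrightarrow> x t = x' t \<and> z t = z' t" "t \<le> 0 \<Longrightarrow> y (- t) = x' t \<and> w (- t) = z' t"
      using yw0 by (auto simp: x'_def z'_def)
    have "(x' has_real_derivative x' t * (x' t - \<kappa> + z' t / P)) (at t)"
      unfolding x'_def[abs_def] by (rule DERIV_glue) (use 1 2 v yw0 in \<open>auto simp: lv_at_def x'_def[symmetric]\<close>)
    moreover have "(z' has_real_derivative z' t * (M - q * x' t - z' t)) (at t)"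
      unfolding z'_def[abs_def] by (rule DERIV_glue) (use 1 2 v yw0 in \<open>auto simp: lv_at_def z'_def[symmetric]\<close>)
    ultimately show ?thesis by (simp add: lv_at_def)
  qed
  moreover have "x' t > 0 \<and> z' t > 0" for t
    using orb[of t] inbox[of "- t"] xl zl by (auto simp: x'_def z'_def box_def)
  moreover have "(x' \<longlongrightarrow> \<gamma>) at_bot" "(z' \<longlongrightarrow> P * (\<kappa> - \<gamma>)) at_bot"
  proof -
    have ev: "\<forall>\<^sub>F t in at_top. y t = x' (- t)" "\<forall>\<^sub>F t in at_top. w t = z' (- t)"
      using eventually_gt_at_top[of "0::real"] by (eventually_elim, simp add: x'_def z'_def)+
    show "(x' \<longlongrightarrow> \<gamma>) at_bot" "(z' \<longlongrightarrow> P * (\<kappa> - \<gamma>)) at_bot"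
      unfolding filterlim_at_bot_mirror using conv
      by (blast intro: Lim_transform_eventually[OF _ ev(1)] Lim_transform_eventually[OF _ ev(2)])+
  qed
  moreover have "(x' \<longlongrightarrow> \<kappa>) at_top"
  proof (rule Lim_transform_eventually[OF x\<kappa>])
    show "\<forall>\<^sub>F t in at_top. x t = x' t"
      using eventually_ge_at_top[of "0::real"] by eventually_elim (simp add: x'_def)
  qed
  moreover have "\<forall>t\<ge>0. \<bar>z' t\<bar> \<le> C * exp (- a * t)" using orb by (simp add: z'_def)
  ultimately show ?thesis using a by blast
qed

text \<open>The two rest points are opposite corners of the box [\<kappa>, \<gamma>] \<times> [z*, 0] with z* = P(\<kappa> - \<gamma>) < 0. Forward orbits leave the box through x = \<gamma>, or else through x = \<kappa> or
z = z*; shooting from a segment that joins the right side to the lower side gives an orbit that stays. Backwards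
no orbit leaves the box. Along this orbit u = |z| x^P does not decrease, since x \<le> \<gamma>, and so converges in both directions of
time. Forwards this gives the interior rest point by LaSalle's principle; backwards the limit of u must be 0, since otherwise
the orbit would tend to the corner (\<gamma>, z*) in both directions, u would be constant and the orbit would be that corner, which the
segment avoids.\<close>

lemma subcritical_connection:
  fixes P q \<kappa> M :: real
  assumes P: "P > 0" and q: "q > P" and \<kappa>: "\<kappa> > 0" and M: "q * \<kappa> < M"
    and \<gamma>_def: "\<gamma> = (M - \<kappa> * P) / (q - P)"
  shows "\<exists>x z a C T. a > 0 \<and> (\<forall>t. lv_at P q \<kappa> M x z t \<and> x t > 0 \<and> z t < 0)
      \<and> (x \<longlongrightarrow> \<gamma>) at_top \<and> (z \<longlongrightarrow> P * (\<kappa> - \<gamma>)) at_top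
      \<and> (x \<longlongrightarrow> \<kappa>) at_bot \<and> (\<forall>t\<le>T. \<bar>z t\<bar> \<le> C * exp (a * t))"
proof -
  have \<gamma>e: "\<gamma> * (q - P) = M - \<kappa> * P" using q by (simp add: \<gamma>_def)
  have "(\<gamma> - \<kappa>) * (q - P) > 0" using \<gamma>e M by (simp add: algebra_simps)
  then have \<gamma>\<kappa>: "\<kappa> < \<gamma>" using q by (simp add: zero_less_mult_iff)
  define zs where "zs = P * (\<kappa> - \<gamma>)"
  have zs: "zs < 0" using P \<gamma>\<kappa> by (simp add: zs_def mult_less_0_iff)
  have zsP: "zs / P = \<kappa> - \<gamma>" using P by (simp add: zs_def)
  have Mz: "M - q * \<gamma> - zs = 0" using \<gamma>e unfolding zs_def by algebra
  have q0: "q > 0" using q P by simp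
  define cx where "cx v = clip \<kappa> \<gamma> (fst v)" for v :: "real \<times> real"
  define cz where "cz v = clip zs 0 (snd v)" for v :: "real \<times> real"
  define f where "f v = cx v * (cx v - \<kappa> + 1 / P * cz v)" for v
  define g where "g v = cz v * (M - q * cx v - cz v)" for v
  have bl: "bounded_lipschitz cx" "bounded_lipschitz cz" unfolding cx_def cz_def by auto
  have "bounded_lipschitz f" "bounded_lipschitz g" unfolding f_def g_def
    by (intro bounded_lipschitz_mult bounded_lipschitz_diff bounded_lipschitz_add bounded_lipschitz_const bl)+
  then obtain X Z where init: "\<And>v. X v 0 = fst v" "\<And>v. Z v 0 = snd v"
    and dX: "\<And>v t. (X v has_real_derivative f (X v t, Z v t)) (at t)"
    and dZ: "\<And>v t. (Z v has_real_derivative g (X v t, Z v t)) (at t)"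
    and cont: "\<And>t. t \<ge> 0 \<Longrightarrow> continuous_on UNIV (\<lambda>v. (X v t, Z v t))"
    using planar_flow[of f g] by blast
  have cxb: "\<kappa> \<le> cx v" "cx v \<le> \<gamma>" for v using clip_bounds[of \<kappa> \<gamma>] \<gamma>\<kappa> by (auto simp: cx_def)
  have czb: "zs \<le> cz v" "cz v \<le> 0" for v using clip_bounds[of zs 0] zs by (auto simp: cz_def)
  have czP: "1 / P * cz v \<ge> \<kappa> - \<gamma>" "1 / P * cz v \<le> 0" for v
  proof -
    have "zs / P \<le> cz v / P" using czb[of v] P by (intro divide_right_mono) auto
    then show "1 / P * cz v \<ge> \<kappa> - \<gamma>" by (simp add: zsP)
    show "1 / P * cz v \<le> 0" using czb[of v] P by (simp add: divide_nonpos_pos)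
  qed
  have f_right: "f v \<ge> 0" and g_right: "g v \<ge> 0" if "fst v > \<gamma>" for v
  proof -
    have c: "cx v = \<gamma>" using that \<gamma>\<kappa> by (simp add: cx_def)
    show "f v \<ge> 0" unfolding f_def c using czP[of v] \<gamma>\<kappa> \<kappa> by (intro mult_nonneg_nonneg) auto
    show "g v \<ge> 0" unfolding g_def c using czb[of v] Mz by (intro mult_nonpos_nonpos) auto
  qed
  have f_low: "f v \<le> 0" and g_low: "g v \<le> 0" if "snd v < zs" for v
  proof -
    have c: "cz v = zs" using that zs by (simp add: cz_def)
    have "cx v - \<kappa> + 1 / P * zs = cx v - \<gamma>" using zsP by simp
    then show "f v \<le> 0" unfolding f_def c using cxb[of v] \<kappa> by (simp add: mult_nonneg_nonpos)
    have "q * cx v \<le> q * \<gamma>" using cxb[of v] q0 by (simp add: mult_left_mono)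
    then show "g v \<le> 0" unfolding g_def c using zs Mz by (intro mult_nonpos_nonneg) auto
  qed
  have f_left: "f v \<le> 0" if "fst v < \<kappa>" for v
  proof -
    have c: "cx v = \<kappa>" using that \<gamma>\<kappa> by (simp add: cx_def)
    show "f v \<le> 0" unfolding f_def c by (rule mult_nonneg_nonpos) (use czP[of v] \<kappa> in simp_all)
  qed
  (* beyond the corner the clipped field vanishes, so no orbit enters from elsewhere; this makes the two exits from the box exclusive *)
  have fg_corner: "f v = 0" "g v = 0" if "fst v > \<gamma>" "snd v < zs" for v
  proof -
    have c: "cx v = \<gamma>" "cz v = zs" using that \<gamma>\<kappa> zs by (simp_all add: cx_def cz_def)
    show "f v = 0" "g v = 0" unfolding f_def g_def c using zsP Mz by auto
  qed
  (* the end points of this segment leave the box at once, through the right and through the lower side *)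
  have seg: "\<kappa> \<le> fst v \<and> fst v \<le> \<gamma> \<and> zs \<le> snd v \<and> snd v \<le> zs / 2 \<and> (fst v = \<gamma> \<longrightarrow> snd v = zs / 2)"
    if "v \<in> closed_segment (\<gamma>, zs / 2) ((\<kappa> + \<gamma>) / 2, zs)" for v
  proof -
    from that[unfolded in_segment(1)]
    obtain u where u': "0 \<le> u \<and> u \<le> 1 \<and> v = (1 - u) *\<^sub>R (\<gamma>, zs / 2) + u *\<^sub>R ((\<kappa> + \<gamma>) / 2, zs)"
      unfolding conj_assoc by (rule exE)
    then have u: "0 \<le> u" "u \<le> 1" by blast+
    from u' have "v = (1 - u) *\<^sub>R (\<gamma>, zs / 2) + u *\<^sub>R ((\<kappa> + \<gamma>) / 2, zs)" by (elim conjE)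
    then have v: "v = ((1 - u) * \<gamma> + u * ((\<kappa> + \<gamma>) / 2), (1 - u) * (zs / 2) + u * zs)" by simp
    have 1: "fst v = \<gamma> - u * ((\<gamma> - \<kappa>) / 2)" "snd v = zs / 2 + u * (zs / 2)" by (simp_all add: v field_simps)
    have 2: "0 \<le> u * ((\<gamma> - \<kappa>) / 2)" "u * ((\<gamma> - \<kappa>) / 2) \<le> 1 * ((\<gamma> - \<kappa>) / 2)"
      using u \<gamma>\<kappa> by (auto intro!: mult_right_mono)
    have 3: "u * (zs / 2) \<le> 0" "u * (zs / 2) \<ge> 1 * (zs / 2)"
      using u zs by (auto intro!: mult_nonneg_nonpos mult_right_mono_neg)
    have "fst v = \<gamma> \<Longrightarrow> u = 0" using 1(1) \<gamma>\<kappa> by simp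
    then have "fst v = \<gamma> \<longrightarrow> snd v = zs / 2" using 1(2) by auto
    moreover have "\<kappa> \<le> fst v" "fst v \<le> \<gamma>" "zs \<le> snd v" "snd v \<le> zs / 2"
    proof -
      define A where "A = u * ((\<gamma> - \<kappa>) / 2)"
      define B where "B = u * (zs / 2)"
      have "0 \<le> A" "A \<le> (\<gamma> - \<kappa>) / 2" "B \<le> 0" "zs / 2 \<le> B" using 2 3 by (simp_all only: A_def B_def mult_1)
      then show "\<kappa> \<le> fst v" "fst v \<le> \<gamma>" "zs \<le> snd v" "snd v \<le> zs / 2"
        unfolding 1 A_def[symmetric] B_def[symmetric] using \<gamma>\<kappa> by simp_all
    qed
    ultimately show ?thesis by blast
  qed
  have no_corner: "\<not> (X v t > \<gamma> \<and> Z v t < zs)" if t: "t \<ge> 0" and start: "\<not> (fst v > \<gamma> \<and> snd v < zs)" for v t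
  proof
    assume corner: "X v t > \<gamma> \<and> Z v t < zs"
    define Y where "Y s = (X v (t - s), Z v (t - s))" for s
    have d1: "((\<lambda>s. X v (t - s)) has_real_derivative - f (Y s)) (at s)"
      and d2: "((\<lambda>s. Z v (t - s)) has_real_derivative - g (Y s)) (at s)" for s
    proof -
      have ds: "((\<lambda>s. t - s) has_real_derivative - 1) (at s)" by (auto intro!: derivative_eq_intros)
      show "((\<lambda>s. X v (t - s)) has_real_derivative - f (Y s)) (at s)"
        unfolding Y_def using DERIV_chain2[where f = "X v" and g = "\<lambda>s. t - s", OF dX ds] by simp
      show "((\<lambda>s. Z v (t - s)) has_real_derivative - g (Y s)) (at s)"
        unfolding Y_def using DERIV_chain2[where f = "Z v" and g = "\<lambda>s. t - s", OF dZ ds] by simp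
    qed
    have c: "continuous_on A (\<lambda>s. X v (t - s))" "continuous_on A (\<lambda>s. Z v (t - s))" for A
      using d1 d2 by (auto intro!: DERIV_continuous_on intro: has_field_derivative_at_within)
    have "Y t \<in> {\<gamma><..} \<times> {..<zs}"
    proof (rule trapped_in_open[OF _ _ _ _ t])
      show "continuous_on {0..} Y" unfolding Y_def by (intro continuous_intros c)
      show "open ({\<gamma><..} \<times> {..<zs})" by (intro open_Times) auto
      show "Y 0 \<in> {\<gamma><..} \<times> {..<zs}" using corner by (simp add: Y_def)
      fix T :: real assume T: "T > 0" and inside: "\<And>s. 0 \<le> s \<Longrightarrow> s < T \<Longrightarrow> Y s \<in> {\<gamma><..} \<times> {..<zs}"
      have z: "f (Y s) = 0" "g (Y s) = 0" if "0 < s" "s < T" for s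
        using fg_corner[of "Y s"] inside[of s] that by (auto simp: mem_Times_iff)
      have d0: "((\<lambda>s. X v (t - s)) has_real_derivative 0) (at s)" "((\<lambda>s. Z v (t - s)) has_real_derivative 0) (at s)"
        if "0 < s" "s < T" for s using d1[of s] d2[of s] z[OF that] by simp_all
      have "X v (t - T) = X v (t - 0)"
        by (rule DERIV_isconst_end[OF T c(1)]) (rule d0(1))
      moreover have "Z v (t - T) = Z v (t - 0)"
        by (rule DERIV_isconst_end[OF T c(2)]) (rule d0(2))
      ultimately show "Y T \<in> {\<gamma><..} \<times> {..<zs}" using corner by (simp add: Y_def)
    qed
    then show False using start init by (simp add: Y_def mem_Times_iff)
  qed
  have "\<exists>v\<in>closed_segment (\<gamma>, zs / 2) ((\<kappa> + \<gamma>) / 2, zs).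
      \<forall>t\<ge>0. (X v t, Z v t) \<notin> {v. fst v > \<gamma>} \<and> (X v t, Z v t) \<notin> {v. snd v < zs \<or> fst v < \<kappa>}"
  proof (rule shooting[OF cont])
    show "open {v::real \<times> real. fst v > \<gamma>}" "open {v::real \<times> real. snd v < zs \<or> fst v < \<kappa>}"
      by (auto intro!: open_Collect_less open_Collect_disj continuous_intros)
    fix v a b
    assume v: "v \<in> closed_segment (\<gamma>, zs / 2) ((\<kappa> + \<gamma>) / 2, zs)" and a: "0 \<le> a" and b: "0 \<le> b"
      and U: "(X v a, Z v a) \<in> {v. fst v > \<gamma>}" and D: "(X v b, Z v b) \<in> {v. snd v < zs \<or> fst v < \<kappa>}"
    have nc: "\<not> (X v t > \<gamma> \<and> Z v t < zs)" if "t \<ge> 0" for t using no_corner[OF that, of v] seg[OF v] by auto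
    show False
    proof (cases "a \<le> b")
      case True
      have "X v b > \<gamma>"
        by (rule stays_gt_barrier[OF dX _ _ True]) (use U f_right in auto)
      then show False using nc[OF b] D \<gamma>\<kappa> by auto
    next
      case False
      then have ba: "b \<le> a" by simp
      show False
      proof (cases "X v b < \<kappa>")
        case True
        have "- X v a > - \<kappa>"
          by (rule stays_gt_barrier[where f = "\<lambda>t. - X v t" and f' = "\<lambda>t. - f (X v t, Z v t)", OF _ _ _ ba])
            (use True f_left in \<open>auto intro!: derivative_eq_intros dX\<close>)
        then show False using U \<gamma>\<kappa> by auto
      next
        case False
        then have "Z v b < zs" using D by auto
        then have "- Z v a > - zs"
          by (intro stays_gt_barrier[where f = "\<lambda>t. - Z v t" and f' = "\<lambda>t. - g (X v t, Z v t)", OF _ _ _ ba])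
            (use g_low in \<open>auto intro!: derivative_eq_intros dZ\<close>)
        then show False using nc[OF a] U by auto
      qed
    qed
  next
    define p where "p = (\<gamma>, zs / 2)"
    have "cx p = \<gamma>" "cz p = zs / 2" using \<gamma>\<kappa> zs by (simp_all add: cx_def cz_def p_def)
    moreover have "1 / P * (zs / 2) = (\<kappa> - \<gamma>) / 2" using zsP by simp
    ultimately have "f p = \<gamma> * ((\<gamma> - \<kappa>) / 2)" unfolding f_def by (simp only:) (simp add: field_simps)
    moreover have "\<gamma> * ((\<gamma> - \<kappa>) / 2) > 0" using \<gamma>\<kappa> \<kappa> by simp
    ultimately have "f (X p 0, Z p 0) > 0" by (simp only: init prod.collapse)
    then obtain h where "h > 0" "\<And>t. t > 0 \<Longrightarrow> t < h \<Longrightarrow> X p 0 < X p (0 + t)"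
      using DERIV_pos_inc_right[OF dX] by blast
    from this(1) this(2)[of "h/2"] show "\<exists>t\<ge>0. (X (\<gamma>, zs / 2) t, Z (\<gamma>, zs / 2) t) \<in> {v. fst v > \<gamma>}"
      unfolding p_def[symmetric] by (intro exI[of _ "h/2"]) (auto simp: init p_def)
    define r where "r = ((\<kappa> + \<gamma>) / 2, zs)"
    have "cx r = (\<kappa> + \<gamma>) / 2" "cz r = zs" using \<gamma>\<kappa> zs by (simp_all add: cx_def cz_def r_def)
    then have "g r = zs * (q * ((\<gamma> - \<kappa>) / 2) + (M - q * \<gamma> - zs))" by (simp add: g_def field_simps)
    moreover have "q * ((\<gamma> - \<kappa>) / 2) + (M - q * \<gamma> - zs) > 0" using \<gamma>\<kappa> q0 Mz by simp
    then have "zs * (q * ((\<gamma> - \<kappa>) / 2) + (M - q * \<gamma> - zs)) < 0" using zs by (simp only: mult_neg_pos)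
    ultimately have "g (X r 0, Z r 0) < 0" by (simp only: init prod.collapse)
    then obtain h where "h > 0" "\<And>t. t > 0 \<Longrightarrow> t < h \<Longrightarrow> Z r 0 > Z r (0 + t)"
      using DERIV_neg_dec_right[OF dZ] by blast
    from this(1) this(2)[of "h/2"] show "\<exists>t\<ge>0. (X ((\<kappa> + \<gamma>) / 2, zs) t, Z ((\<kappa> + \<gamma>) / 2, zs) t) \<in> {v. snd v < zs \<or> fst v < \<kappa>}"
      unfolding r_def[symmetric] by (intro exI[of _ "h/2"]) (auto simp: init r_def)
  qed
  then obtain v where v: "v \<in> closed_segment (\<gamma>, zs / 2) ((\<kappa> + \<gamma>) / 2, zs)"
    and fwd': "\<forall>t\<ge>0. (X v t, Z v t) \<notin> {v. fst v > \<gamma>} \<and> (X v t, Z v t) \<notin> {v. snd v < zs \<or> fst v < \<kappa>}" by blast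
  define x where "x = X v"
  define z where "z = Z v"
  have dx: "(x has_real_derivative f (x t, z t)) (at t)" and dz: "(z has_real_derivative g (x t, z t)) (at t)" for t
    using dX dZ by (simp_all add: x_def z_def)
  have x0: "\<kappa> \<le> x 0" "x 0 \<le> \<gamma>" "zs \<le> z 0" "z 0 \<le> zs / 2" "x 0 = \<gamma> \<Longrightarrow> z 0 = zs / 2"
    using seg[OF v] by (simp_all add: x_def z_def init)
  have fwd: "\<kappa> \<le> x t" "x t \<le> \<gamma>" "zs \<le> z t" if "t \<ge> 0" for t
    using fwd'[rule_format, OF that] by (simp_all add: x_def z_def not_less)
  have drx: "((\<lambda>s. x (- s)) has_real_derivative - f (x (- s), z (- s))) (at s)"
    and drz: "((\<lambda>s. z (- s)) has_real_derivative - g (x (- s), z (- s))) (at s)" for s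
    by (rule DERIV_reflect[OF dx], rule DERIV_reflect[OF dz])
  have bwd: "\<kappa> \<le> x (- t)" "x (- t) \<le> \<gamma>" "zs \<le> z (- t)" if t: "t \<ge> 0" for t
  proof -
    show "\<kappa> \<le> x (- t)"
      by (rule stays_ge_barrier[where f = "\<lambda>s. x (- s)", OF drx _ _ t]) (use f_left x0 in auto)
    have "- x (- t) \<ge> - \<gamma>"
      by (rule stays_ge_barrier[where f = "\<lambda>s. - x (- s)" and f' = "\<lambda>s. f (x (- s), z (- s))", OF _ _ _ t])
        (use f_right x0 DERIV_minus[OF drx] in auto)
    then show "x (- t) \<le> \<gamma>" by simp
    show "zs \<le> z (- t)"
      by (rule stays_ge_barrier[where f = "\<lambda>s. z (- s)", OF drz _ _ t]) (use g_low x0 in auto)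
  qed
  have box: "\<kappa> \<le> x t" "x t \<le> \<gamma>" "zs \<le> z t" for t
    using fwd[of t] bwd[of "- t"] by (cases "t \<ge> 0"; simp)+
  define c where "c = \<bar>M\<bar> + q * \<gamma> - zs"
  (* the rate of z is bounded, so z cannot reach 0 in finite time *)
  have gc: "\<bar>g u\<bar> \<le> c * (- snd u)" if "- snd u > 0" for u
  proof -
    have "q * cx u \<le> q * \<gamma>" "0 \<le> q * cx u" using cxb[of u] q0 \<kappa> by (simp_all add: mult_left_mono)
    then have "\<bar>M - q * cx u - cz u\<bar> \<le> c" using czb[of u] unfolding c_def by linarith
    moreover have "\<bar>cz u\<bar> \<le> - snd u" using that zs by (auto simp: cz_def clip_def)
    ultimately have "\<bar>cz u\<bar> * \<bar>M - q * cx u - cz u\<bar> \<le> (- snd u) * c" by (intro mult_mono) auto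
    then show ?thesis by (simp add: g_def abs_mult mult.commute)
  qed
  have gc': "c * z s \<le> - g (x s, z s)" "c * z s \<le> g (x s, z s)" if "z s < 0" for s
    using gc[of "(x s, z s)"] that by (simp_all add: abs_le_iff)
  have zneg: "z t < 0" for t
  proof (cases "t \<ge> 0")
    case True
    have "- z t > 0"
      by (rule stays_positive[where y = "\<lambda>t. - z t" and y' = "\<lambda>t. - g (x t, z t)" and c = c, OF _ _ _ True])
        (use gc' x0 zs in \<open>auto intro!: derivative_eq_intros dz\<close>)
    then show ?thesis by simp
  next
    case False
    then have t: "0 \<le> - t" by simp
    have "- z (- (- t)) > 0"
      by (rule stays_positive[where y = "\<lambda>t. - z (- t)" and y' = "\<lambda>t. g (x (- t), z (- t))" and c = c, OF _ _ _ t])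
        (use gc' x0 zs DERIV_minus[OF drz] in auto)
    then show ?thesis by simp
  qed
  have xpos: "x t > 0" for t using box(1)[of t] \<kappa> by simp
  have feq: "f (x t, z t) = x t * (x t - \<kappa> + z t / P)" and geq: "g (x t, z t) = z t * (M - q * x t - z t)" for t
    using box[of t] zneg[of t] by (simp_all add: f_def g_def cx_def cz_def)
  have lv: "lv_at P q \<kappa> M x z t" for t
    using dx[of t] dz[of t] feq[of t] geq[of t] by (simp add: lv_at_def)
  define u where "u t = - (z t * x t powr P)" for t
  have u_pos: "u t > 0" for t using zneg[of t] xpos[of t] by (simp add: u_def mult_neg_pos)
  have du: "(u has_real_derivative u t * ((q - P) * (\<gamma> - x t))) (at t)" for t
    using DERIV_minus[OF DERIV_lv_product(2)[OF P \<gamma>e lv xpos]] by (simp add: u_def[abs_def])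
  have u_mono: "u s \<le> u t" if "s \<le> t" for s t
    using that
  proof (rule DERIV_nonneg_imp_nondecreasing)
    fix r
    have "u r * ((q - P) * (\<gamma> - x r)) \<ge> 0"
      using u_pos[of r] q box(2)[of r] by (intro mult_nonneg_nonneg) auto
    then show "\<exists>d. (u has_real_derivative d) (at r) \<and> 0 \<le> d" using du by blast
  qed
  have \<gamma>0: "\<gamma> > 0" using \<gamma>\<kappa> \<kappa> by simp
  have u_bd: "u t \<le> - zs * \<gamma> powr P" for t
  proof -
    have "(- z t) * x t powr P \<le> (- zs) * \<gamma> powr P"
      using box[of t] xpos[of t] zneg[of t] P by (intro mult_mono powr_mono2) auto
    then show ?thesis by (simp add: u_def)
  qed
  define G where "G w = - (snd w * fst w powr P) * ((q - P) * (\<gamma> - fst w))" for w :: "real \<times> real"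
  define K where "K l = {\<kappa>..\<gamma>} \<times> {zs..0} \<inter> {w. l \<le> - (snd w * fst w powr P)}" for l
  have contK: "continuous_on ({\<kappa>..\<gamma>} \<times> {zs..0}) (\<lambda>w. - (snd w * fst w powr P))"
    using \<kappa> by (intro continuous_intros) auto
  have cK: "compact (K l)" for l
  proof -
    have "closed ({\<kappa>..\<gamma>} \<times> {zs..0} \<inter> (\<lambda>w. - (snd w * fst w powr P)) -` {l..})"
      by (rule continuous_closed_preimage[OF contK]) (auto intro: closed_Times)
    moreover have "K l = ({\<kappa>..\<gamma>} \<times> {zs..0}) \<inter> ({\<kappa>..\<gamma>} \<times> {zs..0} \<inter> (\<lambda>w. - (snd w * fst w powr P)) -` {l..})"
      by (auto simp: K_def)
    moreover have "compact ({\<kappa>..\<gamma>} \<times> {zs..0})" by (intro compact_Times compact_Icc)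
    ultimately show ?thesis by (simp only: compact_Int_closed)
  qed
  have contG: "continuous_on (K l) G" for l
    unfolding G_def using \<kappa> by (intro continuous_intros) (auto simp: K_def)
  have inK: "(x t, z t) \<in> K l" if "l \<le> u t" for t l
    using box[of t] zneg[of t] that by (simp add: K_def u_def)
  have zeroG: "a = \<gamma>" if "(a, b) \<in> K l" "l > 0" "G (a, b) = 0" for a b l
    using that q by (auto simp: K_def G_def)
  have "\<exists>l\<le>- zs * \<gamma> powr P. (u \<longlongrightarrow> l) at_top \<and> (\<forall>t>0. u t \<le> l)"
    by (rule monotone_bounded_at_top) (use u_mono u_bd in auto)
  then obtain l where l: "(u \<longlongrightarrow> l) at_top" by blast
  have conv: "(x \<longlongrightarrow> \<gamma>) at_top \<and> (z \<longlongrightarrow> P * (\<kappa> - \<gamma>)) at_top"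
  proof (rule lv_equilibrium_limit[OF P q cK contG inK _ _ _ _ l, where s = 1])
    fix t :: real assume t: "0 \<le> t"
    show "u 0 \<le> u t" by (rule u_mono[OF t])
    show "(x has_real_derivative 1 * (x t * (x t - \<kappa> + z t / P))) (at t)" "(z has_real_derivative 1 * (z t * (M - q * x t - z t))) (at t)"
      using lv[of t] by (simp_all add: lv_at_def)
    show "(u has_real_derivative G (x t, z t)) (at t)" using du[of t] by (simp add: G_def u_def)
  qed (use zeroG u_pos \<gamma>0 in auto)
  have "\<exists>m\<le>0. ((\<lambda>t. - u (- t)) \<longlongrightarrow> m) at_top \<and> (\<forall>t>0. - u (- t) \<le> m)"
    by (rule monotone_bounded_at_top) (use u_mono u_pos in \<open>auto intro: less_imp_le\<close>)
  then obtain m where m: "m \<le> 0" "((\<lambda>t. - u (- t)) \<longlongrightarrow> m) at_top" "\<And>t. t > 0 \<Longrightarrow> - u (- t) \<le> m" by blast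
  have m': "((\<lambda>t. u (- t)) \<longlongrightarrow> - m) at_top" using tendsto_minus[OF m(2)] by simp
  (* m is the limit of - u as t tends to minus infinity *)
  have "m = 0"
  proof (rule ccontr)
    assume "m \<noteq> 0"
    then have m0: "- m > 0" using m(1) by simp
    have um: "- m \<le> u (- t)" if "t \<ge> 0" for t
      using m(3)[of "t + 1"] u_mono[of "- (t + 1)" "- t"] that by simp
    have "((\<lambda>t. x (- t)) \<longlongrightarrow> \<gamma>) at_top \<and> ((\<lambda>t. z (- t)) \<longlongrightarrow> P * (\<kappa> - \<gamma>)) at_top"
    proof (rule lv_equilibrium_limit[OF P q cK _ inK _ _ _ _ m', where s = "-1" and G = "\<lambda>w. - G w"])
      fix t :: real assume t: "0 \<le> t"
      show "- m \<le> u (- t)" by (rule um[OF t])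
      show "((\<lambda>t. x (- t)) has_real_derivative - 1 * (x (- t) * (x (- t) - \<kappa> + z (- t) / P))) (at t)"
        "((\<lambda>t. z (- t)) has_real_derivative - 1 * (z (- t) * (M - q * x (- t) - z (- t)))) (at t)"
        using drx[of t] drz[of t] feq[of "- t"] geq[of "- t"] by simp_all
      show "((\<lambda>t. u (- t)) has_real_derivative - G (x (- t), z (- t))) (at t)"
        using DERIV_reflect[OF du[of "- t"]] by (simp add: G_def u_def)
    next
      show "continuous_on (K (- m)) (\<lambda>w. - G w)" by (intro continuous_intros contG)
    next
      fix a b assume "(a, b) \<in> K (- m)" "- G (a, b) = 0"
      then show "a = \<gamma>" using zeroG m0 by auto
    qed (use \<gamma>0 in auto)
    then have "((\<lambda>t. - (z (- t) * x (- t) powr P)) \<longlongrightarrow> - (P * (\<kappa> - \<gamma>) * \<gamma> powr P)) at_top"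
      using \<gamma>0 by (intro tendsto_intros) auto
    then have "((\<lambda>t. u (- t)) \<longlongrightarrow> - (P * (\<kappa> - \<gamma>) * \<gamma> powr P)) at_top" by (simp add: u_def)
    then have mm: "- m = - (P * (\<kappa> - \<gamma>) * \<gamma> powr P)"
      using m' tendsto_unique trivial_limit_at_top_linorder by blast
    have "((\<lambda>t. - (z t * x t powr P)) \<longlongrightarrow> - (P * (\<kappa> - \<gamma>) * \<gamma> powr P)) at_top"
      using \<gamma>0 conv by (intro tendsto_intros) auto
    then have "(u \<longlongrightarrow> - m) at_top" by (simp add: u_def[abs_def] mm)
    moreover have "\<forall>\<^sub>F s in at_top. u t \<le> u s" for t using eventually_ge_at_top[of t] by eventually_elim (rule u_mono)
    ultimately have ule: "u t \<le> - m" for t by (intro tendsto_lowerbound) auto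
    have uge: "- m \<le> u t" for t
    proof -
      have "- m \<le> u (- \<bar>t\<bar>)" by (rule um) simp
      also have "\<dots> \<le> u t" by (rule u_mono) simp
      finally show ?thesis .
    qed
    have const: "u t = - m" for t using ule uge by (intro antisym)
    have "x t = \<gamma>" for t
    proof -
      have "u = (\<lambda>_. - m)" using const by auto
      then have "(u has_real_derivative 0) (at t)" by simp
      then have "u t * ((q - P) * (\<gamma> - x t)) = 0" using DERIV_unique du by blast
      then show ?thesis using u_pos[of t] q by auto
    qed
    then have x\<gamma>: "x 0 = \<gamma>" by simp
    have "z 0 * \<gamma> powr P = zs * \<gamma> powr P"
      using const[of 0] mm unfolding u_def x\<gamma> zs_def by linarith
    then have "z 0 = zs" using \<gamma>0 by simp
    then show False using x0(5)[OF x\<gamma>] zs by simp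
  qed
  then have u0: "((\<lambda>t. u (- t)) \<longlongrightarrow> 0) at_top" using m' by simp
  have zb: "\<bar>z t\<bar> \<le> u t / \<kappa> powr P" for t
  proof -
    have "\<bar>z t\<bar> * \<kappa> powr P \<le> \<bar>z t\<bar> * x t powr P" using box(1)[of t] \<kappa> P by (intro mult_left_mono powr_mono2) auto
    also have "\<dots> = u t" using zneg[of t] by (simp add: u_def)
    finally show ?thesis using \<kappa> by (simp add: pos_le_divide_eq)
  qed
  have "((\<lambda>t. u (- t) / \<kappa> powr P) \<longlongrightarrow> 0 / \<kappa> powr P) at_top" using \<kappa> by (intro tendsto_intros u0) auto
  then have "((\<lambda>t. u (- t) / \<kappa> powr P) \<longlongrightarrow> 0) at_top" by simp
  then have "((\<lambda>t. z (- t)) \<longlongrightarrow> 0) at_top" by (rule Lim_null_comparison[rotated]) (simp add: zb)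
  then have z0: "(z \<longlongrightarrow> 0) at_bot" by (simp add: filterlim_at_bot_mirror)
  have "(x \<longlongrightarrow> \<kappa>) at_bot \<and> (\<exists>a C T. a > 0 \<and> (\<forall>t\<le>T. \<bar>z t\<bar> \<le> C * exp (a * t)))"
    by (rule lv_backward_fundamental[OF P q0 \<kappa> M \<kappa> _ z0]) (use lv box in blast)
  then obtain a C T where "a > 0" "\<forall>t\<le>T. \<bar>z t\<bar> \<le> C * exp (a * t)" "(x \<longlongrightarrow> \<kappa>) at_bot" by blast
  then show ?thesis using lv xpos zneg conv by blast
qed

section \<open>The Emden-Fowler equation in logarithmic time\<close>

lemma tendsto_at_right_0_iff_exp:
  fixes f :: "real \<Rightarrow> 'a::topological_space"
  shows "(f \<longlongrightarrow> l) (at_right 0) \<longleftrightarrow> ((\<lambda>t. f (exp t)) \<longlongrightarrow> l) at_bot"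
proof
  have "filterlim (exp :: real \<Rightarrow> real) (at_right 0) at_bot"
    by (rule filterlim_at_withinI) (use exp_at_bot in auto)
  then show "((\<lambda>t. f (exp t)) \<longlongrightarrow> l) at_bot" if "(f \<longlongrightarrow> l) (at_right 0)"
    using that by (rule filterlim_compose[rotated])
next
  assume "((\<lambda>t. f (exp t)) \<longlongrightarrow> l) at_bot"
  from filterlim_compose[OF this ln_at_0]
  have "((\<lambda>r. f (exp (ln r))) \<longlongrightarrow> l) (at_right 0)" .
  then show "(f \<longlongrightarrow> l) (at_right 0)"
    by (rule Lim_transform_eventually) (auto simp: eventually_at_right_field intro!: exI[of _ 1])
qed

lemma tendsto_at_top_iff_exp:
  fixes f :: "real \<Rightarrow> 'a::topological_space"
  shows "(f \<longlongrightarrow> l) at_top \<longleftrightarrow> ((\<lambda>t. f (exp t)) \<longlongrightarrow> l) at_top"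
proof
  show "((\<lambda>t. f (exp t)) \<longlongrightarrow> l) at_top" if "(f \<longlongrightarrow> l) at_top"
    using that exp_at_top by (rule filterlim_compose)
next
  assume "((\<lambda>t. f (exp t)) \<longlongrightarrow> l) at_top"
  from filterlim_compose[OF this ln_at_top]
  have "((\<lambda>r. f (exp (ln r))) \<longlongrightarrow> l) at_top" .
  moreover have "\<forall>\<^sub>F r in at_top. f (exp (ln r)) = f r"
    using eventually_gt_at_top[of "0::real"] by eventually_elim simp
  ultimately show "(f \<longlongrightarrow> l) at_top" by (rule Lim_transform_eventually)
qed

text \<open>The inverse of x \<mapsto> |x|^(P-1) x, which recovers w' from the flux |w'|^(p-2) w' when P = p - 1.\<close>

definition psi :: "real \<Rightarrow> real \<Rightarrow> real" where
  "psi P x = sgn x * \<bar>x\<bar> powr (1 / P)"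

lemma psi_scale: "c > 0 \<Longrightarrow> psi P (c * x) = c powr (1 / P) * psi P x"
  by (simp add: psi_def sgn_mult abs_mult powr_mult)

lemma psi_pos: "x > 0 \<Longrightarrow> psi P x = x powr (1 / P)"
  and psi_neg: "x < 0 \<Longrightarrow> psi P x = - ((- x) powr (1 / P))"
  and psi_0 [simp]: "psi P 0 = 0" and psi_minus: "psi P (- x) = - psi P x"
  by (auto simp: psi_def sgn_if)

lemma psi_inverse: "P > 0 \<Longrightarrow> psi P (\<bar>d\<bar> powr (P - 1) * d) = d"
proof (cases "d = 0")
  case False
  assume P: "P > 0"
  have "\<bar>d\<bar> powr (P - 1) * \<bar>d\<bar> = \<bar>d\<bar> powr P" using False by (simp add: powr_diff)
  then have "psi P (\<bar>d\<bar> powr (P - 1) * d) = sgn d * (\<bar>d\<bar> powr P) powr (1 / P)"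
    using False by (simp add: psi_def sgn_mult abs_mult)
  then show ?thesis using P False by (simp add: powr_powr sgn_mult_abs)
qed simp

lemma psi_inverse': "P > 0 \<Longrightarrow> \<bar>psi P x\<bar> powr (P - 1) * psi P x = x"
proof (cases "x = 0")
  case False
  assume P: "P > 0"
  have "\<bar>psi P x\<bar> powr (P - 1) * psi P x = sgn x * (\<bar>x\<bar> powr (1 / P)) powr P"
    using False by (simp add: psi_def abs_mult powr_diff sgn_if)
  also have "\<dots> = x" using P False by (simp add: powr_powr sgn_if)
  finally show ?thesis .
qed simp

text \<open>The equation in the time t = ln r, for W(t) = w(e^t) and \<zeta>(t) = - r^(N-1) |w'|^(p-2) w'. As a first order system in
(W, \<zeta>) it makes sense at critical points of w, where the quotients x and z do not.\<close>

definition log_at :: "real \<Rightarrow> real \<Rightarrow> real \<Rightarrow> real \<Rightarrow> real \<Rightarrow> (real \<Rightarrow> real) \<Rightarrow> (real \<Rightarrow> real) \<Rightarrow> real \<Rightarrow> bool" where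
  "log_at P q \<kappa> M \<epsilon> W \<zeta> t \<longleftrightarrow> W t > 0 \<and>
     (W has_real_derivative - (exp (- \<kappa> * t) * psi P (\<zeta> t))) (at t) \<and>
     (\<zeta> has_real_derivative \<epsilon> * (exp (M * t) * W t powr q)) (at t)"

lemma DERIV_comp_ln:
  assumes "(f has_real_derivative d) (at (ln r))" "r > 0"
  shows "((\<lambda>r. f (ln r)) has_real_derivative d * (1 / r)) (at r)"
  using assms by (intro DERIV_chain2[where f = f and g = ln]) (auto intro!: derivative_eq_intros)

lemma DERIV_comp_exp:
  assumes "(f has_real_derivative d) (at (exp t))"
  shows "((\<lambda>t. f (exp t)) has_real_derivative d * exp t) (at t)"
  using assms by (intro DERIV_chain2[where f = f and g = exp]) (auto intro!: derivative_eq_intros)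

locale emden_fowler =
  fixes N p q \<sigma> :: real
  assumes qp: "q > p - 1" and p1: "p - 1 > 0" and Np: "N > p" and p\<sigma>: "p > - \<sigma>"
begin

definition P where "P = p - 1"
definition \<kappa> where "\<kappa> = (N - p) / (p - 1)"
definition M where "M = N + \<sigma>"
definition \<gamma> where "\<gamma> = gamma_exp p q \<sigma>"

lemma P_pos: "P > 0" and qP: "q > P" and \<kappa>_pos: "\<kappa> > 0" and q_pos: "q > 0"
  using p1 qp Np by (auto simp: P_def \<kappa>_def)

lemma \<kappa>P: "\<kappa> * P = N - p" and M\<kappa>P: "M - \<kappa> * P = p + \<sigma>"
  using p1 by (auto simp: P_def \<kappa>_def M_def)

lemma M_gt: "\<kappa> * P < M" and M_pos: "M > 0"
proof -
  show "\<kappa> * P < M" using M\<kappa>P p\<sigma> by linarith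
  then show "M > 0" using \<kappa>P Np by linarith
qed

lemma \<gamma>_eq: "\<gamma> = (M - \<kappa> * P) / (q - P)" and \<gamma>_mult: "\<gamma> * (q - P) = M - \<kappa> * P" and \<gamma>_pos: "\<gamma> > 0"
proof -
  have "q + 1 - p = q - P" by (simp add: P_def)
  then show *: "\<gamma> = (M - \<kappa> * P) / (q - P)" by (simp add: \<gamma>_def gamma_exp_def M\<kappa>P)
  show "\<gamma> * (q - P) = M - \<kappa> * P" "\<gamma> > 0" using qP M_gt by (auto simp: *)
qed

lemma q_crit_less: "q < q_crit N p \<sigma> \<longleftrightarrow> q * \<kappa> < M" and q_crit_greater: "q > q_crit N p \<sigma> \<longleftrightarrow> M < q * \<kappa>"
  using Np p1 by (auto simp: q_crit_def \<kappa>_def M_def field_simps)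

lemma q_Sobolev_less: "q < q_Sobolev N p \<sigma> \<longleftrightarrow> \<kappa> * P * (q + 1) < M * (P + 1)"
  and q_Sobolev_greater: "q > q_Sobolev N p \<sigma> \<longleftrightarrow> \<kappa> * P * (q + 1) > M * (P + 1)"
  and q_Sobolev_eq: "q = q_Sobolev N p \<sigma> \<longleftrightarrow> \<kappa> * P * (q + 1) = M * (P + 1)"
proof -
  have "q_Sobolev N p \<sigma> * (N - p) = N * (p - 1) + p + p * \<sigma>" using Np by (simp add: q_Sobolev_def)
  then have e: "M * (P + 1) - \<kappa> * P * (q + 1) = (q_Sobolev N p \<sigma> - q) * (N - p)"
    unfolding \<kappa>P by (simp add: P_def M_def algebra_simps)
  show "q < q_Sobolev N p \<sigma> \<longleftrightarrow> \<kappa> * P * (q + 1) < M * (P + 1)"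
    using e Np by (smt (verit) zero_less_mult_iff)
  show "q > q_Sobolev N p \<sigma> \<longleftrightarrow> \<kappa> * P * (q + 1) > M * (P + 1)"
    using e Np by (smt (verit) mult_less_0_iff)
  show "q = q_Sobolev N p \<sigma> \<longleftrightarrow> \<kappa> * P * (q + 1) = M * (P + 1)"
    using e Np by (smt (verit) mult_eq_0_iff)
qed

abbreviation "sol \<epsilon> W \<zeta> t \<equiv> log_at P q \<kappa> M \<epsilon> W \<zeta> t"

definition log_flux where "log_flux w t = - (exp ((N - 1) * t) * p_flux p w (exp t))"

lemma N1: "N - 1 = (\<kappa> + 1) * P"
  using \<kappa>P by (simp add: P_def algebra_simps)

lemma psi_log_flux: "psi P (log_flux w t) = - (exp ((\<kappa> + 1) * t) * deriv w (exp t))"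
proof -
  have pe: "p - 2 = P - 1" by (simp add: P_def)
  have "log_flux w t = - (exp ((N - 1) * t) * (\<bar>deriv w (exp t)\<bar> powr (P - 1) * deriv w (exp t)))"
    unfolding log_flux_def p_flux_def pe ..
  then have "psi P (log_flux w t) = - (exp ((N - 1) * t) powr (1 / P) * deriv w (exp t))"
    by (simp add: psi_minus psi_scale psi_inverse P_pos)
  moreover have "exp ((N - 1) * t) powr (1 / P) = exp ((\<kappa> + 1) * t)"
    using P_pos by (simp add: N1 powr_def)
  ultimately show ?thesis by simp
qed

lemma solution_imp_log:
  assumes sol: "positive_solution_on N p q \<sigma> \<epsilon> I w" and r: "exp t \<in> I"
  shows "sol \<epsilon> (\<lambda>t. w (exp t)) (log_flux w) t"
proof -
  define r where "r = exp t"
  have h: "w r > 0" "w differentiable (at r)" "p_flux p w differentiable (at r)"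
    "- deriv (p_flux p w) r - (N - 1) / r * p_flux p w r = \<epsilon> * r powr \<sigma> * w r powr q"
    using sol assms(2) by (auto simp: positive_solution_on_def r_def)
  have dw: "(w has_real_derivative deriv w r) (at r)" and df: "(p_flux p w has_real_derivative deriv (p_flux p w) r) (at r)"
    using h(2,3) by (simp_all add: DERIV_deriv_iff_real_differentiable)
  have "((\<lambda>t. w (exp t)) has_real_derivative deriv w r * exp t) (at t)"
    using DERIV_comp_exp[OF dw[unfolded r_def]] by (simp add: r_def)
  moreover have "- (exp (- \<kappa> * t) * psi P (log_flux w t)) = deriv w r * exp t"
    unfolding psi_log_flux r_def by (simp flip: exp_add add: algebra_simps)
  moreover have "(log_flux w has_real_derivative
      - ((N - 1) * exp ((N - 1) * t) * p_flux p w r + exp ((N - 1) * t) * (deriv (p_flux p w) r * exp t))) (at t)"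
    unfolding log_flux_def[abs_def] using DERIV_comp_exp[OF df[unfolded r_def]]
    by (auto intro!: derivative_eq_intros simp: r_def)
  moreover have "- ((N - 1) * exp ((N - 1) * t) * p_flux p w r + exp ((N - 1) * t) * (deriv (p_flux p w) r * exp t))
      = \<epsilon> * (exp (M * t) * w r powr q)"
  proof -
    have "deriv (p_flux p w) r * r = - ((N - 1) * p_flux p w r) - \<epsilon> * r powr \<sigma> * w r powr q * r"
      using h(4) by (simp add: r_def field_simps)
    then have "- ((N - 1) * exp ((N - 1) * t) * p_flux p w r + exp ((N - 1) * t) * (deriv (p_flux p w) r * r))
       = \<epsilon> * ((exp ((N - 1) * t) * r * r powr \<sigma>) * w r powr q)" by algebra
    moreover have "exp ((N - 1) * t) * r * r powr \<sigma> = exp (M * t)"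
      by (simp add: r_def M_def powr_def algebra_simps flip: exp_add)
    ultimately show ?thesis by (simp add: r_def)
  qed
  ultimately show ?thesis using h(1) by (simp add: log_at_def r_def)
qed

lemma log_imp_deriv:
  assumes sol: "sol \<epsilon> W \<zeta> (ln r)" and r: "r > 0"
  shows "((\<lambda>r. W (ln r)) has_real_derivative - (r powr (- (\<kappa> + 1)) * psi P (\<zeta> (ln r)))) (at r)"
proof -
  have "(W has_real_derivative - (exp (- \<kappa> * ln r) * psi P (\<zeta> (ln r)))) (at (ln r))"
    using sol by (simp add: log_at_def)
  from DERIV_comp_ln[OF this r]
  have "((\<lambda>r. W (ln r)) has_real_derivative - (exp (- \<kappa> * ln r) * psi P (\<zeta> (ln r))) * (1 / r)) (at r)" .
  moreover have "exp (- \<kappa> * ln r) * (1 / r) = r powr (- (\<kappa> + 1))"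
    using r by (simp add: powr_def algebra_simps exp_diff exp_minus exp_add field_simps)
  then have "- (exp (- \<kappa> * ln r) * psi P (\<zeta> (ln r))) * (1 / r) = - (r powr (- (\<kappa> + 1)) * psi P (\<zeta> (ln r)))"
    by (metis (no_types, opaque_lifting) mult.assoc mult.commute mult_minus_left)
  ultimately show ?thesis by simp
qed

lemma log_imp_flux:
  assumes sol: "sol \<epsilon> W \<zeta> (ln r)" and r: "r > 0"
  shows "p_flux p (\<lambda>r. W (ln r)) r = - (r powr (1 - N) * \<zeta> (ln r))"
proof -
  have "deriv (\<lambda>r. W (ln r)) r = - (r powr (- (\<kappa> + 1)) * psi P (\<zeta> (ln r)))"
    by (rule DERIV_imp_deriv[OF log_imp_deriv[OF assms]])
  moreover have pe: "p - 2 = P - 1" by (simp add: P_def)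
  ultimately have "p_flux p (\<lambda>r. W (ln r)) r =
      - (((r powr (- (\<kappa> + 1))) powr (P - 1) * r powr (- (\<kappa> + 1))) * (\<bar>psi P (\<zeta> (ln r))\<bar> powr (P - 1) * psi P (\<zeta> (ln r))))"
    unfolding p_flux_def pe by (simp add: abs_mult powr_mult)
  moreover have ex: "- (\<kappa> + 1) * (P - 1) + - (\<kappa> + 1) = 1 - N" using N1 by (simp add: algebra_simps)
  have "(r powr (- (\<kappa> + 1))) powr (P - 1) * r powr (- (\<kappa> + 1)) = r powr (1 - N)"
    unfolding powr_powr powr_add[symmetric] ex ..
  ultimately show ?thesis by (simp add: psi_inverse' P_pos)
qed

lemma log_imp_solution:
  assumes J: "open J" and sol: "\<And>t. t \<in> J \<Longrightarrow> sol \<epsilon> W \<zeta> t"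
    and I: "\<And>r. r \<in> I \<Longrightarrow> r > 0 \<and> ln r \<in> J"
  shows "positive_solution_on N p q \<sigma> \<epsilon> I (\<lambda>r. W (ln r))"
  unfolding positive_solution_on_def
proof (intro ballI conjI)
  fix r assume "r \<in> I"
  then have r: "r > 0" "ln r \<in> J" using I by auto
  note s = sol[OF r(2)]
  show "W (ln r) > 0" using s by (simp add: log_at_def)
  show "(\<lambda>r. W (ln r)) differentiable at r"
    using log_imp_deriv[OF s r(1)] by (auto simp: real_differentiable_def)
  define S where "S = {0<..} \<inter> ln -` J"
  have S: "open S" unfolding S_def
    by (rule continuous_open_preimage[OF _ _ J]) (auto intro!: continuous_intros)
  have rS: "r \<in> S" using r by (simp add: S_def)
  have "(\<zeta> has_real_derivative \<epsilon> * (exp (M * ln r) * W (ln r) powr q)) (at (ln r))"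
    using s by (simp add: log_at_def)
  from DERIV_comp_ln[OF this r(1)]
  have d\<zeta>: "((\<lambda>r. \<zeta> (ln r)) has_real_derivative \<epsilon> * (exp (M * ln r) * W (ln r) powr q) * (1 / r)) (at r)" .
  have dp: "((\<lambda>r. r powr (1 - N)) has_real_derivative (1 - N) * r powr (- N)) (at r)"
    using has_real_derivative_powr[OF r(1), of "1 - N"] by simp
  have "((\<lambda>r. - (r powr (1 - N) * \<zeta> (ln r))) has_real_derivative
      - ((1 - N) * r powr (- N) * \<zeta> (ln r) + \<epsilon> * (exp (M * ln r) * W (ln r) powr q) * (1 / r) * r powr (1 - N))) (at r)"
    by (rule DERIV_minus[OF DERIV_mult[OF dp d\<zeta>]])
  then have D: "(p_flux p (\<lambda>r. W (ln r)) has_real_derivative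
      - ((1 - N) * r powr (- N) * \<zeta> (ln r) + \<epsilon> * (exp (M * ln r) * W (ln r) powr q) * (1 / r) * r powr (1 - N))) (at r)"
    by (rule has_field_derivative_transform_within_open[OF _ S rS])
      (auto simp: S_def intro!: log_imp_flux[OF sol, symmetric])
  then show "p_flux p (\<lambda>r. W (ln r)) differentiable at r" by (auto simp: real_differentiable_def)
  have e1: "(N - 1) / r * (r powr (1 - N) * \<zeta> (ln r)) = (N - 1) * r powr (- N) * \<zeta> (ln r)"
    using r(1) by (simp add: powr_diff powr_minus field_simps)
  have e2: "exp (M * ln r) * (1 / r) * r powr (1 - N) = r powr \<sigma>"
    using r(1) by (simp add: M_def powr_def exp_diff exp_add field_simps ring_distribs)
  have "- deriv (p_flux p (\<lambda>r. W (ln r))) r - (N - 1) / r * p_flux p (\<lambda>r. W (ln r)) r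
     = ((1 - N) * r powr (- N) * \<zeta> (ln r) + \<epsilon> * (exp (M * ln r) * W (ln r) powr q) * (1 / r) * r powr (1 - N))
       + (N - 1) / r * (r powr (1 - N) * \<zeta> (ln r))"
    by (simp add: DERIV_imp_deriv[OF D] log_imp_flux[OF s r(1)])
  also have "\<dots> = \<epsilon> * (exp (M * ln r) * (1 / r) * r powr (1 - N)) * W (ln r) powr q"
    unfolding e1 by algebra
  finally show "- deriv (p_flux p (\<lambda>r. W (ln r))) r - (N - 1) / r * p_flux p (\<lambda>r. W (ln r)) r
      = \<epsilon> * r powr \<sigma> * W (ln r) powr q" unfolding e2 .
qed

text \<open>In the time ln r the scaling w \<mapsto> \<lambda>^\<gamma> w(\<lambda> r) with \<lambda> = e^h is a translation by h.\<close>

lemma log_scale: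
  assumes "sol \<epsilon> W \<zeta> (t + h)"
  shows "sol \<epsilon> (\<lambda>t. exp (\<gamma> * h) * W (t + h)) (\<lambda>t. exp ((\<gamma> - \<kappa>) * P * h) * \<zeta> (t + h)) t"
proof -
  have h: "W (t + h) > 0" "(W has_real_derivative - (exp (- \<kappa> * (t + h)) * psi P (\<zeta> (t + h)))) (at (t + h))"
     "(\<zeta> has_real_derivative \<epsilon> * (exp (M * (t + h)) * W (t + h) powr q)) (at (t + h))"
    using assms by (auto simp: log_at_def)
  have 1: "exp (\<gamma> * h) * - (exp (- \<kappa> * (t + h)) * psi P (\<zeta> (t + h)))
      = - (exp (- \<kappa> * t) * psi P (exp ((\<gamma> - \<kappa>) * P * h) * \<zeta> (t + h)))"
  proof -
    have "exp ((\<gamma> - \<kappa>) * P * h) powr (1 / P) = exp ((\<gamma> - \<kappa>) * h)" using P_pos by (simp add: powr_def)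
    moreover have "exp (\<gamma> * h) * exp (- \<kappa> * (t + h)) = exp (- \<kappa> * t) * exp ((\<gamma> - \<kappa>) * h)"
      by (simp add: algebra_simps flip: exp_add)
    ultimately show ?thesis by (simp add: psi_scale)
  qed
  have 2: "exp ((\<gamma> - \<kappa>) * P * h) * (\<epsilon> * (exp (M * (t + h)) * W (t + h) powr q))
      = \<epsilon> * (exp (M * t) * (exp (\<gamma> * h) * W (t + h)) powr q)"
  proof -
    have "(\<gamma> - \<kappa>) * P * h + M * (t + h) = M * t + \<gamma> * h * q" using \<gamma>_mult by algebra
    then have "exp ((\<gamma> - \<kappa>) * P * h) * exp (M * (t + h)) = exp (M * t) * exp (\<gamma> * h * q)" by (simp flip: exp_add)
    moreover have "(exp (\<gamma> * h) * W (t + h)) powr q = exp (\<gamma> * h * q) * W (t + h) powr q"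
      using h(1) by (simp add: powr_mult exp_powr_real)
    ultimately show ?thesis by (simp add: mult_ac)
  qed
  show ?thesis unfolding log_at_def
    using DERIV_cmult[OF DERIV_shift_arg[OF h(2)], of "exp (\<gamma> * h)"]
      DERIV_cmult[OF DERIV_shift_arg[OF h(3)], of "exp ((\<gamma> - \<kappa>) * P * h)"] h(1)
    unfolding 1 2 by simp
qed

lemma a_star_eq:
  assumes "\<epsilon> * (\<kappa> - \<gamma>) > 0"
  shows "a_star N p q \<sigma> \<epsilon> = (\<epsilon> * (P * (\<kappa> - \<gamma>)) * \<gamma> powr P) powr (1 / (q - P))"
    and "a_star N p q \<sigma> \<epsilon> > 0" and "a_star N p q \<sigma> \<epsilon> powr (q - P) = \<epsilon> * (P * (\<kappa> - \<gamma>)) * \<gamma> powr P"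
proof -
  define b where "b = \<epsilon> * (P * (\<kappa> - \<gamma>)) * \<gamma> powr P"
  have "b = P * (\<epsilon> * (\<kappa> - \<gamma>)) * \<gamma> powr P" by (simp add: b_def)
  also have "\<dots> > 0" using mult_pos_pos[OF mult_pos_pos[OF P_pos assms], of "\<gamma> powr P"] \<gamma>_pos by simp
  finally have b: "b > 0" .
  have "\<epsilon> * \<bar>\<gamma>\<bar> powr (p - 2) * \<gamma> * (N - p - (p - 1) * \<gamma>) = b"
  proof -
    have "\<bar>\<gamma>\<bar> powr (p - 2) * \<gamma> = \<gamma> powr P" using \<gamma>_pos by (simp add: P_def powr_diff powr_numeral power2_eq_square)
    moreover have "N - p - (p - 1) * \<gamma> = P * (\<kappa> - \<gamma>)" using \<kappa>P by (simp add: P_def algebra_simps)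
    ultimately show ?thesis by (simp add: b_def mult_ac)
  qed
  moreover have "q - p + 1 = q - P" by (simp add: P_def)
  ultimately have *: "a_star N p q \<sigma> \<epsilon> = (THE a. a > 0 \<and> a powr (q - P) = b)"
    unfolding a_star_def Let_def \<gamma>_def[symmetric] by (simp only:)
  have "(THE a. a > 0 \<and> a powr (q - P) = b) = b powr (1 / (q - P))"
    by (rule the_equality) (use b qP in \<open>auto simp: powr_powr\<close>)
  then show "a_star N p q \<sigma> \<epsilon> = (\<epsilon> * (P * (\<kappa> - \<gamma>)) * \<gamma> powr P) powr (1 / (q - P))"
    and "a_star N p q \<sigma> \<epsilon> > 0" "a_star N p q \<sigma> \<epsilon> powr (q - P) = \<epsilon> * (P * (\<kappa> - \<gamma>)) * \<gamma> powr P"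
    using b qP unfolding * by (auto simp: b_def powr_powr)
qed

end

section \<open>From orbits back to solutions\<close>

text \<open>The system has the same form in (x, z) and in (z, x) after reversal of time; this exchanges the rest points (\<kappa>, 0) and (0, M).\<close>

lemma lv_dual:
  assumes "lv_at (1 / q) (1 / P) M \<kappa> x z (- t)"
  shows "lv_at P q \<kappa> M (\<lambda>t. z (- t)) (\<lambda>t. x (- t)) t"
  using assms DERIV_reflect[of x _ t] DERIV_reflect[of z _ t]
  unfolding lv_at_def by (fastforce simp: algebra_simps)

lemma lv_shift: "lv_at P q \<kappa> M x z (t + h) \<Longrightarrow> lv_at P q \<kappa> M (\<lambda>t. x (t + h)) (\<lambda>t. z (t + h)) t"
  unfolding lv_at_def by (auto intro: DERIV_shift_arg)

context emden_fowler
begin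

text \<open>Solves |z| |x|^P = e^((M - \<kappa>P)t) W^(q-P), an identity that holds for x = - W'/W and z = \<zeta>'/\<zeta>, for W. The
signs sx and sz of x and z are passed separately so that all powers have positive bases.\<close>

definition lvW where
  "lvW sx sz x z t = exp ((ln (sz * z t) + P * ln (sx * x t) - (M - \<kappa> * P) * t) / (q - P))"

text \<open>This is ln |\<zeta>|, obtained from \<psi>(\<zeta>) = x W e^(\<kappa>t).\<close>

definition lvL where "lvL sx sz x z t = P * (ln (sx * x t) + ln (lvW sx sz x z t) + \<kappa> * t)"

definition lv\<zeta> where "lv\<zeta> sx sz x z t = sx * exp (lvL sx sz x z t)"

lemma lvW_pos: "lvW sx sz x z t > 0"
  by (simp add: lvW_def)

text \<open>The converse of the passage to quotients: differentiating the two formulas along an orbit gives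
(ln W)' = - x and (ln |\<zeta>|)' = z, which together with the algebraic identities psi_lv\<zeta> and lv\<zeta>_mult is the equation.\<close>

lemma
  assumes lv: "lv_at P q \<kappa> M x z t" and x: "sx * x t > 0" and z: "sz * z t > 0" and s: "sx = 1 \<or> sx = - 1" "sz = 1 \<or> sz = - 1"
  shows DERIV_lvW: "(lvW sx sz x z has_real_derivative - (x t * lvW sx sz x z t)) (at t)"
    and DERIV_ln_lvW: "((\<lambda>t. ln (lvW sx sz x z t)) has_real_derivative - x t) (at t)"
    and DERIV_lvL: "(lvL sx sz x z has_real_derivative z t) (at t)"
    and psi_lv\<zeta>: "psi P (lv\<zeta> sx sz x z t) = x t * lvW sx sz x z t * exp (\<kappa> * t)"
    and lv\<zeta>_mult: "lv\<zeta> sx sz x z t * z t = sx * sz * (exp (M * t) * lvW sx sz x z t powr q)"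
    and lv_imp_log: "log_at P q \<kappa> M (sx * sz) (lvW sx sz x z) (lv\<zeta> sx sz x z) t"
proof -
  let ?W = "lvW sx sz x z" and ?\<zeta> = "lv\<zeta> sx sz x z"
  have nz: "x t \<noteq> 0" "z t \<noteq> 0" "sx \<noteq> 0" "sz \<noteq> 0" using x z by auto
  have lnx: "((\<lambda>t. ln (sx * x t)) has_real_derivative x t - \<kappa> + z t / P) (at t)"
    using lv x nz by (auto intro!: derivative_eq_intros simp: lv_at_def)
  have lnz: "((\<lambda>t. ln (sz * z t)) has_real_derivative M - q * x t - z t) (at t)"
    using lv z nz by (auto intro!: derivative_eq_intros simp: lv_at_def)
  have e: "(M - q * x t - z t + P * (x t - \<kappa> + z t / P) - (M - \<kappa> * P)) / (q - P) = - x t"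
  proof -
    have "M - q * x t - z t + P * (x t - \<kappa> + z t / P) - (M - \<kappa> * P) = - x t * (q - P)"
      using P_pos by (simp add: field_simps)
    then show ?thesis using qP by simp
  qed
  have "((\<lambda>t. (ln (sz * z t) + P * ln (sx * x t) - (M - \<kappa> * P) * t) / (q - P)) has_real_derivative
     (M - q * x t - z t + P * (x t - \<kappa> + z t / P) - (M - \<kappa> * P)) / (q - P)) (at t)"
    by (rule derivative_eq_intros lnx lnz refl)+ (use qP in auto)
  then have lnW: "((\<lambda>t. (ln (sz * z t) + P * ln (sx * x t) - (M - \<kappa> * P) * t) / (q - P)) has_real_derivative - x t) (at t)"
    unfolding e .
  then show dlnW: "((\<lambda>t. ln (?W t)) has_real_derivative - x t) (at t)" by (simp add: lvW_def)
  from lnW show dW: "(?W has_real_derivative - (x t * ?W t)) (at t)"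
    unfolding lvW_def[abs_def] using DERIV_fun_exp[OF lnW] by (simp add: mult.commute)
  have "((\<lambda>t. P * (ln (sx * x t) + ln (?W t) + \<kappa> * t)) has_real_derivative P * ((x t - \<kappa> + z t / P) + - x t + \<kappa>)) (at t)"
    by (rule derivative_eq_intros lnx dlnW refl)+ auto
  moreover have "P * ((x t - \<kappa> + z t / P) + - x t + \<kappa>) = z t" using P_pos by simp
  ultimately show dL: "(lvL sx sz x z has_real_derivative z t) (at t)" by (simp add: lvL_def[abs_def])
  have "exp (P * (ln (sx * x t) + ln (?W t) + \<kappa> * t)) powr (1 / P) = exp (ln (sx * x t) + ln (?W t) + \<kappa> * t)"
    using P_pos by (simp add: powr_def)
  also have "\<dots> = sx * x t * ?W t * exp (\<kappa> * t)" using x lvW_pos by (simp add: exp_add)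
  finally show psi: "psi P (?\<zeta> t) = x t * ?W t * exp (\<kappa> * t)"
    using s by (auto simp: lv\<zeta>_def lvL_def psi_pos psi_minus)
  have d\<zeta>: "(?\<zeta> has_real_derivative sx * (exp (lvL sx sz x z t) * z t)) (at t)"
    unfolding lv\<zeta>_def[abs_def] using dL by (auto intro!: derivative_eq_intros)
  have "exp (lvL sx sz x z t) * (sz * z t) = exp (M * t) * ?W t powr q"
  proof -
    have "(q - P) * ln (?W t) = ln (sz * z t) + P * ln (sx * x t) - (M - \<kappa> * P) * t" using qP by (simp add: lvW_def)
    then have "lvL sx sz x z t + ln (sz * z t) = M * t + q * ln (?W t)" unfolding lvL_def by algebra
    then have "exp (lvL sx sz x z t) * exp (ln (sz * z t)) = exp (M * t) * exp (q * ln (?W t))" by (simp flip: exp_add)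
    then show ?thesis using z lvW_pos[of sx sz x z t] by (simp add: powr_def)
  qed
  then have z\<zeta>: "sz * (exp (lvL sx sz x z t) * z t) = exp (M * t) * ?W t powr q" by (simp add: mult_ac)
  have ss: "sz * sz = 1" using s by auto
  have e\<zeta>: "sx * (exp (lvL sx sz x z t) * z t) = sx * sz * (exp (M * t) * ?W t powr q)"
    unfolding z\<zeta>[symmetric] using ss by algebra
  then show "?\<zeta> t * z t = sx * sz * (exp (M * t) * ?W t powr q)" by (simp add: lv\<zeta>_def)
  have "- (exp (- \<kappa> * t) * psi P (?\<zeta> t)) = - (x t * ?W t)"
    unfolding psi by (simp add: exp_minus)
  then show "log_at P q \<kappa> M (sx * sz) ?W ?\<zeta> t"
    using dW d\<zeta> lvW_pos unfolding log_at_def e\<zeta> by simp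
qed

lemma filterlim_shift: "filterlim (\<lambda>t::real. t + h) at_top at_top" "filterlim (\<lambda>t::real. t + h) at_bot at_bot"
proof -
  show "filterlim (\<lambda>t::real. t + h) at_top at_top" unfolding filterlim_at_top
  proof
    fix Z show "\<forall>\<^sub>F t in at_top. Z \<le> t + h" using eventually_ge_at_top[of "Z - h"] by eventually_elim simp
  qed
  show "filterlim (\<lambda>t::real. t + h) at_bot at_bot" unfolding filterlim_at_bot
  proof
    fix Z show "\<forall>\<^sub>F t in at_bot. t + h \<le> Z" using eventually_le_at_bot[of "Z - h"] by eventually_elim simp
  qed
qed

lemma lv_equilibrium_log:
  assumes x: "(x \<longlongrightarrow> \<gamma>) F" and z: "(z \<longlongrightarrow> P * (\<kappa> - \<gamma>)) F" and s: "sz * (\<kappa> - \<gamma>) > 0"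
  shows "((\<lambda>t. exp (\<gamma> * t) * lvW 1 sz x z t) \<longlongrightarrow> a_star N p q \<sigma> sz) F"
proof -
  have b: "sz * (P * (\<kappa> - \<gamma>)) > 0" using mult_pos_pos[OF P_pos s] by (simp add: mult_ac)
  have "((\<lambda>t. exp ((ln (sz * z t) + P * ln (x t)) / (q - P))) \<longlongrightarrow>
      exp ((ln (sz * (P * (\<kappa> - \<gamma>))) + P * ln \<gamma>) / (q - P))) F"
    by (intro tendsto_intros x z) (use b \<gamma>_pos qP in auto)
  moreover have "exp ((ln (sz * z t) + P * ln (x t)) / (q - P)) = exp (\<gamma> * t) * lvW 1 sz x z t" for t
  proof -
    have "\<gamma> * t = (M - \<kappa> * P) * t / (q - P)" by (simp add: \<gamma>_eq)
    then have "(ln (sz * z t) + P * ln (x t)) / (q - P) =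
        \<gamma> * t + (ln (sz * z t) + P * ln (x t) - (M - \<kappa> * P) * t) / (q - P)" by (simp add: diff_divide_distrib)
    then show ?thesis by (simp only: lvW_def mult_1 exp_add)
  qed
  moreover have "exp ((ln (sz * (P * (\<kappa> - \<gamma>))) + P * ln \<gamma>) / (q - P)) = a_star N p q \<sigma> sz"
  proof -
    have "exp ((ln b + P * ln \<gamma>) / (q - P)) = (b * \<gamma> powr P) powr (1 / (q - P))" if "b > 0" for b
      using that \<gamma>_pos by (simp add: powr_def ln_mult)
    from this[OF b] show ?thesis unfolding a_star_eq(1)[OF s] .
  qed
  ultimately show ?thesis by simp
qed

text \<open>By \<psi>(\<zeta>) = x W e^(\<kappa>t), convergence of \<zeta> and of x gives convergence of r^\<kappa> w.\<close>

lemma lv_fundamental_log: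
  assumes L: "(lvL 1 sz x z \<longlongrightarrow> l) F" and x: "(x \<longlongrightarrow> \<kappa>) F"
  shows "((\<lambda>t. exp (\<kappa> * t) * lvW 1 sz x z t) \<longlongrightarrow> exp (l / P) / \<kappa>) F"
    and "(lv\<zeta> 1 sz x z \<longlongrightarrow> (\<kappa> * (exp (l / P) / \<kappa>)) powr P) F"
proof -
  have "((\<lambda>t. exp (lvL 1 sz x z t / P) / x t) \<longlongrightarrow> exp (l / P) / \<kappa>) F"
    by (intro tendsto_intros L x) (use P_pos \<kappa>_pos in auto)
  moreover have "\<forall>\<^sub>F t in F. x t > 0" using order_tendstoD(1)[OF x \<kappa>_pos] .
  then have "\<forall>\<^sub>F t in F. exp (lvL 1 sz x z t / P) / x t = exp (\<kappa> * t) * lvW 1 sz x z t"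
    by eventually_elim (use P_pos lvW_pos in \<open>simp add: lvL_def exp_add mult_ac\<close>)
  ultimately show "((\<lambda>t. exp (\<kappa> * t) * lvW 1 sz x z t) \<longlongrightarrow> exp (l / P) / \<kappa>) F"
    by (rule Lim_transform_eventually)
  have "(lv\<zeta> 1 sz x z \<longlongrightarrow> 1 * exp l) F" unfolding lv\<zeta>_def[abs_def] by (intro tendsto_intros L)
  moreover have "(\<kappa> * (exp (l / P) / \<kappa>)) powr P = exp l" using \<kappa>_pos P_pos by (simp add: powr_def)
  ultimately show "(lv\<zeta> 1 sz x z \<longlongrightarrow> (\<kappa> * (exp (l / P) / \<kappa>)) powr P) F" by simp
qed

text \<open>The derivative of ln |\<zeta>| is z, which is exponentially small.\<close>

lemma lv_fundamental_at_top:
  assumes orb: "\<And>t. t > T \<Longrightarrow> lv_at P q \<kappa> M x z t \<and> x t > 0 \<and> sz * z t > 0" and sz: "sz = 1 \<or> sz = - 1"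
    and x: "(x \<longlongrightarrow> \<kappa>) at_top" and z: "\<And>t. t > T \<Longrightarrow> \<bar>z t\<bar> \<le> C * exp (- a * t)" and a: "a > 0"
  shows "\<exists>k>0. ((\<lambda>t. exp (\<kappa> * t) * lvW 1 sz x z t) \<longlongrightarrow> k) at_top \<and> (lv\<zeta> 1 sz x z \<longlongrightarrow> (\<kappa> * k) powr P) at_top"
proof -
  have "(lvL 1 sz x z has_real_derivative z t) (at t)" if "t > T" for t
    using DERIV_lvL[of x z t 1 sz] orb[OF that] sz by simp
  from exp_tail_converges[OF this z a] obtain l where "(lvL 1 sz x z \<longlongrightarrow> l) at_top" by blast
  from lv_fundamental_log[OF this x] show ?thesis using \<kappa>_pos
    by (intro exI[of _ "exp (l / P) / \<kappa>"] conjI) auto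
qed

lemma lv_fundamental_at_bot:
  assumes orb: "\<And>t. t < T \<Longrightarrow> lv_at P q \<kappa> M x z t \<and> x t > 0 \<and> sz * z t > 0" and sz: "sz = 1 \<or> sz = - 1"
    and x: "(x \<longlongrightarrow> \<kappa>) at_bot" and z: "\<And>t. t < T \<Longrightarrow> \<bar>z t\<bar> \<le> C * exp (a * t)" and a: "a > 0"
  shows "\<exists>k>0. ((\<lambda>t. exp (\<kappa> * t) * lvW 1 sz x z t) \<longlongrightarrow> k) at_bot \<and> (lv\<zeta> 1 sz x z \<longlongrightarrow> (\<kappa> * k) powr P) at_bot"
proof -
  have "((\<lambda>s. lvL 1 sz x z (- s)) has_real_derivative - z (- t)) (at t)" if "t > - T" for t
    using DERIV_reflect[OF DERIV_lvL[of x z "- t" 1 sz]] orb[of "- t"] sz that by simp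
  moreover have "\<bar>- z (- t)\<bar> \<le> C * exp (- a * t)" if "t > - T" for t using z[of "- t"] that by simp
  ultimately obtain l where "((\<lambda>s. lvL 1 sz x z (- s)) \<longlongrightarrow> l) at_top"
    using exp_tail_converges[OF _ _ a, of "- T" "\<lambda>s. lvL 1 sz x z (- s)" "\<lambda>t. - z (- t)" C] by blast
  then have "(lvL 1 sz x z \<longlongrightarrow> l) at_bot" by (simp add: filterlim_at_bot_mirror)
  from lv_fundamental_log[OF this x] show ?thesis using \<kappa>_pos
    by (intro exI[of _ "exp (l / P) / \<kappa>"] conjI) auto
qed

text \<open>Near (0, M) it is ln W whose derivative, - x, is exponentially small. The limit of \<zeta> e^(-Mt) then follows from
\<zeta>' = z \<zeta> and z \<longrightarrow> M.\<close>

lemma lv_regular_at_bot: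
  assumes orb: "\<And>t. t < T \<Longrightarrow> lv_at P q \<kappa> M x z t \<and> sx * x t > 0 \<and> z t > 0" and sx: "sx = 1 \<or> sx = - 1"
    and z: "(z \<longlongrightarrow> M) at_bot" and x: "\<And>t. t < T \<Longrightarrow> \<bar>x t\<bar> \<le> C * exp (a * t)" and a: "a > 0"
  shows "\<exists>w0>0. (lvW sx 1 x z \<longlongrightarrow> w0) at_bot \<and> ((\<lambda>t. exp (- M * t) * lv\<zeta> sx 1 x z t) \<longlongrightarrow> sx * (w0 powr q / M)) at_bot"
proof -
  have "((\<lambda>s. ln (lvW sx 1 x z (- s))) has_real_derivative x (- t)) (at t)" if "t > - T" for t
    using DERIV_reflect[OF DERIV_ln_lvW[of x z "- t" sx 1]] orb[of "- t"] sx that by simp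
  moreover have "\<bar>x (- t)\<bar> \<le> C * exp (- a * t)" if "t > - T" for t using x[of "- t"] that by simp
  ultimately obtain l where "((\<lambda>s. ln (lvW sx 1 x z (- s))) \<longlongrightarrow> l) at_top"
    using exp_tail_converges[OF _ _ a, of "- T" "\<lambda>s. ln (lvW sx 1 x z (- s))" "\<lambda>t. x (- t)" C] by blast
  then have "((\<lambda>t. ln (lvW sx 1 x z t)) \<longlongrightarrow> l) at_bot" by (simp add: filterlim_at_bot_mirror)
  then have "((\<lambda>t. exp (ln (lvW sx 1 x z t))) \<longlongrightarrow> exp l) at_bot" by (intro tendsto_intros)
  then have W: "(lvW sx 1 x z \<longlongrightarrow> exp l) at_bot" using lvW_pos by simp
  have "((\<lambda>t. sx * (lvW sx 1 x z t powr q / z t)) \<longlongrightarrow> sx * (exp l powr q / M)) at_bot"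
    using M_pos by (intro tendsto_intros W z) auto
  moreover have "\<forall>\<^sub>F t in at_bot. sx * (lvW sx 1 x z t powr q / z t) = exp (- M * t) * lv\<zeta> sx 1 x z t"
    using eventually_gt_at_bot[of T]
  proof eventually_elim
    case (elim t)
    then have z: "z t > 0" using orb by blast
    have "lv\<zeta> sx 1 x z t * z t = sx * 1 * (exp (M * t) * lvW sx 1 x z t powr q)"
      using lv\<zeta>_mult[of x z t sx 1] orb[OF elim] sx by simp
    then have "lv\<zeta> sx 1 x z t = sx * (exp (M * t) * lvW sx 1 x z t powr q) / z t" using z by (simp add: field_simps)
    then show ?case by (simp add: exp_minus)
  qed
  ultimately have "((\<lambda>t. exp (- M * t) * lv\<zeta> sx 1 x z t) \<longlongrightarrow> sx * (exp l powr q / M)) at_bot"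
    by (rule Lim_transform_eventually)
  then show ?thesis using W by (intro exI[of _ "exp l"]) simp
qed

text \<open>A translation by h multiplies the limit of r^\<kappa> w by e^((\<gamma> - \<kappa>)h); as \<gamma> \<noteq> \<kappa>, every positive value is reached.\<close>

lemma scale_fundamental:
  assumes ne: "\<gamma> \<noteq> \<kappa>" and k0: "k0 > 0" and k: "k > 0" and F: "filterlim (\<lambda>t. t + ln (k / k0) / (\<gamma> - \<kappa>)) F F"
    and W: "((\<lambda>t. exp (\<kappa> * t) * W t) \<longlongrightarrow> k0) F" and \<zeta>: "(\<zeta> \<longlongrightarrow> (\<kappa> * k0) powr P) F"
    and h: "h = ln (k / k0) / (\<gamma> - \<kappa>)"
  shows "((\<lambda>t. exp (\<kappa> * t) * (exp (\<gamma> * h) * W (t + h))) \<longlongrightarrow> k) F"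
    and "((\<lambda>t. exp ((\<gamma> - \<kappa>) * P * h) * \<zeta> (t + h)) \<longlongrightarrow> (\<kappa> * k) powr P) F"
proof -
  have eh: "exp ((\<gamma> - \<kappa>) * h) = k / k0" using ne k k0 by (simp add: h)
  have "((\<lambda>t. exp ((\<gamma> - \<kappa>) * h) * (exp (\<kappa> * (t + h)) * W (t + h))) \<longlongrightarrow> exp ((\<gamma> - \<kappa>) * h) * k0) F"
    using tendsto_mult_left[OF filterlim_compose[OF W F]] unfolding h[symmetric] .
  moreover have "exp ((\<gamma> - \<kappa>) * h) * (exp (\<kappa> * (t + h)) * W (t + h)) = exp (\<kappa> * t) * (exp (\<gamma> * h) * W (t + h))" for t
    by (simp add: algebra_simps flip: exp_add mult.assoc)
  ultimately show "((\<lambda>t. exp (\<kappa> * t) * (exp (\<gamma> * h) * W (t + h))) \<longlongrightarrow> k) F" using k0 eh by simp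
  have "((\<lambda>t. exp ((\<gamma> - \<kappa>) * P * h) * \<zeta> (t + h)) \<longlongrightarrow> exp ((\<gamma> - \<kappa>) * P * h) * (\<kappa> * k0) powr P) F"
    using tendsto_mult_left[OF filterlim_compose[OF \<zeta> F]] unfolding h[symmetric] .
  moreover have "exp ((\<gamma> - \<kappa>) * P * h) = (k / k0) powr P" unfolding eh[symmetric] by (simp add: powr_def)
  moreover have "(k / k0) powr P * (\<kappa> * k0) powr P = (\<kappa> * k) powr P"
    using k0 k \<kappa>_pos by (simp add: mult.commute flip: powr_mult)
  ultimately show "((\<lambda>t. exp ((\<gamma> - \<kappa>) * P * h) * \<zeta> (t + h)) \<longlongrightarrow> (\<kappa> * k) powr P) F" by simp
qed

text \<open>A translation by h multiplies the limit of W by e^(\<gamma>h), and \<gamma> > 0.\<close>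

lemma scale_regular:
  assumes w1: "w1 > 0" and w0: "w0 > 0" and W: "(W \<longlongrightarrow> w1) at_bot"
    and \<zeta>: "((\<lambda>t. exp (- M * t) * \<zeta> t) \<longlongrightarrow> \<epsilon> * (w1 powr q / M)) at_bot" and h: "h = ln (w0 / w1) / \<gamma>"
  shows "((\<lambda>t. exp (\<gamma> * h) * W (t + h)) \<longlongrightarrow> w0) at_bot"
    and "((\<lambda>t. exp (- M * t) * (exp ((\<gamma> - \<kappa>) * P * h) * \<zeta> (t + h))) \<longlongrightarrow> \<epsilon> * (w0 powr q / M)) at_bot"
proof -
  have eh: "exp (\<gamma> * h) = w0 / w1" using w1 w0 \<gamma>_pos by (simp add: h)
  note F = filterlim_shift(2)[of h]
  have "((\<lambda>t. exp (\<gamma> * h) * W (t + h)) \<longlongrightarrow> exp (\<gamma> * h) * w1) at_bot"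
    by (rule tendsto_mult_left[OF filterlim_compose[OF W F]])
  then show "((\<lambda>t. exp (\<gamma> * h) * W (t + h)) \<longlongrightarrow> w0) at_bot" using w1 eh by simp
  have "((\<lambda>t. exp (q * (\<gamma> * h)) * (exp (- M * (t + h)) * \<zeta> (t + h))) \<longlongrightarrow> exp (q * (\<gamma> * h)) * (\<epsilon> * (w1 powr q / M))) at_bot"
    by (rule tendsto_mult_left[OF filterlim_compose[OF \<zeta> F]])
  moreover have "exp (q * (\<gamma> * h)) * (exp (- M * (t + h)) * \<zeta> (t + h)) = exp (- M * t) * (exp ((\<gamma> - \<kappa>) * P * h) * \<zeta> (t + h))" for t
  proof -
    have "q * (\<gamma> * h) + - M * (t + h) = - M * t + (\<gamma> - \<kappa>) * P * h" using \<gamma>_mult by algebra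
    then have "exp (q * (\<gamma> * h)) * exp (- M * (t + h)) = exp (- M * t) * exp ((\<gamma> - \<kappa>) * P * h)" by (simp only: exp_add[symmetric])
    then show ?thesis by (simp only: mult.assoc[symmetric])
  qed
  moreover have "exp (q * (\<gamma> * h)) * (\<epsilon> * (w1 powr q / M)) = \<epsilon> * (w0 powr q / M)"
  proof -
    have "exp (q * (\<gamma> * h)) = (w0 / w1) powr q" unfolding eh[symmetric] by (simp add: powr_def)
    moreover have "(w0 / w1) powr q * w1 powr q = w0 powr q" using w1 w0 by (simp flip: powr_mult)
    ultimately show ?thesis by (simp add: mult_ac)
  qed
  ultimately show "((\<lambda>t. exp (- M * t) * (exp ((\<gamma> - \<kappa>) * P * h) * \<zeta> (t + h))) \<longlongrightarrow> \<epsilon> * (w0 powr q / M)) at_bot" by (simp only:)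
qed

lemma scale_equilibrium:
  assumes W: "((\<lambda>t. exp (\<gamma> * t) * W t) \<longlongrightarrow> l) F" and F: "filterlim (\<lambda>t. t + h) F F"
  shows "((\<lambda>t. exp (\<gamma> * t) * (exp (\<gamma> * h) * W (t + h))) \<longlongrightarrow> l) F"
proof -
  have "((\<lambda>t. exp (\<gamma> * (t + h)) * W (t + h)) \<longlongrightarrow> l) F" by (rule filterlim_compose[OF W F])
  moreover have "exp (\<gamma> * (t + h)) * W (t + h) = exp (\<gamma> * t) * (exp (\<gamma> * h) * W (t + h))" for t
    by (simp add: algebra_simps exp_add)
  ultimately show ?thesis by simp
qed

end

section \<open>Solutions with prescribed asymptotics in logarithmic time\<close>

context emden_fowler
begin

lemma scaled_solution:
  assumes "\<And>t. t \<in> J \<Longrightarrow> sol \<epsilon> W \<zeta> t" and "t + h \<in> J"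
  shows "sol \<epsilon> (\<lambda>t. exp (\<gamma> * h) * W (t + h)) (\<lambda>t. exp ((\<gamma> - \<kappa>) * P * h) * \<zeta> (t + h)) t"
  using assms by (intro log_scale) auto

lemma dual_crit: "\<kappa> < 1 / P * M"
  using M_gt P_pos by (simp add: field_simps)

text \<open>Regular solutions are the dual of fundamental solutions at a saddle. The saddle condition of the dual
system is \<kappa>P < M, which is p + \<sigma> > 0.\<close>

lemma regular_log_exists:
  assumes \<epsilon>: "\<epsilon> = 1 \<or> \<epsilon> = - 1" and w0: "w0 > 0"
  shows "\<exists>W \<zeta> T. (\<forall>t<T. sol \<epsilon> W \<zeta> t) \<and> (W \<longlongrightarrow> w0) at_bot \<and> ((\<lambda>t. exp (- M * t) * \<zeta> t) \<longlongrightarrow> \<epsilon> * (w0 powr q / M)) at_bot"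
proof -
  have "1 / q > 0" "1 / P > 0" using q_pos P_pos by auto
  from fundamental_orbit[OF this M_pos dual_crit \<epsilon>]
  obtain x z a C where a: "a > 0" and orb': "\<forall>t\<ge>0. lv_at (1 / q) (1 / P) M \<kappa> x z t \<and> x t > 0 \<and> \<epsilon> * z t > 0
            \<and> \<bar>x t - M\<bar> \<le> C * exp (- a * t) \<and> \<bar>z t\<bar> \<le> C * exp (- a * t)"
    by (elim exE conjE)
  note orb = orb'[rule_format]
  define X where "X t = z (- t)" for t
  define Z where "Z t = x (- t)" for t
  have lv: "lv_at P q \<kappa> M X Z t \<and> \<epsilon> * X t > 0 \<and> Z t > 0" if "t < 0" for t
    using lv_dual[of q P M \<kappa> x z t] orb[of "- t"] that by (simp add: X_def[abs_def] Z_def[abs_def])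
  have Xb: "\<bar>X t\<bar> \<le> C * exp (a * t)" if "t < 0" for t using orb[of "- t"] that by (simp add: X_def)
  have "(x \<longlongrightarrow> M) at_top" by (rule exp_close_tendsto[OF a, of x M C]) (use orb in simp)
  then have Zl: "(Z \<longlongrightarrow> M) at_bot" unfolding Z_def filterlim_at_bot_mirror by simp
  obtain w1 where w1: "w1 > 0" and lim: "(lvW \<epsilon> 1 X Z \<longlongrightarrow> w1) at_bot"
      "((\<lambda>t. exp (- M * t) * lv\<zeta> \<epsilon> 1 X Z t) \<longlongrightarrow> \<epsilon> * (w1 powr q / M)) at_bot"
    using lv_regular_at_bot[OF lv \<epsilon> Zl Xb a] by blast
  have s: "sol \<epsilon> (lvW \<epsilon> 1 X Z) (lv\<zeta> \<epsilon> 1 X Z) t" if "t \<in> {..<0}" for t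
    using lv_imp_log[of X Z t \<epsilon> 1] lv[of t] \<epsilon> that by simp
  define h where "h = ln (w0 / w1) / \<gamma>"
  have "\<forall>t. t < - h \<longrightarrow> sol \<epsilon> (\<lambda>t. exp (\<gamma> * h) * lvW \<epsilon> 1 X Z (t + h)) (\<lambda>t. exp ((\<gamma> - \<kappa>) * P * h) * lv\<zeta> \<epsilon> 1 X Z (t + h)) t"
    by (intro allI impI scaled_solution[where J = "{..<0}", OF s]) auto
  with scale_regular[OF w1 w0 lim h_def] show ?thesis by blast
qed

lemma fundamental_top_log_exists:
  assumes \<epsilon>: "\<epsilon> = 1 \<or> \<epsilon> = - 1" and k: "k > 0" and crit: "M < q * \<kappa>"
  shows "\<exists>W \<zeta> T. (\<forall>t>T. sol \<epsilon> W \<zeta> t) \<and> ((\<lambda>t. exp (\<kappa> * t) * W t) \<longlongrightarrow> k) at_top \<and> (\<zeta> \<longlongrightarrow> (\<kappa> * k) powr P) at_top"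
proof -
  from fundamental_orbit[OF P_pos q_pos \<kappa>_pos crit \<epsilon>]
  obtain x z a C where a: "a > 0" and orb': "\<forall>t\<ge>0. lv_at P q \<kappa> M x z t \<and> x t > 0 \<and> \<epsilon> * z t > 0
            \<and> \<bar>x t - \<kappa>\<bar> \<le> C * exp (- a * t) \<and> \<bar>z t\<bar> \<le> C * exp (- a * t)"
    by (elim exE conjE)
  note orb = orb'[rule_format]
  have xl: "(x \<longlongrightarrow> \<kappa>) at_top" by (rule exp_close_tendsto[OF a, of x \<kappa> C]) (use orb in simp)
  have lv: "lv_at P q \<kappa> M x z t \<and> x t > 0 \<and> \<epsilon> * z t > 0" if "t > 0" for t using orb[of t] that by simp
  have zb: "\<bar>z t\<bar> \<le> C * exp (- a * t)" if "t > 0" for t using orb[of t] that by simp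
  obtain k0 where k0: "k0 > 0" and lim: "((\<lambda>t. exp (\<kappa> * t) * lvW 1 \<epsilon> x z t) \<longlongrightarrow> k0) at_top"
      "(lv\<zeta> 1 \<epsilon> x z \<longlongrightarrow> (\<kappa> * k0) powr P) at_top"
    using lv_fundamental_at_top[OF lv \<epsilon> xl zb a] by blast
  have s: "sol \<epsilon> (lvW 1 \<epsilon> x z) (lv\<zeta> 1 \<epsilon> x z) t" if "t \<in> {0<..}" for t
    using lv_imp_log[of x z t 1 \<epsilon>] lv[of t] \<epsilon> that by simp
  have "(\<gamma> - \<kappa>) * (q - P) < 0" using \<gamma>_mult crit by (simp add: algebra_simps)
  then have ne: "\<gamma> \<noteq> \<kappa>" by auto
  define h where "h = ln (k / k0) / (\<gamma> - \<kappa>)"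
  have "\<forall>t. t > - h \<longrightarrow> sol \<epsilon> (\<lambda>t. exp (\<gamma> * h) * lvW 1 \<epsilon> x z (t + h)) (\<lambda>t. exp ((\<gamma> - \<kappa>) * P * h) * lv\<zeta> 1 \<epsilon> x z (t + h)) t"
    by (intro allI impI scaled_solution[where J = "{0<..}", OF s]) auto
  with scale_fundamental[OF ne k0 k filterlim_shift(1) lim h_def] show ?thesis by blast
qed

lemma \<gamma>_gt_\<kappa>: "q * \<kappa> < M \<Longrightarrow> \<kappa> < \<gamma>" and \<gamma>_lt_\<kappa>: "M < q * \<kappa> \<Longrightarrow> \<gamma> < \<kappa>"
proof -
  have e: "(\<gamma> - \<kappa>) * (q - P) = M - q * \<kappa>" using \<gamma>_mult by algebra
  show "\<kappa> < \<gamma>" if "q * \<kappa> < M"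
  proof -
    have "(\<gamma> - \<kappa>) * (q - P) > 0" using e that by simp
    then show ?thesis using qP by (simp add: zero_less_mult_iff)
  qed
  show "\<gamma> < \<kappa>" if "M < q * \<kappa>"
  proof -
    have "(\<gamma> - \<kappa>) * (q - P) < 0" using e that by simp
    then show ?thesis using qP by (simp add: mult_less_0_iff)
  qed
qed

lemma subcritical_global_log:
  assumes k: "k > 0" and crit: "q * \<kappa> < M"
  shows "\<exists>W \<zeta>. (\<forall>t. sol (- 1) W \<zeta> t) \<and> ((\<lambda>t. exp (\<kappa> * t) * W t) \<longlongrightarrow> k) at_bot
     \<and> ((\<lambda>t. exp (\<gamma> * t) * W t) \<longlongrightarrow> a_star N p q \<sigma> (- 1)) at_top"
proof -
  from subcritical_connection[OF P_pos qP \<kappa>_pos crit \<gamma>_eq]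
  obtain x z a C T where a: "a > 0" and orb: "\<forall>t. lv_at P q \<kappa> M x z t \<and> x t > 0 \<and> z t < 0"
    and top: "(x \<longlongrightarrow> \<gamma>) at_top" "(z \<longlongrightarrow> P * (\<kappa> - \<gamma>)) at_top" and xl: "(x \<longlongrightarrow> \<kappa>) at_bot"
    and zb: "\<forall>t\<le>T. \<bar>z t\<bar> \<le> C * exp (a * t)"
    by (elim exE conjE)
  have lv: "lv_at P q \<kappa> M x z t \<and> x t > 0 \<and> - 1 * z t > 0" for t using orb by simp
  have zb': "\<bar>z t\<bar> \<le> C * exp (a * t)" if "t < T" for t using zb that by simp
  obtain k0 where k0: "k0 > 0" and lim: "((\<lambda>t. exp (\<kappa> * t) * lvW 1 (- 1) x z t) \<longlongrightarrow> k0) at_bot"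
      "(lv\<zeta> 1 (- 1) x z \<longlongrightarrow> (\<kappa> * k0) powr P) at_bot"
    using lv_fundamental_at_bot[OF lv _ xl zb' a] by blast
  have eq: "((\<lambda>t. exp (\<gamma> * t) * lvW 1 (- 1) x z t) \<longlongrightarrow> a_star N p q \<sigma> (- 1)) at_top"
    using \<gamma>_gt_\<kappa>[OF crit] by (intro lv_equilibrium_log top) simp
  have s: "sol (- 1) (lvW 1 (- 1) x z) (lv\<zeta> 1 (- 1) x z) t" if "t \<in> UNIV" for t
    using lv_imp_log[of x z t 1 "- 1"] lv[of t] by simp
  have ne: "\<gamma> \<noteq> \<kappa>" using \<gamma>_gt_\<kappa>[OF crit] by simp
  define h where "h = ln (k / k0) / (\<gamma> - \<kappa>)"
  have "\<forall>t. sol (- 1) (\<lambda>t. exp (\<gamma> * h) * lvW 1 (- 1) x z (t + h)) (\<lambda>t. exp ((\<gamma> - \<kappa>) * P * h) * lv\<zeta> 1 (- 1) x z (t + h)) t"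
    by (intro allI scaled_solution[where J = "UNIV", OF s]) auto
  with scale_fundamental(1)[OF ne k0 k filterlim_shift(2) lim h_def] scale_equilibrium[OF eq filterlim_shift(1)[of h]]
  show ?thesis by blast
qed

lemma below_Sobolev_global_log:
  assumes k: "k > 0" and crit: "M < q * \<kappa>" and sob: "\<kappa> * P * (q + 1) < M * (P + 1)"
  shows "\<exists>W \<zeta>. (\<forall>t. sol 1 W \<zeta> t) \<and> ((\<lambda>t. exp (\<kappa> * t) * W t) \<longlongrightarrow> k) at_top
     \<and> ((\<lambda>t. exp (\<gamma> * t) * W t) \<longlongrightarrow> a_star N p q \<sigma> 1) at_bot"
proof -
  from supercritical_connection[OF P_pos qP \<kappa>_pos crit M_gt(1) sob \<gamma>_eq]
  obtain x z a C where a: "a > 0" and orb: "\<forall>t. lv_at P q \<kappa> M x z t \<and> x t > 0 \<and> z t > 0"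
    and bot: "(x \<longlongrightarrow> \<gamma>) at_bot" "(z \<longlongrightarrow> P * (\<kappa> - \<gamma>)) at_bot" and xl: "(x \<longlongrightarrow> \<kappa>) at_top"
    and zb: "\<forall>t\<ge>0. \<bar>z t\<bar> \<le> C * exp (- a * t)"
    by (elim exE conjE)
  have lv: "lv_at P q \<kappa> M x z t \<and> x t > 0 \<and> 1 * z t > 0" for t using orb by simp
  have zb': "\<bar>z t\<bar> \<le> C * exp (- a * t)" if "t > 0" for t using zb that by simp
  obtain k0 where k0: "k0 > 0" and lim: "((\<lambda>t. exp (\<kappa> * t) * lvW 1 1 x z t) \<longlongrightarrow> k0) at_top"
      "(lv\<zeta> 1 1 x z \<longlongrightarrow> (\<kappa> * k0) powr P) at_top"
    using lv_fundamental_at_top[OF lv _ xl zb' a] by blast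
  have eq: "((\<lambda>t. exp (\<gamma> * t) * lvW 1 1 x z t) \<longlongrightarrow> a_star N p q \<sigma> 1) at_bot"
    using \<gamma>_lt_\<kappa>[OF crit] by (intro lv_equilibrium_log bot) simp
  have s: "sol 1 (lvW 1 1 x z) (lv\<zeta> 1 1 x z) t" if "t \<in> UNIV" for t
    using lv_imp_log[of x z t 1 1] lv[of t] by simp
  have ne: "\<gamma> \<noteq> \<kappa>" using \<gamma>_lt_\<kappa>[OF crit] by simp
  define h where "h = ln (k / k0) / (\<gamma> - \<kappa>)"
  have "\<forall>t. sol 1 (\<lambda>t. exp (\<gamma> * h) * lvW 1 1 x z (t + h)) (\<lambda>t. exp ((\<gamma> - \<kappa>) * P * h) * lv\<zeta> 1 1 x z (t + h)) t"
    by (intro allI scaled_solution[where J = "UNIV", OF s]) auto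
  with scale_fundamental(1)[OF ne k0 k filterlim_shift(1) lim h_def] scale_equilibrium[OF eq filterlim_shift(2)[of h]]
  show ?thesis by blast
qed

text \<open>The dual of the connection found below the Sobolev exponent: duality exchanges the two inequalities for q, and the regular rest point
(0, M) takes the place of (\<kappa>, 0). The dual values of \<gamma> and P(\<kappa> - \<gamma>) are interchanged.\<close>

lemma above_Sobolev_global_log:
  assumes w0: "w0 > 0" and crit: "M < q * \<kappa>" and sob: "\<kappa> * P * (q + 1) > M * (P + 1)"
  shows "\<exists>W \<zeta>. (\<forall>t. sol 1 W \<zeta> t) \<and> (W \<longlongrightarrow> w0) at_bot
     \<and> ((\<lambda>t. exp (\<gamma> * t) * W t) \<longlongrightarrow> a_star N p q \<sigma> 1) at_top"
proof -
  define \<gamma>' where "\<gamma>' = (\<kappa> - M * (1 / q)) / (1 / P - 1 / q)"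
  have pos: "1 / q > 0" and lt: "1 / q < 1 / P" using q_pos P_pos qP by (auto simp: field_simps)
  have c1: "M * (1 / q) < \<kappa>" using crit q_pos by (simp add: field_simps)
  have c2: "M * (1 / q) * (1 / P + 1) < \<kappa> * (1 / q + 1)"
  proof -
    have "M * (1 / q) * (1 / P + 1) = M * (P + 1) / (q * P)" "\<kappa> * (1 / q + 1) = \<kappa> * P * (q + 1) / (q * P)"
      using q_pos P_pos by (simp_all add: field_simps)
    moreover have "M * (P + 1) / (q * P) < \<kappa> * P * (q + 1) / (q * P)"
      using sob q_pos P_pos by (intro divide_strict_right_mono) auto
    ultimately show ?thesis by simp
  qed
  have \<gamma>': "\<gamma>' = P * (\<kappa> - \<gamma>)" and \<gamma>'': "1 / q * (M - \<gamma>') = \<gamma>"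
  proof -
    have "\<gamma>' * (q - P) = P * (\<kappa> * q - M)" using q_pos P_pos qP by (simp add: \<gamma>'_def field_simps)
    moreover have "P * (\<kappa> - \<gamma>) * (q - P) = P * (\<kappa> * q - M)" using \<gamma>_mult by algebra
    ultimately show *: "\<gamma>' = P * (\<kappa> - \<gamma>)" using qP by (metis mult_right_cancel less_irrefl diff_gt_0_iff_gt)
    have "M - \<gamma>' = q * \<gamma>" unfolding * using \<gamma>_mult by algebra
    then show "1 / q * (M - \<gamma>') = \<gamma>" using q_pos by simp
  qed
  from supercritical_connection[OF pos lt M_pos dual_crit c1 c2 \<gamma>'_def]
  obtain x z a C where a: "a > 0" and orb: "\<forall>t. lv_at (1 / q) (1 / P) M \<kappa> x z t \<and> x t > 0 \<and> z t > 0"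
    and bot: "(x \<longlongrightarrow> \<gamma>') at_bot" "(z \<longlongrightarrow> 1 / q * (M - \<gamma>')) at_bot" and xl: "(x \<longlongrightarrow> M) at_top"
    and zb: "\<forall>t\<ge>0. \<bar>z t\<bar> \<le> C * exp (- a * t)"
    by (elim exE conjE)
  define X where "X t = z (- t)" for t
  define Z where "Z t = x (- t)" for t
  have lv: "lv_at P q \<kappa> M X Z t \<and> 1 * X t > 0 \<and> Z t > 0" for t
    using lv_dual[of q P M \<kappa> x z t] orb by (simp add: X_def[abs_def] Z_def[abs_def])
  have Xb: "\<bar>X t\<bar> \<le> C * exp (a * t)" if "t < 0" for t using zb[rule_format, of "- t"] that by (simp add: X_def)
  have Zl: "(Z \<longlongrightarrow> M) at_bot" unfolding Z_def filterlim_at_bot_mirror using xl by simp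
  have top: "(X \<longlongrightarrow> \<gamma>) at_top" "(Z \<longlongrightarrow> P * (\<kappa> - \<gamma>)) at_top"
    using bot unfolding X_def Z_def filterlim_at_bot_mirror \<gamma>'' by (simp_all add: \<gamma>')
  obtain w1 where w1: "w1 > 0" and lim: "(lvW 1 1 X Z \<longlongrightarrow> w1) at_bot"
      "((\<lambda>t. exp (- M * t) * lv\<zeta> 1 1 X Z t) \<longlongrightarrow> 1 * (w1 powr q / M)) at_bot"
    using lv_regular_at_bot[OF lv _ Zl Xb a] by blast
  have eq: "((\<lambda>t. exp (\<gamma> * t) * lvW 1 1 X Z t) \<longlongrightarrow> a_star N p q \<sigma> 1) at_top"
    using \<gamma>_lt_\<kappa>[OF crit] by (intro lv_equilibrium_log top) simp
  have s: "sol 1 (lvW 1 1 X Z) (lv\<zeta> 1 1 X Z) t" if "t \<in> UNIV" for t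
    using lv_imp_log[of X Z t 1 1] lv[of t] by simp
  define h where "h = ln (w0 / w1) / \<gamma>"
  have "\<forall>t. sol 1 (\<lambda>t. exp (\<gamma> * h) * lvW 1 1 X Z (t + h)) (\<lambda>t. exp ((\<gamma> - \<kappa>) * P * h) * lv\<zeta> 1 1 X Z (t + h)) t"
    by (intro allI scaled_solution[where J = "UNIV", OF s]) auto
  with scale_regular(1)[OF w1 w0 lim h_def] scale_equilibrium[OF eq filterlim_shift(1)[of h]]
  show ?thesis by blast
qed

lemma psi_tendsto:
  assumes "(f \<longlongrightarrow> l) F" "l \<noteq> 0" shows "((\<lambda>t. psi P (f t)) \<longlongrightarrow> psi P l) F"
proof -
  have "((\<lambda>t. sgn (f t) * \<bar>f t\<bar> powr (1 / P)) \<longlongrightarrow> sgn l * \<bar>l\<bar> powr (1 / P)) F"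
    using assms by (intro tendsto_intros) auto
  then show ?thesis by (simp add: psi_def)
qed

lemma psi_tendsto_inverse:
  assumes "((\<lambda>t. psi P (f t)) \<longlongrightarrow> c) F" "c \<noteq> 0" shows "(f \<longlongrightarrow> \<bar>c\<bar> powr (P - 1) * c) F"
proof -
  have "((\<lambda>t. \<bar>psi P (f t)\<bar> powr (P - 1) * psi P (f t)) \<longlongrightarrow> \<bar>c\<bar> powr (P - 1) * c) F"
    using assms by (intro tendsto_intros) auto
  then show ?thesis by (simp add: psi_inverse' P_pos)
qed

lemma deriv_exp_of_log:
  assumes "sol \<epsilon> W \<zeta> t"
  shows "deriv (\<lambda>r. W (ln r)) (exp t) = - (exp (- ((\<kappa> + 1) * t)) * psi P (\<zeta> t))"
  using DERIV_imp_deriv[OF log_imp_deriv[of \<epsilon> W \<zeta> "exp t"]] assms by (simp add: powr_def algebra_simps)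

lemma powr_exp_arg: "exp t powr a = exp (a * t)" for t a :: real
  by (simp add: powr_def)

lemma exponents: "(N - p) / (p - 1) = \<kappa>" "(N - 1) / (p - 1) = \<kappa> + 1" "- ((\<sigma> + 1) / (p - 1)) - (\<kappa> + 1) = - M / P"
proof -
  show "(N - p) / (p - 1) = \<kappa>" by (simp add: \<kappa>_def)
  show 2: "(N - 1) / (p - 1) = \<kappa> + 1" using p1 by (simp add: \<kappa>_def field_simps)
  show "- ((\<sigma> + 1) / (p - 1)) - (\<kappa> + 1) = - M / P"
    unfolding 2[symmetric] using p1 by (simp add: M_def P_def divide_simps)
qed

text \<open>The two admissible pairs of filters are the ends 0 and infinity for r together with the corresponding ends for ln r.\<close>

lemma fundamental_of_log:
  assumes sol: "\<forall>\<^sub>F t in F'. sol \<epsilon> W \<zeta> t" and W: "((\<lambda>t. exp (\<kappa> * t) * W t) \<longlongrightarrow> k) F'"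
    and \<zeta>: "(\<zeta> \<longlongrightarrow> (\<kappa> * k) powr P) F'" and k: "k > 0" and F: "F = at_right 0 \<and> F' = at_bot \<or> F = at_top \<and> F' = at_top"
  shows "fundamental_behaviour N p F k (\<kappa> * k) (\<lambda>r. W (ln r))"
proof -
  have tr: "(f \<longlongrightarrow> l) F \<longleftrightarrow> ((\<lambda>t. f (exp t)) \<longlongrightarrow> l) F'" for f :: "real \<Rightarrow> real" and l
    using F tendsto_at_right_0_iff_exp[of f l] tendsto_at_top_iff_exp[of f l] by auto
  have kp: "(\<kappa> * k) powr P \<noteq> 0" "psi P ((\<kappa> * k) powr P) = \<kappa> * k"
    using k \<kappa>_pos P_pos by (auto simp: psi_pos powr_powr)
  have "((\<lambda>t. - psi P (\<zeta> t)) \<longlongrightarrow> - (\<kappa> * k)) F'" using tendsto_minus[OF psi_tendsto[OF \<zeta> kp(1)]] kp(2) by simp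
  moreover have "\<forall>\<^sub>F t in F'. - psi P (\<zeta> t) = exp t powr (\<kappa> + 1) * deriv (\<lambda>r. W (ln r)) (exp t)"
    using sol by eventually_elim (simp add: deriv_exp_of_log powr_exp_arg exp_minus)
  ultimately have "((\<lambda>t. exp t powr (\<kappa> + 1) * deriv (\<lambda>r. W (ln r)) (exp t)) \<longlongrightarrow> - (\<kappa> * k)) F'"
    by (rule Lim_transform_eventually)
  then show ?thesis unfolding fundamental_behaviour_def tr exponents using W by (simp add: powr_exp_arg)
qed

lemma log_of_fundamental:
  assumes fb: "fundamental_behaviour N p F k (\<kappa> * k) w" and k: "k > 0"
    and F: "F = at_right 0 \<and> F' = at_bot \<or> F = at_top \<and> F' = at_top"
  shows "((\<lambda>t. exp (\<kappa> * t) * w (exp t)) \<longlongrightarrow> k) F'" "(log_flux w \<longlongrightarrow> (\<kappa> * k) powr P) F'"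
proof -
  have tr: "(f \<longlongrightarrow> l) F \<longleftrightarrow> ((\<lambda>t. f (exp t)) \<longlongrightarrow> l) F'" for f :: "real \<Rightarrow> real" and l
    using F tendsto_at_right_0_iff_exp[of f l] tendsto_at_top_iff_exp[of f l] by auto
  show "((\<lambda>t. exp (\<kappa> * t) * w (exp t)) \<longlongrightarrow> k) F'"
    using fb unfolding fundamental_behaviour_def tr exponents by (simp add: powr_exp_arg)
  have "((\<lambda>t. exp t powr (\<kappa> + 1) * deriv w (exp t)) \<longlongrightarrow> - (\<kappa> * k)) F'"
    using fb unfolding fundamental_behaviour_def tr exponents by simp
  from tendsto_minus[OF this] have "((\<lambda>t. psi P (log_flux w t)) \<longlongrightarrow> \<kappa> * k) F'"
    by (simp add: psi_log_flux powr_exp_arg)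
  from psi_tendsto_inverse[OF this] have "(log_flux w \<longlongrightarrow> \<bar>\<kappa> * k\<bar> powr (P - 1) * (\<kappa> * k)) F'"
    using k \<kappa>_pos by simp
  moreover have "\<bar>\<kappa> * k\<bar> powr (P - 1) * (\<kappa> * k) = (\<kappa> * k) powr P" using k \<kappa>_pos by (simp add: powr_diff)
  ultimately show "(log_flux w \<longlongrightarrow> (\<kappa> * k) powr P) F'" by simp
qed

lemma psi_regular_value:
  assumes "\<epsilon> = 1 \<or> \<epsilon> = - 1" "w0 > 0"
  shows "psi P (\<epsilon> * (w0 powr q / M)) = \<epsilon> * (w0 powr q / M) powr (1 / P)"
  using assms M_pos by (auto simp: psi_pos psi_minus)

lemma regular_deriv_exponent:
  "exp t powr (- ((\<sigma> + 1) / (p - 1))) * exp (- ((\<kappa> + 1) * t)) = exp (- M * t) powr (1 / P)"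
proof -
  have "- ((\<sigma> + 1) / (p - 1)) * t + - ((\<kappa> + 1) * t) = (- ((\<sigma> + 1) / (p - 1)) - (\<kappa> + 1)) * t" by (simp add: algebra_simps)
  also have "\<dots> = 1 / P * (- M * t)" unfolding exponents by simp
  finally show ?thesis by (simp only: powr_exp_arg exp_add[symmetric])
qed

lemma regular_of_log:
  assumes sol: "\<forall>\<^sub>F t in at_bot. sol \<epsilon> W \<zeta> t" and W: "(W \<longlongrightarrow> w0) at_bot"
    and \<zeta>: "((\<lambda>t. exp (- M * t) * \<zeta> t) \<longlongrightarrow> \<epsilon> * (w0 powr q / M)) at_bot" and \<epsilon>: "\<epsilon> = 1 \<or> \<epsilon> = - 1" and w0: "w0 > 0"
  shows "regular_behaviour_0 p \<sigma> \<epsilon> w0 ((w0 powr q / M) powr (1 / P)) (\<lambda>r. W (ln r))"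
proof -
  have "\<epsilon> * (w0 powr q / M) \<noteq> 0" using \<epsilon> w0 M_pos by auto
  from tendsto_minus[OF psi_tendsto[OF \<zeta> this]]
  have "((\<lambda>t. - psi P (exp (- M * t) * \<zeta> t)) \<longlongrightarrow> - (\<epsilon> * (w0 powr q / M) powr (1 / P))) at_bot"
    unfolding psi_regular_value[OF \<epsilon> w0] .
  moreover have "\<forall>\<^sub>F t in at_bot. - psi P (exp (- M * t) * \<zeta> t) =
      exp t powr (- ((\<sigma> + 1) / (p - 1))) * deriv (\<lambda>r. W (ln r)) (exp t)"
    using sol
  proof eventually_elim
    case (elim t)
    show ?case unfolding deriv_exp_of_log[OF elim] psi_scale[OF exp_gt_zero] regular_deriv_exponent[symmetric] by simp
  qed
  ultimately have "((\<lambda>t. exp t powr (- ((\<sigma> + 1) / (p - 1))) * deriv (\<lambda>r. W (ln r)) (exp t)) \<longlongrightarrow> - (\<epsilon> * (w0 powr q / M) powr (1 / P))) at_bot"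
    by (rule Lim_transform_eventually)
  then show ?thesis unfolding regular_behaviour_0_def tendsto_at_right_0_iff_exp using W by simp
qed

lemma log_of_regular:
  assumes rb: "regular_behaviour_0 p \<sigma> \<epsilon> w0 ((w0 powr q / M) powr (1 / P)) w" and \<epsilon>: "\<epsilon> = 1 \<or> \<epsilon> = - 1" and w0: "w0 > 0"
  shows "((\<lambda>t. w (exp t)) \<longlongrightarrow> w0) at_bot" "((\<lambda>t. exp (- M * t) * log_flux w t) \<longlongrightarrow> \<epsilon> * (w0 powr q / M)) at_bot"
proof -
  define b where "b = w0 powr q / M"
  have b: "b > 0" using w0 M_pos by (simp add: b_def)
  show "((\<lambda>t. w (exp t)) \<longlongrightarrow> w0) at_bot"
    using rb unfolding regular_behaviour_0_def tendsto_at_right_0_iff_exp by simp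
  have "((\<lambda>t. exp t powr (- ((\<sigma> + 1) / (p - 1))) * deriv w (exp t)) \<longlongrightarrow> - \<epsilon> * b powr (1 / P)) at_bot"
    using rb unfolding regular_behaviour_0_def tendsto_at_right_0_iff_exp b_def by simp
  from tendsto_minus[OF this]
  have "((\<lambda>t. - (exp t powr (- ((\<sigma> + 1) / (p - 1))) * deriv w (exp t))) \<longlongrightarrow> \<epsilon> * b powr (1 / P)) at_bot" by simp
  moreover have "- (exp t powr (- ((\<sigma> + 1) / (p - 1))) * deriv w (exp t)) = psi P (exp (- M * t) * log_flux w t)" for t
    unfolding psi_scale[OF exp_gt_zero] psi_log_flux regular_deriv_exponent[symmetric] by (simp add: exp_minus)
  ultimately have "((\<lambda>t. psi P (exp (- M * t) * log_flux w t)) \<longlongrightarrow> \<epsilon> * b powr (1 / P)) at_bot" by simp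
  from psi_tendsto_inverse[OF this]
  have "((\<lambda>t. exp (- M * t) * log_flux w t) \<longlongrightarrow> \<bar>\<epsilon> * b powr (1 / P)\<bar> powr (P - 1) * (\<epsilon> * b powr (1 / P))) at_bot"
    using b \<epsilon> by auto
  moreover have "\<bar>\<epsilon> * b powr (1 / P)\<bar> powr (P - 1) * (\<epsilon> * b powr (1 / P)) = \<epsilon> * b"
  proof -
    have "\<epsilon> * b powr (1 / P) = psi P (\<epsilon> * b)" using psi_regular_value[OF \<epsilon> w0] by (simp add: b_def)
    then show ?thesis by (simp add: psi_inverse' P_pos)
  qed
  ultimately show "((\<lambda>t. exp (- M * t) * log_flux w t) \<longlongrightarrow> \<epsilon> * (w0 powr q / M)) at_bot" by (simp add: b_def)
qed

end

section \<open>Uniqueness\<close>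

lemma powr_lipschitz:
  fixes c C r :: real
  assumes "0 < c"
  shows "\<exists>L>0. \<forall>a\<in>{c..C}. \<forall>b\<in>{c..C}. \<bar>a powr r - b powr r\<bar> \<le> L * \<bar>a - b\<bar>"
proof -
  define L where "L = \<bar>r\<bar> * (c powr (r - 1) + C powr (r - 1)) + 1"
  have "\<bar>a powr r - b powr r\<bar> \<le> L * \<bar>a - b\<bar>" if ab: "a \<in> {c..C}" "b \<in> {c..C}" for a b
  proof -
    have "norm (a powr r - b powr r) \<le> L * norm (a - b)"
    proof (rule field_differentiable_bound[where f' = "\<lambda>x. r * x powr (r - 1)" and S = "{c..C}"])
      fix x assume x: "x \<in> {c..C}"
      then show "((\<lambda>x. x powr r) has_field_derivative r * x powr (r - 1)) (at x within {c..C})"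
        using assms by (intro has_field_derivative_at_within[OF has_real_derivative_powr]) auto
      have "x powr (r - 1) \<le> c powr (r - 1) + C powr (r - 1)"
      proof (cases "r \<ge> 1")
        case True
        then have "x powr (r - 1) \<le> C powr (r - 1)" using x assms by (intro powr_mono2) auto
        then show ?thesis using powr_ge_zero[of c "r - 1"] by linarith
      next
        case False
        then have "x powr (r - 1) \<le> c powr (r - 1)" using x assms by (intro powr_mono2') auto
        then show ?thesis using powr_ge_zero[of C "r - 1"] by linarith
      qed
      then have "\<bar>r\<bar> * x powr (r - 1) \<le> \<bar>r\<bar> * (c powr (r - 1) + C powr (r - 1))" by (intro mult_left_mono) auto
      then show "norm (r * x powr (r - 1)) \<le> L" by (simp add: L_def abs_mult)
    qed (use ab in auto)
    then show ?thesis by simp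
  qed
  moreover have "L > 0" unfolding L_def by (intro add_nonneg_pos mult_nonneg_nonneg add_nonneg_nonneg) auto
  ultimately show ?thesis by blast
qed

text \<open>The sign s treats the two half-lines with one constant. At 0 there is no such constant when P > 1.\<close>

lemma psi_lipschitz:
  assumes "0 < c"
  shows "\<exists>L>0. \<forall>s a b. (s = 1 \<or> s = - 1) \<and> s * a \<in> {c..C} \<and> s * b \<in> {c..C} \<longrightarrow> \<bar>psi P a - psi P b\<bar> \<le> L * \<bar>a - b\<bar>"
proof -
  obtain L where L: "L > 0" "\<And>a b. a \<in> {c..C} \<Longrightarrow> b \<in> {c..C} \<Longrightarrow> \<bar>a powr (1 / P) - b powr (1 / P)\<bar> \<le> L * \<bar>a - b\<bar>"
    using powr_lipschitz[OF assms, of C "1 / P"] by blast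
  have "\<bar>psi P a - psi P b\<bar> \<le> L * \<bar>a - b\<bar>" if "s = 1 \<or> s = - 1" "s * a \<in> {c..C}" "s * b \<in> {c..C}" for s a b
    using that(1)
  proof
    assume "s = 1"
    then show ?thesis using L(2)[of a b] that assms by (simp add: psi_pos)
  next
    assume s: "s = - 1"
    then have "a < 0" "b < 0" using that assms by auto
    then have "psi P a - psi P b = - ((- a) powr (1 / P) - (- b) powr (1 / P))" by (simp add: psi_neg)
    then show ?thesis using L(2)[of "- a" "- b"] that s by (simp add: abs_minus_commute)
  qed
  then show ?thesis using L(1) by blast
qed

text \<open>A contraction argument that needs no function space.\<close>

lemma zero_by_halving:
  fixes f :: "'a \<Rightarrow> real"
  assumes bd: "\<And>t. t \<in> S \<Longrightarrow> \<bar>f t\<bar> \<le> B0"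
    and half: "\<And>B. B \<ge> 0 \<Longrightarrow> (\<And>t. t \<in> S \<Longrightarrow> \<bar>f t\<bar> \<le> B) \<Longrightarrow> (\<And>t. t \<in> S \<Longrightarrow> \<bar>f t\<bar> \<le> B / 2)"
    and t: "t \<in> S"
  shows "f t = 0"
proof -
  have B0: "B0 \<ge> 0" using bd[OF t] by linarith
  have pw: "\<bar>f s\<bar> \<le> B0 * (1 / 2) ^ n" if "s \<in> S" for s n
    using that
  proof (induction n arbitrary: s)
    case (Suc n)
    have "\<bar>f s\<bar> \<le> B0 * (1 / 2) ^ n / 2" by (rule half[OF _ Suc.IH Suc.prems]) (use B0 in auto)
    then show ?case by simp
  qed (use bd in simp)
  have "(\<lambda>n. B0 * (1 / 2) ^ n) \<longlonglongrightarrow> 0"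
    by (intro tendsto_mult_right_zero LIMSEQ_power_zero) auto
  then have "\<bar>f t\<bar> \<le> 0" by (rule tendsto_lowerbound) (use pw[OF t] in auto)
  then show ?thesis by simp
qed

lemma exp_tail_bound_bot:
  fixes f f' :: "real \<Rightarrow> real"
  assumes der: "\<And>t. t < T \<Longrightarrow> (f has_real_derivative f' t) (at t)"
    and bd: "\<And>t. t < T \<Longrightarrow> \<bar>f' t\<bar> \<le> A * exp (a * t)" and a: "a > 0"
    and lim: "(f \<longlongrightarrow> 0) at_bot" and t: "t < T"
  shows "\<bar>f t\<bar> \<le> A * exp (a * t) / a"
proof -
  have "\<bar>f (- (- t))\<bar> \<le> A * exp (- a * (- t)) / a"
  proof (rule exp_tail_bound[where f = "\<lambda>s. f (- s)" and f' = "\<lambda>s. - f' (- s)" and T = "- T"])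
    fix s assume s: "- T < s"
    show "((\<lambda>s. f (- s)) has_real_derivative - f' (- s)) (at s)" by (rule DERIV_reflect[OF der]) (use s in auto)
    show "\<bar>- f' (- s)\<bar> \<le> A * exp (- a * s)" using bd[of "- s"] s by simp
  next
    show "((\<lambda>s. f (- s)) \<longlongrightarrow> 0) at_top" using lim by (simp add: filterlim_at_bot_mirror)
  qed (use a t in auto)
  then show ?thesis by simp
qed

lemma tendsto_eventually_comparable:
  fixes f :: "'a \<Rightarrow> real"
  assumes f: "(f \<longlongrightarrow> l) F" and l: "l > 0"
  shows "\<forall>\<^sub>F t in F. f t \<in> {l/2..2*l}"
proof -
  have "l/2 < l" "l < 2*l" using l by auto
  from order_tendstoD(1)[OF f this(1)] order_tendstoD(2)[OF f this(2)] show ?thesis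
    by eventually_elim auto
qed

context emden_fowler
begin

text \<open>Suppose |W1 - W2| \<le> B to the left of some time. Integration of the second equation bounds \<zeta>1 - \<zeta>2 by a multiple of B e^(Mt). The
functions \<zeta> e^(-Mt) stay in a compact interval away from 0, on which \<psi> is Lipschitz, and \<psi> is homogeneous of
degree 1/P; so the first equation bounds W1 - W2 by a multiple of B e^(\<lambda>t) with \<lambda> = M/P - \<kappa> > 0, which is at most B/2 for t
far enough to the left.\<close>

lemma sol_unique_regular:
  assumes \<epsilon>: "\<epsilon> = 1 \<or> \<epsilon> = - 1" and w0: "w0 > 0"
    and 1: "\<And>t. t < T \<Longrightarrow> sol \<epsilon> W1 \<zeta>1 t" "(W1 \<longlongrightarrow> w0) at_bot" "((\<lambda>t. exp (- M * t) * \<zeta>1 t) \<longlongrightarrow> \<epsilon> * (w0 powr q / M)) at_bot"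
    and 2: "\<And>t. t < T \<Longrightarrow> sol \<epsilon> W2 \<zeta>2 t" "(W2 \<longlongrightarrow> w0) at_bot" "((\<lambda>t. exp (- M * t) * \<zeta>2 t) \<longlongrightarrow> \<epsilon> * (w0 powr q / M)) at_bot"
  shows "\<exists>T'\<le>T. \<forall>t<T'. W1 t = W2 t"
proof -
  define b where "b = w0 powr q / M"
  have b: "b > 0" using w0 M_pos by (simp add: b_def)
  have ev: "\<forall>\<^sub>F t in at_bot. W t \<in> {w0/2..2*w0} \<and> \<epsilon> * (exp (- M * t) * \<zeta> t) \<in> {b/2..2*b}"
    if "(W \<longlongrightarrow> w0) at_bot" "((\<lambda>t. exp (- M * t) * \<zeta> t) \<longlongrightarrow> \<epsilon> * (w0 powr q / M)) at_bot" for W \<zeta> :: "real \<Rightarrow> real"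
  proof -
    have "((\<lambda>t. \<epsilon> * (exp (- M * t) * \<zeta> t)) \<longlongrightarrow> \<epsilon> * (\<epsilon> * b)) at_bot" using tendsto_mult_left[OF that(2)] by (simp add: b_def)
    moreover have "\<epsilon> * (\<epsilon> * b) = b" using \<epsilon> by auto
    ultimately have l: "((\<lambda>t. \<epsilon> * (exp (- M * t) * \<zeta> t)) \<longlongrightarrow> b) at_bot" by simp
    from tendsto_eventually_comparable[OF that(1) w0] tendsto_eventually_comparable[OF l b]
    show ?thesis by eventually_elim auto
  qed
  from eventually_conj[OF ev[OF 1(2,3)] ev[OF 2(2,3)]]
  obtain T1 where T1: "\<And>t. t \<le> T1 \<Longrightarrow> W1 t \<in> {w0/2..2*w0} \<and> \<epsilon> * (exp (- M * t) * \<zeta>1 t) \<in> {b/2..2*b}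
      \<and> W2 t \<in> {w0/2..2*w0} \<and> \<epsilon> * (exp (- M * t) * \<zeta>2 t) \<in> {b/2..2*b}"
    by (auto simp: eventually_at_bot_linorder)
  obtain Lq where Lq: "Lq > 0" "\<And>x y. x \<in> {w0/2..2*w0} \<Longrightarrow> y \<in> {w0/2..2*w0} \<Longrightarrow> \<bar>x powr q - y powr q\<bar> \<le> Lq * \<bar>x - y\<bar>"
    using powr_lipschitz[of "w0/2" "2*w0" q] w0 by auto
  have "b / 2 > 0" using b by simp
  from psi_lipschitz[OF this, of "2*b" P]
  obtain L where L: "L > 0" "\<And>s x y. s = 1 \<or> s = - 1 \<Longrightarrow> s * x \<in> {b/2..2*b} \<Longrightarrow> s * y \<in> {b/2..2*b} \<Longrightarrow> \<bar>psi P x - psi P y\<bar> \<le> L * \<bar>x - y\<bar>"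
    by blast
  define lam where "lam = M / P - \<kappa>"
  have lam: "lam > 0" using M_gt P_pos by (simp add: lam_def field_simps)
  define K where "K = L * Lq / M"
  have K: "K > 0" using L Lq M_pos by (simp add: K_def)
  define T' where "T' = min (min T T1) (ln (lam / (2 * K)) / lam)"
  have small: "K * exp (lam * t) / lam \<le> 1 / 2" if "t < T'" for t
  proof -
    have "lam * t \<le> ln (lam / (2 * K))" using that lam by (simp add: T'_def field_simps)
    then have "exp (lam * t) \<le> exp (ln (lam / (2 * K)))" by (simp only: exp_le_cancel_iff)
    then have "exp (lam * t) \<le> lam / (2 * K)" using lam K by simp
    then show ?thesis using lam K by (simp add: field_simps)
  qed
  have tT: "t < T" "t \<le> T1" if "t < T'" for t using that by (auto simp: T'_def)
  have z0: "(\<zeta> \<longlongrightarrow> 0) at_bot" if "((\<lambda>t. exp (- M * t) * \<zeta> t) \<longlongrightarrow> \<epsilon> * (w0 powr q / M)) at_bot" for \<zeta> :: "real \<Rightarrow> real"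
  proof -
    have "((\<lambda>s. exp (- M * s)) \<longlongrightarrow> 0) at_top" by (rule exp_decay_tendsto[OF M_pos])
    then have "((\<lambda>t. exp (M * t)) \<longlongrightarrow> 0) at_bot" by (simp add: filterlim_at_bot_mirror)
    from tendsto_mult[OF this that] show ?thesis by (simp flip: exp_add mult.assoc)
  qed
  have "W1 t - W2 t = 0" if "t < T'" for t
  proof (rule zero_by_halving[where S = "{..<T'}" and f = "\<lambda>t. W1 t - W2 t" and ?B0.0 = "2 * w0"])
    fix t assume "t \<in> {..<T'}"
    then show "\<bar>W1 t - W2 t\<bar> \<le> 2 * w0" using T1[OF tT(2)[of t]] w0 by auto
  next
    fix B t :: real assume B: "B \<ge> 0" and le: "\<And>t. t \<in> {..<T'} \<Longrightarrow> \<bar>W1 t - W2 t\<bar> \<le> B" and t: "t \<in> {..<T'}"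
    have z: "\<bar>\<zeta>1 t - \<zeta>2 t\<bar> \<le> (Lq * B) * exp (M * t) / M" if t: "t < T'" for t
    proof (rule exp_tail_bound_bot[OF _ _ M_pos _ t])
      fix s assume s: "s < T'"
      show "((\<lambda>t. \<zeta>1 t - \<zeta>2 t) has_real_derivative \<epsilon> * (exp (M * s) * W1 s powr q) - \<epsilon> * (exp (M * s) * W2 s powr q)) (at s)"
        using 1(1)[OF tT(1)[OF s]] 2(1)[OF tT(1)[OF s]] by (intro DERIV_diff) (auto simp: log_at_def)
      have "\<bar>W1 s powr q - W2 s powr q\<bar> \<le> Lq * \<bar>W1 s - W2 s\<bar>" using T1[OF tT(2)[OF s]] by (intro Lq(2)) auto
      also have "\<dots> \<le> Lq * B" using le[of s] s Lq(1) by simp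
      finally have "\<bar>W1 s powr q - W2 s powr q\<bar> * exp (M * s) \<le> Lq * B * exp (M * s)" by simp
      moreover have "\<epsilon> * (exp (M * s) * W1 s powr q) - \<epsilon> * (exp (M * s) * W2 s powr q) = \<epsilon> * ((W1 s powr q - W2 s powr q) * exp (M * s))"
        by (simp add: algebra_simps)
      ultimately show "\<bar>\<epsilon> * (exp (M * s) * W1 s powr q) - \<epsilon> * (exp (M * s) * W2 s powr q)\<bar> \<le> Lq * B * exp (M * s)"
        using \<epsilon> by (auto simp: abs_mult)
    next
      show "((\<lambda>t. \<zeta>1 t - \<zeta>2 t) \<longlongrightarrow> 0) at_bot" using tendsto_diff[OF z0[OF 1(3)] z0[OF 2(3)]] by simp
    qed
    have "\<bar>W1 t - W2 t\<bar> \<le> (K * B) * exp (lam * t) / lam"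
    proof (rule exp_tail_bound_bot[OF _ _ lam])
      fix s assume s: "s < T'"
      show "((\<lambda>t. W1 t - W2 t) has_real_derivative - (exp (- \<kappa> * s) * psi P (\<zeta>1 s)) - - (exp (- \<kappa> * s) * psi P (\<zeta>2 s))) (at s)"
        using 1(1)[OF tT(1)[OF s]] 2(1)[OF tT(1)[OF s]] by (intro DERIV_diff) (auto simp: log_at_def)
      have e: "exp (M * s) powr (1 / P) = exp (M / P * s)" by (simp add: powr_def)
      have p: "psi P (\<zeta> s) = exp (M / P * s) * psi P (exp (- M * s) * \<zeta> s)" for \<zeta> :: "real \<Rightarrow> real"
      proof -
        have z: "exp (M * s) * (exp (- M * s) * \<zeta> s) = \<zeta> s" by (simp add: exp_minus)
        show ?thesis using psi_scale[of "exp (M * s)" P "exp (- M * s) * \<zeta> s"] unfolding z e by simp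
      qed
      have "\<bar>psi P (exp (- M * s) * \<zeta>1 s) - psi P (exp (- M * s) * \<zeta>2 s)\<bar>
          \<le> L * \<bar>exp (- M * s) * \<zeta>1 s - exp (- M * s) * \<zeta>2 s\<bar>"
        using T1[OF tT(2)[OF s]] by (intro L(2)[OF \<epsilon>]) auto
      also have "\<dots> = L * (exp (- M * s) * \<bar>\<zeta>1 s - \<zeta>2 s\<bar>)" by (simp add: abs_mult flip: right_diff_distrib)
      also have "\<dots> \<le> L * (exp (- M * s) * ((Lq * B) * exp (M * s) / M))"
        using z[OF s] L(1) by (intro mult_left_mono) auto
      also have "\<dots> = K * B" by (simp add: K_def exp_minus)
      finally have A: "\<bar>psi P (exp (- M * s) * \<zeta>1 s) - psi P (exp (- M * s) * \<zeta>2 s)\<bar> \<le> K * B" .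
      have "- (exp (- \<kappa> * s) * psi P (\<zeta>1 s)) - - (exp (- \<kappa> * s) * psi P (\<zeta>2 s))
          = - (exp (- \<kappa> * s) * exp (M / P * s)) * (psi P (exp (- M * s) * \<zeta>1 s) - psi P (exp (- M * s) * \<zeta>2 s))"
        unfolding p[of \<zeta>1] p[of \<zeta>2] by (simp add: algebra_simps)
      moreover have "exp (- \<kappa> * s) * exp (M / P * s) = exp (lam * s)" by (simp add: lam_def algebra_simps flip: exp_add)
      ultimately have "\<bar>- (exp (- \<kappa> * s) * psi P (\<zeta>1 s)) - - (exp (- \<kappa> * s) * psi P (\<zeta>2 s))\<bar>
          = exp (lam * s) * \<bar>psi P (exp (- M * s) * \<zeta>1 s) - psi P (exp (- M * s) * \<zeta>2 s)\<bar>" by (simp only: abs_mult abs_minus abs_exp_cancel)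
      also have "\<dots> \<le> exp (lam * s) * (K * B)" using A by (intro mult_left_mono) auto
      finally show "\<bar>- (exp (- \<kappa> * s) * psi P (\<zeta>1 s)) - - (exp (- \<kappa> * s) * psi P (\<zeta>2 s))\<bar> \<le> (K * B) * exp (lam * s)" by (simp only: mult.commute)
    next
      show "((\<lambda>t. W1 t - W2 t) \<longlongrightarrow> 0) at_bot" using tendsto_diff[OF 1(2) 2(2)] by simp
    qed (use t in auto)
    also have "\<dots> = B * (K * exp (lam * t) / lam)" by simp
    also have "\<dots> \<le> B * (1 / 2)" using small[of t] t B by (intro mult_left_mono) auto
    finally show "\<bar>W1 t - W2 t\<bar> \<le> B / 2" by simp
  qed (use that in auto)
  moreover have "T' \<le> T" by (simp add: T'_def)
  ultimately show ?thesis by (intro exI[of _ T']) auto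
qed

text \<open>As for regular solutions, now with the weight e^(\<kappa>t) on W, and with \<zeta> itself in a compact interval away from 0.
The rate gained by the two integrations is \<nu> = q\<kappa> - M > 0.\<close>

lemma sol_unique_fundamental:
  assumes \<epsilon>: "\<epsilon> = 1 \<or> \<epsilon> = - 1" and k: "k > 0" and crit: "M < q * \<kappa>"
    and 1: "\<And>t. t > T \<Longrightarrow> sol \<epsilon> W1 \<zeta>1 t" "((\<lambda>t. exp (\<kappa> * t) * W1 t) \<longlongrightarrow> k) at_top" "(\<zeta>1 \<longlongrightarrow> (\<kappa> * k) powr P) at_top"
    and 2: "\<And>t. t > T \<Longrightarrow> sol \<epsilon> W2 \<zeta>2 t" "((\<lambda>t. exp (\<kappa> * t) * W2 t) \<longlongrightarrow> k) at_top" "(\<zeta>2 \<longlongrightarrow> (\<kappa> * k) powr P) at_top"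
  shows "\<exists>T'\<ge>T. \<forall>t>T'. W1 t = W2 t"
proof -
  define b where "b = (\<kappa> * k) powr P"
  have b: "b > 0" using k \<kappa>_pos by (simp add: b_def)
  have ev: "\<forall>\<^sub>F t in at_top. exp (\<kappa> * t) * W t \<in> {k/2..2*k} \<and> 1 * \<zeta> t \<in> {b/2..2*b}"
    if "((\<lambda>t. exp (\<kappa> * t) * W t) \<longlongrightarrow> k) at_top" "(\<zeta> \<longlongrightarrow> (\<kappa> * k) powr P) at_top" for W \<zeta> :: "real \<Rightarrow> real"
  proof -
    from tendsto_eventually_comparable[OF that(1) k] tendsto_eventually_comparable[OF that(2)[folded b_def] b]
    show ?thesis by eventually_elim auto
  qed
  from eventually_conj[OF ev[OF 1(2,3)] ev[OF 2(2,3)]]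
  obtain T1 where T1: "\<And>t. t \<ge> T1 \<Longrightarrow> exp (\<kappa> * t) * W1 t \<in> {k/2..2*k} \<and> 1 * \<zeta>1 t \<in> {b/2..2*b}
      \<and> exp (\<kappa> * t) * W2 t \<in> {k/2..2*k} \<and> 1 * \<zeta>2 t \<in> {b/2..2*b}"
    by (auto simp: eventually_at_top_linorder)
  obtain Lq where Lq: "Lq > 0" "\<And>x y. x \<in> {k/2..2*k} \<Longrightarrow> y \<in> {k/2..2*k} \<Longrightarrow> \<bar>x powr q - y powr q\<bar> \<le> Lq * \<bar>x - y\<bar>"
    using powr_lipschitz[of "k/2" "2*k" q] k by auto
  have "b / 2 > 0" using b by simp
  from psi_lipschitz[OF this, of "2*b" P]
  obtain L where L: "L > 0" "\<And>s x y. s = 1 \<or> s = - 1 \<Longrightarrow> s * x \<in> {b/2..2*b} \<Longrightarrow> s * y \<in> {b/2..2*b} \<Longrightarrow> \<bar>psi P x - psi P y\<bar> \<le> L * \<bar>x - y\<bar>"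
    by blast
  define \<nu> where "\<nu> = q * \<kappa> - M"
  have \<nu>: "\<nu> > 0" "\<kappa> + \<nu> > 0" using crit \<kappa>_pos by (auto simp: \<nu>_def)
  define K where "K = L * Lq / \<nu> / (\<kappa> + \<nu>)"
  have K: "K > 0" using L Lq \<nu> by (simp add: K_def)
  define T' where "T' = max (max T T1) (ln (2 * K) / \<nu>)"
  have small: "K * exp (- \<nu> * t) \<le> 1 / 2" if "t > T'" for t
  proof -
    have "ln (2 * K) \<le> \<nu> * t" using that \<nu> by (simp add: T'_def field_simps)
    then have "exp (ln (2 * K)) \<le> exp (\<nu> * t)" by (simp only: exp_le_cancel_iff)
    then have "2 * K \<le> exp (\<nu> * t)" using K by simp
    then show ?thesis by (simp add: exp_minus field_simps)
  qed
  have tT: "t > T" "t \<ge> T1" if "t > T'" for t using that by (auto simp: T'_def)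
  have w0: "(W \<longlongrightarrow> 0) at_top" if "((\<lambda>t. exp (\<kappa> * t) * W t) \<longlongrightarrow> k) at_top" for W :: "real \<Rightarrow> real"
    using tendsto_mult[OF exp_decay_tendsto[OF \<kappa>_pos] that] by (simp flip: exp_add mult.assoc)
  have "exp (\<kappa> * t) * (W1 t - W2 t) = 0" if "t > T'" for t
  proof (rule zero_by_halving[where S = "{T'<..}" and f = "\<lambda>t. exp (\<kappa> * t) * (W1 t - W2 t)" and ?B0.0 = "2 * k"])
    fix t assume "t \<in> {T'<..}"
    then show "\<bar>exp (\<kappa> * t) * (W1 t - W2 t)\<bar> \<le> 2 * k" using T1[OF tT(2)[of t]] k by (auto simp: right_diff_distrib)
  next
    fix B t :: real assume B: "B \<ge> 0" and le: "\<And>t. t \<in> {T'<..} \<Longrightarrow> \<bar>exp (\<kappa> * t) * (W1 t - W2 t)\<bar> \<le> B" and t: "t \<in> {T'<..}"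
    have z: "\<bar>\<zeta>1 t - \<zeta>2 t\<bar> \<le> (Lq * B) * exp (- \<nu> * t) / \<nu>" if t: "t > T'" for t
    proof (rule exp_tail_bound[OF _ _ \<nu>(1) _ t])
      fix s assume s: "s > T'"
      show "((\<lambda>t. \<zeta>1 t - \<zeta>2 t) has_real_derivative \<epsilon> * (exp (M * s) * W1 s powr q) - \<epsilon> * (exp (M * s) * W2 s powr q)) (at s)"
        using 1(1)[OF tT(1)[OF s]] 2(1)[OF tT(1)[OF s]] by (intro DERIV_diff) (auto simp: log_at_def)
      have Wp: "W1 s > 0" "W2 s > 0" using 1(1)[OF tT(1)[OF s]] 2(1)[OF tT(1)[OF s]] by (auto simp: log_at_def)
      have "\<bar>(exp (\<kappa> * s) * W1 s) powr q - (exp (\<kappa> * s) * W2 s) powr q\<bar> \<le> Lq * \<bar>exp (\<kappa> * s) * W1 s - exp (\<kappa> * s) * W2 s\<bar>"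
        using T1[OF tT(2)[OF s]] by (intro Lq(2)) auto
      also have "\<dots> \<le> Lq * B" using le[of s] s Lq(1) by (simp add: right_diff_distrib)
      finally have A: "\<bar>(exp (\<kappa> * s) * W1 s) powr q - (exp (\<kappa> * s) * W2 s) powr q\<bar> * exp (- \<nu> * s) \<le> Lq * B * exp (- \<nu> * s)" by simp
      have e: "exp (M * s) * w powr q = (exp (\<kappa> * s) * w) powr q * exp (- \<nu> * s)" if "w > 0" for w
      proof -
        have "exp (\<kappa> * s) powr q * exp (- \<nu> * s) = exp (M * s)"
          by (simp add: powr_exp_arg \<nu>_def algebra_simps flip: exp_add)
        then show ?thesis using that by (simp add: powr_mult)
      qed
      have "\<epsilon> * (exp (M * s) * W1 s powr q) - \<epsilon> * (exp (M * s) * W2 s powr q)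
          = \<epsilon> * (((exp (\<kappa> * s) * W1 s) powr q - (exp (\<kappa> * s) * W2 s) powr q) * exp (- \<nu> * s))"
        unfolding e[OF Wp(1)] e[OF Wp(2)] by (simp add: algebra_simps)
      then show "\<bar>\<epsilon> * (exp (M * s) * W1 s powr q) - \<epsilon> * (exp (M * s) * W2 s powr q)\<bar> \<le> Lq * B * exp (- \<nu> * s)"
        using \<epsilon> A by (auto simp: abs_mult)
    next
      show "((\<lambda>t. \<zeta>1 t - \<zeta>2 t) \<longlongrightarrow> 0) at_top" using tendsto_diff[OF 1(3) 2(3)] by simp
    qed
    have "\<bar>W1 t - W2 t\<bar> \<le> (L * Lq / \<nu> * B) * exp (- (\<kappa> + \<nu>) * t) / (\<kappa> + \<nu>)"
    proof (rule exp_tail_bound[OF _ _ \<nu>(2)])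
      fix s assume s: "s > T'"
      show "((\<lambda>t. W1 t - W2 t) has_real_derivative - (exp (- \<kappa> * s) * psi P (\<zeta>1 s)) - - (exp (- \<kappa> * s) * psi P (\<zeta>2 s))) (at s)"
        using 1(1)[OF tT(1)[OF s]] 2(1)[OF tT(1)[OF s]] by (intro DERIV_diff) (auto simp: log_at_def)
      have "\<bar>psi P (\<zeta>1 s) - psi P (\<zeta>2 s)\<bar> \<le> L * \<bar>\<zeta>1 s - \<zeta>2 s\<bar>"
        using T1[OF tT(2)[OF s]] by (intro L(2)[of 1]) auto
      also have "\<dots> \<le> L * ((Lq * B) * exp (- \<nu> * s) / \<nu>)"
        using z[OF s] L(1) by (intro mult_left_mono) auto
      finally have A: "\<bar>psi P (\<zeta>1 s) - psi P (\<zeta>2 s)\<bar> \<le> L * ((Lq * B) * exp (- \<nu> * s) / \<nu>)" .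
      have "- (exp (- \<kappa> * s) * psi P (\<zeta>1 s)) - - (exp (- \<kappa> * s) * psi P (\<zeta>2 s)) = - exp (- \<kappa> * s) * (psi P (\<zeta>1 s) - psi P (\<zeta>2 s))"
        by (simp add: algebra_simps)
      then have "\<bar>- (exp (- \<kappa> * s) * psi P (\<zeta>1 s)) - - (exp (- \<kappa> * s) * psi P (\<zeta>2 s))\<bar> = exp (- \<kappa> * s) * \<bar>psi P (\<zeta>1 s) - psi P (\<zeta>2 s)\<bar>"
        by (simp only: abs_mult abs_minus abs_exp_cancel)
      also have "\<dots> \<le> exp (- \<kappa> * s) * (L * ((Lq * B) * exp (- \<nu> * s) / \<nu>))" using A by (intro mult_left_mono) auto
      also have "\<dots> = (L * Lq / \<nu> * B) * (exp (- \<kappa> * s) * exp (- \<nu> * s))" by simp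
      also have "exp (- \<kappa> * s) * exp (- \<nu> * s) = exp (- (\<kappa> + \<nu>) * s)" by (simp add: algebra_simps flip: exp_add)
      finally show "\<bar>- (exp (- \<kappa> * s) * psi P (\<zeta>1 s)) - - (exp (- \<kappa> * s) * psi P (\<zeta>2 s))\<bar> \<le> (L * Lq / \<nu> * B) * exp (- (\<kappa> + \<nu>) * s)" .
    next
      show "((\<lambda>t. W1 t - W2 t) \<longlongrightarrow> 0) at_top" using tendsto_diff[OF w0[OF 1(2)] w0[OF 2(2)]] by simp
    qed (use t in auto)
    then have "exp (\<kappa> * t) * \<bar>W1 t - W2 t\<bar> \<le> exp (\<kappa> * t) * ((L * Lq / \<nu> * B) * exp (- (\<kappa> + \<nu>) * t) / (\<kappa> + \<nu>))"
      by (intro mult_left_mono) auto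
    also have "\<dots> = B * (K * (exp (\<kappa> * t) * exp (- (\<kappa> + \<nu>) * t)))" by (simp add: K_def)
    also have "exp (\<kappa> * t) * exp (- (\<kappa> + \<nu>) * t) = exp (- \<nu> * t)" by (simp add: algebra_simps flip: exp_add)
    also have "B * (K * exp (- \<nu> * t)) \<le> B * (1 / 2)" using small[of t] t B by (intro mult_left_mono) auto
    finally show "\<bar>exp (\<kappa> * t) * (W1 t - W2 t)\<bar> \<le> B / 2" by (simp add: abs_mult)
  qed (use that in auto)
  moreover have "T' \<ge> T" by (simp add: T'_def)
  ultimately show ?thesis by (intro exI[of _ T']) auto
qed

text \<open>For \<zeta> = 0 at t0 the function \<psi> need not be Lipschitz, but t0 is then a simple zero of \<zeta>, because \<zeta>' has the sign of \<epsilon>.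
So \<zeta>/(t - t0) stays in a compact interval away from 0. If |\<zeta>1 - \<zeta>2| \<le> c |t - t0|, homogeneity of \<psi>
gives a bound for \<psi>(\<zeta>1) - \<psi>(\<zeta>2) by a multiple of c, which is all that the halving argument needs.\<close>

lemma sol_unique_local:
  assumes \<epsilon>: "\<epsilon> = 1 \<or> \<epsilon> = - 1" and J: "open J" "t0 \<in> J"
    and 1: "\<And>t. t \<in> J \<Longrightarrow> sol \<epsilon> W1 \<zeta>1 t" and 2: "\<And>t. t \<in> J \<Longrightarrow> sol \<epsilon> W2 \<zeta>2 t"
    and eq: "W1 t0 = W2 t0" "\<zeta>1 t0 = \<zeta>2 t0"
  shows "\<exists>d>0. \<forall>t\<in>ball t0 d. W1 t = W2 t \<and> \<zeta>1 t = \<zeta>2 t"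
proof -
  obtain d0 where d0: "d0 > 0" "ball t0 d0 \<subseteq> J" using J open_contains_ball by blast
  define w0 where "w0 = W1 t0"
  have w0: "w0 > 0" using 1[OF J(2)] by (simp add: w0_def log_at_def)
  have dW: "(W1 has_real_derivative - (exp (- \<kappa> * t) * psi P (\<zeta>1 t))) (at t)" "(W2 has_real_derivative - (exp (- \<kappa> * t) * psi P (\<zeta>2 t))) (at t)"
    and d\<zeta>: "(\<zeta>1 has_real_derivative \<epsilon> * (exp (M * t) * W1 t powr q)) (at t)" "(\<zeta>2 has_real_derivative \<epsilon> * (exp (M * t) * W2 t powr q)) (at t)"
    if "t \<in> J" for t using 1[OF that] 2[OF that] by (auto simp: log_at_def)
  have cW: "(W1 \<longlongrightarrow> w0) (at t0)" "(W2 \<longlongrightarrow> w0) (at t0)" and c\<zeta>: "(\<zeta>1 \<longlongrightarrow> \<zeta>1 t0) (at t0)" "(\<zeta>2 \<longlongrightarrow> \<zeta>1 t0) (at t0)"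
    using DERIV_isCont[OF dW(1)[OF J(2)]] DERIV_isCont[OF dW(2)[OF J(2)]] DERIV_isCont[OF d\<zeta>(1)[OF J(2)]] DERIV_isCont[OF d\<zeta>(2)[OF J(2)]]
    by (simp_all add: isCont_def w0_def eq)
  have evW: "\<forall>\<^sub>F t in at t0. W1 t \<in> {w0/2..2*w0} \<and> W2 t \<in> {w0/2..2*w0}"
    using tendsto_eventually_comparable[OF cW(1) w0] tendsto_eventually_comparable[OF cW(2) w0]
    by eventually_elim auto
  obtain Lq where Lq: "Lq > 0" "\<And>x y. x \<in> {w0/2..2*w0} \<Longrightarrow> y \<in> {w0/2..2*w0} \<Longrightarrow> \<bar>x powr q - y powr q\<bar> \<le> Lq * \<bar>x - y\<bar>"
    using powr_lipschitz[of "w0/2" "2*w0" q] w0 by auto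
  (* c is the bound for the difference quotient of \<zeta>1 - \<zeta>2 at t0 *)
  have key: "\<exists>L>0. \<forall>\<^sub>F t in at t0. \<forall>c\<ge>0. \<bar>\<zeta>1 t - \<zeta>2 t\<bar> \<le> c * \<bar>t - t0\<bar> \<longrightarrow> \<bar>psi P (\<zeta>1 t) - psi P (\<zeta>2 t)\<bar> \<le> L * c"
  proof (cases "\<zeta>1 t0 = 0")
    case False
    define s where "s = sgn (\<zeta>1 t0)"
    define b where "b = \<bar>\<zeta>1 t0\<bar>"
    have s: "s = 1 \<or> s = - 1" "s * \<zeta>1 t0 = b" and b: "b > 0" using False by (auto simp: s_def b_def sgn_if)
    have l: "((\<lambda>t. s * \<zeta>1 t) \<longlongrightarrow> b) (at t0)" "((\<lambda>t. s * \<zeta>2 t) \<longlongrightarrow> b) (at t0)"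
      using tendsto_mult_left[OF c\<zeta>(1), of s] tendsto_mult_left[OF c\<zeta>(2), of s] s(2) by simp_all
    have "b / 2 > 0" using b by simp
    from psi_lipschitz[OF this, of "2*b" P]
    obtain L where L: "L > 0" "\<And>s x y. s = 1 \<or> s = - 1 \<Longrightarrow> s * x \<in> {b/2..2*b} \<Longrightarrow> s * y \<in> {b/2..2*b} \<Longrightarrow> \<bar>psi P x - psi P y\<bar> \<le> L * \<bar>x - y\<bar>"
      by blast
    note tendsto_eventually_comparable[OF l(1) b] tendsto_eventually_comparable[OF l(2) b]
    moreover have "\<forall>\<^sub>F t in at t0. dist t t0 < 1" by (simp add: eventually_at) (metis zero_less_one)
    ultimately have "\<forall>\<^sub>F t in at t0. \<forall>c\<ge>0. \<bar>\<zeta>1 t - \<zeta>2 t\<bar> \<le> c * \<bar>t - t0\<bar> \<longrightarrow> \<bar>psi P (\<zeta>1 t) - psi P (\<zeta>2 t)\<bar> \<le> L * c"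
    proof eventually_elim
      case (elim t)
      show ?case
      proof (intro allI impI)
        fix c :: real assume c: "c \<ge> 0" "\<bar>\<zeta>1 t - \<zeta>2 t\<bar> \<le> c * \<bar>t - t0\<bar>"
        have "c * \<bar>t - t0\<bar> \<le> c * 1" using c elim by (intro mult_left_mono) (auto simp: dist_real_def)
        then have "\<bar>\<zeta>1 t - \<zeta>2 t\<bar> \<le> c" using c by simp
        moreover have "\<bar>psi P (\<zeta>1 t) - psi P (\<zeta>2 t)\<bar> \<le> L * \<bar>\<zeta>1 t - \<zeta>2 t\<bar>" using elim by (intro L(2)[OF s(1)]) auto
        ultimately show "\<bar>psi P (\<zeta>1 t) - psi P (\<zeta>2 t)\<bar> \<le> L * c" using L(1) by (meson mult_left_mono less_imp_le order_trans)
      qed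
    qed
    then show ?thesis using L(1) by blast
  next
    case True
    define b where "b = exp (M * t0) * w0 powr q"
    have b: "b > 0" using w0 by (simp add: b_def)
    have e2: "\<epsilon> * (\<epsilon> * b) = b" using \<epsilon> by auto
    have "((\<lambda>t. (\<zeta>1 t - \<zeta>1 t0) / (t - t0)) \<longlongrightarrow> \<epsilon> * b) (at t0)" "((\<lambda>t. (\<zeta>2 t - \<zeta>2 t0) / (t - t0)) \<longlongrightarrow> \<epsilon> * b) (at t0)"
      using d\<zeta>[OF J(2)] by (simp_all add: has_field_derivative_iff b_def w0_def eq)
    from this[THEN tendsto_mult_left, of \<epsilon>]
    have l: "((\<lambda>t. \<epsilon> * (\<zeta>1 t / (t - t0))) \<longlongrightarrow> b) (at t0)" "((\<lambda>t. \<epsilon> * (\<zeta>2 t / (t - t0))) \<longlongrightarrow> b) (at t0)"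
      using True eq e2 by simp_all
    have "b / 2 > 0" using b by simp
    from psi_lipschitz[OF this, of "2*b" P]
    obtain L where L: "L > 0" "\<And>s x y. s = 1 \<or> s = - 1 \<Longrightarrow> s * x \<in> {b/2..2*b} \<Longrightarrow> s * y \<in> {b/2..2*b} \<Longrightarrow> \<bar>psi P x - psi P y\<bar> \<le> L * \<bar>x - y\<bar>"
      by blast
    note tendsto_eventually_comparable[OF l(1) b] tendsto_eventually_comparable[OF l(2) b]
    moreover have "\<forall>\<^sub>F t in at t0. dist t t0 < 1" by (simp add: eventually_at) (metis zero_less_one)
    moreover have "\<forall>\<^sub>F t in at t0. t \<noteq> t0" by (simp add: eventually_at) (metis zero_less_one)
    ultimately have "\<forall>\<^sub>F t in at t0. \<forall>c\<ge>0. \<bar>\<zeta>1 t - \<zeta>2 t\<bar> \<le> c * \<bar>t - t0\<bar> \<longrightarrow> \<bar>psi P (\<zeta>1 t) - psi P (\<zeta>2 t)\<bar> \<le> L * c"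
    proof eventually_elim
      case (elim t)
      show ?case
      proof (intro allI impI)
        fix c :: real assume c: "c \<ge> 0" "\<bar>\<zeta>1 t - \<zeta>2 t\<bar> \<le> c * \<bar>t - t0\<bar>"
        define r where "r = \<bar>t - t0\<bar>"
        have r: "0 < r" "r < 1" using elim by (auto simp: r_def dist_real_def)
        define g where "g = sgn (t - t0)"
        have g: "g = 1 \<or> g = - 1" "t - t0 = g * r" using elim by (auto simp: g_def r_def sgn_if)
        have p: "psi P x = r powr (1 / P) * psi P (x / r)" for x
          using psi_scale[OF r(1), of P "x / r"] r by simp
        have div: "g * \<epsilon> * (x / r) = \<epsilon> * (x / (t - t0))" for x using g r by auto
        have ge: "g * \<epsilon> = 1 \<or> g * \<epsilon> = - 1" using g(1) \<epsilon> by auto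
        have "\<bar>psi P (\<zeta>1 t / r) - psi P (\<zeta>2 t / r)\<bar> \<le> L * \<bar>\<zeta>1 t / r - \<zeta>2 t / r\<bar>"
          by (rule L(2)[OF ge]) (use elim in \<open>simp_all only: div\<close>)
        also have "\<bar>\<zeta>1 t / r - \<zeta>2 t / r\<bar> = \<bar>\<zeta>1 t - \<zeta>2 t\<bar> / r" using r by (simp flip: diff_divide_distrib)
        also have "\<dots> \<le> c" using c r by (simp add: r_def pos_divide_le_eq)
        finally have A: "\<bar>psi P (\<zeta>1 t / r) - psi P (\<zeta>2 t / r)\<bar> \<le> L * c" using L(1) by simp
        have "r powr (1 / P) \<le> 1" using r P_pos by (simp add: powr_le1)
        then have "r powr (1 / P) * \<bar>psi P (\<zeta>1 t / r) - psi P (\<zeta>2 t / r)\<bar> \<le> 1 * (L * c)" using A by (intro mult_mono) auto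
        moreover have "\<bar>psi P (\<zeta>1 t) - psi P (\<zeta>2 t)\<bar> = r powr (1 / P) * \<bar>psi P (\<zeta>1 t / r) - psi P (\<zeta>2 t / r)\<bar>"
          unfolding p[of "\<zeta>1 t"] p[of "\<zeta>2 t"] by (simp add: abs_mult flip: right_diff_distrib)
        ultimately show "\<bar>psi P (\<zeta>1 t) - psi P (\<zeta>2 t)\<bar> \<le> L * c" by simp
      qed
    qed
    then show ?thesis using L(1) by blast
  qed
  then obtain L where L: "L > 0" and evL: "\<forall>\<^sub>F t in at t0. \<forall>c\<ge>0. \<bar>\<zeta>1 t - \<zeta>2 t\<bar> \<le> c * \<bar>t - t0\<bar> \<longrightarrow> \<bar>psi P (\<zeta>1 t) - psi P (\<zeta>2 t)\<bar> \<le> L * c" by blast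
  from eventually_conj[OF evW evL] obtain d1 where d1: "d1 > 0"
    "\<And>t. t \<noteq> t0 \<Longrightarrow> dist t t0 < d1 \<Longrightarrow> (W1 t \<in> {w0/2..2*w0} \<and> W2 t \<in> {w0/2..2*w0}) \<and>
      (\<forall>c\<ge>0. \<bar>\<zeta>1 t - \<zeta>2 t\<bar> \<le> c * \<bar>t - t0\<bar> \<longrightarrow> \<bar>psi P (\<zeta>1 t) - psi P (\<zeta>2 t)\<bar> \<le> L * c)"
    unfolding eventually_at by blast
  define E where "E = exp (M * (t0 + 1))"
  define E' where "E' = exp (- \<kappa> * (t0 - 1))"
  define C where "C = E' * L * E * Lq"
  have EE: "E > 0" "E' > 0" and C: "C > 0" using L Lq by (auto simp: E_def E'_def C_def)
  define d where "d = Min {d0, d1, 1, 1 / (2 * C)}"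
  have d: "d > 0" "d \<le> d0" "d \<le> d1" "d \<le> 1" "d \<le> 1 / (2 * C)" using d0 d1 C by (auto simp: d_def)
  have inJ: "t \<in> J" if "t \<in> ball t0 d" for t using that d d0 by auto
  have Wb: "W1 t \<in> {w0/2..2*w0}" "W2 t \<in> {w0/2..2*w0}" if "t \<in> ball t0 d" for t
    using d1(2)[of t] that d w0 eq by (cases "t = t0"; auto simp: dist_commute w0_def)+
  have incr: "\<bar>f t\<bar> \<le> A * \<bar>t - t0\<bar>" if "\<And>s. s \<in> ball t0 d \<Longrightarrow> (f has_real_derivative f' s) (at s)"
     "\<And>s. s \<in> ball t0 d \<Longrightarrow> \<bar>f' s\<bar> \<le> A" "f t0 = 0" "t \<in> ball t0 d" for f f' A t
  proof -
    have "norm (f t - f t0) \<le> A * norm (t - t0)"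
      by (rule field_differentiable_bound[of "ball t0 d" f f'])
        (use that d in \<open>auto intro: has_field_derivative_at_within\<close>)
    then show ?thesis using that by simp
  qed
  have z: "\<bar>\<zeta>1 t - \<zeta>2 t\<bar> \<le> (E * Lq * B) * \<bar>t - t0\<bar>"
    if "B \<ge> 0" "\<And>s. s \<in> ball t0 d \<Longrightarrow> \<bar>W1 s - W2 s\<bar> \<le> B" "t \<in> ball t0 d" for B t
  proof (rule incr[where f = "\<lambda>t. \<zeta>1 t - \<zeta>2 t"])
    fix s assume s: "s \<in> ball t0 d"
    show "((\<lambda>t. \<zeta>1 t - \<zeta>2 t) has_real_derivative \<epsilon> * (exp (M * s) * W1 s powr q) - \<epsilon> * (exp (M * s) * W2 s powr q)) (at s)"
      using d\<zeta>[OF inJ[OF s]] by (intro DERIV_diff)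
    have "\<bar>W1 s powr q - W2 s powr q\<bar> \<le> Lq * \<bar>W1 s - W2 s\<bar>" using Wb[OF s] by (intro Lq(2))
    also have "\<dots> \<le> Lq * B" using that(2)[OF s] Lq(1) by simp
    finally have A: "\<bar>W1 s powr q - W2 s powr q\<bar> \<le> Lq * B" .
    have "M * s \<le> M * (t0 + 1)" using s d M_pos by (auto simp: dist_real_def)
    then have "exp (M * s) * \<bar>W1 s powr q - W2 s powr q\<bar> \<le> E * (Lq * B)" using A by (intro mult_mono) (auto simp: E_def)
    moreover have "\<bar>\<epsilon> * (exp (M * s) * W1 s powr q) - \<epsilon> * (exp (M * s) * W2 s powr q)\<bar> = exp (M * s) * \<bar>W1 s powr q - W2 s powr q\<bar>"
      using \<epsilon> by (auto simp: abs_mult abs_minus_commute simp flip: right_diff_distrib)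
    ultimately show "\<bar>\<epsilon> * (exp (M * s) * W1 s powr q) - \<epsilon> * (exp (M * s) * W2 s powr q)\<bar> \<le> E * Lq * B" by simp
  qed (use that eq in auto)
  have W0: "W1 t - W2 t = 0" if "t \<in> ball t0 d" for t
  proof (rule zero_by_halving[where S = "ball t0 d" and f = "\<lambda>t. W1 t - W2 t" and ?B0.0 = "2 * w0"])
    show "\<bar>W1 t - W2 t\<bar> \<le> 2 * w0" if "t \<in> ball t0 d" for t using Wb[OF that] w0 by auto
    fix B t assume B: "B \<ge> 0" and le: "\<And>t. t \<in> ball t0 d \<Longrightarrow> \<bar>W1 t - W2 t\<bar> \<le> B" and t: "t \<in> ball t0 d"
    have "\<bar>W1 t - W2 t\<bar> \<le> (C * B) * \<bar>t - t0\<bar>"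
    proof (rule incr[where f = "\<lambda>t. W1 t - W2 t", OF _ _ _ t])
      fix s assume s: "s \<in> ball t0 d"
      show "((\<lambda>t. W1 t - W2 t) has_real_derivative - (exp (- \<kappa> * s) * psi P (\<zeta>1 s)) - - (exp (- \<kappa> * s) * psi P (\<zeta>2 s))) (at s)"
        using dW[OF inJ[OF s]] by (intro DERIV_diff)
      have "\<bar>psi P (\<zeta>1 s) - psi P (\<zeta>2 s)\<bar> \<le> L * (E * Lq * B)"
      proof (cases "s = t0")
        case True then show ?thesis using eq L EE Lq B by simp
      next
        case False
        then show ?thesis using d1(2)[of s] s d z[OF B le s] EE Lq B by (auto simp: dist_commute)
      qed
      moreover have "- \<kappa> * s \<le> - \<kappa> * (t0 - 1)" using s d \<kappa>_pos by (auto simp: dist_real_def)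
      ultimately have "exp (- \<kappa> * s) * \<bar>psi P (\<zeta>1 s) - psi P (\<zeta>2 s)\<bar> \<le> E' * (L * (E * Lq * B))"
        by (intro mult_mono) (auto simp: E'_def)
      moreover have "\<bar>- (exp (- \<kappa> * s) * psi P (\<zeta>1 s)) - - (exp (- \<kappa> * s) * psi P (\<zeta>2 s))\<bar> = exp (- \<kappa> * s) * \<bar>psi P (\<zeta>1 s) - psi P (\<zeta>2 s)\<bar>"
        by (simp add: abs_mult abs_minus_commute flip: right_diff_distrib)
      ultimately show "\<bar>- (exp (- \<kappa> * s) * psi P (\<zeta>1 s)) - - (exp (- \<kappa> * s) * psi P (\<zeta>2 s))\<bar> \<le> C * B" by (simp add: C_def mult_ac)
    qed (use eq in auto)
    also have "\<dots> \<le> (C * B) * (1 / (2 * C))" using t d C B by (intro mult_left_mono) (auto simp: dist_real_def)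
    finally show "\<bar>W1 t - W2 t\<bar> \<le> B / 2" using C by simp
  qed (rule that)
  have "\<zeta>1 t = \<zeta>2 t" if "t \<in> ball t0 d" for t
    using z[of 0 t] W0 that by simp
  then show ?thesis using W0 d(1) by (intro exI[of _ d]) auto
qed

text \<open>The set where both components agree is open by local uniqueness and closed by continuity.\<close>

lemma sol_unique_connected:
  assumes \<epsilon>: "\<epsilon> = 1 \<or> \<epsilon> = - 1" and J: "open J" "connected J"
    and 1: "\<And>t. t \<in> J \<Longrightarrow> sol \<epsilon> W1 \<zeta>1 t" and 2: "\<And>t. t \<in> J \<Longrightarrow> sol \<epsilon> W2 \<zeta>2 t"
    and U: "open U" "U \<subseteq> J" "U \<noteq> {}" and eq: "\<And>t. t \<in> U \<Longrightarrow> W1 t = W2 t" and t: "t \<in> J"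
  shows "W1 t = W2 t"
proof -
  obtain a where a: "a \<in> U" using U by blast
  have aJ: "a \<in> J" using a U by blast
  have dW: "(W1 has_real_derivative - (exp (- \<kappa> * a) * psi P (\<zeta>1 a))) (at a)" "(W2 has_real_derivative - (exp (- \<kappa> * a) * psi P (\<zeta>2 a))) (at a)"
    using 1[OF aJ] 2[OF aJ] by (auto simp: log_at_def)
  have "(W2 has_real_derivative - (exp (- \<kappa> * a) * psi P (\<zeta>1 a))) (at a)"
    by (rule has_field_derivative_transform_within_open[OF dW(1) U(1) a]) (rule eq)
  from DERIV_unique[OF this dW(2)] have "psi P (\<zeta>1 a) = psi P (\<zeta>2 a)" by simp
  then have \<zeta>a: "\<zeta>1 a = \<zeta>2 a" using psi_inverse'[OF P_pos] by metis
  define Q where "Q t \<longleftrightarrow> W1 t = W2 t \<and> \<zeta>1 t = \<zeta>2 t" for t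
  have "Q t"
  proof (rule connected_induction_simple[where S = J and a = a and b = t and P = Q])
    show "connected J" "a \<in> J" "t \<in> J" by (fact J aJ t)+
    show "Q a" using \<zeta>a eq[OF a] by (simp add: Q_def)
    fix b assume b: "b \<in> J"
    show "\<exists>T. openin (top_of_set J) T \<and> b \<in> T \<and> (\<forall>x\<in>T. \<forall>y\<in>T. Q x \<longrightarrow> Q y)"
    proof (cases "Q b")
      case True
      then obtain d where d: "d > 0" "\<forall>t\<in>ball b d. W1 t = W2 t \<and> \<zeta>1 t = \<zeta>2 t"
        using sol_unique_local[OF \<epsilon> J(1) b 1 2] by (auto simp: Q_def)
      then show ?thesis using b
        by (intro exI[of _ "J \<inter> ball b d"]) (auto simp: Q_def intro: openin_open_Int)
    next
      case False
      have c: "continuous_on J (\<lambda>t. \<bar>W1 t - W2 t\<bar> + \<bar>\<zeta>1 t - \<zeta>2 t\<bar>)"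
        using 1 2 by (intro continuous_intros DERIV_continuous_on)
          (auto simp: log_at_def intro: has_field_derivative_at_within)
      have "open (J \<inter> (\<lambda>t. \<bar>W1 t - W2 t\<bar> + \<bar>\<zeta>1 t - \<zeta>2 t\<bar>) -` {0<..})"
        by (rule continuous_open_preimage[OF c J(1)]) auto
      moreover have "J \<inter> (\<lambda>t. \<bar>W1 t - W2 t\<bar> + \<bar>\<zeta>1 t - \<zeta>2 t\<bar>) -` {0<..} = {t \<in> J. \<not> Q t}" by (auto simp: Q_def)
      ultimately have "open {t \<in> J. \<not> Q t}" by simp
      then show ?thesis using b False
        by (intro exI[of _ "{t \<in> J. \<not> Q t}"]) (auto intro: open_subset)
    qed
  qed
  then show ?thesis by (simp add: Q_def)
qed

end

section \<open>Blow-up and nonexistence\<close>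

text \<open>First x \<ge> 1 eventually, since the last term of its growth rate becomes large with U. Then R = x^(P+1)/U is
bounded below, for it has a positive slope whenever it is small. So x \<ge> const U^(1/(P+1)), and U' grows faster
than linearly in U: a negative power of U
would vanish in finite time.\<close>

lemma lv_blowup:
  fixes x U :: "real \<Rightarrow> real"
  assumes P: "P > 0" and b: "b > 0" and d: "d > 0"
    and pos: "\<And>t. t \<ge> T \<Longrightarrow> x t > 0 \<and> U t > 0"
    and dx: "\<And>t. t \<ge> T \<Longrightarrow> (x has_real_derivative x t * (a - x t + b * (x t powr (- P) * U t))) (at t)"
    and dU: "\<And>t. t \<ge> T \<Longrightarrow> (U has_real_derivative U t * (d * x t + e)) (at t)"
    and inf: "filterlim U at_top at_top"
  shows False
proof -
  have evU: "\<exists>T'\<ge>T0. \<forall>t\<ge>T'. U t \<ge> K" for K T0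
  proof -
    have "\<forall>\<^sub>F t in at_top. K \<le> U t" using inf by (simp add: filterlim_at_top)
    then obtain T1 where "\<And>t. t \<ge> T1 \<Longrightarrow> K \<le> U t" by (auto simp: eventually_at_top_linorder)
    then show ?thesis by (intro exI[of _ "max T0 T1"]) auto
  qed
  obtain T1 where T1: "T1 \<ge> T" "\<And>t. t \<ge> T1 \<Longrightarrow> U t \<ge> (\<bar>a\<bar> + 2) / b" using evU by blast
  have "\<exists>T'\<ge>T1. \<forall>t\<ge>T'. ln (x t) \<ge> 0"
  proof (rule eventually_above_barrier[where f' = "\<lambda>t. a - x t + b * (x t powr (- P) * U t)" and c = 1])
    fix t assume t: "T1 \<le> t"
    then have x: "x t > 0" "U t > 0" using pos[of t] T1(1) by auto
    show "((\<lambda>t. ln (x t)) has_real_derivative a - x t + b * (x t powr (- P) * U t)) (at t)"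
      using dx[of t] t T1(1) x by (auto intro!: derivative_eq_intros)
    assume "ln (x t) \<le> 0"
    then have x1: "x t \<le> 1" using x by simp
    have "1 powr (- P) \<le> x t powr (- P)" using x x1 P by (intro powr_mono2') auto
    then have "1 * ((\<bar>a\<bar> + 2) / b) \<le> x t powr (- P) * U t" using T1(2)[OF t] b by (intro mult_mono) auto
    then have "b * ((\<bar>a\<bar> + 2) / b) \<le> b * (x t powr (- P) * U t)" using b by (intro mult_left_mono) auto
    then show "1 \<le> a - x t + b * (x t powr (- P) * U t)" using x1 b by simp
  qed auto
  then obtain T2 where T2: "T2 \<ge> T1" "\<And>t. t \<ge> T2 \<Longrightarrow> ln (x t) \<ge> 0" by blast
  have tT: "t \<ge> T" if "t \<ge> T2" for t using that T2(1) T1(1) by simp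
  have x1: "x t \<ge> 1" if "t \<ge> T2" for t using T2(2)[OF that] pos[OF tT[OF that]] by simp
  define A where "A = \<bar>(P + 1) * a - e\<bar>"
  define R1 where "R1 = (P + 1) * b / (2 * (A + (P + 1 + d)))"
  have den: "A + (P + 1 + d) > 0" using P d by (simp add: A_def)
  have R1: "R1 > 0" "R1 * (A + (P + 1 + d)) = (P + 1) * b / 2"
  proof -
    have "c / (2 * D) * D = c / 2" if "D > 0" for c D :: real using that by simp
    from this[OF den] show "R1 * (A + (P + 1 + d)) = (P + 1) * b / 2" unfolding R1_def .
    show "R1 > 0" unfolding R1_def using den P b by (intro divide_pos_pos mult_pos_pos) auto
  qed
  (* R1 is half of a level below which R increases, whatever the value of x \<ge> 1 *)
  define R where "R t = x t powr (P + 1) / U t" for t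
  define R' where "R' t = R t * ((P + 1) * a - e - (P + 1 + d) * x t) + (P + 1) * b * x t" for t
  have Rpos: "R t > 0" if "t \<ge> T2" for t using pos[OF tT[OF that]] by (simp add: R_def)
  have dR: "(R has_real_derivative R' t) (at t)" if t: "t \<ge> T2" for t
  proof -
    note p = pos[OF tT[OF t]]
    have "(R has_real_derivative ((P + 1) * x t powr (P + 1) * (x t * (a - x t + b * (x t powr (- P) * U t)) / x t) * U t
        - x t powr (P + 1) * (U t * (d * x t + e))) / (U t * U t)) (at t)"
      unfolding R_def[abs_def] using p DERIV_powr_const[OF dx[OF tT[OF t]], of "P + 1"]
      by (auto intro!: DERIV_quotient DERIV_divide dU tT t)
    moreover have "((P + 1) * x t powr (P + 1) * (x t * (a - x t + b * (x t powr (- P) * U t)) / x t) * U t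
        - x t powr (P + 1) * (U t * (d * x t + e))) / (U t * U t) = R' t"
    proof -
      have "x t powr (P + 1) * x t powr (- P) = x t" using p by (simp flip: powr_add)
      moreover have "((P + 1) * x t powr (P + 1) * (x t * (a - x t + b * (x t powr (- P) * U t)) / x t) * U t
        - x t powr (P + 1) * (U t * (d * x t + e))) / (U t * U t)
        = R t * ((P + 1) * (a - x t) - (d * x t + e)) + (P + 1) * b * (x t powr (P + 1) * x t powr (- P))"
        using p by (simp add: R_def field_simps)
      ultimately show ?thesis by (simp add: R'_def algebra_simps)
    qed
    ultimately show ?thesis by (simp only:)
  qed
  have "\<exists>T'\<ge>T2. \<forall>t\<ge>T'. R t \<ge> R1"
  proof (rule eventually_above_barrier[OF dR])
    fix t assume t: "T2 \<le> t" and le: "R t \<le> R1"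
    have "(P + 1) * a - e \<ge> - A * x t"
    proof -
      have "A * 1 \<le> A * x t" using x1[OF t] by (intro mult_left_mono) (auto simp: A_def)
      then show ?thesis by (simp add: A_def)
    qed
    then have "R t * ((P + 1) * a - e - (P + 1 + d) * x t) \<ge> R t * (- A * x t - (P + 1 + d) * x t)"
      using Rpos[OF t] by (intro mult_left_mono) auto
    moreover have "R t * (- A * x t - (P + 1 + d) * x t) = - (R t * (A + (P + 1 + d)) * x t)" by (simp add: algebra_simps)
    moreover have "R t * (A + (P + 1 + d)) * x t \<le> R1 * (A + (P + 1 + d)) * x t"
      using le den x1[OF t] by (intro mult_right_mono) auto
    moreover have "(P + 1) * b / 2 * x t + (P + 1) * b / 2 * x t = (P + 1) * b * x t" by simp
    ultimately have "R' t \<ge> (P + 1) * b / 2 * x t" unfolding R'_def R1(2) by linarith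
    moreover have "(P + 1) * b / 2 * x t \<ge> (P + 1) * b / 2 * 1" using x1[OF t] P b by (intro mult_left_mono) auto
    ultimately show "R' t \<ge> (P + 1) * b / 2" by simp
  qed (use P b in auto)
  then obtain T3 where T3: "T3 \<ge> T2" "\<And>t. t \<ge> T3 \<Longrightarrow> R t \<ge> R1" by blast
  define m where "m = 1 / (P + 1)"
  have m: "m > 0" using P by (simp add: m_def)
  define c where "c = d * R1 powr m"
  have c: "c > 0" using d R1 by (simp add: c_def)
  define V where "V t = U t powr (- m)" for t
  have xV: "V t * x t \<ge> R1 powr m" if t: "t \<ge> T3" for t
  proof -
    note p = pos[OF tT[OF order_trans[OF T3(1) t]]]
    have "R1 powr m \<le> (x t powr (P + 1) / U t) powr m" using T3(2)[OF t] R1 m unfolding R_def by (intro powr_mono2) auto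
    also have "\<dots> = x t * V t" using p P by (simp add: powr_divide powr_powr m_def V_def powr_minus_divide)
    finally show ?thesis by (simp add: mult.commute)
  qed
  define K where "K = (2 * \<bar>e\<bar> / c + 1) powr (P + 1)"
  obtain T4 where T4: "T4 \<ge> T3" "\<And>t. t \<ge> T4 \<Longrightarrow> U t \<ge> K" using evU by blast
  have eV: "\<bar>e\<bar> * V t \<le> c / 2" if t: "t \<ge> T4" for t
  proof -
    have base: "2 * \<bar>e\<bar> / c + 1 > 0" using c by (intro add_nonneg_pos divide_nonneg_pos) auto
    have "V t \<le> K powr (- m)" unfolding V_def using T4(2)[OF t] m base by (intro powr_mono2') (auto simp: K_def)
    also have "K powr (- m) = 1 / (2 * \<bar>e\<bar> / c + 1)"
      using base P by (simp add: K_def powr_powr m_def powr_minus_divide)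
    finally have "\<bar>e\<bar> * V t \<le> \<bar>e\<bar> * (1 / (2 * \<bar>e\<bar> / c + 1))" by (intro mult_left_mono) auto
    also have "\<dots> \<le> c / 2" using c base by (simp add: field_simps)
    finally show ?thesis .
  qed
  have "\<exists>T'\<ge>T4. \<forall>t\<ge>T'. - V t \<ge> 0"
  proof (rule eventually_above_barrier[where f' = "\<lambda>t. m * (d * (V t * x t) + e * V t)" and c = "m * (c / 2)"])
    fix t assume t: "T4 \<le> t"
    have t3: "T3 \<le> t" using t T4(1) by simp
    have tt: "T \<le> t" using tT T3(1) t3 by simp
    note p = pos[OF tt]
    show "((\<lambda>t. - V t) has_real_derivative m * (d * (V t * x t) + e * V t)) (at t)"
    proof -
      have "U t * (d * x t + e) / U t = d * x t + e" using p by simp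
      from DERIV_minus[OF DERIV_powr_const[OF dU[OF tt], of "- m"], unfolded this] p show ?thesis
        unfolding V_def[abs_def] by (simp add: algebra_simps)
    qed
    have "d * (V t * x t) \<ge> c" using xV[OF t3] d by (simp add: c_def)
    moreover have "V t \<ge> 0" by (simp add: V_def)
    then have "e * V t \<ge> - (\<bar>e\<bar> * V t)" by (simp add: abs_if mult_nonneg_nonneg mult_nonpos_nonneg)
    ultimately have "d * (V t * x t) + e * V t \<ge> c / 2" using eV[OF t] by linarith
    then show "m * (c / 2) \<le> m * (d * (V t * x t) + e * V t)" using m by (intro mult_left_mono) auto
  qed (use m c in auto)
  then obtain T5 where T5: "T5 \<ge> T4" "- V T5 \<ge> 0" by auto
  have "U T5 > 0" using pos[of T5] tT T5(1) T4(1) T3(1) by auto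
  then show False using T5(2) by (simp add: V_def)
qed

context emden_fowler
begin

text \<open>Here x = |W'|/W and U = r^(p+\<sigma>) w^(q-P), in the direction s of time in which W increases. In the absorption case z and x have
opposite signs, and |z| = x^(-P) U pushes x up in that direction.\<close>

lemma blowup_log:
  assumes s: "s = 1 \<or> s = - 1" and sol: "\<And>t. t \<ge> T \<Longrightarrow> sol (- 1) W \<zeta> (s * t) \<and> - s * \<zeta> (s * t) > 0"
    and inf: "filterlim (\<lambda>t. exp ((M - \<kappa> * P) * (s * t)) * W (s * t) powr (q - P)) at_top at_top"
  shows False
proof -
  define w where "w t = W (s * t)" for t
  define Y where "Y t = - s * \<zeta> (s * t)" for t
  define x where "x t = exp (- \<kappa> * (s * t)) * Y t powr (1 / P) / w t" for t
  define U where "U t = exp ((M - \<kappa> * P) * (s * t)) * w t powr (q - P)" for t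
  have ss: "s * s = 1" using s by auto
  have wp: "w t > 0" and Yp: "Y t > 0" if "t \<ge> T" for t using sol[OF that] by (auto simp: w_def Y_def log_at_def)
  have xp: "x t > 0" and Up: "U t > 0" if "t \<ge> T" for t using wp[OF that] Yp[OF that] by (auto simp: x_def U_def)
  have dst: "((\<lambda>t. s * t) has_real_derivative s) (at t)" for t by (auto intro!: derivative_eq_intros)
  have psiY: "psi P (\<zeta> (s * t)) = - s * Y t powr (1 / P)" if "t \<ge> T" for t
  proof -
    have "\<zeta> (s * t) = - s * Y t" using ss by (simp add: Y_def flip: mult.assoc)
    then show ?thesis using s Yp[OF that] by (auto simp: psi_pos psi_minus)
  qed
  have dw: "(w has_real_derivative x t * w t) (at t)" if t: "t \<ge> T" for t
  proof -
    have "(W has_real_derivative - (exp (- \<kappa> * (s * t)) * psi P (\<zeta> (s * t)))) (at (s * t))" using sol[OF t] by (auto simp: log_at_def)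
    from DERIV_chain2[where f = W and g = "\<lambda>t. s * t", OF this dst]
    have "(w has_real_derivative - (exp (- \<kappa> * (s * t)) * psi P (\<zeta> (s * t))) * s) (at t)" by (simp add: w_def[abs_def])
    moreover have "- (exp (- \<kappa> * (s * t)) * psi P (\<zeta> (s * t))) * s = x t * w t"
      unfolding psiY[OF t] using ss wp[OF t] by (simp add: x_def)
    ultimately show ?thesis by simp
  qed
  have dY: "(Y has_real_derivative exp (M * (s * t)) * w t powr q) (at t)" if t: "t \<ge> T" for t
  proof -
    have "(\<zeta> has_real_derivative - 1 * (exp (M * (s * t)) * W (s * t) powr q)) (at (s * t))" using sol[OF t] by (auto simp: log_at_def)
    note DERIV_cmult[OF DERIV_chain2[where f = \<zeta> and g = "\<lambda>t. s * t", OF this dst], of "- s"]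
    then have "((\<lambda>t. - s * \<zeta> (s * t)) has_real_derivative - s * (- 1 * (exp (M * (s * t)) * W (s * t) powr q) * s)) (at t)" .
    moreover have "- s * (- 1 * c * s) = c" for c using ss by algebra
    ultimately show ?thesis by (simp only: Y_def[abs_def] w_def)
  qed
  have Yx: "exp (M * (s * t)) * w t powr q / Y t = x t powr (- P) * U t" if t: "t \<ge> T" for t
  proof -
    have "x t powr P = exp (- \<kappa> * P * (s * t)) * Y t / w t powr P"
      using wp[OF t] Yp[OF t] P_pos by (simp add: x_def powr_divide powr_mult powr_powr powr_exp_arg mult_ac)
    then have "x t powr P * (exp (M * (s * t)) * w t powr q) = Y t * (exp (- \<kappa> * P * (s * t)) * exp (M * (s * t))) * (w t powr q / w t powr P)"
      by simp
    also have "exp (- \<kappa> * P * (s * t)) * exp (M * (s * t)) = exp ((M - \<kappa> * P) * (s * t))" by (simp add: algebra_simps flip: exp_add)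
    also have "w t powr q / w t powr P = w t powr (q - P)" by (simp add: powr_diff)
    finally have "x t powr P * (exp (M * (s * t)) * w t powr q) = Y t * U t" by (simp add: U_def mult_ac)
    then show ?thesis using xp[OF t] Yp[OF t] by (simp add: powr_minus field_simps)
  qed
  have lx: "ln (x u) = - \<kappa> * (s * u) + 1 / P * ln (Y u) - ln (w u)" if "u \<ge> T" for u
  proof -
    have "w u > 0" "Y u powr (1 / P) > 0" using wp[OF that] Yp[OF that] by simp_all
    then show ?thesis using Yp[OF that] by (simp add: x_def ln_mult ln_div)
  qed
  have lnx: "((\<lambda>t. ln (x t)) has_real_derivative (- \<kappa> * s) - x t + 1 / P * (x t powr (- P) * U t)) (at t)" if t: "t > T" for t
  proof -
    have tt: "t \<ge> T" using t by simp
    have "((\<lambda>t. - \<kappa> * (s * t) + 1 / P * ln (Y t) - ln (w t)) has_real_derivative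
        - \<kappa> * s + 1 / P * (exp (M * (s * t)) * w t powr q / Y t) - x t * w t / w t) (at t)"
      using wp[OF tt] Yp[OF tt] P_pos by (auto intro!: derivative_eq_intros dw[OF tt] dY[OF tt])
    then have d: "((\<lambda>t. - \<kappa> * (s * t) + 1 / P * ln (Y t) - ln (w t)) has_real_derivative (- \<kappa> * s) - x t + 1 / P * (x t powr (- P) * U t)) (at t)"
      unfolding Yx[OF tt] using wp[OF tt] by (simp add: algebra_simps)
    show ?thesis
      by (rule has_field_derivative_transform_within_open[OF d, of "{T<..}"])
        (use t lx in \<open>simp_all\<close>)
  qed
  have dx: "(x has_real_derivative x t * ((- \<kappa> * s) - x t + 1 / P * (x t powr (- P) * U t))) (at t)" if t: "t > T" for t
  proof -
    have "((\<lambda>t. exp (ln (x t))) has_real_derivative exp (ln (x t)) * ((- \<kappa> * s) - x t + 1 / P * (x t powr (- P) * U t))) (at t)"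
      by (rule DERIV_fun_exp[OF lnx[OF t]])
    then have d: "((\<lambda>t. exp (ln (x t))) has_real_derivative x t * ((- \<kappa> * s) - x t + 1 / P * (x t powr (- P) * U t))) (at t)"
      using xp[of t] t by simp
    show ?thesis
      by (rule has_field_derivative_transform_within_open[OF d, of "{T<..}"]) (use t xp in auto)
  qed
  have dU: "(U has_real_derivative U t * ((q - P) * x t + (M - \<kappa> * P) * s)) (at t)" if t: "t > T" for t
  proof -
    have tt: "t \<ge> T" using t by simp
    have e: "((\<lambda>t. exp ((M - \<kappa> * P) * (s * t))) has_real_derivative exp ((M - \<kappa> * P) * (s * t)) * ((M - \<kappa> * P) * s)) (at t)"
      by (auto intro!: derivative_eq_intros)
    from DERIV_mult[OF e DERIV_powr_const[OF dw[OF tt] wp[OF tt], of "q - P"]] show ?thesis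
      unfolding U_def[abs_def] using wp[OF tt] by (simp add: algebra_simps)
  qed
  show False
  proof (rule lv_blowup[where x = x and U = U and T = "T + 1" and P = P and b = "1 / P" and d = "q - P"
        and a = "- \<kappa> * s" and e = "(M - \<kappa> * P) * s"])
    show "filterlim U at_top at_top" using inf by (simp add: U_def[abs_def] w_def)
  qed (use P_pos qP xp Up dx dU in auto)
qed

text \<open>If \<zeta> were positive somewhere, it would be bounded below by a positive constant to the left, as \<zeta> decreases. Then W is at least a
multiple of e^(-\<kappa>t), and q > q_c makes r^(p+\<sigma>) w^(q-P) tend to infinity as r \<longrightarrow> 0, against blowup_log in reversed time.\<close>

lemma absorption_flux_nonpos:
  assumes crit: "M < q * \<kappa>" and sol: "\<And>t. t < T \<Longrightarrow> sol (- 1) W \<zeta> t" and t1: "t1 < T"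
  shows "\<zeta> t1 \<le> 0"
proof (rule ccontr)
  assume "\<not> \<zeta> t1 \<le> 0"
  then have z1: "\<zeta> t1 > 0" by simp
  have \<zeta>dec: "\<zeta> t \<ge> \<zeta> t1" if "t \<le> t1" for t
    using that
  proof (rule DERIV_nonpos_imp_nonincreasing)
    fix x assume "t \<le> x" "x \<le> t1"
    then have "sol (- 1) W \<zeta> x" using sol t1 by simp
    then show "\<exists>y. (\<zeta> has_real_derivative y) (at x) \<and> y \<le> 0"
      by (auto simp: log_at_def intro!: exI[of _ "- 1 * (exp (M * x) * W x powr q)"])
  qed
  define c where "c = \<zeta> t1 powr (1 / P)"
  have c: "c > 0" using z1 by (simp add: c_def)
  have Wlow: "W t \<ge> c / \<kappa> * (exp (- \<kappa> * t) - exp (- \<kappa> * t1))" if t: "t \<le> t1" for t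
  proof -
    have "W t1 - c / \<kappa> * exp (- \<kappa> * t1) \<le> W t - c / \<kappa> * exp (- \<kappa> * t)"
      using t
    proof (rule DERIV_nonpos_imp_nonincreasing)
      fix x assume x: "t \<le> x" "x \<le> t1"
      then have "sol (- 1) W \<zeta> x" using sol t1 by simp
      then have d: "((\<lambda>t. W t - c / \<kappa> * exp (- \<kappa> * t)) has_real_derivative
          - (exp (- \<kappa> * x) * psi P (\<zeta> x)) - c / \<kappa> * (exp (- \<kappa> * x) * (- \<kappa>))) (at x)"
        by (auto intro!: derivative_eq_intros simp: log_at_def)
      have "c \<le> \<zeta> x powr (1 / P)" unfolding c_def using \<zeta>dec[OF x(2)] z1 P_pos by (intro powr_mono2) auto
      also have "\<dots> = psi P (\<zeta> x)" using \<zeta>dec[OF x(2)] z1 by (simp add: psi_pos)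
      finally have "exp (- \<kappa> * x) * c \<le> exp (- \<kappa> * x) * psi P (\<zeta> x)" by simp
      then have "- (exp (- \<kappa> * x) * psi P (\<zeta> x)) - c / \<kappa> * (exp (- \<kappa> * x) * (- \<kappa>)) \<le> 0"
        using \<kappa>_pos by (simp add: mult_ac)
      then show "\<exists>y. ((\<lambda>t. W t - c / \<kappa> * exp (- \<kappa> * t)) has_real_derivative y) (at x) \<and> y \<le> 0" using d by blast
    qed
    moreover have "W t1 > 0" using sol[OF t1] by (simp add: log_at_def)
    ultimately show ?thesis by (simp add: algebra_simps)
  qed
  define \<nu> where "\<nu> = q * \<kappa> - M"
  have \<nu>: "\<nu> > 0" using crit by (simp add: \<nu>_def)
  (* to the left of t2 the constant e^(-\<kappa>t1) is at most half of e^(-\<kappa>t) *)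
  define t2 where "t2 = t1 - ln 2 / \<kappa>"
  have t21: "t2 \<le> t1" using \<kappa>_pos by (simp add: t2_def)
  have Ulow: "exp ((M - \<kappa> * P) * t) * W t powr (q - P) \<ge> (c / (2 * \<kappa>)) powr (q - P) * exp (- \<nu> * t)" if t: "t \<le> t2" for t
  proof -
    have "\<kappa> * (t - t1) \<le> \<kappa> * (- (ln 2 / \<kappa>))" using t \<kappa>_pos by (intro mult_left_mono) (auto simp: t2_def)
    then have "\<kappa> * (t - t1) \<le> - ln 2" using \<kappa>_pos by simp
    then have "exp (\<kappa> * (t - t1)) \<le> exp (- ln 2)" by (simp only: exp_le_cancel_iff)
    then have h: "exp (\<kappa> * (t - t1)) \<le> 1 / 2" by (simp add: exp_minus)
    have "exp (- \<kappa> * t) - exp (- \<kappa> * t1) = exp (- \<kappa> * t) * (1 - exp (\<kappa> * (t - t1)))" by (simp add: algebra_simps flip: exp_add)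
    also have "\<dots> \<ge> exp (- \<kappa> * t) * (1 / 2)" using h by (intro mult_left_mono) auto
    finally have "c / \<kappa> * (exp (- \<kappa> * t) - exp (- \<kappa> * t1)) \<ge> c / \<kappa> * (exp (- \<kappa> * t) * (1 / 2))"
      using c \<kappa>_pos by (intro mult_left_mono) auto
    then have "W t \<ge> c / (2 * \<kappa>) * exp (- \<kappa> * t)" using Wlow[of t] t t21 by simp
    then have "W t powr (q - P) \<ge> (c / (2 * \<kappa>) * exp (- \<kappa> * t)) powr (q - P)"
      using c \<kappa>_pos qP by (intro powr_mono2) auto
    also have "(c / (2 * \<kappa>) * exp (- \<kappa> * t)) powr (q - P) = (c / (2 * \<kappa>)) powr (q - P) * exp ((q - P) * (- \<kappa> * t))"
      using powr_mult[of "c / (2 * \<kappa>)" "exp (- \<kappa> * t)" "q - P"] c \<kappa>_pos unfolding powr_exp_arg by simp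
    finally have "exp ((M - \<kappa> * P) * t) * W t powr (q - P) \<ge> exp ((M - \<kappa> * P) * t) * ((c / (2 * \<kappa>)) powr (q - P) * exp ((q - P) * (- \<kappa> * t)))"
      by (intro mult_left_mono) auto
    moreover have "exp ((M - \<kappa> * P) * t) * exp ((q - P) * (- \<kappa> * t)) = exp (- \<nu> * t)"
      by (simp add: \<nu>_def algebra_simps flip: exp_add)
    ultimately show ?thesis by (metis mult.left_commute)
  qed
  have "filterlim (\<lambda>t. exp (\<nu> * t)) at_top at_top"
    by (rule filterlim_compose[OF exp_at_top filterlim_tendsto_pos_mult_at_top[OF tendsto_const \<nu> filterlim_ident]])
  from filterlim_tendsto_pos_mult_at_top[OF tendsto_const _ this, of "(c / (2 * \<kappa>)) powr (q - P)"]
  have inf: "filterlim (\<lambda>t. (c / (2 * \<kappa>)) powr (q - P) * exp (\<nu> * t)) at_top at_top" using c \<kappa>_pos by simp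
  show False
  proof (rule blowup_log[where s = "- 1" and T = "- t1"])
    fix t assume "- t1 \<le> t"
    then have "- t \<le> t1" by simp
    then show "sol (- 1) W \<zeta> (- 1 * t) \<and> - (- 1) * \<zeta> (- 1 * t) > 0"
      using sol[of "- t"] \<zeta>dec[of "- t"] z1 t1 by simp
  next
    show "filterlim (\<lambda>t. exp ((M - \<kappa> * P) * (- 1 * t)) * W (- 1 * t) powr (q - P)) at_top at_top"
    proof (rule filterlim_at_top_mono[OF inf])
      show "\<forall>\<^sub>F t in at_top. (c / (2 * \<kappa>)) powr (q - P) * exp (\<nu> * t) \<le> exp ((M - \<kappa> * P) * (- 1 * t)) * W (- 1 * t) powr (q - P)"
        using eventually_ge_at_top[of "- t2"] by eventually_elim (use Ulow[of "- _"] in simp)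
    qed
  qed auto
qed

text \<open>By absorption_flux_nonpos w is increasing, so r^(p+\<sigma>) w^(q-P) tends to infinity with r.\<close>

lemma absorption_not_global:
  assumes crit: "M < q * \<kappa>" and sol: "\<And>t. sol (- 1) W \<zeta> t"
  shows False
proof -
  have npos: "\<zeta> t \<le> 0" for t by (rule absorption_flux_nonpos[OF crit, of "t + 1" W \<zeta>]) (use sol in auto)
  have Wp: "W t > 0" for t using sol[of t] by (simp add: log_at_def)
  have d\<zeta>: "(\<zeta> has_real_derivative - 1 * (exp (M * t) * W t powr q)) (at t)"
    and dW: "(W has_real_derivative - (exp (- \<kappa> * t) * psi P (\<zeta> t))) (at t)" for t
    using sol[of t] by (auto simp: log_at_def)
  have neg: "\<zeta> t < 0" for t
  proof -
    have "\<zeta> t < \<zeta> (t - 1)"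
    proof (rule DERIV_neg_imp_decreasing[of "t - 1" t \<zeta>])
      fix x show "\<exists>y. (\<zeta> has_real_derivative y) (at x) \<and> y < 0" using d\<zeta>[of x] Wp[of x] by (auto intro!: exI[of _ "- 1 * (exp (M * x) * W x powr q)"])
    qed simp
    then show ?thesis using npos[of "t - 1"] by simp
  qed
  have mono: "W 0 \<le> W t" if "t \<ge> 0" for t
    using that
  proof (rule DERIV_nonneg_imp_nondecreasing)
    fix x
    have "- (exp (- \<kappa> * x) * psi P (\<zeta> x)) \<ge> 0" using neg[of x] by (simp add: psi_neg mult_nonneg_nonpos)
    then show "\<exists>y. (W has_real_derivative y) (at x) \<and> 0 \<le> y" using dW[of x] by blast
  qed
  have th: "M - \<kappa> * P > 0" using M_gt by simp
  have "filterlim (\<lambda>t. exp ((M - \<kappa> * P) * t)) at_top at_top"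
    by (rule filterlim_compose[OF exp_at_top filterlim_tendsto_pos_mult_at_top[OF tendsto_const th filterlim_ident]])
  from filterlim_tendsto_pos_mult_at_top[OF tendsto_const _ this, of "W 0 powr (q - P)"]
  have inf: "filterlim (\<lambda>t. W 0 powr (q - P) * exp ((M - \<kappa> * P) * t)) at_top at_top" using Wp[of 0] by simp
  show False
  proof (rule blowup_log[where s = 1 and T = 0])
    show "filterlim (\<lambda>t. exp ((M - \<kappa> * P) * (1 * t)) * W (1 * t) powr (q - P)) at_top at_top"
    proof (rule filterlim_at_top_mono[OF inf])
      show "\<forall>\<^sub>F t in at_top. W 0 powr (q - P) * exp ((M - \<kappa> * P) * t) \<le> exp ((M - \<kappa> * P) * (1 * t)) * W (1 * t) powr (q - P)"
        using eventually_ge_at_top[of "0::real"]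
      proof eventually_elim
        case (elim t)
        have "W 0 powr (q - P) \<le> W t powr (q - P)" using mono[OF elim] Wp[of 0] qP by (intro powr_mono2) auto
        then show ?case by (simp add: mult.commute)
      qed
    qed
  qed (use sol neg in auto)
qed

text \<open>For \<epsilon> = 1 the solution is a concave function of the fundamental solution r^(-\<kappa>), with slope \<psi>(\<zeta>)/\<kappa>. Being positive as
r^(-\<kappa>) \<longrightarrow> 0, it lies above the line through the origin with that slope.\<close>

lemma source_concavity:
  assumes sol: "\<And>t. t > T \<Longrightarrow> sol 1 W \<zeta> t \<and> \<zeta> t > 0" and t: "t > T"
  shows "psi P (\<zeta> t) * exp (- \<kappa> * t) \<le> \<kappa> * W t"
proof (rule ccontr)
  assume neg: "\<not> psi P (\<zeta> t) * exp (- \<kappa> * t) \<le> \<kappa> * W t"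
  define g where "g u = psi P (\<zeta> u) * exp (- \<kappa> * u) - \<kappa> * W u" for u
  have dg: "\<exists>y\<ge>0. (g has_real_derivative y) (at u)" if u: "u > T" for u
  proof -
    have z: "\<zeta> u > 0" and s: "sol 1 W \<zeta> u" using sol[OF u] by auto
    have d\<zeta>: "(\<zeta> has_real_derivative 1 * (exp (M * u) * W u powr q)) (at u)" using s by (simp add: log_at_def)
    note d1 = DERIV_powr_const[OF d\<zeta> z, of "1 / P"]
    have d1: "((\<lambda>u. psi P (\<zeta> u)) has_real_derivative 1 / P * \<zeta> u powr (1 / P) * (1 * (exp (M * u) * W u powr q) / \<zeta> u)) (at u)"
      by (rule has_field_derivative_transform_within_open[OF d1, of "{T<..}"]) (use u sol in \<open>auto simp: psi_pos\<close>)
    have dW: "(W has_real_derivative - (exp (- \<kappa> * u) * psi P (\<zeta> u))) (at u)" using s by (simp add: log_at_def)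
    have de: "((\<lambda>u. exp (- \<kappa> * u)) has_real_derivative exp (- \<kappa> * u) * (- \<kappa>)) (at u)" by (auto intro!: derivative_eq_intros)
    from DERIV_diff[OF DERIV_mult[OF d1 de] DERIV_cmult[OF dW, of \<kappa>]]
    have "(g has_real_derivative 1 / P * \<zeta> u powr (1 / P) * (1 * (exp (M * u) * W u powr q) / \<zeta> u) * exp (- \<kappa> * u)) (at u)"
      unfolding g_def[abs_def] by (simp add: algebra_simps)
    moreover have "1 / P * \<zeta> u powr (1 / P) * (1 * (exp (M * u) * W u powr q) / \<zeta> u) * exp (- \<kappa> * u) \<ge> 0"
      using z P_pos by simp
    ultimately show ?thesis by blast
  qed
  have gt: "g t > 0" using neg by (simp add: g_def)
  have gm: "g u \<ge> g t" if "u \<ge> t" for u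
    using that
  proof (rule DERIV_nonneg_imp_nondecreasing)
    fix x assume "t \<le> x" "x \<le> u"
    then show "\<exists>y. (g has_real_derivative y) (at x) \<and> 0 \<le> y" using dg[of x] t by auto
  qed
  have "\<exists>T'\<ge>t. \<forall>u\<ge>T'. - W u \<ge> 0"
  proof (rule eventually_above_barrier[where c = "g t" and f' = "\<lambda>u. exp (- \<kappa> * u) * psi P (\<zeta> u)"])
    fix u assume u: "t \<le> u"
    then have s: "sol 1 W \<zeta> u" using sol t by auto
    then show "((\<lambda>u. - W u) has_real_derivative exp (- \<kappa> * u) * psi P (\<zeta> u)) (at u)"
      unfolding log_at_def using DERIV_minus[of W "- (exp (- \<kappa> * u) * psi P (\<zeta> u))" u] by simp
    have "\<kappa> * W u \<ge> 0" using s \<kappa>_pos by (simp add: log_at_def)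
    then show "g t \<le> exp (- \<kappa> * u) * psi P (\<zeta> u)" using gm[OF u] by (simp add: g_def mult.commute)
  qed (use gt in auto)
  then obtain u where "u \<ge> t" "- W u \<ge> 0" by auto
  then show False using sol[of u] t by (auto simp: log_at_def)
qed

text \<open>The flux \<zeta> becomes positive, since otherwise w would increase and \<zeta>' would be bounded below. The concavity bound
then turns the second equation into \<zeta>' \<ge> const e^((M - q\<kappa>)t) \<zeta>^(q/P), and q/P > 1 makes \<zeta> blow up.\<close>

lemma source_no_solution_at_infinity:
  assumes crit: "q * \<kappa> < M" and sol: "\<And>t. t > T \<Longrightarrow> sol 1 W \<zeta> t"
  shows False
proof -
  have Wp: "W t > 0" and d\<zeta>: "(\<zeta> has_real_derivative 1 * (exp (M * t) * W t powr q)) (at t)"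
    and dW: "(W has_real_derivative - (exp (- \<kappa> * t) * psi P (\<zeta> t))) (at t)" if "t > T" for t
    using sol[OF that] by (auto simp: log_at_def)
  have \<zeta>mono: "\<zeta> s \<le> \<zeta> t" if "T < s" "s \<le> t" for s t
    using that(2)
  proof (rule DERIV_nonneg_imp_nondecreasing)
    fix x assume "s \<le> x" "x \<le> t"
    then show "\<exists>y. (\<zeta> has_real_derivative y) (at x) \<and> 0 \<le> y" using d\<zeta>[of x] that
      by (auto intro!: exI[of _ "1 * (exp (M * x) * W x powr q)"])
  qed
  have "\<exists>t1>T. \<zeta> t1 > 0"
  proof (rule ccontr)
    assume "\<not> ?thesis"
    then have np: "\<zeta> t \<le> 0" if "t > T" for t using that by (meson not_less)
    have mono: "W (T + 1) \<le> W t" if "t \<ge> T + 1" for t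
      using that
    proof (rule DERIV_nonneg_imp_nondecreasing)
      fix x assume "T + 1 \<le> x" "x \<le> t"
      then have x: "x > T" by simp
      have "psi P (\<zeta> x) \<le> 0" using np[OF x] by (cases "\<zeta> x = 0") (auto simp: psi_neg)
      then have "- (exp (- \<kappa> * x) * psi P (\<zeta> x)) \<ge> 0" by (simp add: mult_nonneg_nonpos)
      then show "\<exists>y. (W has_real_derivative y) (at x) \<and> 0 \<le> y" using dW[OF x] by blast
    qed
    define c where "c = exp (M * (T + 1)) * W (T + 1) powr q"
    have "\<exists>T'\<ge>T + 1. \<forall>t\<ge>T'. \<zeta> t \<ge> 1"
    proof (rule eventually_above_barrier[where f' = "\<lambda>t. 1 * (exp (M * t) * W t powr q)" and c = c])
      fix t assume t: "T + 1 \<le> t"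
      show "(\<zeta> has_real_derivative 1 * (exp (M * t) * W t powr q)) (at t)" using d\<zeta>[of t] t by simp
      have "exp (M * (T + 1)) * W (T + 1) powr q \<le> exp (M * t) * W t powr q"
        using mono[OF t] Wp[of "T + 1"] q_pos M_pos t by (intro mult_mono powr_mono2) auto
      then show "c \<le> 1 * (exp (M * t) * W t powr q)" by (simp add: c_def)
    qed (use Wp[of "T + 1"] in \<open>auto simp: c_def\<close>)
    then obtain u where "u \<ge> T + 1" "\<zeta> u \<ge> 1" by auto
    then show False using np[of u] by simp
  qed
  then obtain t1 where t1: "t1 > T" "\<zeta> t1 > 0" by blast
  have pos: "\<zeta> t > 0" if "t > t1" for t using \<zeta>mono[of t1 t] t1 that by simp
  (* the negative power of \<zeta> whose derivative is bounded away from 0 in the blow-up *)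
  define \<eta> where "\<eta> = q / P - 1"
  have \<eta>: "\<eta> > 0" using qP P_pos by (simp add: \<eta>_def)
  define c where "c = (1 / \<kappa>) powr q"
  have c: "c > 0" using \<kappa>_pos by (simp add: c_def)
  define T2 where "T2 = max (t1 + 1) 0"
  have "\<exists>T'\<ge>T2. \<forall>t\<ge>T'. - (\<zeta> t powr (- \<eta>)) \<ge> 0"
  proof (rule eventually_above_barrier[where f' = "\<lambda>t. \<eta> * (\<zeta> t powr (- \<eta>) * (exp (M * t) * W t powr q / \<zeta> t))" and c = "\<eta> * c"])
    fix t assume t: "T2 \<le> t"
    then have tt: "t > t1" "t > T" "t \<ge> 0" using t1 by (auto simp: T2_def)
    note z = pos[OF tt(1)]
    show "((\<lambda>t. - (\<zeta> t powr (- \<eta>))) has_real_derivative \<eta> * (\<zeta> t powr (- \<eta>) * (exp (M * t) * W t powr q / \<zeta> t))) (at t)"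
      using DERIV_minus[OF DERIV_powr_const[OF d\<zeta>[OF tt(2)] z, of "- \<eta>"]] by (simp add: mult_ac)
    have "psi P (\<zeta> t) * exp (- \<kappa> * t) \<le> \<kappa> * W t"
      by (rule source_concavity[of t1]) (use sol pos t1 tt in auto)
    then have "1 / \<kappa> * (\<zeta> t powr (1 / P) * exp (- \<kappa> * t)) \<le> W t" using z \<kappa>_pos by (simp add: psi_pos field_simps)
    then have "(1 / \<kappa> * (\<zeta> t powr (1 / P) * exp (- \<kappa> * t))) powr q \<le> W t powr q" using \<kappa>_pos q_pos z by (intro powr_mono2) auto
    moreover have "(1 / \<kappa> * (\<zeta> t powr (1 / P) * exp (- \<kappa> * t))) powr q = c * \<zeta> t powr (q / P) * exp (- (q * \<kappa>) * t)"
      using powr_mult[of "1 / \<kappa>" "\<zeta> t powr (1 / P) * exp (- \<kappa> * t)" q] powr_mult[of "\<zeta> t powr (1 / P)" "exp (- \<kappa> * t)" q] z \<kappa>_pos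
      unfolding powr_exp_arg powr_powr by (simp add: c_def mult_ac)
    ultimately have "exp (M * t) * (c * \<zeta> t powr (q / P) * exp (- (q * \<kappa>) * t)) \<le> exp (M * t) * W t powr q" by simp
    moreover have "exp (M * t) * (c * \<zeta> t powr (q / P) * exp (- (q * \<kappa>) * t)) = exp ((M - q * \<kappa>) * t) * (c * \<zeta> t powr (q / P))"
    proof -
      have "exp (M * t) * exp (- (q * \<kappa>) * t) = exp ((M - q * \<kappa>) * t)" by (simp add: algebra_simps flip: exp_add)
      then show ?thesis by (metis mult.assoc mult.commute)
    qed
    moreover have "1 * (c * \<zeta> t powr (q / P)) \<le> exp ((M - q * \<kappa>) * t) * (c * \<zeta> t powr (q / P))"
      using crit tt c by (intro mult_right_mono) auto
    ultimately have "c * \<zeta> t powr (q / P) \<le> exp (M * t) * W t powr q" by linarith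
    then have "\<zeta> t powr (- \<eta>) * (c * \<zeta> t powr (q / P) / \<zeta> t) \<le> \<zeta> t powr (- \<eta>) * (exp (M * t) * W t powr q / \<zeta> t)"
      using z by (intro mult_left_mono divide_right_mono) auto
    moreover have "\<zeta> t powr (- \<eta>) * (c * \<zeta> t powr (q / P) / \<zeta> t) = c"
    proof -
      have "\<zeta> t powr (- \<eta>) * \<zeta> t powr (q / P) = \<zeta> t powr 1" unfolding powr_add[symmetric] by (simp add: \<eta>_def)
      then have "\<zeta> t powr (- \<eta>) * \<zeta> t powr (q / P) = \<zeta> t" using z by simp
      then show ?thesis using z by (simp add: field_simps)
    qed
    ultimately have "c \<le> \<zeta> t powr (- \<eta>) * (exp (M * t) * W t powr q / \<zeta> t)" by (simp only:)
    then show "\<eta> * c \<le> \<eta> * (\<zeta> t powr (- \<eta>) * (exp (M * t) * W t powr q / \<zeta> t))"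
      by (rule mult_left_mono) (use \<eta> in simp)
  qed (use \<eta> c in auto)
  then obtain u where u: "u \<ge> T2" "- (\<zeta> u powr (- \<eta>)) \<ge> 0" by auto
  then have "u > t1" by (simp add: T2_def)
  from pos[OF this] show False using u by simp
qed

end

section \<open>The Sobolev exponent and explicit solutions\<close>

context emden_fowler
begin

text \<open>The Pohozaev function Q has derivative c e^(Mt) W^(q+1), and c > 0 is the condition q < q_S. For a solution with a finite limit at 0, the
flux tends to 0 like e^(Mt), so Q \<longrightarrow> 0 as t \<longrightarrow> -\<infinity>. The concavity bound together with the growth of \<zeta> gives
w \<le> D r^(-\<gamma>), so Q is at most a multiple of e^(-\<mu>t), where \<mu> > 0 again because q < q_S. Thus Q would
increase from 0 and be at most 0.\<close>

lemma source_no_ground_state: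
  assumes crit: "M < q * \<kappa>" and sob: "\<kappa> * P * (q + 1) < M * (P + 1)"
    and sol: "\<And>t. sol 1 W \<zeta> t" and W: "(W \<longlongrightarrow> l) at_bot"
  shows False
proof -
  have Wp: "W t > 0" and d\<zeta>: "(\<zeta> has_real_derivative 1 * (exp (M * t) * W t powr q)) (at t)"
    and dW: "(W has_real_derivative - (exp (- \<kappa> * t) * psi P (\<zeta> t))) (at t)" for t
    using sol[of t] by (auto simp: log_at_def)
  have \<zeta>mono: "\<zeta> s < \<zeta> t" if "s < t" for s t
    using that
  proof (rule DERIV_pos_imp_increasing[of s t \<zeta>])
    fix x show "\<exists>y. (\<zeta> has_real_derivative y) (at x) \<and> 0 < y" using d\<zeta>[of x] Wp[of x]
      by (auto intro!: exI[of _ "1 * (exp (M * x) * W x powr q)"])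
  qed
  (* a negative flux would make W decrease to the left at a rate bounded away from 0 *)
  have \<zeta>pos: "\<zeta> t > 0" for t
  proof (rule ccontr)
    assume "\<not> \<zeta> t > 0"
    then have neg: "\<zeta> (t - 1) < 0" using \<zeta>mono[of "t - 1" t] by simp
    define c where "c = exp (- \<kappa> * (t - 1)) * (- \<zeta> (t - 1)) powr (1 / P)"
    have c: "c > 0" using neg by (simp add: c_def)
    have "\<exists>T'\<ge>1 - t. \<forall>s\<ge>T'. - W (- s) \<ge> 0"
    proof (rule eventually_above_barrier[where c = c and f' = "\<lambda>s. - (exp (- \<kappa> * (- s)) * psi P (\<zeta> (- s)))"])
      fix s assume s: "1 - t \<le> s"
      show "((\<lambda>s. - W (- s)) has_real_derivative - (exp (- \<kappa> * (- s)) * psi P (\<zeta> (- s)))) (at s)"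
        using DERIV_minus[OF DERIV_reflect[OF dW[of "- s"]]] by simp
      have le: "\<zeta> (- s) \<le> \<zeta> (t - 1)" using s \<zeta>mono[of "- s" "t - 1"] by (cases "- s = t - 1") auto
      have "(- \<zeta> (t - 1)) powr (1 / P) \<le> (- \<zeta> (- s)) powr (1 / P)" using le neg P_pos by (intro powr_mono2) auto
      moreover have "psi P (\<zeta> (- s)) = - ((- \<zeta> (- s)) powr (1 / P))" using le neg by (simp add: psi_neg)
      moreover have "- \<kappa> * (t - 1) \<le> - \<kappa> * (- s)"
        using s \<kappa>_pos mult_left_mono[of "1 - t" s \<kappa>] by (simp add: algebra_simps)
      then have "exp (- \<kappa> * (t - 1)) \<le> exp (- \<kappa> * (- s))" by (simp only: exp_le_cancel_iff)
      ultimately have "c \<le> exp (- \<kappa> * (- s)) * (- \<zeta> (- s)) powr (1 / P)" unfolding c_def by (intro mult_mono) auto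
      then show "c \<le> - (exp (- \<kappa> * (- s)) * psi P (\<zeta> (- s)))" using \<open>psi P (\<zeta> (- s)) = _\<close> by simp
    qed (use c in auto)
    then obtain s where "- W (- s) \<ge> 0" by auto
    then show False using Wp[of "- s"] by simp
  qed
  have Wdec: "W t \<le> W s" if "s \<le> t" for s t
    using that
  proof (rule DERIV_nonpos_imp_nonincreasing)
    fix x
    have "- (exp (- \<kappa> * x) * psi P (\<zeta> x)) \<le> 0" using \<zeta>pos[of x] by (simp add: psi_pos)
    then show "\<exists>y. (W has_real_derivative y) (at x) \<and> y \<le> 0" using dW[of x] by blast
  qed
  (* a flux bounded away from 0 would make w unbounded near 0 *)
  have \<zeta>0: "(\<zeta> \<longlongrightarrow> 0) at_bot"
  proof (rule tendstoI)
    fix e :: real assume e: "e > 0"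
    have "\<exists>t0. \<zeta> t0 < e"
    proof (rule ccontr)
      assume "\<not> ?thesis"
      then have ge: "\<zeta> t \<ge> e" for t by (meson not_less)
      have "\<exists>T'\<ge>0. \<forall>s\<ge>T'. W (- s) \<ge> l + 1"
      proof (rule eventually_above_barrier[where c = "e powr (1 / P)" and f' = "\<lambda>s. exp (- \<kappa> * (- s)) * psi P (\<zeta> (- s))"])
        fix s :: real assume s: "0 \<le> s"
        show "((\<lambda>s. W (- s)) has_real_derivative exp (- \<kappa> * (- s)) * psi P (\<zeta> (- s))) (at s)"
          using DERIV_reflect[OF dW[of "- s"]] by simp
        have "1 * e powr (1 / P) \<le> exp (- \<kappa> * (- s)) * \<zeta> (- s) powr (1 / P)"
          using s \<kappa>_pos e ge[of "- s"] P_pos by (intro mult_mono powr_mono2) auto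
        then show "e powr (1 / P) \<le> exp (- \<kappa> * (- s)) * psi P (\<zeta> (- s))" using \<zeta>pos[of "- s"] by (simp add: psi_pos)
      qed (use e in auto)
      then obtain T' where T': "\<And>s. s \<ge> T' \<Longrightarrow> W (- s) \<ge> l + 1" by blast
      have "l < l + 1" by simp
      from order_tendstoD(2)[OF W this] obtain T where T: "\<And>t. t \<le> T \<Longrightarrow> W t < l + 1" by (auto simp: eventually_at_bot_linorder)
      have "min T (- T') \<le> T" "T' \<le> - min T (- T')" by auto
      from T[OF this(1)] T'[OF this(2)] show False by simp
    qed
    then obtain t0 where t0: "\<zeta> t0 < e" by blast
    have "\<zeta> t < e" if "t \<le> t0" for t using \<zeta>mono[of t t0] t0 that by (cases "t = t0") auto
    then show "\<forall>\<^sub>F t in at_bot. dist (\<zeta> t) 0 < e"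
      using \<zeta>pos by (auto simp: eventually_at_bot_linorder dist_real_def intro!: exI[of _ t0] simp: less_imp_le)
  qed
  have Wl: "W t \<le> l" for t
    by (rule tendsto_lowerbound[OF W]) (use Wdec in \<open>auto simp: eventually_at_bot_linorder\<close>)
  have l: "l > 0" using Wl[of 0] Wp[of 0] by simp
  define C where "C = l powr q / M"
  have C: "C > 0" using l M_pos by (simp add: C_def)
  have \<zeta>C: "\<zeta> t \<le> C * exp (M * t)" for t
  proof -
    have "\<bar>\<zeta> t\<bar> \<le> l powr q * exp (M * t) / M"
    proof (rule exp_tail_bound_bot[OF d\<zeta> _ M_pos \<zeta>0])
      fix s
      have "W s powr q \<le> l powr q" using Wl[of s] Wp[of s] q_pos by (intro powr_mono2) auto
      then show "\<bar>1 * (exp (M * s) * W s powr q)\<bar> \<le> l powr q * exp (M * s)" by (simp add: abs_mult mult.commute)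
      show "t < t + 1" by simp
    qed
    then show ?thesis by (simp add: C_def)
  qed
  define p' where "p' = (P + 1) / P"
  have p': "p' > 0" "P * p' = P + 1" using P_pos by (auto simp: p'_def)
  define Q where "Q t = exp (- \<kappa> * t) * \<zeta> t powr p' / p' - \<kappa> / p' * (W t * \<zeta> t) + exp (M * t) * W t powr (q + 1) / (q + 1)" for t
  define c where "c = M / (q + 1) - \<kappa> / p'"
  have c: "c > 0"
  proof -
    have "\<kappa> / p' = \<kappa> * P / (P + 1)" by (simp add: p'_def)
    also have "\<dots> < M / (q + 1)" using sob P_pos q_pos by (simp add: field_simps)
    finally show ?thesis by (simp add: c_def)
  qed
  have dQ: "(Q has_real_derivative c * (exp (M * t) * W t powr (q + 1))) (at t)" for t
  proof -
    define E where "E = exp (- \<kappa> * t)"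
    define F where "F = exp (M * t)"
    define z where "z = \<zeta> t"
    define Wq where "Wq = W t powr q"
    have z: "z > 0" using \<zeta>pos by (simp add: z_def)
    have dE: "((\<lambda>t. exp (- \<kappa> * t)) has_real_derivative - \<kappa> * E) (at t)" and dF: "((\<lambda>t. exp (M * t)) has_real_derivative M * F) (at t)"
      by (auto intro!: derivative_eq_intros simp: E_def F_def)
    have d1: "((\<lambda>t. \<zeta> t powr p') has_real_derivative p' * (z powr (1 / P) * (F * Wq))) (at t)"
    proof -
      have "z powr p' = z powr (1 / P) * z" using z P_pos by (simp add: p'_def add_divide_distrib powr_add mult.commute)
      then have "p' * z powr p' * (1 * (exp (M * t) * W t powr q) / z) = p' * (z powr (1 / P) * (F * Wq))"
        using z by (simp add: F_def Wq_def)
      then show ?thesis using DERIV_powr_const[OF d\<zeta> \<zeta>pos, of p' t] by (simp add: z_def)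
    qed
    have d\<zeta>': "(\<zeta> has_real_derivative F * Wq) (at t)" using d\<zeta>[of t] by (simp add: F_def Wq_def)
    have dW': "(W has_real_derivative - (E * z powr (1 / P))) (at t)" using dW[of t] z by (simp add: E_def z_def psi_pos)
    have d2: "((\<lambda>t. W t powr (q + 1)) has_real_derivative (q + 1) * (Wq * (- (E * z powr (1 / P))))) (at t)"
    proof -
      have "(q + 1) * W t powr (q + 1) * (- (E * z powr (1 / P)) / W t) = (q + 1) * (Wq * (- (E * z powr (1 / P))))"
        using Wp[of t] by (simp add: Wq_def powr_add)
      then show ?thesis using DERIV_powr_const[OF dW' Wp, of "q + 1"] by simp
    qed
    have "(Q has_real_derivative ((- \<kappa> * E) * \<zeta> t powr p' + p' * (z powr (1 / P) * (F * Wq)) * exp (- \<kappa> * t)) / p'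
        - \<kappa> / p' * (- (E * z powr (1 / P)) * \<zeta> t + F * Wq * W t)
        + ((M * F) * W t powr (q + 1) + (q + 1) * (Wq * (- (E * z powr (1 / P)))) * exp (M * t)) / (q + 1)) (at t)"
      unfolding Q_def[abs_def]
      by (intro DERIV_add DERIV_diff DERIV_cdivide DERIV_cmult DERIV_mult dE dF d1 d2 d\<zeta>' dW')
    moreover have "((- \<kappa> * E) * \<zeta> t powr p' + p' * (z powr (1 / P) * (F * Wq)) * exp (- \<kappa> * t)) / p'
        - \<kappa> / p' * (- (E * z powr (1 / P)) * \<zeta> t + F * Wq * W t)
        + ((M * F) * W t powr (q + 1) + (q + 1) * (Wq * (- (E * z powr (1 / P)))) * exp (M * t)) / (q + 1)
        = c * (exp (M * t) * W t powr (q + 1))"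
    proof -
      have zp: "z powr p' = z powr (1 / P) * z" using z P_pos by (simp add: p'_def add_divide_distrib powr_add mult.commute)
      have Wq1: "W t powr (q + 1) = Wq * W t" using Wp[of t] by (simp add: Wq_def powr_add)
      define g where "g = z powr (1 / P)"
      have "((- \<kappa> * E) * (g * z) + p' * (g * (F * Wq)) * E) / p' - \<kappa> / p' * (- (E * g) * z + F * Wq * W t)
        + ((M * F) * (Wq * W t) + (q + 1) * (Wq * (- (E * g))) * F) / (q + 1) = c * (F * (Wq * W t))"
        using p'(1) q_pos by (simp add: c_def field_simps)
      then show ?thesis unfolding zp Wq1 g_def E_def[symmetric] F_def[symmetric] z_def[symmetric] .
    qed
    ultimately show ?thesis by simp
  qed
  have Qmono: "Q s < Q t" if "s < t" for s t
    using that
  proof (rule DERIV_pos_imp_increasing[of s t Q])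
    fix x
    have "c * (exp (M * x) * W x powr (q + 1)) > 0" using c Wp[of x] by simp
    then show "\<exists>y. (Q has_real_derivative y) (at x) \<and> 0 < y" using dQ[of x] by blast
  qed
  have expl: "((\<lambda>t. exp (a * t)) \<longlongrightarrow> 0) at_bot" if "a > 0" for a :: real
    using exp_decay_tendsto[OF that] by (simp add: filterlim_at_bot_mirror)
  have Q0: "Q 0 > 0"
  proof -
    have "(Q \<longlongrightarrow> 0 / p' - \<kappa> / p' * (l * 0) + 0 * l powr (q + 1) / (q + 1)) at_bot"
      unfolding Q_def[abs_def]
    proof (intro tendsto_intros W \<zeta>0 expl M_pos)
      show "((\<lambda>t. exp (- \<kappa> * t) * \<zeta> t powr p') \<longlongrightarrow> 0) at_bot"
      proof (rule Lim_null_comparison)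
        have pos: "M * p' - \<kappa> > 0"
        proof -
          have "\<kappa> * P * 1 < M * (P + 1)" using M_gt P_pos \<kappa>_pos M_pos by (intro mult_strict_mono) auto
          then show ?thesis using P_pos by (simp add: p'_def field_simps)
        qed
        show "((\<lambda>t. C powr p' * exp ((M * p' - \<kappa>) * t)) \<longlongrightarrow> 0) at_bot" by (rule tendsto_mult_right_zero[OF expl[OF pos]])
        show "\<forall>\<^sub>F t in at_bot. norm (exp (- \<kappa> * t) * \<zeta> t powr p') \<le> C powr p' * exp ((M * p' - \<kappa>) * t)"
        proof (intro always_eventually allI)
          fix t
          have "\<zeta> t powr p' \<le> (C * exp (M * t)) powr p'" using \<zeta>C[of t] \<zeta>pos[of t] p' by (intro powr_mono2) auto
          also have "\<dots> = C powr p' * exp (p' * (M * t))" using C by (simp add: powr_mult powr_exp_arg)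
          finally have "exp (- \<kappa> * t) * \<zeta> t powr p' \<le> exp (- \<kappa> * t) * (C powr p' * exp (p' * (M * t)))" by simp
          also have "\<dots> = C powr p' * exp ((M * p' - \<kappa>) * t)" by (simp add: algebra_simps flip: exp_add)
          finally show "norm (exp (- \<kappa> * t) * \<zeta> t powr p') \<le> C powr p' * exp ((M * p' - \<kappa>) * t)" by simp
        qed
      qed
    qed (use p' q_pos l in auto)
    then have "(Q \<longlongrightarrow> 0) at_bot" by simp
    moreover have "\<forall>\<^sub>F t in at_bot. Q t \<le> Q (- 1)"
      unfolding eventually_at_bot_linorder
    proof (intro exI[of _ "- 1"] allI impI)
      fix t :: real assume "t \<le> - 1"
      then show "Q t \<le> Q (- 1)" using Qmono[of t "- 1"] by (cases "t = - 1") auto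
    qed
    ultimately have "0 \<le> Q (- 1)" by (intro tendsto_upperbound[of Q 0 at_bot]) auto
    then show ?thesis using Qmono[of "- 1" 0] by simp
  qed
  have conc: "\<zeta> t \<le> (\<kappa> * W t * exp (\<kappa> * t)) powr P" for t
  proof -
    have "psi P (\<zeta> t) * exp (- \<kappa> * t) \<le> \<kappa> * W t" by (rule source_concavity[of "t - 1"]) (use sol \<zeta>pos in auto)
    then have "\<zeta> t powr (1 / P) \<le> \<kappa> * W t * exp (\<kappa> * t)" using \<zeta>pos[of t] by (simp add: psi_pos exp_minus field_simps)
    then have "(\<zeta> t powr (1 / P)) powr P \<le> (\<kappa> * W t * exp (\<kappa> * t)) powr P" using P_pos by (intro powr_mono2) auto
    then show ?thesis using P_pos \<zeta>pos[of t] by (simp add: powr_powr)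
  qed
  define D where "D = (exp M * \<kappa> powr P) powr (1 / (q - P))"
  have D: "D > 0" using \<kappa>_pos by (simp add: D_def)
  (* over a unit of time \<zeta> grows at least by the right-hand side at its smallest, and \<zeta> is bounded by concavity *)
  have Wdecay: "W t \<le> D * exp (- \<gamma> * t)" for t
  proof -
    obtain z where z: "t - 1 < z" "z < t" "\<zeta> t - \<zeta> (t - 1) = (t - (t - 1)) * (1 * (exp (M * z) * W z powr q))"
      using MVT2[of "t - 1" t \<zeta> "\<lambda>s. 1 * (exp (M * s) * W s powr q)"] d\<zeta> by auto
    have "exp (M * (t - 1)) * W t powr q \<le> exp (M * z) * W z powr q"
      using z Wdec[of z t] Wp[of t] q_pos M_pos by (intro mult_mono powr_mono2) auto
    then have "exp (M * (t - 1)) * W t powr q \<le> \<zeta> t" using z(3) \<zeta>pos[of "t - 1"] by simp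
    also have "\<dots> \<le> (\<kappa> * W t * exp (\<kappa> * t)) powr P" by (rule conc)
    also have "\<dots> = \<kappa> powr P * W t powr P * exp (P * (\<kappa> * t))" by (simp add: powr_mult powr_exp_arg)
    finally have "W t powr q * exp (M * (t - 1)) \<le> \<kappa> powr P * W t powr P * exp (P * (\<kappa> * t))" by (simp only: mult.commute)
    moreover have "W t powr q = W t powr (q - P) * W t powr P" by (simp flip: powr_add)
    ultimately have "W t powr P * (W t powr (q - P) * exp (M * (t - 1))) \<le> W t powr P * (\<kappa> powr P * exp (P * (\<kappa> * t)))"
      by (simp only: mult_ac)
    then have "W t powr (q - P) * exp (M * (t - 1)) \<le> \<kappa> powr P * exp (P * (\<kappa> * t))" using Wp[of t] by simp
    then have "(W t powr (q - P) * exp (M * (t - 1))) * exp (- M * (t - 1)) \<le> (\<kappa> powr P * exp (P * (\<kappa> * t))) * exp (- M * (t - 1))"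
      by (intro mult_right_mono) auto
    moreover have "(W t powr (q - P) * exp (M * (t - 1))) * exp (- M * (t - 1)) = W t powr (q - P)" by (simp flip: exp_add add: mult.assoc)
    moreover have "(\<kappa> powr P * exp (P * (\<kappa> * t))) * exp (- M * (t - 1)) = (exp M * \<kappa> powr P) * exp ((q - P) * (- \<gamma> * t))"
    proof -
      have "P * (\<kappa> * t) + - M * (t - 1) = M + (q - P) * (- \<gamma> * t)" using \<gamma>_mult by algebra
      then have "exp (P * (\<kappa> * t)) * exp (- M * (t - 1)) = exp M * exp ((q - P) * (- \<gamma> * t))" by (simp only: exp_add[symmetric])
      then show ?thesis by (simp only: mult_ac)
    qed
    ultimately have "W t powr (q - P) \<le> (exp M * \<kappa> powr P) * exp ((q - P) * (- \<gamma> * t))" by (simp only:)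
    then have "(W t powr (q - P)) powr (1 / (q - P)) \<le> ((exp M * \<kappa> powr P) * exp ((q - P) * (- \<gamma> * t))) powr (1 / (q - P))"
      using qP by (intro powr_mono2) auto
    moreover have "(W t powr (q - P)) powr (1 / (q - P)) = W t" using qP Wp[of t] by (simp add: powr_powr)
    moreover have "((exp M * \<kappa> powr P) * exp ((q - P) * (- \<gamma> * t))) powr (1 / (q - P)) = D * exp (- \<gamma> * t)"
      unfolding powr_mult[of "exp M * \<kappa> powr P"] powr_exp_arg D_def using qP by simp
    ultimately show ?thesis by simp
  qed
  define \<mu> where "\<mu> = \<gamma> * (P + 1) - \<kappa> * P"
  have \<mu>: "\<mu> > 0"
  proof -
    have "\<mu> * (q - P) = M * (P + 1) - \<kappa> * P * (q + 1)" unfolding \<mu>_def using \<gamma>_mult by algebra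
    then have "\<mu> * (q - P) > 0" using sob by simp
    then show ?thesis using qP by (simp add: zero_less_mult_iff)
  qed
  define B where "B = (\<kappa> * D) powr (P + 1) / p' + D powr (q + 1) / (q + 1)"
  have Qle: "Q t \<le> B * exp (- \<mu> * t)" for t
  proof -
    have "\<zeta> t powr p' \<le> ((\<kappa> * W t * exp (\<kappa> * t)) powr P) powr p'" using conc[of t] \<zeta>pos[of t] p' by (intro powr_mono2) auto
    also have "\<dots> = (\<kappa> * W t * exp (\<kappa> * t)) powr (P + 1)" by (simp add: powr_powr p'(2))
    also have "\<dots> \<le> (\<kappa> * (D * exp (- \<gamma> * t)) * exp (\<kappa> * t)) powr (P + 1)"
      using Wdecay[of t] Wp[of t] \<kappa>_pos P_pos by (intro powr_mono2 mult_right_mono mult_left_mono) auto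
    also have "\<kappa> * (D * exp (- \<gamma> * t)) * exp (\<kappa> * t) = \<kappa> * D * exp ((\<kappa> - \<gamma>) * t)" by (simp add: algebra_simps flip: exp_add)
    also have "(\<kappa> * D * exp ((\<kappa> - \<gamma>) * t)) powr (P + 1) = (\<kappa> * D) powr (P + 1) * exp ((P + 1) * ((\<kappa> - \<gamma>) * t))"
      unfolding powr_mult[of "\<kappa> * D"] powr_exp_arg ..
    finally have "exp (- \<kappa> * t) * \<zeta> t powr p' \<le> exp (- \<kappa> * t) * ((\<kappa> * D) powr (P + 1) * exp ((P + 1) * ((\<kappa> - \<gamma>) * t)))" by simp
    also have "\<dots> = (\<kappa> * D) powr (P + 1) * exp (- \<mu> * t)" by (simp add: \<mu>_def algebra_simps flip: exp_add)
    finally have 1: "exp (- \<kappa> * t) * \<zeta> t powr p' / p' \<le> (\<kappa> * D) powr (P + 1) * exp (- \<mu> * t) / p'" using p' by (intro divide_right_mono) auto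
    have "W t powr (q + 1) \<le> (D * exp (- \<gamma> * t)) powr (q + 1)" using Wdecay[of t] Wp[of t] q_pos by (intro powr_mono2) auto
    also have "\<dots> = D powr (q + 1) * exp ((q + 1) * (- \<gamma> * t))" unfolding powr_mult powr_exp_arg ..
    finally have "exp (M * t) * W t powr (q + 1) \<le> exp (M * t) * (D powr (q + 1) * exp ((q + 1) * (- \<gamma> * t)))" by simp
    also have "\<dots> = D powr (q + 1) * exp (- \<mu> * t)"
    proof -
      have "M * t + (q + 1) * (- \<gamma> * t) = - \<mu> * t" unfolding \<mu>_def using \<gamma>_mult by algebra
      then have "exp (M * t) * exp ((q + 1) * (- \<gamma> * t)) = exp (- \<mu> * t)" by (simp only: exp_add[symmetric])
      then show ?thesis by (metis mult.left_commute)
    qed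
    finally have 2: "exp (M * t) * W t powr (q + 1) / (q + 1) \<le> D powr (q + 1) * exp (- \<mu> * t) / (q + 1)"
      using q_pos by (intro divide_right_mono) auto
    have "\<kappa> / p' * (W t * \<zeta> t) \<ge> 0" using \<kappa>_pos p' Wp[of t] \<zeta>pos[of t] by simp
    then have "Q t \<le> (\<kappa> * D) powr (P + 1) * exp (- \<mu> * t) / p' + D powr (q + 1) * exp (- \<mu> * t) / (q + 1)"
      unfolding Q_def using 1 2 by linarith
    then show ?thesis by (simp add: B_def algebra_simps)
  qed
  have "((\<lambda>t. B * exp (- \<mu> * t)) \<longlongrightarrow> 0) at_top" by (rule tendsto_mult_right_zero[OF exp_decay_tendsto[OF \<mu>]])
  moreover have "\<forall>\<^sub>F t in at_top. Q 0 \<le> B * exp (- \<mu> * t)"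
    using eventually_gt_at_top[of "0::real"] by eventually_elim (use Qmono Qle in \<open>meson less_imp_le order_trans\<close>)
  ultimately have "Q 0 \<le> 0" by (rule tendsto_lowerbound) simp
  then show False using Q0 by simp
qed

text \<open>Explicit formulas agree with functions of ln r for r > 0 only.\<close>

lemma positive_solution_cong:
  assumes sol: "positive_solution_on N p q \<sigma> \<epsilon> I v" and I: "I \<subseteq> {0<..}" and eq: "\<And>r. r > 0 \<Longrightarrow> w r = v r"
  shows "positive_solution_on N p q \<sigma> \<epsilon> I w"
proof -
  have ev: "eventually (\<lambda>x. w x = v x) (nhds r)" if "r > 0" for r
    by (rule eventually_nhds_in_open[of "{0<..}", THEN eventually_mono]) (use that eq in auto)
  have d: "deriv w r = deriv v r" if "r > 0" for r by (rule deriv_cong_ev[OF ev[OF that] refl])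
  have f: "p_flux p w r = p_flux p v r" if "r > 0" for r using d[OF that] by (simp add: p_flux_def)
  have evf: "eventually (\<lambda>x. p_flux p w x = p_flux p v x) (nhds r)" if "r > 0" for r
    by (rule eventually_nhds_in_open[of "{0<..}", THEN eventually_mono]) (use that f in auto)
  have df: "deriv (p_flux p w) r = deriv (p_flux p v) r" if "r > 0" for r by (rule deriv_cong_ev[OF evf[OF that] refl])
  have diff: "g differentiable (at r)" if "h differentiable (at r)" "r > 0" "\<And>x. x > 0 \<Longrightarrow> g x = h x" for g h :: "real \<Rightarrow> real" and r
  proof -
    have "(h has_real_derivative deriv h r) (at r)" using that(1) by (simp add: DERIV_deriv_iff_real_differentiable)
    then have "(g has_real_derivative deriv h r) (at r)"
      by (rule has_field_derivative_transform_within_open[of _ _ _ "{0<..}"]) (use that in auto)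
    then show ?thesis by (auto simp: real_differentiable_def)
  qed
  show ?thesis unfolding positive_solution_on_def
  proof (intro ballI)
    fix r assume r: "r \<in> I"
    then have r0: "r > 0" using I by auto
    have s: "v r > 0" "v differentiable (at r)" "p_flux p v differentiable (at r)"
      "- deriv (p_flux p v) r - (N - 1) / r * p_flux p v r = \<epsilon> * r powr \<sigma> * v r powr q"
      using sol r by (auto simp: positive_solution_on_def)
    show "0 < w r \<and> w differentiable at r \<and> p_flux p w differentiable at r \<and>
      - deriv (p_flux p w) r - (N - 1) / r * p_flux p w r = \<epsilon> * r powr \<sigma> * w r powr q"
      using s diff[OF s(2) r0 eq] diff[OF s(3) r0 f] by (simp add: df[OF r0] f[OF r0] eq[OF r0])
  qed
qed

lemma global_of_log:
  assumes sol: "\<And>t. sol \<epsilon> W \<zeta> t" and eq: "\<And>r. r > 0 \<Longrightarrow> w r = W (ln r)"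
  shows "global_solution N p q \<sigma> \<epsilon> w"
  unfolding global_solution_def
  by (rule positive_solution_cong[OF log_imp_solution[of UNIV]]) (use sol eq in auto)

lemma w_star_global:
  assumes \<epsilon>: "\<epsilon> = 1 \<or> \<epsilon> = - 1" and s: "\<epsilon> * (\<kappa> - \<gamma>) > 0"
  shows "global_solution N p q \<sigma> \<epsilon> (w_star N p q \<sigma> \<epsilon>)"
proof -
  define a where "a = a_star N p q \<sigma> \<epsilon>"
  have a: "a > 0" "a powr (q - P) = \<epsilon> * (P * (\<kappa> - \<gamma>)) * \<gamma> powr P" using a_star_eq[OF s] by (auto simp: a_def)
  have ee: "\<epsilon> * \<epsilon> = 1" using \<epsilon> by auto
  show ?thesis
  proof (rule global_of_log)
    fix t
    define E where "E = exp ((\<kappa> - \<gamma>) * P * t)"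
    have "psi P ((\<gamma> * a) powr P * E) = \<gamma> * a * exp ((\<kappa> - \<gamma>) * t)"
      using a \<gamma>_pos P_pos by (simp add: E_def psi_pos powr_mult powr_powr powr_exp_arg)
    moreover have "exp (- \<kappa> * t) * exp ((\<kappa> - \<gamma>) * t) = exp (- \<gamma> * t)" by (simp add: algebra_simps flip: exp_add)
    ultimately have 1: "- (exp (- \<kappa> * t) * psi P ((\<gamma> * a) powr P * E)) = a * (exp (- \<gamma> * t) * (- \<gamma>))"
      by (simp add: mult_ac)
    have 2: "\<epsilon> * (exp (M * t) * (a * exp (- \<gamma> * t)) powr q) = (\<gamma> * a) powr P * (E * ((\<kappa> - \<gamma>) * P))"
    proof -
      have "M * t + q * (- \<gamma> * t) = (\<kappa> - \<gamma>) * P * t" using \<gamma>_mult by algebra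
      then have "exp (M * t) * exp (q * (- \<gamma> * t)) = E" by (simp only: E_def exp_add[symmetric])
      moreover have "(a * exp (- \<gamma> * t)) powr q = a powr q * exp (q * (- \<gamma> * t))" unfolding powr_mult powr_exp_arg ..
      moreover have "a powr q = a powr (q - P) * a powr P" by (simp flip: powr_add)
      ultimately have "\<epsilon> * (exp (M * t) * (a * exp (- \<gamma> * t)) powr q) = \<epsilon> * (a powr (q - P) * a powr P) * E" by simp
      also have "\<dots> = (\<epsilon> * \<epsilon>) * ((P * (\<kappa> - \<gamma>)) * (\<gamma> powr P * a powr P) * E)" unfolding a(2) by simp
      also have "\<dots> = (\<gamma> * a) powr P * (E * ((\<kappa> - \<gamma>) * P))" by (simp add: ee powr_mult)
      finally show ?thesis .
    qed
    have dW: "((\<lambda>t. a * exp (- \<gamma> * t)) has_real_derivative a * (exp (- \<gamma> * t) * (- \<gamma>))) (at t)"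
      and dz: "((\<lambda>t. (\<gamma> * a) powr P * exp ((\<kappa> - \<gamma>) * P * t)) has_real_derivative (\<gamma> * a) powr P * (E * ((\<kappa> - \<gamma>) * P))) (at t)"
      unfolding E_def by (auto intro!: derivative_eq_intros)
    show "sol \<epsilon> (\<lambda>t. a * exp (- \<gamma> * t)) (\<lambda>t. (\<gamma> * a) powr P * exp ((\<kappa> - \<gamma>) * P * t)) t"
      unfolding log_at_def 2 E_def[symmetric] 1 using a(1) dW dz by simp
  next
    fix r :: real assume "r > 0"
    then show "w_star N p q \<sigma> \<epsilon> r = a * exp (- \<gamma> * ln r)"
      by (simp add: w_star_def a_def powr_def flip: \<gamma>_def)
  qed
qed

text \<open>With X = r^a and a = (p + \<sigma>)/(p - 1) the flux is \<zeta> = (\<kappa>c)^P (X/(d + X))^(M/a). In the second equation the powers of d + X match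
because q = q_S, and the constants match by the choice of d.\<close>

lemma explicit_ground_state:
  assumes sob: "\<kappa> * P * (q + 1) = M * (P + 1)" and c: "c > 0"
    and d_def: "d = c powr (q - p + 1) * inverse (N + \<sigma>) * ((N - p) / (p - 1)) powr (1 - p)"
  shows "C0_ground_state N p q \<sigma> 1 (\<lambda>r. c * (d + r powr ((p + \<sigma>) / (p - 1))) powr (- ((N - p) / (p + \<sigma>))))"
proof -
  define a where "a = (p + \<sigma>) / (p - 1)"
  have a: "a > 0" "a * P = M - \<kappa> * P" using p1 p\<sigma> unfolding M\<kappa>P by (auto simp: a_def P_def)
  have b: "(N - p) / (p + \<sigma>) = \<kappa> / a" using p1 p\<sigma> by (simp add: a_def \<kappa>_def)
  have d: "d > 0" and Md: "M * d * \<kappa> powr P * c powr P = c powr q"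
  proof -
    have d': "d = c powr (q - P) / M * \<kappa> powr (- P)"
      using d_def by (simp add: M_def \<kappa>_def P_def divide_inverse algebra_simps)
    then show "d > 0" using c M_pos \<kappa>_pos by simp
    have "\<kappa> powr (- P) * \<kappa> powr P = 1" using \<kappa>_pos by (simp flip: powr_add)
    moreover have "c powr (q - P) * c powr P = c powr q" by (simp flip: powr_add)
    ultimately show "M * d * \<kappa> powr P * c powr P = c powr q" unfolding d' using M_pos by (simp add: mult_ac)
  qed
  have M': "M = (a + \<kappa>) * P" using a(2) by (simp add: algebra_simps)
  have \<kappa>q: "\<kappa> * q = M + a"
  proof -
    have "\<kappa> * q * P = (M + a) * P" using sob M' by algebra
    then show ?thesis using P_pos by simp
  qed
  define X where "X t = exp (a * t)" for t
  define W where "W t = c * (d + X t) powr (- (\<kappa> / a))" for t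
  define \<zeta> where "\<zeta> t = (\<kappa> * c) powr P * (X t / (d + X t)) powr (M / a)" for t
  have Xp: "X t > 0" "d + X t > 0" for t using d by (auto simp: X_def intro: add_pos_pos)
  have dX: "(X has_real_derivative a * X t) (at t)" for t unfolding X_def[abs_def] by (auto intro!: derivative_eq_intros)
  have sol: "sol 1 W \<zeta> t" for t
  proof -
    define D where "D = d + X t"
    have D: "D > 0" using Xp by (simp add: D_def)
    have dD: "((\<lambda>t. d + X t) has_real_derivative a * X t) (at t)" using DERIV_add[OF DERIV_const dX] by simp
    have dW: "(W has_real_derivative c * (- (\<kappa> / a) * D powr (- (\<kappa> / a)) * (a * X t / D))) (at t)"
      unfolding W_def[abs_def] D_def by (intro DERIV_cmult DERIV_powr_const dD Xp)
    have Xe: "X t powr (1 + \<kappa> / a) = X t * exp (\<kappa> * t)" using Xp[of t] a(1) by (simp add: powr_add X_def powr_exp_arg)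
    have De: "D powr (1 + \<kappa> / a) = D * D powr (\<kappa> / a)" using D by (simp add: powr_add)
    have "psi P (\<zeta> t) = \<kappa> * c * (X t / D) powr (1 + \<kappa> / a)"
    proof -
      have "\<zeta> t > 0" using c \<kappa>_pos Xp[of t] by (simp add: \<zeta>_def)
      then have "psi P (\<zeta> t) = \<zeta> t powr (1 / P)" by (rule psi_pos)
      also have "\<dots> = \<kappa> * c * (X t / D) powr (M / a * (1 / P))"
        using c \<kappa>_pos P_pos unfolding \<zeta>_def powr_mult[of "(\<kappa> * c) powr P"] powr_powr by (simp add: D_def)
      also have "M / a * (1 / P) = 1 + \<kappa> / a" using M' a P_pos by (simp add: field_simps)
      finally show ?thesis .
    qed
    also have "\<dots> = \<kappa> * c * (X t * exp (\<kappa> * t) / (D * D powr (\<kappa> / a)))"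
      using Xp[of t] D by (simp add: powr_divide Xe De)
    finally have psi: "psi P (\<zeta> t) = \<kappa> * c * (X t * exp (\<kappa> * t) / (D * D powr (\<kappa> / a)))" .
    have 1: "- (exp (- \<kappa> * t) * psi P (\<zeta> t)) = c * (- (\<kappa> / a) * D powr (- (\<kappa> / a)) * (a * X t / D))"
    proof -
      have "exp (- \<kappa> * t) * exp (\<kappa> * t) = 1" by (simp flip: exp_add)
      moreover have "exp (- \<kappa> * t) * psi P (\<zeta> t) = (exp (- \<kappa> * t) * exp (\<kappa> * t)) * (\<kappa> * c * (X t / (D * D powr (\<kappa> / a))))"
        unfolding psi by simp
      ultimately show ?thesis using a(1) D by (simp add: powr_minus field_simps)
    qed
    have dq: "((\<lambda>t. X t / (d + X t)) has_real_derivative (a * X t * D - X t * (a * X t)) / (D * D)) (at t)"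
      unfolding D_def by (rule DERIV_divide[OF dX dD]) (use Xp[of t] in simp)
    have q0: "X t / (d + X t) > 0" using Xp[of t] by simp
    have dz: "(\<zeta> has_real_derivative (\<kappa> * c) powr P * (M / a * (X t / D) powr (M / a) * ((a * X t * D - X t * (a * X t)) / (D * D) / (X t / D)))) (at t)"
      unfolding \<zeta>_def[abs_def] using DERIV_cmult[OF DERIV_powr_const[OF dq q0], of "(\<kappa> * c) powr P" "M / a"] by (simp add: D_def)
    have 2: "(\<kappa> * c) powr P * (M / a * (X t / D) powr (M / a) * ((a * X t * D - X t * (a * X t)) / (D * D) / (X t / D)))
        = 1 * (exp (M * t) * W t powr q)"
    proof -
      have "a * X t * D - X t * (a * X t) = a * X t * d" by (simp add: D_def algebra_simps)
      then have "(a * X t * D - X t * (a * X t)) / (D * D) / (X t / D) = a * d / D"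
        using Xp(1)[of t] D by simp
      moreover have "(X t / D) powr (M / a) = exp (M * t) / D powr (M / a)"
        using Xp[of t] D a(1) by (simp add: powr_divide X_def powr_exp_arg)
      ultimately have "(\<kappa> * c) powr P * (M / a * (X t / D) powr (M / a) * ((a * X t * D - X t * (a * X t)) / (D * D) / (X t / D)))
        = (M * d * \<kappa> powr P * c powr P) * (exp (M * t) / (D powr (M / a) * D))" using a(1) by (simp add: powr_mult)
      also have "D powr (M / a) * D = D powr (\<kappa> / a * q)"
      proof -
        have "\<kappa> / a * q = M / a + 1" using \<kappa>q a(1) by (simp add: field_simps)
        then show ?thesis using D by (simp add: powr_add)
      qed
      also have "(M * d * \<kappa> powr P * c powr P) * (exp (M * t) / D powr (\<kappa> / a * q)) = 1 * (exp (M * t) * W t powr q)"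
        unfolding Md W_def powr_mult D_def[symmetric] powr_powr by (simp add: powr_minus divide_inverse)
      finally show ?thesis .
    qed
    have "W t > 0" using c Xp[of t] by (simp add: W_def)
    then show ?thesis unfolding log_at_def 1 2[symmetric] using dW dz by simp
  qed
  have "global_solution N p q \<sigma> 1 (\<lambda>r. c * (d + r powr a) powr (- (\<kappa> / a)))"
    by (rule global_of_log[OF sol]) (simp add: W_def X_def powr_def)
  moreover have "C0_regular (\<lambda>r. c * (d + r powr a) powr (- (\<kappa> / a)))"
  proof -
    have "(X \<longlongrightarrow> 0) at_bot" unfolding X_def[abs_def] using exp_decay_tendsto[OF a(1)] by (simp add: filterlim_at_bot_mirror)
    then have "((\<lambda>t. c * (d + X t) powr (- (\<kappa> / a))) \<longlongrightarrow> c * (d + 0) powr (- (\<kappa> / a))) at_bot"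
      using d by (intro tendsto_intros) auto
    then have "((\<lambda>r. c * (d + r powr a) powr (- (\<kappa> / a))) \<longlongrightarrow> c * d powr (- (\<kappa> / a))) (at_right 0)"
      unfolding tendsto_at_right_0_iff_exp by (simp add: X_def powr_exp_arg)
    then show ?thesis unfolding C0_regular_def using c by (intro exI[of _ "c * d powr (- (\<kappa> / a))"]) auto
  qed
  ultimately show ?thesis by (simp add: C0_ground_state_def b a_def)
qed

end

section \<open>Solutions of the radial equation\<close>

context emden_fowler
begin

text \<open>Each member of the family of orbits is translated by h u so that r^\<kappa> w tends to the prescribed k. If two of the
resulting solutions agree near 0, the two orbits agree up to the translation h u - h v. As |z| equals \<eta> at time 0 only, the
translation is 0, and then the starting points u and v coincide.\<close>

lemma fundamental_family_exists:
  assumes \<epsilon>: "\<epsilon> = 1 \<or> \<epsilon> = - 1" and k: "k > 0" and crit: "q * \<kappa> < M"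
  shows "\<exists>W. infinite W \<and>
      (\<forall>w\<in>W. (\<exists>r0. local_solution_0 N p q \<sigma> \<epsilon> r0 w) \<and> fundamental_behaviour N p (at_right 0) k (\<kappa> * k) w) \<and>
      (\<forall>w1\<in>W. \<forall>w2\<in>W. w1 \<noteq> w2 \<longrightarrow> \<not> (\<forall>\<^sub>F r in at_right 0. w1 r = w2 r))"
proof -
  from fundamental_orbit_family[OF P_pos q_pos \<kappa>_pos crit \<epsilon>]
  obtain X Z \<delta> \<eta> where \<delta>: "0 < \<delta>" "\<delta> < \<kappa>" and \<eta>: "0 < \<eta>" and fam: "\<forall>u. \<kappa> - \<delta> \<le> u \<and> u \<le> \<kappa> + \<delta> \<longrightarrow> X u 0 = u \<and> \<epsilon> * Z u 0 = \<eta> \<and>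
     (\<forall>t\<le>0. lv_at P q \<kappa> M (X u) (Z u) t \<and> \<kappa> - \<delta> \<le> X u t \<and> X u t \<le> \<kappa> + \<delta> \<and> 0 < \<epsilon> * Z u t \<and> \<epsilon> * Z u t \<le> \<eta>)
     \<and> (\<forall>t<0. \<epsilon> * Z u t < \<eta>) \<and> (Z u \<longlongrightarrow> 0) at_bot"
    by (elim exE conjE)
  define I where "I = {\<kappa> - \<delta>..\<kappa> + \<delta>}"
  have init: "X u 0 = u" "\<epsilon> * Z u 0 = \<eta>" and zl: "(Z u \<longlongrightarrow> 0) at_bot" if "u \<in> I" for u
    using fam[rule_format, of u] that by (auto simp: I_def)
  have orb: "lv_at P q \<kappa> M (X u) (Z u) t" "\<kappa> - \<delta> \<le> X u t" "X u t \<le> \<kappa> + \<delta>" "0 < \<epsilon> * Z u t" "\<epsilon> * Z u t \<le> \<eta>" if "u \<in> I" "t \<le> 0" for u t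
    using fam[rule_format, of u] that by (auto simp: I_def)
  have strict: "\<epsilon> * Z u t < \<eta>" if "u \<in> I" "t < 0" for u t
    using fam[rule_format, of u] that by (auto simp: I_def)
  have Xpos: "X u t > 0" if "u \<in> I" "t \<le> 0" for u t using orb(2)[OF that] \<delta> by simp
  have ne: "\<gamma> \<noteq> \<kappa>" using \<gamma>_gt_\<kappa>[OF crit] by simp
  have "\<exists>h. ((\<lambda>t. exp (\<kappa> * t) * (exp (\<gamma> * h) * lvW 1 \<epsilon> (X u) (Z u) (t + h))) \<longlongrightarrow> k) at_bot
      \<and> ((\<lambda>t. exp ((\<gamma> - \<kappa>) * P * h) * lv\<zeta> 1 \<epsilon> (X u) (Z u) (t + h)) \<longlongrightarrow> (\<kappa> * k) powr P) at_bot" if u: "u \<in> I" for u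
  proof -
    have c0: "\<kappa> - \<delta> > 0" using \<delta> by simp
    have "(X u \<longlongrightarrow> \<kappa>) at_bot \<and> (\<exists>a C T. a > 0 \<and> (\<forall>t\<le>T. \<bar>Z u t\<bar> \<le> C * exp (a * t)))"
      by (rule lv_backward_fundamental[OF P_pos q_pos \<kappa>_pos crit c0 _ zl[OF u]]) (use orb[OF u] in blast)
    then obtain a C T where xl: "(X u \<longlongrightarrow> \<kappa>) at_bot" and a: "a > 0" and zb: "\<And>t. t \<le> T \<Longrightarrow> \<bar>Z u t\<bar> \<le> C * exp (a * t)" by blast
    have o: "lv_at P q \<kappa> M (X u) (Z u) t \<and> X u t > 0 \<and> \<epsilon> * Z u t > 0" if "t < min T 0" for t
      using orb[OF u, of t] Xpos[OF u, of t] that by simp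
    have zb': "\<bar>Z u t\<bar> \<le> C * exp (a * t)" if "t < min T 0" for t using zb[of t] that by simp
    obtain k0 where k0: "k0 > 0" and lim: "((\<lambda>t. exp (\<kappa> * t) * lvW 1 \<epsilon> (X u) (Z u) t) \<longlongrightarrow> k0) at_bot"
      "(lv\<zeta> 1 \<epsilon> (X u) (Z u) \<longlongrightarrow> (\<kappa> * k0) powr P) at_bot"
      using lv_fundamental_at_bot[OF o \<epsilon> xl zb' a] by blast
    from scale_fundamental[OF ne k0 k filterlim_shift(2) lim refl] show ?thesis by blast
  qed
  then have "\<forall>u\<in>I. \<exists>h. ((\<lambda>t. exp (\<kappa> * t) * (exp (\<gamma> * h) * lvW 1 \<epsilon> (X u) (Z u) (t + h))) \<longlongrightarrow> k) at_bot
      \<and> ((\<lambda>t. exp ((\<gamma> - \<kappa>) * P * h) * lv\<zeta> 1 \<epsilon> (X u) (Z u) (t + h)) \<longlongrightarrow> (\<kappa> * k) powr P) at_bot" by blast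
  from bchoice[OF this]
  obtain h where h: "\<forall>u\<in>I. ((\<lambda>t. exp (\<kappa> * t) * (exp (\<gamma> * h u) * lvW 1 \<epsilon> (X u) (Z u) (t + h u))) \<longlongrightarrow> k) at_bot
      \<and> ((\<lambda>t. exp ((\<gamma> - \<kappa>) * P * h u) * lv\<zeta> 1 \<epsilon> (X u) (Z u) (t + h u)) \<longlongrightarrow> (\<kappa> * k) powr P) at_bot" by (elim exE)
  have hW: "\<And>u. u \<in> I \<Longrightarrow> ((\<lambda>t. exp (\<kappa> * t) * (exp (\<gamma> * h u) * lvW 1 \<epsilon> (X u) (Z u) (t + h u))) \<longlongrightarrow> k) at_bot"
    and h\<zeta>: "\<And>u. u \<in> I \<Longrightarrow> ((\<lambda>t. exp ((\<gamma> - \<kappa>) * P * h u) * lv\<zeta> 1 \<epsilon> (X u) (Z u) (t + h u)) \<longlongrightarrow> (\<kappa> * k) powr P) at_bot"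
    using h by blast+
  define V where "V u t = exp (\<gamma> * h u) * lvW 1 \<epsilon> (X u) (Z u) (t + h u)" for u t
  define \<zeta> where "\<zeta> u t = exp ((\<gamma> - \<kappa>) * P * h u) * lv\<zeta> 1 \<epsilon> (X u) (Z u) (t + h u)" for u t
  define w where "w u r = V u (ln r)" for u r
  have s0: "sol \<epsilon> (lvW 1 \<epsilon> (X u) (Z u)) (lv\<zeta> 1 \<epsilon> (X u) (Z u)) t" if "u \<in> I" "t \<le> 0" for u t
    using lv_imp_log[of "X u" "Z u" t 1 \<epsilon>] orb[OF that] Xpos[OF that] \<epsilon> by simp
  have sol: "sol \<epsilon> (V u) (\<zeta> u) t" if u: "u \<in> I" and t: "t < - h u" for u t
    unfolding V_def[abs_def] \<zeta>_def[abs_def] by (rule log_scale, rule s0[OF u]) (use t in simp)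
  have local: "(\<exists>r0. local_solution_0 N p q \<sigma> \<epsilon> r0 (w u)) \<and> fundamental_behaviour N p (at_right 0) k (\<kappa> * k) (w u)" if u: "u \<in> I" for u
  proof
    have "positive_solution_on N p q \<sigma> \<epsilon> {0<..<exp (- h u)} (\<lambda>r. V u (ln r))"
    proof (rule log_imp_solution[where J = "{..<- h u}"])
      fix r assume "r \<in> {0<..<exp (- h u)}"
      then have r: "0 < r" "r < exp (- h u)" by auto
      then have "ln r < ln (exp (- h u))" by (subst ln_less_cancel_iff) auto
      then show "0 < r \<and> ln r \<in> {..<- h u}" using r by simp
    qed (use sol[OF u] in auto)
    then show "\<exists>r0. local_solution_0 N p q \<sigma> \<epsilon> r0 (w u)"
      by (intro exI[of _ "exp (- h u)"]) (simp add: local_solution_0_def w_def[abs_def])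
    have "\<forall>\<^sub>F t in at_bot. sol \<epsilon> (V u) (\<zeta> u) t"
      using eventually_gt_at_bot[of "- h u"] by eventually_elim (rule sol[OF u])
    from fundamental_of_log[OF this hW[OF u, folded V_def] h\<zeta>[OF u, folded \<zeta>_def] k]
    show "fundamental_behaviour N p (at_right 0) k (\<kappa> * k) (w u)" by (simp add: w_def[abs_def])
  qed
  (* the translation enters only through the argument of the orbit, not through an extra factor *)
  have lnV: "ln (V u t) = (ln (\<epsilon> * Z u (t + h u)) + P * ln (X u (t + h u)) - (M - \<kappa> * P) * t) / (q - P)" for u t
  proof -
    define L where "L = ln (\<epsilon> * Z u (t + h u)) + P * ln (X u (t + h u))"
    have "ln (V u t) = \<gamma> * h u + (L - (M - \<kappa> * P) * (t + h u)) / (q - P)"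
      using lvW_pos by (simp add: V_def ln_mult) (simp add: lvW_def L_def)
    also have "\<dots> = (\<gamma> * h u * (q - P) + (L - (M - \<kappa> * P) * (t + h u))) / (q - P)" using qP by (simp add: add_divide_distrib)
    also have "\<gamma> * h u * (q - P) + (L - (M - \<kappa> * P) * (t + h u)) = L - (M - \<kappa> * P) * t" using \<gamma>_mult by algebra
    finally show ?thesis by (simp add: L_def)
  qed
  have claim: "u = v" if u: "u \<in> I" and v: "v \<in> I" and le: "h u \<le> h v" and T0: "\<And>t. t < T0 \<Longrightarrow> V u t = V v t" for u v T0
  proof -
    define t0 where "t0 = min T0 (- h v) - 1"
    have t0: "t0 < T0" "t0 + h u \<le> 0" "t0 + h v \<le> 0" "t0 \<le> - h v" using le by (auto simp: t0_def)
    have dV: "(V a has_real_derivative - (X a (t0 + h a) * V a t0)) (at t0)" if a: "a \<in> I" "t0 + h a \<le> 0" for a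
    proof -
      have "(lvW 1 \<epsilon> (X a) (Z a) has_real_derivative - (X a (t0 + h a) * lvW 1 \<epsilon> (X a) (Z a) (t0 + h a))) (at (t0 + h a))"
        by (rule DERIV_lvW) (use orb[OF a] Xpos[OF a] \<epsilon> in auto)
      from DERIV_cmult[OF DERIV_shift_arg[OF this], of "exp (\<gamma> * h a)"] show ?thesis
        unfolding V_def[abs_def] by (simp add: mult_ac)
    qed
    have "(V v has_real_derivative - (X u (t0 + h u) * V u t0)) (at t0)"
      by (rule has_field_derivative_transform_within_open[OF dV[OF u t0(2)], of "{..<T0}"]) (use t0 T0 in auto)
    from DERIV_unique[OF this dV[OF v t0(3)]] have "X u (t0 + h u) * V u t0 = X v (t0 + h v) * V v t0" by simp
    moreover have V0: "V u t0 = V v t0" "V v t0 > 0" using T0[OF t0(1)] lvW_pos by (auto simp: V_def)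
    ultimately have Xeq: "X u (t0 + h u) = X v (t0 + h v)" by simp
    have "ln (V u t0) * (q - P) = ln (V v t0) * (q - P)" using V0 by simp
    then have "ln (\<epsilon> * Z u (t0 + h u)) = ln (\<epsilon> * Z v (t0 + h v))" unfolding lnV Xeq using qP by simp
    then have "\<epsilon> * Z u (t0 + h u) = \<epsilon> * Z v (t0 + h v)" using orb(4)[OF u t0(2)] orb(4)[OF v t0(3)] by simp
    then have Zeq: "Z u (t0 + h u) = Z v (t0 + h v)" using \<epsilon> by auto
    have bd: "\<bar>X a s\<bar> \<le> \<kappa> + \<delta> + \<eta>" "\<bar>Z a s\<bar> \<le> \<kappa> + \<delta> + \<eta>" if "a \<in> I" "s \<le> 0" for a s
    proof -
      show "\<bar>X a s\<bar> \<le> \<kappa> + \<delta> + \<eta>" using orb(3)[OF that] Xpos[OF that] \<eta> by simp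
      have "\<bar>Z a s\<bar> = \<epsilon> * Z a s" using orb(4)[OF that] \<epsilon> by auto
      then show "\<bar>Z a s\<bar> \<le> \<kappa> + \<delta> + \<eta>" using orb(5)[OF that] \<kappa>_pos \<delta> by simp
    qed
    have eq: "X u (- h v + h u) = X v (- h v + h v) \<and> Z u (- h v + h u) = Z v (- h v + h v)"
    proof (rule lv_unique[where ?x1.0 = "\<lambda>t. X u (t + h u)" and ?z1.0 = "\<lambda>t. Z u (t + h u)" and ?x2.0 = "\<lambda>t. X v (t + h v)" and ?z2.0 = "\<lambda>t. Z v (t + h v)", OF t0(4)])
      fix t assume t: "t0 \<le> t" "t \<le> - h v"
      then have tt: "t + h u \<le> 0" "t + h v \<le> 0" using le by auto
      show "lv_at P q \<kappa> M (\<lambda>t. X u (t + h u)) (\<lambda>t. Z u (t + h u)) t \<and> \<bar>X u (t + h u)\<bar> \<le> \<kappa> + \<delta> + \<eta> \<and> \<bar>Z u (t + h u)\<bar> \<le> \<kappa> + \<delta> + \<eta>"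
        using lv_shift[OF orb(1)[OF u tt(1)]] bd[OF u tt(1)] by blast
      show "lv_at P q \<kappa> M (\<lambda>t. X v (t + h v)) (\<lambda>t. Z v (t + h v)) t \<and> \<bar>X v (t + h v)\<bar> \<le> \<kappa> + \<delta> + \<eta> \<and> \<bar>Z v (t + h v)\<bar> \<le> \<kappa> + \<delta> + \<eta>"
        using lv_shift[OF orb(1)[OF v tt(2)]] bd[OF v tt(2)] by blast
    qed (use Xeq Zeq in auto)
    then have "\<epsilon> * Z u (h u - h v) = \<eta>" using init(2)[OF v] by simp
    then have "\<not> h u - h v < 0" using strict[OF u, of "h u - h v"] by auto
    then have "h u = h v" using le by simp
    then show "u = v" using eq init(1)[OF u] init(1)[OF v] by simp
  qed
  have distinct: "u = v" if u: "u \<in> I" and v: "v \<in> I" and ev: "\<forall>\<^sub>F r in at_right 0. w u r = w v r" for u v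
  proof -
    obtain b where b: "b > 0" "\<And>r. 0 < r \<Longrightarrow> r < b \<Longrightarrow> w u r = w v r"
      using ev unfolding eventually_at_right_field by blast
    have eq: "V u t = V v t" if "t < ln b" for t
    proof -
      have "exp t < exp (ln b)" using that by (simp only: exp_less_cancel_iff)
      then show ?thesis using b(2)[of "exp t"] b(1) by (simp add: w_def)
    qed
    show ?thesis
    proof (cases "h u \<le> h v")
      case True then show ?thesis using claim[OF u v True eq] by blast
    next
      case False
      then have "h v \<le> h u" by simp
      from claim[OF v u this eq[symmetric]] show ?thesis by simp
    qed
  qed
  have "inj_on w I" using distinct by (intro inj_onI) simp
  moreover have "infinite I" unfolding I_def using \<delta> by simp
  ultimately have "infinite (w ` I)" using finite_image_iff by blast
  moreover have "\<not> (\<forall>\<^sub>F r in at_right 0. w1 r = w2 r)" if "w1 \<in> w ` I" "w2 \<in> w ` I" "w1 \<noteq> w2" for w1 w2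
    using that distinct by blast
  ultimately show ?thesis using local by (intro exI[of _ "w ` I"]) blast
qed

lemma powr_limit_0_of_log:
  fixes a l :: real and W :: "real \<Rightarrow> real"
  assumes "((\<lambda>t. exp (a * t) * W t) \<longlongrightarrow> l) at_bot"
  shows "((\<lambda>r. r powr a * W (ln r)) \<longlongrightarrow> l) (at_right 0)"
  by (rule iffD2[OF tendsto_at_right_0_iff_exp]) (use assms in \<open>simp add: powr_exp_arg\<close>)

lemma powr_limit_infty_of_log:
  fixes a l :: real and W :: "real \<Rightarrow> real"
  assumes "((\<lambda>t. exp (a * t) * W t) \<longlongrightarrow> l) at_top"
  shows "((\<lambda>r. r powr a * W (ln r)) \<longlongrightarrow> l) at_top"
  by (rule iffD2[OF tendsto_at_top_iff_exp]) (use assms in \<open>simp add: powr_exp_arg\<close>)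

lemma local_0_of_log:
  assumes "\<And>t. t < T \<Longrightarrow> sol \<epsilon> W \<zeta> t"
  shows "local_solution_0 N p q \<sigma> \<epsilon> (exp T) (\<lambda>r. W (ln r))"
  unfolding local_solution_0_def
proof
  show "positive_solution_on N p q \<sigma> \<epsilon> {0<..<exp T} (\<lambda>r. W (ln r))"
  proof (rule log_imp_solution[where J = "{..<T}"])
    fix r assume "r \<in> {0<..<exp T}"
    then have r: "0 < r" "r < exp T" by auto
    then have "ln r < ln (exp T)" by (subst ln_less_cancel_iff) auto
    then show "0 < r \<and> ln r \<in> {..<T}" using r by simp
  qed (use assms in auto)
qed simp

lemma local_infty_of_log:
  assumes "\<And>t. t > T \<Longrightarrow> sol \<epsilon> W \<zeta> t"
  shows "local_solution_infty N p q \<sigma> \<epsilon> (exp T) (\<lambda>r. W (ln r))"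
  unfolding local_solution_infty_def
proof
  show "positive_solution_on N p q \<sigma> \<epsilon> {exp T<..} (\<lambda>r. W (ln r))"
  proof (rule log_imp_solution[where J = "{T<..}"])
    fix r assume "r \<in> {exp T<..}"
    then have r: "exp T < r" "0 < r" by (auto intro: less_trans[OF exp_gt_zero])
    then have "ln (exp T) < ln r" by (subst ln_less_cancel_iff) auto
    then show "0 < r \<and> ln r \<in> {T<..}" using r by simp
  qed (use assms in auto)
qed simp

lemma log_of_local_0:
  assumes "local_solution_0 N p q \<sigma> \<epsilon> r0 w" and "t < ln r0"
  shows "sol \<epsilon> (\<lambda>t. w (exp t)) (log_flux w) t"
proof (rule solution_imp_log)
  have r0: "r0 > 0" and s: "positive_solution_on N p q \<sigma> \<epsilon> {0<..<r0} w" using assms(1) by (auto simp: local_solution_0_def)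
  show "positive_solution_on N p q \<sigma> \<epsilon> {0<..<r0} w" by (rule s)
  have "exp t < exp (ln r0)" using assms(2) by (simp only: exp_less_cancel_iff)
  then show "exp t \<in> {0<..<r0}" using r0 by simp
qed

lemma log_of_local_infty:
  assumes "local_solution_infty N p q \<sigma> \<epsilon> r0 w" and "t > ln r0"
  shows "sol \<epsilon> (\<lambda>t. w (exp t)) (log_flux w) t"
proof (rule solution_imp_log)
  have r0: "r0 > 0" and s: "positive_solution_on N p q \<sigma> \<epsilon> {r0<..} w" using assms(1) by (auto simp: local_solution_infty_def)
  show "positive_solution_on N p q \<sigma> \<epsilon> {r0<..} w" by (rule s)
  have "exp (ln r0) < exp t" using assms(2) by (simp only: exp_less_cancel_iff)
  then show "exp t \<in> {r0<..}" using r0 by simp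
qed

lemma log_of_global:
  assumes "global_solution N p q \<sigma> \<epsilon> w"
  shows "sol \<epsilon> (\<lambda>t. w (exp t)) (log_flux w) t"
  using assms by (intro solution_imp_log[of \<epsilon> "{0<..}"]) (auto simp: global_solution_def)

lemma regular_solution_exists_unique:
  assumes \<epsilon>: "\<epsilon> = 1 \<or> \<epsilon> = - 1" and w0: "w0 > 0" and c: "c = (w0 powr q / M) powr (1 / P)"
  shows "(\<exists>r0 w. local_solution_0 N p q \<sigma> \<epsilon> r0 w \<and> regular_behaviour_0 p \<sigma> \<epsilon> w0 c w) \<and>
     (\<forall>r1 w1 r2 w2.
        local_solution_0 N p q \<sigma> \<epsilon> r1 w1 \<and> regular_behaviour_0 p \<sigma> \<epsilon> w0 c w1 \<and>
        local_solution_0 N p q \<sigma> \<epsilon> r2 w2 \<and> regular_behaviour_0 p \<sigma> \<epsilon> w0 c w2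
        \<longrightarrow> (\<forall>r\<in>{0<..<min r1 r2}. w1 r = w2 r))"
proof (intro conjI allI impI ballI)
  from regular_log_exists[OF \<epsilon> w0]
  obtain W \<zeta> T where s: "\<forall>t<T. sol \<epsilon> W \<zeta> t" and lim: "(W \<longlongrightarrow> w0) at_bot" "((\<lambda>t. exp (- M * t) * \<zeta> t) \<longlongrightarrow> \<epsilon> * (w0 powr q / M)) at_bot"
    by (elim exE conjE)
  have "local_solution_0 N p q \<sigma> \<epsilon> (exp T) (\<lambda>r. W (ln r))" using local_0_of_log[of T \<epsilon> W \<zeta>] s by blast
  moreover have "\<forall>\<^sub>F t in at_bot. sol \<epsilon> W \<zeta> t"
    using eventually_gt_at_bot[of T] by eventually_elim (use s in blast)
  from regular_of_log[OF this lim \<epsilon> w0] have "regular_behaviour_0 p \<sigma> \<epsilon> w0 c (\<lambda>r. W (ln r))" by (simp add: c)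
  ultimately show "\<exists>r0 w. local_solution_0 N p q \<sigma> \<epsilon> r0 w \<and> regular_behaviour_0 p \<sigma> \<epsilon> w0 c w" by blast
next
  fix r1 w1 r2 w2 r
  assume "local_solution_0 N p q \<sigma> \<epsilon> r1 w1 \<and> regular_behaviour_0 p \<sigma> \<epsilon> w0 c w1 \<and>
        local_solution_0 N p q \<sigma> \<epsilon> r2 w2 \<and> regular_behaviour_0 p \<sigma> \<epsilon> w0 c w2"
  then have l1: "local_solution_0 N p q \<sigma> \<epsilon> r1 w1" and b1: "regular_behaviour_0 p \<sigma> \<epsilon> w0 c w1"
    and l2: "local_solution_0 N p q \<sigma> \<epsilon> r2 w2" and b2: "regular_behaviour_0 p \<sigma> \<epsilon> w0 c w2" by blast+
  assume r: "r \<in> {0<..<min r1 r2}"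
  define T where "T = min (ln r1) (ln r2)"
  have rp: "r1 > 0" "r2 > 0" using l1 l2 by (auto simp: local_solution_0_def)
  have s1: "sol \<epsilon> (\<lambda>t. w1 (exp t)) (log_flux w1) t" and s2: "sol \<epsilon> (\<lambda>t. w2 (exp t)) (log_flux w2) t" if "t < T" for t
    using log_of_local_0[OF l1, of t] log_of_local_0[OF l2, of t] that by (auto simp: T_def)
  from sol_unique_regular[OF \<epsilon> w0 s1 log_of_regular[OF b1[unfolded c] \<epsilon> w0] s2 log_of_regular[OF b2[unfolded c] \<epsilon> w0]]
  obtain T' where T': "T' \<le> T" "\<forall>t<T'. w1 (exp t) = w2 (exp t)" by blast
  have "ln r < T" using r rp by (auto simp: T_def)
  have "w1 (exp (ln r)) = w2 (exp (ln r))"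
  proof (rule sol_unique_connected[OF \<epsilon>, of "{..<T}" "\<lambda>t. w1 (exp t)" "log_flux w1" "\<lambda>t. w2 (exp t)" "log_flux w2" "{..<T'}"])
    show "{..<T'} \<noteq> {}" by (auto intro: lt_ex)
  qed (use s1 s2 T' \<open>ln r < T\<close> in auto)
  then show "w1 r = w2 r" using r by simp
qed

lemma fundamental_infty_exists:
  assumes \<epsilon>: "\<epsilon> = 1 \<or> \<epsilon> = - 1" and k: "k > 0" and crit: "M < q * \<kappa>"
  shows "\<exists>r0 w. local_solution_infty N p q \<sigma> \<epsilon> r0 w \<and> fundamental_behaviour N p at_top k (\<kappa> * k) w"
proof -
  from fundamental_top_log_exists[OF \<epsilon> k crit]
  obtain W \<zeta> T where s: "\<forall>t>T. sol \<epsilon> W \<zeta> t" and lim: "((\<lambda>t. exp (\<kappa> * t) * W t) \<longlongrightarrow> k) at_top" "(\<zeta> \<longlongrightarrow> (\<kappa> * k) powr P) at_top"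
    by (elim exE conjE)
  have "local_solution_infty N p q \<sigma> \<epsilon> (exp T) (\<lambda>r. W (ln r))" using local_infty_of_log[of T \<epsilon> W \<zeta>] s by blast
  moreover have "\<forall>\<^sub>F t in at_top. sol \<epsilon> W \<zeta> t"
    using eventually_gt_at_top[of T] by eventually_elim (use s in blast)
  from fundamental_of_log[OF this lim k] have "fundamental_behaviour N p at_top k (\<kappa> * k) (\<lambda>r. W (ln r))" by blast
  ultimately show ?thesis by blast
qed

lemma fundamental_infty_unique:
  assumes \<epsilon>: "\<epsilon> = 1 \<or> \<epsilon> = - 1" and crit: "M < q * \<kappa>" and k: "k1 > 0" "k2 > 0"
    and l1: "local_solution_infty N p q \<sigma> \<epsilon> r1 w1" and b1: "fundamental_behaviour N p at_top k1 (\<kappa> * k1) w1"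
    and l2: "local_solution_infty N p q \<sigma> \<epsilon> r2 w2" and b2: "fundamental_behaviour N p at_top k2 (\<kappa> * k2) w2"
  shows "\<exists>t>0. \<forall>r. r > r2 \<and> t * r > r1 \<longrightarrow> w2 r = scaling \<gamma> t w1 r"
proof -
  have ne: "\<gamma> \<noteq> \<kappa>" using \<gamma>_lt_\<kappa>[OF crit] by simp
  have rp: "r1 > 0" "r2 > 0" using l1 l2 by (auto simp: local_solution_infty_def)
  define h where "h = ln (k2 / k1) / (\<gamma> - \<kappa>)"
  define V where "V t = exp (\<gamma> * h) * w1 (exp (t + h))" for t
  define \<zeta> where "\<zeta> t = exp ((\<gamma> - \<kappa>) * P * h) * log_flux w1 (t + h)" for t
  define T where "T = max (ln r2) (ln r1 - h)"
  have s1: "sol \<epsilon> V \<zeta> t" if "t > T" for t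
    unfolding V_def[abs_def] \<zeta>_def[abs_def]
    by (rule log_scale[where W = "\<lambda>t. w1 (exp t)"], rule log_of_local_infty[OF l1]) (use that in \<open>simp add: T_def\<close>)
  have s2: "sol \<epsilon> (\<lambda>t. w2 (exp t)) (log_flux w2) t" if "t > T" for t
    by (rule log_of_local_infty[OF l2]) (use that in \<open>simp add: T_def\<close>)
  have at: "at_top = at_right (0::real) \<and> at_top = (at_bot::real filter) \<or> at_top = (at_top::real filter) \<and> at_top = (at_top::real filter)" by simp
  note f1 = log_of_fundamental[OF b1 k(1) at] and f2 = log_of_fundamental[OF b2 k(2) at]
  note sc = scale_fundamental[OF ne k(1) k(2) filterlim_shift(1) f1 h_def]
  from sol_unique_fundamental[OF \<epsilon> k(2) crit s1 sc[folded V_def \<zeta>_def] s2 f2]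
  obtain T' where T': "T' \<ge> T" "\<forall>t>T'. V t = w2 (exp t)" by blast
  have eq: "V t = w2 (exp t)" if t: "t > T" for t
  proof (rule sol_unique_connected[OF \<epsilon>, of "{T<..}" V \<zeta> "\<lambda>t. w2 (exp t)" "log_flux w2" "{T'<..}"])
    show "{T'<..} \<noteq> {}" by (auto intro: gt_ex)
  qed (use s1 s2 T' t in auto)
  have "w2 r = scaling \<gamma> (exp h) w1 r" if r: "r > r2" "exp h * r > r1" for r
  proof -
    have r0: "r > 0" using r rp by simp
    have "ln r > ln r2" using r rp by simp
    moreover have "ln r1 < ln (exp h * r)" using r rp by (subst ln_less_cancel_iff) auto
    then have "ln r > ln r1 - h" using r0 by (simp add: ln_mult)
    ultimately have "V (ln r) = w2 (exp (ln r))" by (intro eq) (simp add: T_def)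
    then show ?thesis using r0 by (simp add: V_def scaling_def powr_exp_arg exp_add mult.commute)
  qed
  then show ?thesis by (intro exI[of _ "exp h"]) auto
qed

text \<open>A solution with nonpositive flux is increasing in r and positive, so it has a limit at 0.\<close>

lemma absorption_local_C0_regular:
  assumes crit: "M < q * \<kappa>" and l: "local_solution_0 N p q \<sigma> (- 1) r0 w"
  shows "C0_regular w"
proof -
  define W where "W t = w (exp t)" for t
  have s: "sol (- 1) W (log_flux w) t" if "t < ln r0" for t
    unfolding W_def[abs_def] by (rule log_of_local_0[OF l that])
  have Wp: "W t > 0" if "t < ln r0" for t using s[OF that] by (simp add: log_at_def)
  have mono: "W a \<le> W b" if "a \<le> b" "b < ln r0" for a b
    using that(1)
  proof (rule DERIV_nonneg_imp_nondecreasing)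
    fix x assume "a \<le> x" "x \<le> b"
    then have x: "x < ln r0" using that by simp
    have "log_flux w x \<le> 0" by (rule absorption_flux_nonpos[OF crit s x])
    then have "psi P (log_flux w x) \<le> 0" by (cases "log_flux w x = 0") (auto simp: psi_neg)
    then have "- (exp (- \<kappa> * x) * psi P (log_flux w x)) \<ge> 0" by (simp add: mult_nonneg_nonpos)
    then show "\<exists>y. (W has_real_derivative y) (at x) \<and> 0 \<le> y" using s[OF x] unfolding log_at_def by blast
  qed
  have "\<exists>m\<le>0. ((\<lambda>s. - W (- s)) \<longlongrightarrow> m) at_top \<and> (\<forall>s>- ln r0. - W (- s) \<le> m)"
    by (rule monotone_bounded_at_top) (use mono Wp in \<open>auto intro: less_imp_le\<close>)
  then obtain m where m: "m \<le> 0" "((\<lambda>s. - W (- s)) \<longlongrightarrow> m) at_top" by blast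
  have "(W \<longlongrightarrow> - m) at_bot" using tendsto_minus[OF m(2)] by (simp add: filterlim_at_bot_mirror)
  then have "(w \<longlongrightarrow> - m) (at_right 0)" unfolding tendsto_at_right_0_iff_exp W_def .
  then show ?thesis using m(1) unfolding C0_regular_def by (intro exI[of _ "- m"]) simp
qed

end

theorem theorem4p9:
  fixes N p q \<sigma> :: real
  assumes "q > p - 1" and "p - 1 > 0" and "N > p" and "p > - \<sigma>"
  shows
    "(\<exists>c. (\<forall>w0>0. c w0 > 0) \<and>
        (\<forall>\<epsilon>\<in>{1, -1}. \<forall>w0>0.
           (\<exists>r0 w. local_solution_0 N p q \<sigma> \<epsilon> r0 w \<and> regular_behaviour_0 p \<sigma> \<epsilon> w0 (c w0) w) \<and>
           (\<forall>r1 w1 r2 w2.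
              local_solution_0 N p q \<sigma> \<epsilon> r1 w1 \<and> regular_behaviour_0 p \<sigma> \<epsilon> w0 (c w0) w1 \<and>
              local_solution_0 N p q \<sigma> \<epsilon> r2 w2 \<and> regular_behaviour_0 p \<sigma> \<epsilon> w0 (c w0) w2
              \<longrightarrow> (\<forall>r\<in>{0<..<min r1 r2}. w1 r = w2 r))))
     \<and>
     (q < q_crit N p \<sigma> \<longrightarrow>
        (\<exists>c. (\<forall>k>0. c k > 0) \<and>
           (\<forall>\<epsilon>\<in>{1, -1}. \<forall>k>0. \<exists>W. infinite W \<and>
              (\<forall>w\<in>W. (\<exists>r0. local_solution_0 N p q \<sigma> \<epsilon> r0 w) \<and>
                 fundamental_behaviour N p (at_right 0) k (c k) w) \<and>
              (\<forall>w1\<in>W. \<forall>w2\<in>W. w1 \<noteq> w2 \<longrightarrow>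
                 \<not> (\<forall>\<^sub>F r in at_right 0. w1 r = w2 r))))
        \<and> \<not> (\<exists>r0 w. local_solution_infty N p q \<sigma> 1 r0 w)
        \<and> global_solution N p q \<sigma> (-1) (w_star N p q \<sigma> (-1))
        \<and> (\<forall>k>0. \<exists>w. global_solution N p q \<sigma> (-1) w \<and>
              ((\<lambda>r. r powr ((N - p) / (p - 1)) * w r) \<longlongrightarrow> k) (at_right 0) \<and>
              ((\<lambda>r. r powr gamma_exp p q \<sigma> * w r) \<longlongrightarrow> a_star N p q \<sigma> (-1)) at_top))
     \<and>
     (q > q_crit N p \<sigma> \<longrightarrow>
        (\<exists>c. (\<forall>k>0. c k > 0) \<and>
           (\<forall>\<epsilon>\<in>{1, -1}.
              (\<forall>k>0. \<exists>r0 w. local_solution_infty N p q \<sigma> \<epsilon> r0 w \<and>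
                 fundamental_behaviour N p at_top k (c k) w) \<and>
              (\<forall>k1>0. \<forall>k2>0. \<forall>r1 w1 r2 w2.
                 local_solution_infty N p q \<sigma> \<epsilon> r1 w1 \<and>
                 fundamental_behaviour N p at_top k1 (c k1) w1 \<and>
                 local_solution_infty N p q \<sigma> \<epsilon> r2 w2 \<and>
                 fundamental_behaviour N p at_top k2 (c k2) w2
                 \<longrightarrow> (\<exists>t>0. \<forall>r. r > r2 \<and> t * r > r1 \<longrightarrow> w2 r = scaling (gamma_exp p q \<sigma>) t w1 r))))
        \<and> (\<forall>r0 w. local_solution_0 N p q \<sigma> (-1) r0 w \<longrightarrow>
              C0_regular w \<and>
              \<not> (\<exists>v. global_solution N p q \<sigma> (-1) v \<and> (\<forall>r\<in>{0<..<r0}. v r = w r)))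
        \<and> global_solution N p q \<sigma> 1 (w_star N p q \<sigma> 1)
        \<and> (q < q_Sobolev N p \<sigma> \<longrightarrow>
              \<not> (\<exists>w. C0_ground_state N p q \<sigma> 1 w) \<and>
              (\<forall>k>0. \<exists>w. global_solution N p q \<sigma> 1 w \<and>
                 ((\<lambda>r. r powr gamma_exp p q \<sigma> * w r) \<longlongrightarrow> a_star N p q \<sigma> 1) (at_right 0) \<and>
                 ((\<lambda>r. r powr ((N - p) / (p - 1)) * w r) \<longlongrightarrow> k) at_top))
        \<and> (q > q_Sobolev N p \<sigma> \<longrightarrow>
              (\<forall>w0>0. \<exists>w. C0_ground_state N p q \<sigma> 1 w \<and>
                 (w \<longlongrightarrow> w0) (at_right 0) \<and>
                 ((\<lambda>r. r powr gamma_exp p q \<sigma> * w r) \<longlongrightarrow> a_star N p q \<sigma> 1) at_top))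
        \<and> (q = q_Sobolev N p \<sigma> \<longrightarrow>
              (\<forall>c>0. \<forall>d. d = c powr (q - p + 1) * inverse (N + \<sigma>) * ((N - p) / (p - 1)) powr (1 - p)
                 \<longrightarrow> C0_ground_state N p q \<sigma> 1
                      (\<lambda>r. c * (d + r powr ((p + \<sigma>) / (p - 1))) powr (- ((N - p) / (p + \<sigma>)))))))"
    (is "?regular \<and> (_ \<longrightarrow> ?sub1 \<and> ?sub2 \<and> ?sub3 \<and> ?sub4) \<and> (_ \<longrightarrow> ?sup1 \<and> ?sup2 \<and> ?sup3 \<and> ?i \<and> ?ii \<and> ?iii)")
proof -
  interpret emden_fowler N p q \<sigma> using assms by unfold_locales
  have pm: "(\<epsilon> :: real) = 1 \<or> \<epsilon> = - 1" if "\<epsilon> \<in> {1, -1}" for \<epsilon> using that by auto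
  (* c(w0) is the limit of |w'| r^(-(\<sigma>+1)/(p-1)) forced by \<zeta> e^(-Mt) tending to \<epsilon> w0^q / M *)
  have ?regular
  proof (intro exI[of _ "\<lambda>w0. (w0 powr q / M) powr (1 / P)"] conjI allI impI ballI)
    fix w0 :: real assume "w0 > 0"
    then show "(w0 powr q / M) powr (1 / P) > 0" using M_pos by simp
  next
    fix \<epsilon> w0 :: real assume "\<epsilon> \<in> {1, -1}" "w0 > 0"
    note regular_solution_exists_unique[OF pm[OF this(1)] this(2) refl]
    then show "\<exists>r0 w. local_solution_0 N p q \<sigma> \<epsilon> r0 w \<and> regular_behaviour_0 p \<sigma> \<epsilon> w0 ((w0 powr q / M) powr (1 / P)) w" by (rule conjunct1)
  next
    fix \<epsilon> w0 r1 r2 r :: real and w1 w2 assume e: "\<epsilon> \<in> {1, -1}" and w0: "w0 > 0"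
      and h: "local_solution_0 N p q \<sigma> \<epsilon> r1 w1 \<and> regular_behaviour_0 p \<sigma> \<epsilon> w0 ((w0 powr q / M) powr (1 / P)) w1 \<and>
              local_solution_0 N p q \<sigma> \<epsilon> r2 w2 \<and> regular_behaviour_0 p \<sigma> \<epsilon> w0 ((w0 powr q / M) powr (1 / P)) w2"
      and r: "r \<in> {0<..<min r1 r2}"
    show "w1 r = w2 r"
      using conjunct2[OF regular_solution_exists_unique[OF pm[OF e] w0 refl], rule_format, OF h r] .
  qed
  moreover have "?sub1 \<and> ?sub2 \<and> ?sub3 \<and> ?sub4" if "q < q_crit N p \<sigma>"
  proof -
    have crit: "q * \<kappa> < M" using that q_crit_less by simp
    have ?sub1
    proof (intro exI[of _ "\<lambda>k. \<kappa> * k"] conjI allI impI ballI)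
      fix \<epsilon> k :: real assume "\<epsilon> \<in> {1, -1}" "k > 0"
      from fundamental_family_exists[OF pm[OF this(1)] this(2) crit]
      show "\<exists>W. infinite W \<and>
              (\<forall>w\<in>W. (\<exists>r0. local_solution_0 N p q \<sigma> \<epsilon> r0 w) \<and>
                 fundamental_behaviour N p (at_right 0) k (\<kappa> * k) w) \<and>
              (\<forall>w1\<in>W. \<forall>w2\<in>W. w1 \<noteq> w2 \<longrightarrow>
                 \<not> (\<forall>\<^sub>F r in at_right 0. w1 r = w2 r))" .
    qed (use \<kappa>_pos in simp)
    moreover have ?sub2
    proof
      assume "\<exists>r0 w. local_solution_infty N p q \<sigma> 1 r0 w"
      then obtain r0 w where "local_solution_infty N p q \<sigma> 1 r0 w" by blast
      from source_no_solution_at_infinity[OF crit log_of_local_infty[OF this]] show False .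
    qed
    moreover have ?sub3 by (rule w_star_global) (use \<gamma>_gt_\<kappa>[OF crit] in auto)
    moreover have ?sub4
    proof (intro allI impI)
      fix k :: real assume "k > 0"
      from subcritical_global_log[OF this crit]
      obtain W \<zeta> where s: "\<forall>t. sol (- 1) W \<zeta> t" and lim: "((\<lambda>t. exp (\<kappa> * t) * W t) \<longlongrightarrow> k) at_bot"
        "((\<lambda>t. exp (\<gamma> * t) * W t) \<longlongrightarrow> a_star N p q \<sigma> (- 1)) at_top" by (elim exE conjE)
      have "global_solution N p q \<sigma> (- 1) (\<lambda>r. W (ln r))" using s by (intro global_of_log[of _ W \<zeta>]) auto
      then show "\<exists>w. global_solution N p q \<sigma> (-1) w \<and>
              ((\<lambda>r. r powr ((N - p) / (p - 1)) * w r) \<longlongrightarrow> k) (at_right 0) \<and>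
              ((\<lambda>r. r powr gamma_exp p q \<sigma> * w r) \<longlongrightarrow> a_star N p q \<sigma> (-1)) at_top"
        using powr_limit_0_of_log[OF lim(1)] powr_limit_infty_of_log[OF lim(2)]
        unfolding exponents \<gamma>_def[symmetric] by blast
    qed
    ultimately show ?thesis by blast
  qed
  moreover have "?sup1 \<and> ?sup2 \<and> ?sup3 \<and> ?i \<and> ?ii \<and> ?iii" if "q > q_crit N p \<sigma>"
  proof -
    have crit: "M < q * \<kappa>" using that q_crit_greater by simp
    have ?sup1
    proof (intro exI[of _ "\<lambda>k. \<kappa> * k"] conjI allI impI ballI)
      fix \<epsilon> k :: real assume "\<epsilon> \<in> {1, -1}" "k > 0"
      from fundamental_infty_exists[OF pm[OF this(1)] this(2) crit]
      show "\<exists>r0 w. local_solution_infty N p q \<sigma> \<epsilon> r0 w \<and> fundamental_behaviour N p at_top k (\<kappa> * k) w" .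
    next
      fix \<epsilon> k1 k2 r1 r2 :: real and w1 w2 assume e: "\<epsilon> \<in> {1, -1}" and k: "k1 > 0" "k2 > 0"
        and h: "local_solution_infty N p q \<sigma> \<epsilon> r1 w1 \<and> fundamental_behaviour N p at_top k1 (\<kappa> * k1) w1 \<and>
                 local_solution_infty N p q \<sigma> \<epsilon> r2 w2 \<and> fundamental_behaviour N p at_top k2 (\<kappa> * k2) w2"
      show "\<exists>t>0. \<forall>r. r > r2 \<and> t * r > r1 \<longrightarrow> w2 r = scaling (gamma_exp p q \<sigma>) t w1 r"
        unfolding \<gamma>_def[symmetric] using h by (intro fundamental_infty_unique[OF pm[OF e] crit k]) blast+
    qed (use \<kappa>_pos in simp)
    moreover have ?sup2
    proof (intro allI impI conjI)
      fix r0 w assume l: "local_solution_0 N p q \<sigma> (-1) r0 w"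
      show "C0_regular w" by (rule absorption_local_C0_regular[OF crit l])
      show "\<not> (\<exists>v. global_solution N p q \<sigma> (-1) v \<and> (\<forall>r\<in>{0<..<r0}. v r = w r))"
        using absorption_not_global[OF crit log_of_global] by blast
    qed
    moreover have ?sup3 by (rule w_star_global) (use \<gamma>_lt_\<kappa>[OF crit] in auto)
    moreover have ?i
    proof (intro impI conjI allI)
      assume "q < q_Sobolev N p \<sigma>"
      then have sob: "\<kappa> * P * (q + 1) < M * (P + 1)" using q_Sobolev_less by simp
      show "\<not> (\<exists>w. C0_ground_state N p q \<sigma> 1 w)"
      proof
        assume "\<exists>w. C0_ground_state N p q \<sigma> 1 w"
        then obtain w l where g: "global_solution N p q \<sigma> 1 w" and l: "(w \<longlongrightarrow> l) (at_right 0)"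
          unfolding C0_ground_state_def C0_regular_def by blast
        from source_no_ground_state[OF crit sob log_of_global[OF g] l[unfolded tendsto_at_right_0_iff_exp]] show False .
      qed
      fix k :: real assume "k > 0"
      from below_Sobolev_global_log[OF this crit sob]
      obtain W \<zeta> where s: "\<forall>t. sol 1 W \<zeta> t" and lim: "((\<lambda>t. exp (\<kappa> * t) * W t) \<longlongrightarrow> k) at_top"
        "((\<lambda>t. exp (\<gamma> * t) * W t) \<longlongrightarrow> a_star N p q \<sigma> 1) at_bot" by (elim exE conjE)
      have "global_solution N p q \<sigma> 1 (\<lambda>r. W (ln r))" using s by (intro global_of_log[of _ W \<zeta>]) auto
      then show "\<exists>w. global_solution N p q \<sigma> 1 w \<and>
                 ((\<lambda>r. r powr gamma_exp p q \<sigma> * w r) \<longlongrightarrow> a_star N p q \<sigma> 1) (at_right 0) \<and>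
                 ((\<lambda>r. r powr ((N - p) / (p - 1)) * w r) \<longlongrightarrow> k) at_top"
        using powr_limit_infty_of_log[OF lim(1)] powr_limit_0_of_log[OF lim(2)]
        unfolding exponents \<gamma>_def[symmetric] by blast
    qed
    moreover have ?ii
    proof (intro impI allI)
      assume "q > q_Sobolev N p \<sigma>"
      then have sob: "\<kappa> * P * (q + 1) > M * (P + 1)" using q_Sobolev_greater by simp
      fix w0 :: real assume w0: "w0 > 0"
      from above_Sobolev_global_log[OF this crit sob]
      obtain W \<zeta> where s: "\<forall>t. sol 1 W \<zeta> t" and lim: "(W \<longlongrightarrow> w0) at_bot"
        "((\<lambda>t. exp (\<gamma> * t) * W t) \<longlongrightarrow> a_star N p q \<sigma> 1) at_top" by (elim exE conjE)
      have "global_solution N p q \<sigma> 1 (\<lambda>r. W (ln r))" using s by (intro global_of_log[of _ W \<zeta>]) auto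
      moreover have l0: "((\<lambda>r. W (ln r)) \<longlongrightarrow> w0) (at_right 0)" unfolding tendsto_at_right_0_iff_exp using lim(1) by simp
      moreover have "C0_regular (\<lambda>r. W (ln r))" unfolding C0_regular_def using l0 w0 by (intro exI[of _ w0]) simp
      moreover have "((\<lambda>r. r powr \<gamma> * W (ln r)) \<longlongrightarrow> a_star N p q \<sigma> 1) at_top"
        by (rule powr_limit_infty_of_log[OF lim(2)])
      ultimately show "\<exists>w. C0_ground_state N p q \<sigma> 1 w \<and> (w \<longlongrightarrow> w0) (at_right 0) \<and>
                 ((\<lambda>r. r powr gamma_exp p q \<sigma> * w r) \<longlongrightarrow> a_star N p q \<sigma> 1) at_top"
        unfolding \<gamma>_def[symmetric] C0_ground_state_def by blast
    qed
    moreover have ?iii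
    proof (intro impI allI)
      assume "q = q_Sobolev N p \<sigma>"
      then have sob: "\<kappa> * P * (q + 1) = M * (P + 1)" using q_Sobolev_eq by simp
      fix c d :: real assume "c > 0" "d = c powr (q - p + 1) * inverse (N + \<sigma>) * ((N - p) / (p - 1)) powr (1 - p)"
      from explicit_ground_state[OF sob this]
      show "C0_ground_state N p q \<sigma> 1 (\<lambda>r. c * (d + r powr ((p + \<sigma>) / (p - 1))) powr (- ((N - p) / (p + \<sigma>))))" .
    qed
    ultimately show ?thesis by blast
  qed
  ultimately show ?thesis by blast
qed

end
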